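(* Let $\Delta>1$ be a fundamental discriminant, let $p$ be a prime not dividing $\Delta$, and let $m,n$ be non-negative integers with $n>0$. For a negative discriminant $-d$, write $d=p^{2u}d'$ where $p^2\nmid d'$ and $u\ge 0$; when $m\ge u$, $-d'$ is assumed to be a discriminant. Let $\ell=\min(\mathrm{ord}_p(n),m)$. Then $$\sum_{t=0}^{\ell}p^{t}\,\mathrm{Tr}_{\Delta,d}\left(\mathbb J_{1,\frac{p^mn}{p^{2t}}}\right)=\sum_{t=0}^{m}p^{m-t}\,\mathrm{Tr}_{\Delta,p^{2u-2m+4t}d'}(\mathbb J_{1,n})\qquad\text{if }0\le m<u,$$ and $$\sum_{t=0}^{\ell}p^{t}\,\mathrm{Tr}_{\Delta,d}\left(\mathbb J_{1,\frac{p^mn}{p^{2t}}}\right)=\sum_{t=0}^{m-u}\left(\frac{-d'}{p}\right)^{m-u-t}p^{u}\,\mathrm{Tr}_{\Delta,p^{2t}d'}(\mathbb J_{1,n})+\sum_{t=1}^{u}p^{u-t}\,\mathrm{Tr}_{\Delta,p^{2m-2u+4t}d'}(\mathbb J_{1,n})\qquad\text{if }m\ge u.$$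
   Context: Notation: $\Gamma=\mathrm{SL}_2(\mathbb Z)$, $\bar\Gamma=\mathrm{PSL}_2(\mathbb Z)$, $\tau=x+iy\in\mathbb H$ (upper half-plane), $e(x)=e^{2\pi i x}$, $\Gamma_\infty$ is the stabilizer of the cusp $i\infty$ in $\Gamma$ (translations up to sign), $(\frac{\cdot}{\cdot})$ is the Kronecker symbol, a zeroth power is $1$, and an empty sum is $0$. A discriminant is an integer congruent to $0$ or $1$ modulo $4$. Sesquiharmonic Maass functions $\mathbb J_{1,n}$ ($n>0$). For $\mathrm{Re}(s)>1$ let $$F_{1,0,-n}(\tau,s):=2\pi\sqrt n\sum_{\gamma\in\Gamma_\infty\backslash\Gamma}(\mathrm{Im}(\gamma\tau))^{1/2}\,I_{s-\frac12}(2\pi n\,\mathrm{Im}(\gamma\tau))\,e(-n\,\mathrm{Re}(\gamma\tau)),$$ with $I_\nu$ the $I$-Bessel function; this has an analytic continuation in $s$ to a neighbourhood of $s=1$, and $\mathbb J_{1,n}(\tau)$ is defined as the coefficient of $(s-1)^1$ in the Taylor expansion of $F_{1,0,-n}(\tau,s)$ at $s=1$. It is $\Gamma$-invariant. Twisted traces. Let $\Delta>1$ be a fundamental discriminant and let $d$ be a positive integer such that $-d$ is a discriminant. Let $\mathcal Q_{d\Delta}$ denote the set of positive definite integral binary quadratic forms $Q=[a,b,c]=aX^2+bXY+cY^2$ (not necessarily primitive) of discriminant $b^2-4ac=-d\Delta$, with the usual action of $\Gamma$. For such $Q$, $\alpha_Q\in\mathbb H$ is its unique root in $\mathbb H$ (the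 root of $aX^2+bX+c$) and $\omega_Q$ is the cardinality of the stabilizer of $Q$ in $\bar\Gamma$. The genus character is $$\chi_\Delta(Q):=\begin{cases}\left(\frac{\Delta}{r}\right),&\text{if }\gcd(a,b,c,\Delta)=1,\text{ where } Q \text{ represents } r \text{ and }\gcd(r,\Delta)=1,\\0,&\text{otherwise.}\end{cases}$$ For a $\Gamma$-invariant function $g$ on $\mathbb H$, $$\mathrm{Tr}_{\Delta,d}(g):=\sum_{Q\in\mathcal Q_{d\Delta}/\bar\Gamma}\frac{\chi_\Delta(Q)}{\omega_Q}\,g(\alpha_Q).$$ *)

theory Defs
  imports
    "HOL-Complex_Analysis.Complex_Analysis"
    "HOL-Computational_Algebra.Squarefree"
    "HOL-Number_Theory.Residues"
begin

text \<open>Otherwise \<^const>\<open>vec_nth\<close> and \<^const>\<open>fps_nth\<close> share the dollar sign, and parsing matrix entries is exponential.\<close>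

no_notation fps_nth (infixl "$" 75)

section \<open>Discriminants and the Kronecker symbol\<close>

definition is_discriminant :: "int \<Rightarrow> bool" where
  "is_discriminant D \<longleftrightarrow> D mod 4 = 0 \<or> D mod 4 = 1"

text \<open>The usual classification; the trivial discriminant 1 counts as fundamental.\<close>

definition fundamental_discriminant :: "int \<Rightarrow> bool" where
  "fundamental_discriminant D \<longleftrightarrow>
     (D mod 4 = 1 \<and> squarefree D) \<or>
     (\<exists>k. D = 4 * k \<and> (k mod 4 = 2 \<or> k mod 4 = 3) \<and> squarefree k)"

definition kronecker_prime :: "int \<Rightarrow> int \<Rightarrow> int" where
  "kronecker_prime a p =
     (if p = 2 then (if even a then 0 else if a mod 8 = 1 \<or> a mod 8 = 7 then 1 else - 1)
      else Legendre a p)"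

text \<open>The sign factor is \<open>(a / -1)\<close>, occurring for \<open>n < 0\<close>;
  \<^const>\<open>prime_factors\<close> of an integer consists of positive primes.\<close>

definition kronecker :: "int \<Rightarrow> int \<Rightarrow> int" where
  "kronecker a n =
     (if n = 0 then (if \<bar>a\<bar> = 1 then 1 else 0)
      else (if n < 0 \<and> a < 0 then - 1 else 1) *
           (\<Prod>p\<in>prime_factors n. kronecker_prime a p ^ multiplicity p n))"


section \<open>The modular group\<close>

definition SL2Z :: "(int^2^2) set" where
  "SL2Z = {\<gamma>. det \<gamma> = 1}"

text \<open>An element of \<open>PSL\<^sub>2(\<int>)\<close> is represented by the pair of its two lifts.\<close>

definition PSL2Z :: "(int^2^2) set set" where
  "PSL2Z = (\<lambda>\<gamma>. {\<gamma>, - \<gamma>}) ` SL2Z"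

definition moebius :: "int^2^2 \<Rightarrow> complex \<Rightarrow> complex" where
  "moebius \<gamma> \<tau> =
     (of_int (\<gamma>$1$1) * \<tau> + of_int (\<gamma>$1$2)) / (of_int (\<gamma>$2$1) * \<tau> + of_int (\<gamma>$2$2))"

text \<open>The stabilizer of the cusp \<open>i\<infinity>\<close>; it contains \<open>-1\<close>.\<close>

definition Gamma_inf :: "(int^2^2) set" where
  "Gamma_inf = {\<gamma> \<in> SL2Z. \<gamma>$2$1 = 0}"

definition Gamma_inf_cosets :: "(int^2^2) set set" where
  "Gamma_inf_cosets = (\<lambda>\<gamma>. (\<lambda>\<sigma>. \<sigma> ** \<gamma>) ` Gamma_inf) ` SL2Z"


section \<open>The functions \<open>J\<^sub>1\<^sub>,\<^sub>n\<close>\<close>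

definition bessel_I :: "complex \<Rightarrow> real \<Rightarrow> complex" where
  "bessel_I \<nu> x =
     (\<Sum>k. (of_real (x / 2) powr (\<nu> + 2 * of_nat k)) * rGamma (\<nu> + of_nat k + 1) / fact k)"

text \<open>The summand is constant on each coset, so the representative does not matter.
  Note \<open>cis (2 * pi * x) = e(x)\<close>.\<close>

definition poincare_F :: "nat \<Rightarrow> complex \<Rightarrow> complex \<Rightarrow> complex" where
  "poincare_F n \<tau> s =
     of_real (2 * pi * sqrt (real n)) *
     (\<Sum>\<^sub>\<infinity>C\<in>Gamma_inf_cosets.
        (let z = moebius (SOME \<gamma>. \<gamma> \<in> C) \<tau>
         in of_real (sqrt (Im z)) * bessel_I (s - 1 / 2) (2 * pi * real n * Im z)
            * cis (2 * pi * (- (real n) * Re z))))"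

text \<open>\<open>G\<close> analytically continues a function \<open>F\<close> given on \<open>Re s > 1\<close> to a neighbourhood
  of \<open>s = 1\<close>. The germ of \<open>G\<close> at \<open>1\<close> is determined by \<open>F\<close>.\<close>

definition continues_to_1 :: "(complex \<Rightarrow> complex) \<Rightarrow> (complex \<Rightarrow> complex) \<Rightarrow> bool" where
  "continues_to_1 F G \<longleftrightarrow>
     (\<exists>U. open U \<and> connected U \<and> {s. Re s > 1} \<subseteq> U \<and> 1 \<in> U \<and>
          G holomorphic_on U \<and> (\<forall>s. Re s > 1 \<longrightarrow> G s = F s))"

definition J1 :: "nat \<Rightarrow> complex \<Rightarrow> complex" where
  "J1 n \<tau> = fps_nth (fps_expansion (SOME G. continues_to_1 (poincare_F n \<tau>) G) 1) 1"


section \<open>Binary quadratic forms and twisted traces\<close>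

text \<open>\<open>(a, b, c)\<close> stands for \<open>[a, b, c] = a X\<^sup>2 + b X Y + c Y\<^sup>2\<close>.\<close>

type_synonym bqf = "int \<times> int \<times> int"

fun form_eval :: "bqf \<Rightarrow> 'a::comm_ring_1 \<Rightarrow> 'a \<Rightarrow> 'a" where
  "form_eval (a, b, c) x y = of_int a * x^2 + of_int b * x * y + of_int c * y^2"

fun form_disc :: "bqf \<Rightarrow> int" where
  "form_disc (a, b, c) = b^2 - 4 * a * c"

definition pos_def_form :: "bqf \<Rightarrow> bool" where
  "pos_def_form Q \<longleftrightarrow> (\<forall>x y :: real. (x, y) \<noteq> (0, 0) \<longrightarrow> form_eval Q x y > 0)"

text \<open>The substitution \<open>(X, Y) \<mapsto> (g\<^sub>1\<^sub>1 X + g\<^sub>1\<^sub>2 Y, g\<^sub>2\<^sub>1 X + g\<^sub>2\<^sub>2 Y)\<close>, a right action.\<close>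

fun form_act :: "bqf \<Rightarrow> int^2^2 \<Rightarrow> bqf" where
  "form_act (a, b, c) g =
     (form_eval (a, b, c) (g$1$1) (g$2$1),
      2 * a * g$1$1 * g$1$2 + b * (g$1$1 * g$2$2 + g$1$2 * g$2$1) + 2 * c * g$2$1 * g$2$2,
      form_eval (a, b, c) (g$1$2) (g$2$2))"

text \<open>\<open>forms_of D\<close> consists of the forms of discriminant \<open>-D\<close>.\<close>

definition forms_of :: "int \<Rightarrow> bqf set" where
  "forms_of D = {Q. pos_def_form Q \<and> form_disc Q = - D}"

definition form_classes :: "int \<Rightarrow> bqf set set" where
  "form_classes D = (\<lambda>Q. form_act Q ` SL2Z) ` forms_of D"

definition form_root :: "bqf \<Rightarrow> complex" where
  "form_root Q = (THE z. Im z > 0 \<and> form_eval Q z 1 = 0)"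

definition form_omega :: "bqf \<Rightarrow> nat" where
  "form_omega Q = card {P \<in> PSL2Z. \<forall>\<gamma>\<in>P. form_act Q \<gamma> = Q}"

definition represents :: "bqf \<Rightarrow> int \<Rightarrow> bool" where
  "represents Q r \<longleftrightarrow> (\<exists>x y :: int. form_eval Q x y = r)"

text \<open>For a fundamental discriminant \<open>\<Delta>\<close> and \<open>Q\<close> of discriminant \<open>-d\<Delta>\<close> with \<open>-d\<close> a
  discriminant, the symbol does not depend on the choice of \<open>r\<close>.\<close>

fun genus_char :: "int \<Rightarrow> bqf \<Rightarrow> int" where
  "genus_char \<Delta> (a, b, c) =
     (if Gcd {a, b, c, \<Delta>} = 1
      then kronecker \<Delta> (SOME r. represents (a, b, c) r \<and> coprime r \<Delta>)
      else 0)"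

definition twisted_trace :: "int \<Rightarrow> nat \<Rightarrow> (complex \<Rightarrow> complex) \<Rightarrow> complex" where
  "twisted_trace \<Delta> d g =
     (\<Sum>C\<in>form_classes (int d * \<Delta>).
        (let Q = (SOME Q. Q \<in> C)
         in of_int (genus_char \<Delta> Q) / of_nat (form_omega Q) * g (form_root Q)))"

end

theory Submission
  imports Defs "HOL-Number_Theory.Totient" "HOL-Number_Theory.Modular_Inverse"
    "HOL-Number_Theory.Quadratic_Reciprocity"
begin

text \<open>
  Subtracting from the $I$-Bessel function its leading power splits $F_{1,0,-1}$ into a series that
  converges absolutely near $s = 1$ and a series of powers $|c\tau + d|^{-2s}$ weighted by
  $e(-a/c)$. Fourier inversion modulo $c$ turns the latter into Kloosterman sums, and the elementary
  fourth moment bound $|K(m,-1;c)| \le 2 c^{3/4} d(c)$ suffices for convergence to the left of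
  $s = 1$; Weil's bound is not needed. Counting the integral
  matrices of determinant $p$ by left and by right cosets gives
  $F_{n}|T_p = F_{pn} + p F_{n/p}$, which propagates the continuation to all $n$ and passes
  to the coefficient of $s - 1$.

  On the other side, $(Q, M) \mapsto (Q \circ M, \mathrm{adj}\, M)$ for $\det M = p$ matches Hecke
  translates of CM points, and counting those $M$ for which $Q \circ M$ is divisible by $p^2$ yields
  $\mathrm{Tr}_d(g|T_p) = \mathrm{Tr}_{p^2 d}(g) + (\frac{-d}{p}) \mathrm{Tr}_d(g) + p \mathrm{Tr}_{d/p^2}(g)$.
  Both recursions have the same Chebyshev shape, and the corollary follows by induction on $m$.
\<close>

section \<open>Kloosterman sums\<close>

text \<open>\<open>J1\<close> is read off from a continuation picked by \<open>SOME\<close>, so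
  nothing is known about it before some continuation exists. The estimates produce one for n = 1;
  every later identity is proved for Re s > 1 and carried to the derivative at 1 by uniqueness. For
  fixed c the sum over d converges absolutely for Re s > 1/2; only the sum over c needs
  cancellation. Its terms are O(d(c) c^k) with k = 3/4 - 1 + (1 - 2 Re s) + 1/16: the Kloosterman
  bound, the 1/c of Fourier inversion, the size of a sum over d, a harmonic sum over the
  frequencies. At Re s = 15/16 this is -17/16, whence the abscissa 15/16 used throughout. Cosets and
  form classes do not transform well under determinant p. Coset sums become sums over those elements
  of \<open>SL2Z\<close> that move the point into the strip 0 \<le> Re < 1; class sums run over the
  forms whose root is the chosen point of its orbit, weighted by inverse stabilizer orders. For p =
  2 and m < u, -d' need not be a discriminant, so the recursion must stay above level 0 there;
  discriminant conditions are therefore attached to the single levels.\<close>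

definition e_mod :: "nat \<Rightarrow> int \<Rightarrow> complex" where
  "e_mod c k = cis (2 * pi * of_int k / of_nat c)"

lemma e_mod_add: "e_mod c (a + b) = e_mod c a * e_mod c b"
  by (simp add: e_mod_def cis_mult add_divide_distrib distrib_left)

lemma e_mod_0 [simp]: "e_mod c 0 = 1"
  by (simp add: e_mod_def)

lemma norm_e_mod [simp]: "norm (e_mod c k) = 1"
  by (simp add: e_mod_def)

lemma cnj_e_mod: "cnj (e_mod c k) = e_mod c (- k)"
  by (simp add: e_mod_def cis_cnj)

lemma e_mod_mult_eq_1: "c > 0 \<Longrightarrow> e_mod c (int c * k) = 1"
proof -
  assume "c > 0"
  then have "2 * pi * of_int (int c * k) / of_nat c = 2 * pi * of_int k" by simp
  then show ?thesis unfolding e_mod_def by (simp add: cis_multiple_2pi)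
qed

lemma e_mod_cong: "c > 0 \<Longrightarrow> [a = b] (mod int c) \<Longrightarrow> e_mod c a = e_mod c b"
proof -
  assume c: "c > 0" and "[a = b] (mod int c)"
  then obtain k where "a = b + int c * k"
    by (metis cong_iff_lin cong_sym)
  then show ?thesis using c by (simp add: e_mod_add e_mod_mult_eq_1)
qed

lemma e_mod_pow: "e_mod c (m * k) = e_mod c k ^ nat m" if "m \<ge> 0"
proof -
  have "real (nat m) = real_of_int m" using that by simp
  moreover have "e_mod c k ^ nat m = cis (real (nat m) * (2 * pi * of_int k / of_nat c))"
    unfolding e_mod_def by (rule Complex.DeMoivre)
  ultimately show ?thesis by (simp add: e_mod_def mult_ac)
qed

lemma e_mod_eq_1_iff: "c > 0 \<Longrightarrow> e_mod c k = 1 \<longleftrightarrow> int c dvd k"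
proof
  assume c: "c > 0" and "e_mod c k = 1"
  then have "cos (2 * pi * of_int k / of_nat c) = 1"
    by (simp add: e_mod_def complex_eq_iff)
  then obtain j :: int where "2 * pi * of_int k / of_nat c = of_int j * (2 * pi)"
    using cos_one_2pi_int[of "2 * pi * of_int k / of_nat c"] by (auto simp: mult_ac)
  then have "of_int k = (of_int j * of_nat c :: real)" using c by (simp add: field_simps)
  then have "k = j * int c" by (metis of_int_eq_iff of_int_mult of_int_of_nat_eq)
  then show "int c dvd k" by simp
next
  assume "c > 0" "int c dvd k"
  then show "e_mod c k = 1" using e_mod_mult_eq_1 by (auto elim!: dvdE)
qed

lemma e_mod_orthogonality:
  assumes c: "c > 0"
  shows "(\<Sum>m\<in>{0..<int c}. e_mod c (m * k)) = (if int c dvd k then of_nat c else 0)"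
proof -
  have "(\<Sum>m\<in>{0..<int c}. e_mod c (m * k)) = (\<Sum>m<c. e_mod c k ^ m)"
    by (rule sum.reindex_bij_witness[of _ int nat]) (auto simp: e_mod_pow)
  also have "\<dots> = (if int c dvd k then of_nat c else 0)"
  proof (cases "int c dvd k")
    case True
    then show ?thesis using c by (simp add: e_mod_eq_1_iff[THEN iffD2])
  next
    case False
    have "e_mod c k ^ c = 1" using e_mod_pow[of "int c" c k] c by (simp add: e_mod_mult_eq_1)
    then show ?thesis using False c by (simp add: sum_gp_strict e_mod_eq_1_iff)
  qed
  finally show ?thesis .
qed

definition units_mod :: "nat \<Rightarrow> int set" where
  "units_mod c = {x \<in> {0..<int c}. coprime x (int c)}"

definition kloosterman :: "nat \<Rightarrow> int \<Rightarrow> int \<Rightarrow> complex" where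
  "kloosterman c m n = (\<Sum>x\<in>units_mod c. e_mod c (m * x + n * modular_inverse (int c) x))"

lemma finite_units_mod [simp]: "finite (units_mod c)"
  by (rule finite_subset[of _ "{0..<int c}"]) (auto simp: units_mod_def)

lemma card_units_mod: "c > 0 \<Longrightarrow> card (units_mod c) = totient c"
proof -
  assume c: "c > 0"
  show ?thesis
  \<comment> \<open>The representatives differ for c = 1: \<open>units_mod 1\<close> is {0}, whereas
    \<open>totatives 1\<close> is {1}.\<close>
  proof (cases "c = 1")
    case True
    then have "units_mod c = {0}" by (auto simp: units_mod_def)
    then show ?thesis using True by simp
  next
    case False
    have "units_mod c = int ` totatives c"
    proof (intro equalityI subsetI)
      fix x assume x: "x \<in> units_mod c"
      then have "x \<noteq> 0" using False c by (auto simp: units_mod_def)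
      then have "nat x \<in> totatives c" "x = int (nat x)"
        using x by (auto simp: units_mod_def in_totatives_iff coprime_int_iff[symmetric])
      then show "x \<in> int ` totatives c" by blast
    next
      fix x assume "x \<in> int ` totatives c"
      then show "x \<in> units_mod c"
        using False c totatives_less[of _ c] by (auto simp: units_mod_def in_totatives_iff)
    qed
    then show ?thesis by (simp add: totient_def card_image)
  qed
qed

section \<open>Fourth moment of Kloosterman sums\<close>

text \<open>Parseval: after expanding the square, the sums over both frequencies vanish except on
  pairs where f and g agree modulo c. With A a set of pairs of units, the inner sum is the square of
  a Kloosterman sum, and this second moment becomes the fourth moment that gives the lemma its
  name.\<close>

lemma norm_power4_moment:
  fixes f g :: "'a \<Rightarrow> int"
  assumes c: "c > 0" and A: "finite A"
  shows "(\<Sum>m\<in>{0..<int c}. \<Sum>n\<in>{0..<int c}.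
            (norm (\<Sum>x\<in>A. e_mod c (m * f x + n * g x)))^2)
       = real c ^ 2 * real (card {(x, y) \<in> A \<times> A. int c dvd f x - f y \<and> int c dvd g x - g y})"
proof -
  let ?I = "{0..<int c}"
  have sq: "of_real ((norm (\<Sum>x\<in>A. e_mod c (m * f x + n * g x)))^2)
      = (\<Sum>(x,y)\<in>A\<times>A. e_mod c (m * (f x - f y)) * e_mod c (n * (g x - g y)))" for m n
  proof -
    have "of_real ((norm (\<Sum>x\<in>A. e_mod c (m * f x + n * g x)))^2)
       = (\<Sum>x\<in>A. e_mod c (m * f x + n * g x)) * cnj (\<Sum>x\<in>A. e_mod c (m * f x + n * g x))"
      by (simp only: of_real_power complex_norm_square[symmetric])
    also have "\<dots> = (\<Sum>(x,y)\<in>A\<times>A. e_mod c (m * f x + n * g x) * e_mod c (- (m * f y + n * g y)))"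
      by (simp add: sum_product cnj_e_mod sum.cartesian_product)
    also have "\<dots> = (\<Sum>(x,y)\<in>A\<times>A. e_mod c (m * (f x - f y)) * e_mod c (n * (g x - g y)))"
      by (intro sum.cong refl) (auto simp: e_mod_add[symmetric] algebra_simps)
    finally show ?thesis .
  qed
  have "of_real (\<Sum>m\<in>?I. \<Sum>n\<in>?I. (norm (\<Sum>x\<in>A. e_mod c (m * f x + n * g x)))^2)
     = (\<Sum>m\<in>?I. \<Sum>n\<in>?I. \<Sum>(x,y)\<in>A\<times>A. e_mod c (m * (f x - f y)) * e_mod c (n * (g x - g y)))"
    unfolding of_real_sum using sq by simp
  also have "\<dots> = (\<Sum>m\<in>?I. \<Sum>z\<in>A\<times>A. \<Sum>n\<in>?I. case z of (x,y) \<Rightarrow> e_mod c (m * (f x - f y)) * e_mod c (n * (g x - g y)))"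
    by (subst (2) sum.swap) simp
  also have "\<dots> = (\<Sum>z\<in>A\<times>A. \<Sum>m\<in>?I. \<Sum>n\<in>?I. case z of (x,y) \<Rightarrow> e_mod c (m * (f x - f y)) * e_mod c (n * (g x - g y)))"
    by (rule sum.swap)
  also have "\<dots> = (\<Sum>z\<in>A\<times>A. case z of (x,y) \<Rightarrow>
      (\<Sum>m\<in>?I. e_mod c (m * (f x - f y))) * (\<Sum>n\<in>?I. e_mod c (n * (g x - g y))))"
    by (intro sum.cong refl) (auto simp: sum_product)
  also have "\<dots> = (\<Sum>z\<in>A\<times>A. if z \<in> {(x, y) \<in> A \<times> A. int c dvd f x - f y \<and> int c dvd g x - g y} then of_nat (c^2) else 0)"
    using c by (intro sum.cong refl) (auto simp: e_mod_orthogonality power2_eq_square split: if_splits)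
  also have "\<dots> = of_real (real c ^ 2 * real (card {(x, y) \<in> A \<times> A. int c dvd f x - f y \<and> int c dvd g x - g y}))"
    using A by (subst sum.If_cases)
      (auto simp: Collect_conj_eq[symmetric] Int_def case_prod_unfold intro!: arg_cong[of _ _ card])
  finally show ?thesis by (simp only: of_real_eq_iff)
qed

text \<open>Replacing the summation variable y by u y multiplies one frequency by u and the other by
  its inverse. One Kloosterman sum thus occurs many times in the moment over all
  frequencies.\<close>

lemma kloosterman_dilate:
  assumes c: "c > 0" and u: "u \<in> units_mod c"
  shows "kloosterman c (m * u mod int c) (n * modular_inverse (int c) u mod int c) = kloosterman c m n"
proof -
  let ?c = "int c" and ?i = "modular_inverse (int c)"
  have cu: "coprime u ?c" using u by (simp add: units_mod_def)
  have bij: "bij_betw (\<lambda>y. u * y mod ?c) (units_mod c) (units_mod c)"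
  proof (rule bij_betwI[of _ _ _ "\<lambda>y. ?i u * y mod ?c"])
    have 1: "u * (?i u * y) mod ?c = y" if "y \<in> units_mod c" for y
    proof -
      have "[u * ?i u * y = 1 * y] (mod ?c)"
        by (intro cong_mult cong_modular_inverse1 cu cong_refl)
      then show ?thesis using that by (simp add: cong_def units_mod_def mult.assoc)
    qed
    show "u * (?i u * y mod ?c) mod ?c = y" if "y \<in> units_mod c" for y
      using 1[OF that] by (simp add: mod_mult_right_eq)
    show "?i u * (u * y mod ?c) mod ?c = y" if "y \<in> units_mod c" for y
      using 1[OF that] by (simp add: mod_mult_right_eq mult.left_commute)
    show "(\<lambda>y. u * y mod ?c) \<in> units_mod c \<rightarrow> units_mod c"
      using cu c by (auto simp: units_mod_def coprime_commute)
    show "(\<lambda>y. ?i u * y mod ?c) \<in> units_mod c \<rightarrow> units_mod c"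
      using cu c coprime_modular_inverse[OF cu] by (auto simp: units_mod_def coprime_commute)
  qed
  have "kloosterman c m n = (\<Sum>y\<in>units_mod c. e_mod c (m * (u * y mod ?c) + n * ?i (u * y mod ?c)))"
    unfolding kloosterman_def
    by (rule sum.reindex_bij_betw[OF bij, symmetric])
  also have "\<dots> = (\<Sum>y\<in>units_mod c. e_mod c ((m * u mod ?c) * y + (n * ?i u mod ?c) * ?i y))"
  proof (intro sum.cong refl e_mod_cong c)
    fix y assume y: "y \<in> units_mod c"
    then have cy: "coprime y ?c" by (simp add: units_mod_def)
    have cuy: "coprime (u * y mod ?c) ?c" using cy cu c by (auto simp: coprime_commute)
    have "?i (u * y mod ?c) = ?i y * ?i u mod ?c"
    proof (rule modular_inverse_int_eqI)
      show "?i y * ?i u mod ?c \<in> {0..<?c}" using c by simp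
      have "[(u * ?i u) * (y * ?i y) = 1 * 1] (mod ?c)"
        by (intro cong_mult cong_modular_inverse1 cu cy)
      then show "[(u * y mod ?c) * (?i y * ?i u mod ?c) = 1] (mod ?c)"
        by (simp add: cong_def mod_mult_eq mult_ac)
    qed
    moreover have "[m * (u * y mod ?c) + n * (?i y * ?i u mod ?c) = (m * u mod ?c) * y + (n * ?i u mod ?c) * ?i y] (mod ?c)"
    proof -
      have "[m * (u * y mod ?c) + n * (?i y * ?i u mod ?c) = m * (u * y) + n * (?i y * ?i u)] (mod ?c)"
        by (intro cong_add cong_mult cong_refl) auto
      also have "m * (u * y) + n * (?i y * ?i u) = (m * u) * y + (n * ?i u) * ?i y"
        by (simp add: algebra_simps)
      also have "[\<dots> = (m * u mod ?c) * y + (n * ?i u mod ?c) * ?i y] (mod ?c)"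
        by (intro cong_add cong_mult cong_refl) auto
      finally show ?thesis .
    qed
    ultimately show "[m * (u * y mod ?c) + n * ?i (u * y mod ?c) = (m * u mod ?c) * y + (n * ?i u mod ?c) * ?i y] (mod ?c)"
      by simp
  qed
  also have "\<dots> = kloosterman c (m * u mod ?c) (n * ?i u mod ?c)"
    by (simp add: kloosterman_def)
  finally show ?thesis by simp
qed

lemma card_residue_class:
  fixes L r :: int
  assumes "L > 0" "L dvd int c"
  shows "card {x \<in> {0..<int c}. L dvd x - r} \<le> c div nat L"
proof -
  obtain k where k: "int c = L * k" using assms by auto
  have "int (c div nat L) = k" using assms k by (simp add: zdiv_int)
  then have ck: "c div nat L = nat k" by simp
  have "{x \<in> {0..<int c}. L dvd x - r} \<subseteq> (\<lambda>j. L * j + r mod L) ` {0..<k}"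
  proof
    fix x assume "x \<in> {x \<in> {0..<int c}. L dvd x - r}"
    then have x: "0 \<le> x" "x < L * k" "x mod L = r mod L"
      using k by (auto simp: mod_eq_dvd_iff)
    have "x = L * (x div L) + r mod L" using x by (metis mult_div_mod_eq)
    moreover have "x div L < k"
    proof (rule ccontr)
      assume "\<not> x div L < k"
      then have "L * k \<le> L * (x div L)" using assms by simp
      also have "\<dots> \<le> x" using mult_div_mod_eq[of L x] assms pos_mod_sign[of L x] by linarith
      finally show False using x by simp
    qed
    moreover have "x div L \<ge> 0" using x assms by (simp add: pos_imp_zdiv_nonneg_iff)
    ultimately show "x \<in> (\<lambda>j. L * j + r mod L) ` {0..<k}" by auto
  qed
  then have "card {x \<in> {0..<int c}. L dvd x - r} \<le> card {0..<k}"
    by (rule surj_card_le[rotated]) simp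
  then show ?thesis using ck by simp
qed

text \<open>If there is a solution at all, the solutions form one class modulo
  \<open>lcm a b\<close>. The bound is stated over the reals so that gcd times lcm can be cancelled
  without rounding.\<close>

lemma card_residue_class2:
  fixes a b r r' :: int
  assumes c: "c > 0" and ab: "a > 0" "b > 0" "a dvd int c" "b dvd int c"
  shows "real (card {x \<in> {0..<int c}. a dvd x - r \<and> b dvd x - r'}) \<le> real c * of_int (gcd a b) / (of_int a * of_int b)"
proof (cases "{x \<in> {0..<int c}. a dvd x - r \<and> b dvd x - r'} = {}")
  case True
  then have "card {x \<in> {0..<int c}. a dvd x - r \<and> b dvd x - r'} = 0" by (simp only: card.empty)
  then show ?thesis using ab by (simp only:) simp
next
  case False
  then obtain x0 where x0: "a dvd x0 - r" "b dvd x0 - r'" by auto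
  have L: "lcm a b > 0" using ab by (simp add: lcm_pos_int)
  have Lc: "lcm a b dvd int c" using ab by simp
  have "{x \<in> {0..<int c}. a dvd x - r \<and> b dvd x - r'} \<subseteq> {x \<in> {0..<int c}. lcm a b dvd x - x0}"
  proof clarify
    fix x assume x: "a dvd x - r" "b dvd x - r'"
    have "a dvd (x - r) - (x0 - r)" "b dvd (x - r') - (x0 - r')"
      using x x0 by (blast intro: dvd_diff)+
    then show "lcm a b dvd x - x0" by simp
  qed
  then have "card {x \<in> {0..<int c}. a dvd x - r \<and> b dvd x - r'} \<le> card {x \<in> {0..<int c}. lcm a b dvd x - x0}"
    by (intro card_mono finite_subset[of "{x \<in> {0..<int c}. lcm a b dvd x - x0}" "{0..<int c}"]) auto
  also have "\<dots> \<le> c div nat (lcm a b)" by (rule card_residue_class[OF L Lc])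
  finally have "real (card {x \<in> {0..<int c}. a dvd x - r \<and> b dvd x - r'}) \<le> real (c div nat (lcm a b))" by simp
  also have "\<dots> \<le> real c / real (nat (lcm a b))" using of_nat_div_le_of_nat by blast
  also have "real (nat (lcm a b)) = of_int a * of_int b / of_int (gcd a b)"
  proof -
    have "a * b = gcd a b * lcm a b" using ab by (simp add: prod_gcd_lcm_int[symmetric] abs_mult)
    then have "real_of_int a * of_int b = of_int (gcd a b) * of_int (lcm a b)"
      by (metis of_int_mult)
    then show ?thesis using ab L by (simp add: field_simps)
  qed
  finally show ?thesis by simp
qed

text \<open>Fix x3 and let g = gcd(e1, e3). The congruences modulo e1 and e3 add up to g dvd x1 +
  x3, so x1 is restricted modulo e2 and g, and then x2 modulo e1 and e3. The factor g lost in
  counting x2 is regained in counting x1. The constant 2 bounds gcd(e2, g), which divides 2 x3 and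
  is coprime to the unit x3.\<close>

lemma card_triple_congruences:
  fixes e1 e2 e3 :: nat
  assumes c: "c > 0" and e: "e1 * e2 * e3 = c"
  shows "card {(x1, x2, x3). x1 \<in> {0..<int c} \<and> x2 \<in> {0..<int c} \<and> x3 \<in> units_mod c \<and>
     int e1 dvd x1 + x2 \<and> int e2 dvd x3 - x1 \<and> int e3 dvd x3 - x2} \<le> 2 * c ^ 2"
proof -
  have pos: "e1 > 0" "e2 > 0" "e3 > 0" using c e by auto
  have dv: "int e1 dvd int c" "int e2 dvd int c" "int e3 dvd int c" using e by auto
  define g where "g = gcd (int e1) (int e3)"
  have g: "g > 0" "g dvd int e1" "g dvd int e3" using pos by (auto simp: g_def)
  have gc: "g dvd int c" using g dv dvd_trans by blast
  define X1 where "X1 x3 = {x1 \<in> {0..<int c}. int e2 dvd x1 - x3 \<and> g dvd x1 - (- x3)}" for x3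
  define X2 where "X2 x3 x1 = {x2 \<in> {0..<int c}. int e1 dvd x2 - (- x1) \<and> int e3 dvd x2 - x3}" for x3 x1
  have finX: "finite (X1 x3)" "finite (X2 x3 x1)" for x3 x1
    by (rule finite_subset[of _ "{0..<int c}"]; auto simp: X1_def X2_def)+
  have cardX2: "real (card (X2 x3 x1)) \<le> real c * of_int g / (real e1 * real e3)" for x3 x1
    using card_residue_class2[OF c, of "int e1" "int e3" "- x1" x3] pos dv by (simp add: X2_def g_def)
  have cardX1: "real (card (X1 x3)) \<le> real c * 2 / (real e2 * of_int g)" if x3: "x3 \<in> units_mod c" for x3
  proof (cases "X1 x3 = {}")
    case True
    then show ?thesis using g by simp
  next
    case False
    then obtain x1 where "int e2 dvd x1 - x3" "g dvd x1 - (- x3)" by (auto simp: X1_def)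
    then have "gcd (int e2) g dvd x1 - x3" "gcd (int e2) g dvd x1 - (- x3)"
      by (meson dvd_trans gcd_dvd1 gcd_dvd2)+
    then have "gcd (int e2) g dvd (x1 - (- x3)) - (x1 - x3)" by (rule dvd_diff[rotated])
    then have "gcd (int e2) g dvd 2 * x3" by simp
    moreover have "coprime (gcd (int e2) g) x3"
    proof -
      have "coprime (int c) x3" using x3 by (simp add: units_mod_def coprime_commute)
      moreover have "gcd (int e2) g dvd int c" using gc by (meson dvd_trans gcd_dvd2)
      ultimately show ?thesis by (rule coprime_divisors[rotated 2]) auto
    qed
    ultimately have "gcd (int e2) g dvd 2" by (simp add: coprime_dvd_mult_left_iff)
    then have le2: "gcd (int e2) g \<le> 2" by (simp add: zdvd_imp_le)
    have "real (card (X1 x3)) \<le> real c * of_int (gcd (int e2) g) / (real e2 * of_int g)"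
      using card_residue_class2[OF c, of "int e2" g x3 "- x3"] pos dv g gc by (simp add: X1_def)
    also have "\<dots> \<le> real c * 2 / (real e2 * of_int g)"
      using le2 g by (intro divide_right_mono mult_left_mono) auto
    finally show ?thesis .
  qed
  let ?T = "{(x1, x2, x3). x1 \<in> {0..<int c} \<and> x2 \<in> {0..<int c} \<and> x3 \<in> units_mod c \<and>
     int e1 dvd x1 + x2 \<and> int e2 dvd x3 - x1 \<and> int e3 dvd x3 - x2}"
  let ?S = "SIGMA x3:units_mod c. SIGMA x1:X1 x3. X2 x3 x1"
  have sub: "?T \<subseteq> (\<lambda>(x3, x1, x2). (x1, x2, x3)) ` ?S"
  proof
    fix z assume "z \<in> ?T"
    then obtain x1 x2 x3 where z: "z = (x1, x2, x3)" and r: "x1 \<in> {0..<int c}" "x2 \<in> {0..<int c}"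
      "x3 \<in> units_mod c" and d: "int e1 dvd x1 + x2" "int e2 dvd x3 - x1" "int e3 dvd x3 - x2" by auto
    have "g dvd (x1 + x2) + (x3 - x2)" using d g by (meson dvd_add dvd_trans)
    then have "x1 \<in> X1 x3" using r d by (auto simp: X1_def dvd_diff_commute algebra_simps)
    moreover have "x2 \<in> X2 x3 x1" using r d by (auto simp: X2_def dvd_diff_commute algebra_simps)
    ultimately show "z \<in> (\<lambda>(x3, x1, x2). (x1, x2, x3)) ` ?S" using z r by (auto intro!: image_eqI[of _ _ "(x3, x1, x2)"])
  qed
  have finS: "finite ?S" using finX by auto
  have "card ?T \<le> card ?S"
    using sub finS by (meson card_image_le card_mono finite_imageI le_trans)
  also have "card ?S = (\<Sum>x3\<in>units_mod c. \<Sum>x1\<in>X1 x3. card (X2 x3 x1))"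
    using finX by (simp add: card_SigmaI)
  finally have "real (card ?T) \<le> (\<Sum>x3\<in>units_mod c. \<Sum>x1\<in>X1 x3. real (card (X2 x3 x1)))"
    by (metis (mono_tags, lifting) of_nat_le_iff of_nat_sum sum.cong)
  also have "\<dots> \<le> (\<Sum>x3\<in>units_mod c. \<Sum>x1\<in>X1 x3. real c * of_int g / (real e1 * real e3))"
    by (intro sum_mono cardX2)
  also have "\<dots> = (\<Sum>x3\<in>units_mod c. real (card (X1 x3)) * (real c * of_int g / (real e1 * real e3)))"
    by simp
  also have "\<dots> \<le> (\<Sum>x3\<in>units_mod c. (real c * 2 / (real e2 * of_int g)) * (real c * of_int g / (real e1 * real e3)))"
    using g by (intro sum_mono mult_right_mono cardX1) auto
  also have "\<dots> = real (card (units_mod c)) * ((real c * 2 / (real e2 * of_int g)) * (real c * of_int g / (real e1 * real e3)))"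
    by simp
  also have "(real c * 2 / (real e2 * of_int g)) * (real c * of_int g / (real e1 * real e3)) = 2 * real c"
    using g pos by (simp add: e[symmetric] field_simps)
  also have "real (card (units_mod c)) * (2 * real c) \<le> real c * (2 * real c)"
    by (intro mult_right_mono) (auto simp: card_units_mod[OF c] totient_le)
  also have "\<dots> = real (2 * c ^ 2)" by (simp add: power2_eq_square)
  finally show ?thesis by (simp only: of_nat_le_iff)
qed

text \<open>Clearing the inverses and eliminating x4 leaves c dvd (x1 + x2)(x3 - x1)(x3 - x2).
  Splitting c along the three factors reduces the count to \<open>card_triple_congruences\<close>; a
  splitting is determined by two divisors of c, whence the square, and x4 is determined by x1, x2,
  x3.\<close>

lemma card_kloosterman_solutions:
  assumes c: "c > 0"
  shows "card {(x, y) \<in> (units_mod c \<times> units_mod c) \<times> (units_mod c \<times> units_mod c).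
      int c dvd (fst x + snd x) - (fst y + snd y) \<and>
      int c dvd (modular_inverse (int c) (fst x) + modular_inverse (int c) (snd x))
              - (modular_inverse (int c) (fst y) + modular_inverse (int c) (snd y))}
    \<le> 2 * c ^ 2 * card {e. e dvd c} ^ 2" (is "card ?N \<le> _")
proof -
  let ?i = "modular_inverse (int c)" and ?U = "units_mod c"
  define T where "T e1 e2 e3 = {(x1, x2, x3). x1 \<in> {0..<int c} \<and> x2 \<in> {0..<int c} \<and> x3 \<in> units_mod c \<and>
     int e1 dvd x1 + x2 \<and> int e2 dvd x3 - x1 \<and> int e3 dvd x3 - x2}" for e1 e2 e3 :: nat
  define E where "E = {(e1, e2, e3). e1 * e2 * e3 = c}"
  let ?pr = "\<lambda>((x1, x2), (x3, x4 :: int)). (x1, x2, x3 :: int)"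
  have finT: "finite (T e1 e2 e3)" for e1 e2 e3
    by (rule finite_subset[of _ "{0..<int c} \<times> {0..<int c} \<times> ?U"]) (auto simp: T_def)
  have E: "E \<subseteq> (\<lambda>(e1, e2). (e1, e2, c div (e1 * e2))) ` ({e. e dvd c} \<times> {e. e dvd c})"
  proof
    fix z assume "z \<in> E"
    then obtain e1 e2 e3 where z: "z = (e1, e2, e3)" "e1 * e2 * e3 = c" by (auto simp: E_def)
    then have nz: "e1 * e2 \<noteq> 0" and dv: "e1 dvd c" "e2 dvd c" using c by auto
    from nz have "e3 = c div (e1 * e2)" using z by auto
    then show "z \<in> (\<lambda>(e1, e2). (e1, e2, c div (e1 * e2))) ` ({e. e dvd c} \<times> {e. e dvd c})"
      using z dv by (intro image_eqI[of _ _ "(e1, e2)"]) auto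
  qed
  have fdiv: "finite {e. e dvd c}" using c by simp
  have finE: "finite E" using E fdiv by (meson finite_SigmaI finite_imageI finite_subset)
  have cardE: "card E \<le> card {e. e dvd c} ^ 2"
    using card_mono[OF _ E] card_image_le[of "{e. e dvd c} \<times> {e. e dvd c}" "\<lambda>(e1, e2). (e1, e2, c div (e1 * e2))"] fdiv
    by (simp add: card_cartesian_product power2_eq_square)
  have sub: "?pr ` ?N \<subseteq> (\<Union>(e1, e2, e3)\<in>E. T e1 e2 e3)"
  proof
    fix z assume "z \<in> ?pr ` ?N"
    then obtain x1 x2 x3 x4 where z: "z = (x1, x2, x3)" and U: "x1 \<in> ?U" "x2 \<in> ?U" "x3 \<in> ?U" "x4 \<in> ?U"
      and d: "int c dvd (x1 + x2) - (x3 + x4)" "int c dvd (?i x1 + ?i x2) - (?i x3 + ?i x4)" by force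
    have inv: "[x * ?i x = 1] (mod int c)" if "x \<in> ?U" for x
      using that by (intro cong_modular_inverse1) (simp add: units_mod_def)
    have s: "[x3 + x4 = x1 + x2] (mod int c)"
      using d(1) by (simp add: cong_iff_dvd_diff dvd_diff_commute)
    then have x4: "[x4 = x1 + x2 - x3] (mod int c)" 
      by (simp add: cong_iff_dvd_diff algebra_simps)
    have "[?i x1 + ?i x2 = ?i x3 + ?i x4] (mod int c)"
      using d(2) by (simp add: cong_iff_dvd_diff)
    then have "[(x1 * x2 * x3 * x4) * (?i x1 + ?i x2) = (x1 * x2 * x3 * x4) * (?i x3 + ?i x4)] (mod int c)"
      by (intro cong_mult cong_refl)
    moreover have "[(x1 * x2 * x3 * x4) * (?i x1 + ?i x2) = (x3 * x4) * (x1 + x2)] (mod int c)"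
    proof -
      have "[x3 * x4 * x2 * (x1 * ?i x1) + x3 * x4 * x1 * (x2 * ?i x2) = x3 * x4 * x2 * 1 + x3 * x4 * x1 * 1] (mod int c)"
        by (intro cong_add cong_mult cong_refl inv U)
      then show ?thesis by (simp add: algebra_simps)
    qed
    moreover have "[(x1 * x2 * x3 * x4) * (?i x3 + ?i x4) = (x1 * x2) * (x3 + x4)] (mod int c)"
    proof -
      have "[x1 * x2 * x4 * (x3 * ?i x3) + x1 * x2 * x3 * (x4 * ?i x4) = x1 * x2 * x4 * 1 + x1 * x2 * x3 * 1] (mod int c)"
        by (intro cong_add cong_mult cong_refl inv U)
      then show ?thesis by (simp add: algebra_simps)
    qed
    moreover have "[(x1 * x2) * (x3 + x4) = (x1 * x2) * (x1 + x2)] (mod int c)"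
      by (intro cong_mult cong_refl s)
    moreover have "[(x3 * x4) * (x1 + x2) = (x3 * (x1 + x2 - x3)) * (x1 + x2)] (mod int c)"
      by (intro cong_mult cong_refl x4)
    ultimately have "[(x3 * (x1 + x2 - x3)) * (x1 + x2) = (x1 * x2) * (x1 + x2)] (mod int c)"
      by (meson cong_sym cong_trans)
    then have "int c dvd (x3 * (x1 + x2 - x3)) * (x1 + x2) - (x1 * x2) * (x1 + x2)"
      by (simp add: cong_iff_dvd_diff)
    \<comment> \<open>The pairs (x1, x2) and (x3, x1 + x2 - x3) have equal sums, so the difference
      of their products factors as -(x3 - x1)(x3 - x2).\<close>
    also have "(x3 * (x1 + x2 - x3)) * (x1 + x2) - (x1 * x2) * (x1 + x2) = - (((x1 + x2) * (x3 - x1)) * (x3 - x2))"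
      by (simp add: algebra_simps)
    finally have "int c dvd \<bar>(x1 + x2) * (x3 - x1) * (x3 - x2)\<bar>" by simp
    then have "int c dvd int (nat \<bar>x1 + x2\<bar> * nat \<bar>x3 - x1\<bar> * nat \<bar>x3 - x2\<bar>)"
      by (simp add: abs_mult)
    then have "c dvd nat \<bar>x1 + x2\<bar> * nat \<bar>x3 - x1\<bar> * nat \<bar>x3 - x2\<bar>"
      by (simp only: int_dvd_int_iff)
    then obtain f e3 where f: "c = f * e3" "f dvd nat \<bar>x1 + x2\<bar> * nat \<bar>x3 - x1\<bar>" "e3 dvd nat \<bar>x3 - x2\<bar>"
      using division_decomp by blast
    then obtain e1 e2 where "f = e1 * e2" "e1 dvd nat \<bar>x1 + x2\<bar>" "e2 dvd nat \<bar>x3 - x1\<bar>"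
      using division_decomp by blast
    then have "(e1, e2, e3) \<in> E" "z \<in> T e1 e2 e3"
      using f U z by (auto simp: E_def T_def units_mod_def int_dvd_int_iff[symmetric])
    then show "z \<in> (\<Union>(e1, e2, e3)\<in>E. T e1 e2 e3)" by blast
  qed
  have inj: "inj_on ?pr ?N"
  proof (rule inj_onI)
    fix z w assume zw: "z \<in> ?N" "w \<in> ?N" "?pr z = ?pr w"
    obtain x1 x2 x3 x4 where z: "z = ((x1, x2), (x3, x4))" by (metis surj_pair)
    obtain x4' where w: "w = ((x1, x2), (x3, x4'))" using zw(3) z by (cases w) auto
    have "int c dvd (x1 + x2) - (x3 + x4)" "int c dvd (x1 + x2) - (x3 + x4')"
      using zw z w by auto
    then have "int c dvd ((x1 + x2) - (x3 + x4)) - ((x1 + x2) - (x3 + x4'))" by (rule dvd_diff)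
    then have "[x4' = x4] (mod int c)" by (simp add: cong_iff_dvd_diff)
    then have "x4' = x4" using zw z w by (auto simp: units_mod_def cong_def)
    then show "z = w" using z w by simp
  qed
  have "card ?N = card (?pr ` ?N)" using inj by (simp add: card_image)
  also have "\<dots> \<le> card (\<Union>(e1, e2, e3)\<in>E. T e1 e2 e3)"
    using sub finE finT by (intro card_mono) auto
  also have "\<dots> \<le> (\<Sum>(e1, e2, e3)\<in>E. card (T e1 e2 e3))"
    using card_UN_le[OF finE, of "\<lambda>(e1, e2, e3). T e1 e2 e3"] by (simp add: case_prod_unfold)
  also have "\<dots> \<le> (\<Sum>(e1, e2, e3)\<in>E. 2 * c ^ 2)"
    using card_triple_congruences[OF c] by (intro sum_mono) (auto simp: E_def T_def)
  also have "\<dots> = 2 * c ^ 2 * card E" by (simp add: case_prod_unfold)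
  also have "\<dots> \<le> 2 * c ^ 2 * card {e. e dvd c} ^ 2" using cardE by simp
  finally show ?thesis .
qed

text \<open>Lets the division by \<open>totient c\<close> in the moment argument be replaced by a
  division by c, at the cost of one divisor factor.\<close>

lemma totient_divisor_bound: "c > 0 \<Longrightarrow> c \<le> totient c * card {e. e dvd c}"
proof -
  assume c: "c > 0"
  have "c = (\<Sum>d | d dvd c. totient d)" by (simp add: totient_divisor_sum)
  also have "\<dots> \<le> (\<Sum>d | d dvd c. totient c)"
    using c by (intro sum_mono) (auto intro: totient_dvd_mono)
  finally show ?thesis by (simp add: mult.commute)
qed

text \<open>The dilations by units give \<open>totient c\<close> distinct frequency pairs with the
  same value; they are distinct because the second coordinate, minus the inverse of u, determines u
  whatever m is. So totient(c) S^4 is at most the fourth moment 2 c^4 d(c)^2, and S^4 is at most 2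
  c^3 d(c)^3.\<close>

theorem kloosterman_bound:
  assumes c: "c > 0"
  shows "norm (kloosterman c m (-1)) \<le> 2 * real c powr (3/4) * real (card {e. e dvd c})"
proof -
  let ?U = "units_mod c" and ?i = "modular_inverse (int c)" and ?I = "{0..<int c}"
  define D where "D = real (card {e. e dvd c})"
  define S where "S = norm (kloosterman c m (-1))"
  define N where "N = {(x, y) \<in> (?U \<times> ?U) \<times> (?U \<times> ?U).
      int c dvd (fst x + snd x) - (fst y + snd y) \<and>
      int c dvd (?i (fst x) + ?i (snd x)) - (?i (fst y) + ?i (snd y))}"
  have sq: "(kloosterman c a b)^2 = (\<Sum>x\<in>?U\<times>?U. e_mod c (a * (fst x + snd x) + b * (?i (fst x) + ?i (snd x))))" for a b
    unfolding kloosterman_def power2_eq_square sum_product sum.cartesian_product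
    by (intro sum.cong refl) (auto simp: e_mod_add[symmetric] algebra_simps)
  have mom: "(\<Sum>a\<in>?I. \<Sum>b\<in>?I. norm (kloosterman c a b) ^ 4) = real c ^ 2 * real (card N)"
  proof -
    have "norm (kloosterman c a b) ^ 4 = norm (\<Sum>x\<in>?U\<times>?U. e_mod c (a * (fst x + snd x) + b * (?i (fst x) + ?i (snd x)))) ^ 2" for a b
      by (simp only: sq[symmetric] norm_power power_mult[symmetric]) simp
    then show ?thesis using norm_power4_moment[OF c, of "?U \<times> ?U" "\<lambda>x. fst x + snd x" "\<lambda>x. ?i (fst x) + ?i (snd x)"]
      by (simp add: N_def)
  qed
  define P where "P = (\<lambda>u. (m * u mod int c, (-1) * ?i u mod int c)) ` ?U"
  have P: "P \<subseteq> ?I \<times> ?I" using c by (auto simp: P_def)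
  have injP: "inj_on (\<lambda>u. (m * u mod int c, (-1) * ?i u mod int c)) ?U"
  proof (rule inj_onI)
    fix u v assume uv: "u \<in> ?U" "v \<in> ?U" "(m * u mod int c, (-1) * ?i u mod int c) = (m * v mod int c, (-1) * ?i v mod int c)"
    then have "[(-1) * ?i u = (-1) * ?i v] (mod int c)" by (simp add: cong_def)
    then have "[(-1) * ((-1) * ?i u) = (-1) * ((-1) * ?i v)] (mod int c)" by (rule cong_scalar_left)
    then have iuv: "[?i v = ?i u] (mod int c)" by (simp add: cong_sym)
    have cop: "coprime u (int c)" "coprime v (int c)" using uv by (auto simp: units_mod_def)
    have "[u * 1 = u * (v * ?i v)] (mod int c)"
      by (intro cong_mult cong_refl cong_sym[OF cong_modular_inverse1] cop)
    also have "u * (v * ?i v) = v * (u * ?i v)" by (simp add: mult_ac)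
    also have "[v * (u * ?i v) = v * (u * ?i u)] (mod int c)"
      by (intro cong_mult cong_refl iuv)
    also have "[v * (u * ?i u) = v * 1] (mod int c)"
      by (intro cong_mult cong_refl cong_modular_inverse1 cop)
    finally show "u = v" using uv by (auto simp: cong_def units_mod_def)
  qed
  have "real (totient c) * S ^ 4 = (\<Sum>(a, b)\<in>P. norm (kloosterman c a b) ^ 4)"
    unfolding P_def
    by (subst sum.reindex[OF injP]) (auto simp: kloosterman_dilate[OF c, of _ m "-1", simplified] S_def card_units_mod[OF c])
  also have "\<dots> \<le> (\<Sum>(a, b)\<in>?I \<times> ?I. norm (kloosterman c a b) ^ 4)"
    using P by (intro sum_mono2) auto
  also have "\<dots> = real c ^ 2 * real (card N)" using mom by (simp add: sum.cartesian_product)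
  also have "\<dots> \<le> real c ^ 2 * (2 * real c ^ 2 * D ^ 2)"
    using card_kloosterman_solutions[OF c] unfolding N_def[symmetric] D_def
    by (intro mult_left_mono) (simp_all flip: of_nat_power of_nat_mult add: mult_ac)
  finally have 1: "real (totient c) * S ^ 4 \<le> 2 * real c ^ 4 * D ^ 2" by (simp add: power_numeral_reduce mult_ac)
  have D1: "D \<ge> 1"
  proof -
    have "card {e. e dvd c} > 0" using c by (auto simp: card_gt_0_iff)
    then show ?thesis by (simp add: D_def)
  qed
  have "real c * S ^ 4 \<le> (real (totient c) * D) * S ^ 4"
    using totient_divisor_bound[OF c] unfolding D_def
    by (intro mult_right_mono) (simp_all flip: of_nat_mult)
  also have "\<dots> = (real (totient c) * S ^ 4) * D" by (simp add: mult_ac)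
  also have "\<dots> \<le> (2 * real c ^ 4 * D ^ 2) * D" using 1 D1 by (intro mult_right_mono) auto
  finally have "real c * S ^ 4 \<le> real c * (2 * real c ^ 3 * D ^ 3)" by (simp add: power_numeral_reduce mult_ac)
  then have "S ^ 4 \<le> 2 * real c ^ 3 * D ^ 3" using c by simp
  \<comment> \<open>The constant 2 and the cube of D are enlarged so that the right-hand side
    becomes a perfect fourth power.\<close>
  also have "\<dots> \<le> 16 * real c ^ 3 * D ^ 4"
    using D1 by (intro mult_mono power_increasing) (use c in auto)
  also have "real c ^ 3 = (real c powr (3/4)) ^ 4"
    using c by (simp add: powr_power)
  also have "16 * (real c powr (3/4)) ^ 4 * D ^ 4 = (2 * real c powr (3/4) * D) ^ 4" by (simp add: power_mult_distrib)
  finally show ?thesis unfolding S_def[symmetric] D_def[symmetric]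
    using D1 by (subst (asm) power_mono_iff) (auto simp: S_def)
qed

section \<open>The Kloosterman zeta function\<close>

lemma summable_on_int_max_powr:
  fixes a :: real
  assumes "a > 1"
  shows "(\<lambda>k::int. (max 1 \<bar>of_int k\<bar>) powr (-a)) summable_on UNIV"
proof -
  let ?g = "\<lambda>n::nat. (max 1 (real n)) powr (-a)"
  have "summable (\<lambda>n::nat. real n powr (-a))" using assms by (simp add: summable_real_powr_iff)
  moreover have "eventually (\<lambda>n. ?g n = real n powr (-a)) sequentially"
    using eventually_ge_at_top[of "1::nat"] by eventually_elim (simp add: max_def)
  ultimately have "summable ?g" using summable_cong by fastforce
  then have g: "?g summable_on UNIV" by (subst summable_on_UNIV_nonneg_real_iff) auto
  have "(\<lambda>k::int. (max 1 \<bar>of_int k\<bar>) powr (-a)) summable_on range int"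
    by (subst summable_on_reindex) (use g in \<open>auto simp: o_def\<close>)
  moreover have "(\<lambda>k::int. (max 1 \<bar>of_int k\<bar>) powr (-a)) summable_on range (\<lambda>n. - int n)"
    by (subst summable_on_reindex) (use g in \<open>auto simp: o_def inj_on_def\<close>)
  ultimately have "(\<lambda>k::int. (max 1 \<bar>of_int k\<bar>) powr (-a)) summable_on (range int \<union> range (\<lambda>n. - int n))"
    by (rule summable_on_union)
  moreover have "range int \<union> range (\<lambda>n. - int n) = UNIV"
    by (auto simp: image_iff) (metis int_cases2)
  ultimately show ?thesis by simp
qed

lemma summable_on_nat_powr:
  assumes "a > 1"
  shows "(\<lambda>c::nat. real c powr (-a)) summable_on UNIV"
  using assms by (subst summable_on_UNIV_nonneg_real_iff) (auto simp: summable_real_powr_iff)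

lemma summable_on_int_quadratic_powr:
  fixes a :: real
  assumes "a > 1/2"
  shows "(\<lambda>k::int. (1 + (of_int k)^2) powr (-a)) summable_on UNIV"
proof (rule summable_on_comparison_test)
  show "(\<lambda>k::int. (max 1 \<bar>of_int k\<bar>) powr (-(2*a))) summable_on UNIV"
    using assms by (intro summable_on_int_max_powr) auto
  fix k :: int
  have "(max 1 \<bar>of_int k\<bar> :: real)^2 \<le> 1 + (of_int k)^2" by (auto simp: max_def)
  then have "(1 + (of_int k)^2) powr (-a) \<le> ((max 1 \<bar>of_int k\<bar> :: real)^2) powr (-a)"
    using assms by (intro powr_mono2') auto
  also have "\<dots> = (max 1 \<bar>of_int k\<bar>) powr (-(2*a))"
    by (simp add: powr_powr flip: powr_numeral)
  finally show "(1 + (of_int k)^2) powr (-a) \<le> (max 1 \<bar>of_int k\<bar> :: real) powr (-(2*a))" .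
qed auto

text \<open>Write d = j + c k with 0 \<le> j < c and t = j/c + k; then c^2 + d^2 = c^2 (1 + t^2) and
  1 + t^2 \<ge> (1 + k^2)/4. Each of the c residue classes contributes at most a constant times
  c^(-2a). One constant serves all a \<ge> a0 because 1 + t^2 \<ge> 1.\<close>

lemma sum_int_quadratic_bound:
  fixes a0 :: real
  assumes a0: "a0 > 1/2"
  shows "\<exists>K. \<forall>c::nat. \<forall>a. c \<ge> 1 \<longrightarrow> a \<ge> a0 \<longrightarrow>
     (\<lambda>d::int. (real c ^ 2 + (of_int d)^2) powr (-a)) summable_on UNIV \<and>
     (\<Sum>\<^sub>\<infinity>d::int. (real c ^ 2 + (of_int d)^2) powr (-a)) \<le> K * real c powr (1 - 2 * a)"
proof (intro exI allI impI)
  let ?W = "\<lambda>k::int. (1 + (of_int k)^2) powr (-a0)"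
  let ?K = "4 powr a0 * (\<Sum>\<^sub>\<infinity>k. ?W k)"
  fix c :: nat and a :: real
  assume c: "c \<ge> 1" and a: "a \<ge> a0"
  define f where "f d = (real c ^ 2 + (of_int d)^2) powr (-a)" for d :: int
  define b where "b k = real c powr (-2*a) * (4 powr a0 * ?W k)" for k
  let ?A = "{0..<int c}"
  have W: "?W summable_on UNIV" using a0 by (rule summable_on_int_quadratic_powr)
  have bs: "b summable_on UNIV" unfolding b_def using W by (intro summable_on_cmult_right)
  have b0: "b k \<ge> 0" for k by (simp add: b_def)
  have fb: "f (j + int c * k) \<le> b k" if "j \<in> ?A" for j k
  proof -
    define t :: real where "t = of_int j / real c + of_int k"
    have t0: "0 \<le> of_int j / real c" "of_int j / real c < 1" using that c by (auto simp: field_simps)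
    have "(1 + (of_int k)^2) / 4 \<le> 1 + t^2"
    proof (cases "k \<ge> 0")
      case True
      have "(of_int k)^2 \<le> t^2" using True t0 by (intro power_mono) (auto simp: t_def)
      moreover have "(1 + y) / 4 \<le> 1 + x" if "y \<le> x" "0 \<le> x" for x y :: real
        using that by (simp add: divide_le_eq)
      ultimately show ?thesis using zero_le_power2[of t] by blast
    next
      case False
      then have k: "of_int k \<le> (-1 :: real)" by linarith
      have "(of_int (-k) - 1)^2 \<le> (-t)^2" using k t0 by (intro power_mono) (auto simp: t_def)
      moreover have "(1 + (of_int k)^2) / 4 \<le> 1 + (of_int (-k) - 1 :: real)^2"
      proof -
        \<comment> \<open>Clearing denominators leaves 3 k^2 + 8 k + 7 \<ge> 0, and three times the
          left side is (3 k + 4)^2 + 5.\<close>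
        have "0 \<le> (3 * of_int k + 4 :: real)^2" by simp
        then show ?thesis by (simp add: power2_eq_square algebra_simps)
      qed
      ultimately show ?thesis by simp
    qed
    moreover have "f (j + int c * k) = real c powr (-2*a) * (1 + t^2) powr (-a)"
    proof -
      have "real c ^ 2 + (of_int (j + int c * k))^2 = (real c)^2 * (1 + t^2)"
        using c by (simp add: t_def power2_eq_square field_simps)
      then show ?thesis using c by (simp add: f_def powr_mult powr_powr flip: powr_numeral)
    qed
    moreover have "(1 + t^2) powr (-a) \<le> (1 + t^2) powr (-a0)" using a by (intro powr_mono) auto
    moreover have "(1 + t^2) powr (-a0) \<le> ((1 + (of_int k)^2) / 4) powr (-a0)" if "(1 + (of_int k)^2) / 4 \<le> 1 + t^2"
      using that a0 by (intro powr_mono2') (auto intro: add_pos_nonneg)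
    moreover have "((1 + (of_int k)^2) / 4 :: real) powr (-a0) = 4 powr a0 * ?W k"
      by (simp add: powr_divide powr_minus divide_simps)
    ultimately have "f (j + int c * k) = real c powr (-2*a) * (1 + t^2) powr (-a)" "(1 + t^2) powr (-a) \<le> 4 powr a0 * ?W k" by auto
    then show ?thesis unfolding b_def by (metis mult_left_mono powr_ge_zero)
  qed
  have hb: "((\<lambda>(j,k). b k) has_sum (\<Sum>j\<in>?A. infsum b UNIV)) (?A \<times> UNIV)"
  proof (rule has_sum_SigmaI)
    show "((\<lambda>y. case (x, y) of (j, k) \<Rightarrow> b k) has_sum infsum b UNIV) UNIV" for x using bs by simp
    show "((\<lambda>x. infsum b UNIV) has_sum (\<Sum>j\<in>?A. infsum b UNIV)) ?A" by (intro has_sum_finite) simp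
    show "(\<lambda>(j,k). b k) summable_on ?A \<times> UNIV"
      by (rule summable_on_SigmaI[where g = "\<lambda>_. infsum b UNIV"]) (use bs b0 in auto)
  qed
  have bij: "bij_betw (\<lambda>(j,k). j + int c * k) (?A \<times> UNIV) UNIV"
    by (rule bij_betwI[of _ _ _ "\<lambda>d. (d mod int c, d div int c)"]) (use c in auto)
  have sF: "(\<lambda>x. f (case x of (j,k) \<Rightarrow> j + int c * k)) summable_on (?A \<times> UNIV)"
    by (rule summable_on_comparison_test[OF has_sum_imp_summable[OF hb]]) (use fb in \<open>auto simp: f_def\<close>)
  then have sf: "f summable_on UNIV" by (subst (asm) summable_on_reindex_bij_betw[OF bij])
  have "infsum f UNIV = infsum (\<lambda>x. f (case x of (j,k) \<Rightarrow> j + int c * k)) (?A \<times> UNIV)"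
    by (rule infsum_reindex_bij_betw[OF bij, symmetric])
  also have "\<dots> \<le> infsum (\<lambda>(j,k). b k) (?A \<times> UNIV)"
    by (rule infsum_mono[OF sF has_sum_imp_summable[OF hb]]) (use fb in auto)
  also have "\<dots> = real c * infsum b UNIV" using infsumI[OF hb] by simp
  also have "infsum b UNIV = real c powr (-2*a) * ?K" unfolding b_def using W
    by (simp add: infsum_cmult_right')
  also have "real c * (real c powr (-2*a) * ?K) = ?K * real c powr (1 - 2 * a)"
    using c by (simp add: powr_diff powr_minus field_simps)
  finally show "(\<lambda>d::int. (real c ^ 2 + (of_int d)^2) powr (-a)) summable_on UNIV \<and>
     (\<Sum>\<^sub>\<infinity>d::int. (real c ^ 2 + (of_int d)^2) powr (-a)) \<le> ?K * real c powr (1 - 2 * a)"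
    using sf by (simp add: f_def[abs_def])
qed

text \<open>Jordan's inequality: the concave sine lies above its chord on [0, pi/2].\<close>

lemma sin_ge_linear: "0 \<le> x \<Longrightarrow> x \<le> pi / 2 \<Longrightarrow> sin x \<ge> 2 * x / pi"
proof -
  assume x: "0 \<le> x" "x \<le> pi / 2"
  have "convex_on {0..pi/2} (\<lambda>x. - sin x)"
    by (rule f''_ge0_imp_convex[of _ _ "\<lambda>x. - cos x" sin])
       (auto intro!: derivative_eq_intros sin_ge_zero)
  from convex_onD[OF this, of "2 * x / pi" 0 "pi / 2"] x show ?thesis by (simp add: field_simps)
qed

text \<open>The left-hand norm is 2 sin(pi m / c), and Jordan's inequality applies to pi m / c or to
  pi minus it, whichever is smaller. This is the divisor that appears after summation by
  parts.\<close>

lemma norm_e_mod_minus_1: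
  assumes "c > 0" "0 \<le> m" "m \<le> int c"
  shows "norm (e_mod c m - 1) \<ge> 4 * min (of_int m) (of_nat c - of_int m) / real c"
proof -
  define x where "x = pi * of_int m / real c"
  have "(norm (e_mod c m - 1))^2 = (2 * sin x)^2"
  proof -
    have "e_mod c m = cis (2 * x)" by (simp add: e_mod_def x_def mult.assoc)
    then have "(norm (e_mod c m - 1))^2 = (cos (2*x) - 1)^2 + (sin (2*x))^2"
      by (simp add: cmod_power2)
    also have "\<dots> = 2 - 2 * cos (2*x)"
      using sin_cos_squared_add[of "2*x"] by (simp add: power2_eq_square algebra_simps)
    also have "\<dots> = (2 * sin x)^2" by (simp add: cos_double_sin power2_eq_square)
    finally show ?thesis .
  qed
  moreover have xr: "0 \<le> x" "x \<le> pi" using assms by (auto simp: x_def field_simps)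
  ultimately have n: "norm (e_mod c m - 1) = 2 * sin x"
    using sin_ge_zero[OF xr] by (metis abs_of_nonneg mult_nonneg_nonneg norm_ge_zero power2_eq_iff_nonneg zero_le_numeral)
  show ?thesis
  proof (cases "x \<le> pi / 2")
    case True
    have "2 * (2 * x / pi) = 4 * of_int m / real c" by (simp add: x_def)
    with sin_ge_linear[OF xr(1) True] have "2 * sin x \<ge> 4 * of_int m / real c" by linarith
    moreover have "4 * min (of_int m) (of_nat c - of_int m) / real c \<le> 4 * of_int m / real c"
      using assms by (intro divide_right_mono) auto
    ultimately show ?thesis using n by linarith
  next
    case False
    then have "sin (pi - x) \<ge> 2 * (pi - x) / pi" using xr by (intro sin_ge_linear) auto
    then have "sin x \<ge> 2 * (pi - x) / pi" by simp
    moreover have "2 * (2 * (pi - x) / pi) = 4 * (of_nat c - of_int m) / real c"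
      using assms by (simp add: x_def field_simps)
    ultimately have "2 * sin x \<ge> 4 * (of_nat c - of_int m) / real c" by linarith
    moreover have "4 * min (of_int m) (of_nat c - of_int m) / real c \<le> 4 * (of_nat c - of_int m) / real c"
      using assms by (intro divide_right_mono mult_left_mono) auto
    ultimately show ?thesis using n by linarith
  qed
qed

text \<open>Writing 1/m as m^(-17/16) m^(1/16) replaces the logarithm by a small power. The loss
  1/16 is affordable: the final exponent of c stays below -1.\<close>

lemma harmonic_sum_bound:
  "\<exists>K\<ge>0. \<forall>c\<ge>1. (\<Sum>m\<in>{1..<c}. 1 / real m) \<le> K * real c powr (1/16)"
proof (intro exI conjI allI impI)
  let ?K = "\<Sum>\<^sub>\<infinity>m::nat. real m powr (-17/16)"
  show "?K \<ge> 0" by (intro infsum_nonneg) auto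
  have s: "(\<lambda>m::nat. real m powr (-17/16)) summable_on UNIV"
    using summable_on_nat_powr[of "17/16"] by simp
  fix c :: nat assume "c \<ge> 1"
  have "(\<Sum>m\<in>{1..<c}. 1 / real m) \<le> (\<Sum>m\<in>{1..<c}. real m powr (-17/16) * real c powr (1/16))"
  proof (rule sum_mono)
    fix m assume m: "m \<in> {1..<c}"
    have "1 / real m = real m powr (-17/16) * real m powr (1/16)"
      using m by (subst powr_add[symmetric]) (simp add: powr_minus_divide)
    also have "\<dots> \<le> real m powr (-17/16) * real c powr (1/16)"
      using m by (intro mult_left_mono powr_mono2) auto
    finally show "1 / real m \<le> real m powr (-17/16) * real c powr (1/16)" .
  qed
  also have "\<dots> = (\<Sum>m\<in>{1..<c}. real m powr (-17/16)) * real c powr (1/16)" by (simp add: sum_distrib_right)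
  also have "\<dots> \<le> ?K * real c powr (1/16)"
    by (intro mult_right_mono finite_sum_le_infsum s) auto
  finally show "(\<Sum>m\<in>{1..<c}. 1 / real m) \<le> ?K * real c powr (1/16)" .
qed

text \<open>The positive definite form |a \<tau> + b|^2 dominates the standard one. The constant
  comes from b^2 \<le> 2 (a Re \<tau> + b)^2 + 2 (a Re \<tau>)^2 together with a^2 = (a Im \<tau>)^2
  / (Im \<tau>)^2.\<close>

lemma lattice_lower_bound:
  assumes "Im \<tau> > 0"
  shows "\<exists>K\<ge>1. \<forall>a b :: real. a^2 + b^2 \<le> K * (norm (of_real a * \<tau> + of_real b))^2"
proof -
  define K where "K = 2 + (1 + 2 * (Re \<tau>)^2) / (Im \<tau>)^2"
  have "a^2 + b^2 \<le> K * (norm (of_real a * \<tau> + of_real b))^2" for a b :: real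
  proof -
    have n: "(norm (of_real a * \<tau> + of_real b))^2 = (a * Re \<tau> + b)^2 + (a * Im \<tau>)^2"
      by (simp add: cmod_power2)
    have "K * (norm (of_real a * \<tau> + of_real b))^2 \<ge> 2 * (a * Re \<tau> + b)^2 + (1 + 2 * (Re \<tau>)^2) / (Im \<tau>)^2 * (a * Im \<tau>)^2"
      unfolding n K_def distrib_left distrib_right by (simp add: add_increasing)
    moreover have "(1 + 2 * (Re \<tau>)^2) / (Im \<tau>)^2 * (a * Im \<tau>)^2 = a^2 * (1 + 2 * (Re \<tau>)^2)"
      using assms by (simp add: power_mult_distrib field_simps)
    moreover have "a^2 + b^2 \<le> 2 * (a * Re \<tau> + b)^2 + a^2 * (1 + 2 * (Re \<tau>)^2)"
    proof -
      have "0 \<le> (b + 2 * a * Re \<tau>)^2" by simp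
      then show ?thesis by (simp add: power2_eq_square algebra_simps)
    qed
    ultimately show ?thesis by linarith
  qed
  moreover have "K \<ge> 1" unfolding K_def by (simp add: add_increasing2)
  ultimately show ?thesis by blast
qed

text \<open>The divisors e of c correspond to the factorizations c = e k, so the series is the
  square of a convergent zeta series.\<close>

lemma summable_on_divisor_count_powr:
  assumes a: "a > 1"
  shows "(\<lambda>c::nat. real c powr (-a) * real (card {e. e dvd c})) summable_on {1..}"
proof -
  have "(\<lambda>(x::nat, y::nat). real x powr (-a) * real y powr (-a)) summable_on ({1..} \<times> {1..})"
  proof (rule summable_on_SigmaI[where g = "\<lambda>x. real x powr (-a) * (\<Sum>\<^sub>\<infinity>y\<in>{1..}. real y powr (-a))"])
    have s: "(\<lambda>y::nat. real y powr (-a)) summable_on {1..}"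
      using summable_on_nat_powr[OF a] summable_on_subset_banach by blast
    then show "((\<lambda>y. case (x, y) of (x, y) \<Rightarrow> real x powr - a * real y powr - a) has_sum
          real x powr - a * (\<Sum>\<^sub>\<infinity>y\<in>{1..}. real y powr - a)) {1::nat..}" for x :: nat
      by (auto intro!: has_sum_cmult_right)
    show "(\<lambda>x. real x powr - a * (\<Sum>\<^sub>\<infinity>y\<in>{1::nat..}. real y powr - a)) summable_on {1::nat..}"
      using s by (intro summable_on_cmult_left)
  qed auto
  moreover have bij: "bij_betw (\<lambda>(c, e). (e, c div e)) (SIGMA c:{1::nat..}. {e. e dvd c}) ({1..} \<times> {1..})"
    by (rule bij_betwI[of _ _ _ "\<lambda>(x, y). (x * y, x)"]) (auto simp: Suc_le_eq dvd_div_eq_0_iff intro!: Nat.gr0I)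
  ultimately have "(\<lambda>z. case (case z of (c, e) \<Rightarrow> (e, c div e)) of (x, y) \<Rightarrow> real x powr (-a) * real y powr (-a))
      summable_on (SIGMA c:{1::nat..}. {e. e dvd c})"
    by (subst summable_on_reindex_bij_betw[OF bij])
  then have "(\<lambda>(c, e). real c powr (-a)) summable_on (SIGMA c:{1::nat..}. {e. e dvd c})"
  proof (rule summable_on_cong[THEN iffD1, rotated])
    fix z assume "z \<in> (SIGMA c:{1::nat..}. {e. e dvd c})"
    then obtain e k where "z = (e * k, e)" "e > 0" "k > 0" by (auto elim!: dvdE)
    then show "(case (case z of (c, e) \<Rightarrow> (e, c div e)) of (x, y) \<Rightarrow> real x powr (-a) * real y powr (-a)) =
      (case z of (c, e) \<Rightarrow> real c powr (-a))" by (simp add: powr_mult)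
  qed
  then have "(\<lambda>c. \<Sum>\<^sub>\<infinity>e\<in>{e. e dvd c}. real c powr (-a)) summable_on {1::nat..}"
    by (intro summable_on_Sigma_banach)
  then show ?thesis
    by (rule summable_on_cong[THEN iffD1, rotated]) (simp add: infsum_finite)
qed

text \<open>The squared automorphy factor: Im \<tau> divided by it is the height of \<gamma>\<tau>
  when \<gamma> has bottom row (c, d).\<close>

definition lat :: "complex \<Rightarrow> nat \<Rightarrow> int \<Rightarrow> real" where
  "lat \<tau> c d = (norm (of_nat c * \<tau> + of_int d))^2"

lemma lat_pos: "Im \<tau> > 0 \<Longrightarrow> c > 0 \<Longrightarrow> lat \<tau> c d > 0"
proof -
  assume "Im \<tau> > 0" "c > 0"
  then have "Im (of_nat c * \<tau> + of_int d) \<noteq> 0" by simp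
  then have "of_nat c * \<tau> + of_int d \<noteq> 0" by (metis zero_complex.simps(2))
  then show ?thesis by (simp add: lat_def)
qed

lemma infsum_diff:
  fixes f g :: "'a \<Rightarrow> 'b :: real_normed_vector"
  assumes "f summable_on A" "g summable_on A"
  shows "infsum (\<lambda>x. f x - g x) A = infsum f A - infsum g A"
  using infsum_add[OF assms(1) summable_on_uminus[THEN iffD2, OF assms(2)]] by (simp add: infsum_uminus)

lemma infsum_sum_finite:
  fixes f :: "'i \<Rightarrow> 'a \<Rightarrow> 'b :: real_normed_vector"
  assumes "finite I" "\<And>i. i \<in> I \<Longrightarrow> f i summable_on A"
  shows "(\<lambda>x. \<Sum>i\<in>I. f i x) summable_on A \<and> infsum (\<lambda>x. \<Sum>i\<in>I. f i x) A = (\<Sum>i\<in>I. infsum (f i) A)"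
  using assms
proof (induction I rule: finite_induct)
  case (insert i I)
  then show ?case by (auto simp: infsum_add intro: summable_on_add)
qed simp

lemma norm_of_real_powr: "q > 0 \<Longrightarrow> norm (of_real q powr (s :: complex)) = q powr Re s"
  by (simp add: norm_powr_real_powr)

lemma norm_exp_diff_le:
  fixes a b :: complex
  shows "norm (exp a - exp b) \<le> exp (max (Re a) (Re b)) * norm (a - b)"
proof (rule field_differentiable_bound[where S = "closed_segment a b" and f' = exp])
  show "(exp has_field_derivative exp z) (at z within closed_segment a b)" for z :: complex
    by (rule DERIV_subset[OF DERIV_exp]) simp
  fix z assume "z \<in> closed_segment a b"
  then obtain u where "0 \<le> u" "u \<le> 1" "z = (1 - u) *\<^sub>R a + u *\<^sub>R b" by (auto simp: closed_segment_def)
  then have "Re z \<le> max (Re a) (Re b)"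
    using convex_bound_le[of "Re a" "max (Re a) (Re b)" "Re b" "1 - u" u] by simp
  then show "norm (exp z) \<le> exp (max (Re a) (Re b))" by simp
qed auto

text \<open>Both \<open>lat\<close> values are at least (c^2 + d^2)/(3 K), the 3 absorbing the shift
  of d. For the difference, the powers are exponentials of -2 s ln|c \<tau> + d|. Neighbouring
  moduli differ by at most 1, so their logarithms differ by at most the inverse of the smaller
  modulus; hence a shift of d gains half a power of c^2 + d^2.\<close>

lemma lat_powr_bounds:
  assumes K: "K \<ge> 1" "\<forall>a b :: real. a^2 + b^2 \<le> K * (norm (of_real a * \<tau> + of_real b))^2"
    and \<tau>: "Im \<tau> > 0" and c: "c \<ge> 1" and s: "0 \<le> Re s" "Re s \<le> B" "norm s \<le> B"
  shows "norm (of_real (lat \<tau> c d) powr (-s)) \<le> (3 * K) powr B * (real c ^ 2 + (of_int d)^2) powr (- Re s)"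
    and "norm (of_real (lat \<tau> c (d + 1)) powr (-s) - of_real (lat \<tau> c d) powr (-s))
           \<le> 2 * B * (3 * K) powr (B + 1/2) * (real c ^ 2 + (of_int d)^2) powr (- (Re s + 1/2))"
proof -
  define X where "X = real c ^ 2 + (of_int d)^2"
  have X: "X > 0" using c by (simp add: X_def add_pos_nonneg)
  define m where "m = X / (3 * K)"
  have m: "m > 0" using X K by (simp add: m_def)
  have q1: "lat \<tau> c d \<ge> m"
  proof -
    have "X \<le> K * lat \<tau> c d" using K(2)[rule_format, of "real c" "of_int d"] by (simp add: X_def lat_def)
    then have "X \<le> 3 * K * lat \<tau> c d" using X by linarith
    then show ?thesis using K by (simp add: m_def field_simps)
  qed
  have q2: "lat \<tau> c (d + 1) \<ge> m"
  proof -
    have "(real c)^2 + (of_int d + 1)^2 \<le> K * lat \<tau> c (d + 1)"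
      using K(2)[rule_format, of "real c" "of_int (d + 1)"] by (simp add: lat_def)
    moreover have "X \<le> 3 * ((real c)^2 + (of_int d + 1)^2)"
    proof -
      \<comment> \<open>The nonnegative sum assembled here expands to 3 (c^2 + (d + 1)^2) - (c^2 +
        d^2).\<close>
      have "0 \<le> (of_int d + 2 :: real)^2" "1 \<le> (real c)^2" using c by auto
      then have "0 \<le> (of_int d + 2)^2 + ((of_int d + 1)^2 - 1 + 1) + 2 * ((real c)^2 - 1)" by simp
      then show ?thesis unfolding X_def by (simp add: power2_eq_square algebra_simps)
    qed
    moreover have "x \<le> 3 * z" if "y \<le> z" "x \<le> 3 * y" for x y z :: real using that by linarith
    ultimately have "X \<le> 3 * (K * lat \<tau> c (d + 1))" by blast
    then show ?thesis using K by (simp add: m_def field_simps)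
  qed
  have mp: "m powr (- r) = (3 * K) powr r * X powr (- r)" for r
    using X K by (simp add: m_def powr_divide powr_minus field_simps)
  have B: "B \<ge> 0" using s by linarith
  have le: "(3 * K) powr (Re s + r) \<le> (3 * K) powr (B + r)" for r using K s by (intro powr_mono) auto
  have "norm (of_real (lat \<tau> c d) powr (-s)) = lat \<tau> c d powr (- Re s)"
    using lat_pos[OF \<tau>, of c d] c by (simp add: norm_of_real_powr)
  also have "\<dots> \<le> m powr (- Re s)" using q1 m s by (intro powr_mono2') auto
  also have "\<dots> \<le> (3 * K) powr B * X powr (- Re s)" using le[of 0] by (simp add: mp mult_right_mono)
  finally show "norm (of_real (lat \<tau> c d) powr (-s)) \<le> (3 * K) powr B * (real c ^ 2 + (of_int d)^2) powr (- Re s)"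
    by (simp add: X_def)
  define n1 n2 where "n1 = norm (of_nat c * \<tau> + of_int d)" and "n2 = norm (of_nat c * \<tau> + of_int (d + 1))"
  have n: "n1 \<ge> sqrt m" "n2 \<ge> sqrt m"
    using real_sqrt_le_mono[OF q1] real_sqrt_le_mono[OF q2] by (simp_all add: n1_def n2_def lat_def)
  have sm: "sqrt m > 0" using m by simp
  have n0: "n1 > 0" "n2 > 0" using n sm by linarith+
  have n12: "\<bar>n2 - n1\<bar> \<le> 1"
    using norm_triangle_ineq3[of "of_nat c * \<tau> + of_int (d + 1)" "of_nat c * \<tau> + of_int d"] by (simp add: n1_def n2_def)
  have lndiff: "ln x - ln y \<le> 1 / sqrt m" if "x > 0" "y \<ge> sqrt m" "x - y \<le> 1" for x y
  proof -
    have y: "y > 0" using that sm by linarith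
    have "ln x - ln y \<le> (x - y) / y" using that y by (intro ln_diff_le) auto
    also have "\<dots> \<le> 1 / y" using that y by (intro divide_right_mono) auto
    also have "\<dots> \<le> 1 / sqrt m" using that m y by (intro divide_left_mono) auto
    finally show ?thesis .
  qed
  have ln12: "\<bar>ln n2 - ln n1\<bar> \<le> 1 / sqrt m"
    using lndiff[of n2 n1] lndiff[of n1 n2] n n0 n12 by (simp add: abs_le_iff)
  have lat12: "of_real (lat \<tau> c d) powr (-s) = exp (- s * of_real (2 * ln n1))"
      "of_real (lat \<tau> c (d + 1)) powr (-s) = exp (- s * of_real (2 * ln n2))"
  proof -
    have "of_real (x^2) powr (-s) = exp (- s * of_real (2 * ln x))" if "x > 0" for x :: real
      using that by (simp add: powr_def Ln_of_real ln_realpow del: of_real_power)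
    then show "of_real (lat \<tau> c d) powr (-s) = exp (- s * of_real (2 * ln n1))"
        "of_real (lat \<tau> c (d + 1)) powr (-s) = exp (- s * of_real (2 * ln n2))"
      using n0 by (simp_all only: lat_def n1_def n2_def)
  qed
  have ex: "exp (Re (- s * of_real (2 * ln x))) \<le> m powr (- Re s)" if "x \<ge> sqrt m" for x
  proof -
    have x: "x > 0" using that sm by linarith
    have "exp (Re (- s * of_real (2 * ln x))) = (x^2) powr (- Re s)"
      using x by (simp add: powr_def ln_realpow)
    also have "\<dots> \<le> m powr (- Re s)"
      using that m s x by (intro powr_mono2') (auto simp: real_sqrt_le_iff' sqrt_le_D)
    finally show ?thesis .
  qed
  have "norm (of_real (lat \<tau> c (d + 1)) powr (-s) - of_real (lat \<tau> c d) powr (-s))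
     \<le> exp (max (Re (- s * of_real (2 * ln n2))) (Re (- s * of_real (2 * ln n1)))) * norm (- s * of_real (2 * ln n2) - (- s * of_real (2 * ln n1)))"
    unfolding lat12 by (rule norm_exp_diff_le)
  also have "\<dots> \<le> m powr (- Re s) * (B * (2 * (1 / sqrt m)))"
  proof (rule mult_mono)
    show "exp (max (Re (- s * of_real (2 * ln n2))) (Re (- s * of_real (2 * ln n1)))) \<le> m powr (- Re s)"
      using ex[OF n(1)] ex[OF n(2)] by (simp add: max_def)
    have "- s * of_real (2 * ln n2) - (- s * of_real (2 * ln n1)) = - s * of_real (2 * (ln n2 - ln n1))"
      by (simp add: algebra_simps)
    then have "norm (- s * of_real (2 * ln n2) - (- s * of_real (2 * ln n1))) = norm s * (2 * \<bar>ln n2 - ln n1\<bar>)"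
      by (simp only: norm_mult norm_minus_cancel norm_of_real abs_mult abs_numeral)
    also have "\<dots> \<le> B * (2 * (1 / sqrt m))" using s B ln12 by (intro mult_mono) auto
    finally show "norm (- s * of_real (2 * ln n2) - (- s * of_real (2 * ln n1))) \<le> B * (2 * (1 / sqrt m))" .
  qed auto
  also have "\<dots> = 2 * B * m powr (- (Re s + 1/2))"
  proof -
    have e: "- (Re s + 1/2) = - Re s - 1/2" by simp
    have "m powr (- (Re s + 1/2)) = m powr (- Re s) / sqrt m"
      unfolding e powr_diff using m by (simp add: powr_half_sqrt)
    then show ?thesis by simp
  qed
  also have "m powr (- (Re s + 1/2)) \<le> (3 * K) powr (B + 1/2) * X powr (- (Re s + 1/2))"
    unfolding mp using le[of "1/2"] by (intro mult_right_mono) auto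
  finally show "norm (of_real (lat \<tau> c (d + 1)) powr (-s) - of_real (lat \<tau> c d) powr (-s))
           \<le> 2 * B * (3 * K) powr (B + 1/2) * (real c ^ 2 + (of_int d)^2) powr (- (Re s + 1/2))"
    using B by (simp add: X_def mult_left_mono mult.assoc)
qed

section \<open>Fourier inversion modulo c and the size of the c-th term\<close>

text \<open>Orthogonality in m leaves the single unit congruent to d. The weight e(-d^(-1)/c),
  erratic in d, is thereby traded for the additive characters e(-m d/c), to which summation by parts
  applies.\<close>

lemma kloosterman_inversion:
  assumes c: "c > 0"
  shows "(\<Sum>m\<in>{0..<int c}. kloosterman c m (-1) * e_mod c (- m * d))
     = of_nat c * (if coprime d (int c) then e_mod c (- modular_inverse (int c) d) else 0)"
proof -
  let ?i = "modular_inverse (int c)"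
  have inv_mod: "?i (d mod int c) = ?i d" if "coprime d (int c)"
  proof (rule modular_inverse_int_eqI)
    show "?i d \<in> {0..<int c}" using c by (auto simp: modular_inverse_int_nonneg modular_inverse_int_less)
    have "[d mod int c * ?i d = d * ?i d] (mod int c)" by (intro cong_mult cong_refl) auto
    then show "[d mod int c * ?i d = 1] (mod int c)" using cong_modular_inverse1[OF that] cong_trans by blast
  qed
  have dv: "int c dvd x - d \<longleftrightarrow> x = d mod int c" if "x \<in> units_mod c" for x
    using that by (auto simp: units_mod_def mod_eq_dvd_iff[symmetric])
  have "(\<Sum>m\<in>{0..<int c}. kloosterman c m (-1) * e_mod c (- m * d))
      = (\<Sum>m\<in>{0..<int c}. \<Sum>x\<in>units_mod c. e_mod c (- ?i x) * e_mod c (m * (x - d)))"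
    unfolding kloosterman_def sum_distrib_right
    by (intro sum.cong refl) (simp add: e_mod_add[symmetric] algebra_simps)
  also have "\<dots> = (\<Sum>x\<in>units_mod c. e_mod c (- ?i x) * (\<Sum>m\<in>{0..<int c}. e_mod c (m * (x - d))))"
    by (subst sum.swap) (simp add: sum_distrib_left)
  also have "\<dots> = (\<Sum>x\<in>units_mod c. if x = d mod int c then e_mod c (- ?i x) * of_nat c else 0)"
    using c dv by (intro sum.cong refl) (auto simp: e_mod_orthogonality)
  also have "\<dots> = (if d mod int c \<in> units_mod c then e_mod c (- ?i (d mod int c)) * of_nat c else 0)"
    by simp
  also have "d mod int c \<in> units_mod c \<longleftrightarrow> coprime d (int c)"
    using c by (auto simp: units_mod_def)
  finally show ?thesis using inv_mod by (simp add: mult.commute)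
qed

text \<open>The inverse of d modulo c is the upper left entry a of a matrix with bottom row (c, d),
  so the weight is the e(-a/c) of the leading part of the series.\<close>

definition kloosterman_zeta_term :: "complex \<Rightarrow> nat \<Rightarrow> complex \<Rightarrow> complex" where
  "kloosterman_zeta_term \<tau> c s = (\<Sum>\<^sub>\<infinity>d\<in>{d. coprime d (int c)}.
     e_mod c (- modular_inverse (int c) d) * of_real (lat \<tau> c d) powr (-s))"

text \<open>After inversion the term is the mean over m of Kloosterman sums times exponential sums
  \<open>H m\<close> of the smooth weights. \<open>H 0\<close> is bounded trivially and the other
  \<open>H m\<close> by summation by parts; adding up the inverses of |e(m/c) - 1| yields two
  harmonic sums.\<close>

theorem kloosterman_zeta_term_bound:
  assumes \<tau>: "Im \<tau> > 0"
  shows "\<exists>C. \<forall>c s. c \<ge> 1 \<longrightarrow> Re s \<ge> 15/16 \<longrightarrow> norm s \<le> B \<longrightarrow>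
     norm (kloosterman_zeta_term \<tau> c s) \<le> C * (real c powr (-17/16) * real (card {e. e dvd c}))"
proof -
  obtain K where K: "K \<ge> 1" "\<forall>a b :: real. a^2 + b^2 \<le> K * (norm (of_real a * \<tau> + of_real b))^2"
    using lattice_lower_bound[OF \<tau>] by blast
  obtain K1 where K1: "\<forall>c::nat. \<forall>a. c \<ge> 1 \<longrightarrow> a \<ge> 15/16 \<longrightarrow>
     (\<lambda>d::int. (real c ^ 2 + (of_int d)^2) powr (-a)) summable_on UNIV \<and>
     (\<Sum>\<^sub>\<infinity>d::int. (real c ^ 2 + (of_int d)^2) powr (-a)) \<le> K1 * real c powr (1 - 2 * a)"
    using sum_int_quadratic_bound[of "15/16"] by auto
  obtain K2 where K2: "K2 \<ge> 0" "\<forall>c\<ge>1. (\<Sum>m\<in>{1..<c}. 1 / real m) \<le> K2 * real c powr (1/16)"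
    using harmonic_sum_bound by blast
  define A1 where "A1 = \<bar>(3 * K) powr B * K1\<bar>"
  define A2 where "A2 = \<bar>2 * B * (3 * K) powr (B + 1/2) * K1\<bar>"
  show ?thesis
  proof (intro exI allI impI)
    fix c :: nat and s :: complex
    assume c: "c \<ge> 1" and s: "Re s \<ge> 15/16" "norm s \<le> B"
    have sB: "0 \<le> Re s" "Re s \<le> B" using s complex_Re_le_cmod[of s] by linarith+
    have c0: "c > 0" using c by simp
    define F where "F d = of_real (lat \<tau> c d) powr (-s)" for d
    define D where "D = real (card {e. e dvd c})"
    define w where "w = real c powr (1 - 2 * Re s)"
    have w: "w \<ge> 0" by (simp add: w_def)
    note lb = lat_powr_bounds[OF K \<tau> c sB s(2)]
    let ?Q = "\<lambda>r d. (real c ^ 2 + (real_of_int d)^2) powr (- r)"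
    have Q1: "?Q (Re s) summable_on UNIV" "infsum (?Q (Re s)) UNIV \<le> K1 * w"
      using K1 c s by (auto simp: w_def)
    have Q2: "?Q (Re s + 1/2) summable_on UNIV" "infsum (?Q (Re s + 1/2)) UNIV \<le> K1 * (w / real c)"
    proof -
      have "1 - 2 * (Re s + 1/2) = (1 - 2 * Re s) - 1" by simp
      then have "real c powr (1 - 2 * (Re s + 1/2)) = w / real c"
        using c by (simp only: w_def powr_diff) simp
      then show "?Q (Re s + 1/2) summable_on UNIV" "infsum (?Q (Re s + 1/2)) UNIV \<le> K1 * (w / real c)"
        using K1[rule_format, of c "Re s + 1/2"] c s by auto
    qed
    have Fe: "(\<lambda>d. norm (F d * x d)) summable_on UNIV" "norm (\<Sum>\<^sub>\<infinity>d. F d * x d) \<le> A1 * w"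
      if x: "\<And>d. norm (x d) \<le> 1" for x
    proof -
      have le: "norm (F d * x d) \<le> (3 * K) powr B * ?Q (Re s) d" for d
        using mult_mono[OF lb(1) x[of d]] by (simp add: F_def norm_mult)
      have sm: "(\<lambda>d. (3 * K) powr B * ?Q (Re s) d) summable_on UNIV"
        using Q1 by (intro summable_on_cmult_right)
      show "(\<lambda>d. norm (F d * x d)) summable_on UNIV"
        by (rule summable_on_comparison_test[OF sm]) (use le in auto)
      have "norm (\<Sum>\<^sub>\<infinity>d. F d * x d) \<le> (\<Sum>\<^sub>\<infinity>d. (3 * K) powr B * ?Q (Re s) d)"
        by (rule norm_infsum_le[OF has_sum_infsum[OF abs_summable_summable] has_sum_infsum[OF sm]])
           (use le \<open>(\<lambda>d. norm (F d * x d)) summable_on UNIV\<close> in auto)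
      also have "\<dots> = (3 * K) powr B * infsum (?Q (Re s)) UNIV" using Q1 by (simp add: infsum_cmult_right')
      also have "\<dots> \<le> (3 * K) powr B * (K1 * w)" using Q1 by (intro mult_left_mono) auto
      also have "\<dots> \<le> A1 * w" using w by (simp add: A1_def mult.assoc[symmetric] mult_right_mono)
      finally show "norm (\<Sum>\<^sub>\<infinity>d. F d * x d) \<le> A1 * w" .
    qed
    define H where "H m = (\<Sum>\<^sub>\<infinity>d. F d * e_mod c (- m * d))" for m
    have sumF: "(\<lambda>d. F d * x d) summable_on UNIV" if "\<And>d. norm (x d) \<le> 1" for x
      by (rule abs_summable_summable[OF Fe(1)]) (rule that)
    have H0: "norm (H m) \<le> A1 * w" for m unfolding H_def by (rule Fe) simp
    \<comment> \<open>Shifting d by 1 multiplies the character by e(-m/c), so (e(m/c) - 1)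
      \<open>H m\<close> is a sum over the differences F(d + 1) - F(d), which is smaller by a factor
      c.\<close>
    have Hm: "norm (e_mod c m - 1) * norm (H m) \<le> A2 * (w / real c)" for m
    proof -
      have "H m = (\<Sum>\<^sub>\<infinity>d. F (d + 1) * e_mod c (- m * (d + 1)))"
        unfolding H_def by (rule infsum_reindex_bij_betw[symmetric, of "\<lambda>d. d + 1"])
          (rule bij_betwI[of _ _ _ "\<lambda>d. d - 1"], auto)
      then have "e_mod c m * H m = (\<Sum>\<^sub>\<infinity>d. e_mod c m * (F (d + 1) * e_mod c (- m * (d + 1))))"
        by (simp add: infsum_cmult_right')
      also have "\<dots> = (\<Sum>\<^sub>\<infinity>d. F (d + 1) * e_mod c (- m * d))"
        by (intro infsum_cong) (simp add: e_mod_add[symmetric] algebra_simps)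
      finally have "(e_mod c m - 1) * H m = (\<Sum>\<^sub>\<infinity>d. F (d + 1) * e_mod c (- m * d)) - (\<Sum>\<^sub>\<infinity>d. F d * e_mod c (- m * d))"
        by (simp add: H_def algebra_simps)
      also have "\<dots> = (\<Sum>\<^sub>\<infinity>d. F (d + 1) * e_mod c (- m * d) - F d * e_mod c (- m * d))"
      proof (rule infsum_diff[symmetric])
        have "(\<lambda>d. F d * e_mod c (- m * (d - 1))) summable_on UNIV" by (rule sumF) simp
        then show "(\<lambda>d. F (d + 1) * e_mod c (- m * d)) summable_on UNIV"
          by (subst (asm) summable_on_reindex_bij_betw[symmetric, of "\<lambda>d. d + 1" UNIV])
            (rule bij_betwI[of _ _ _ "\<lambda>d. d - 1"], auto)
      qed (rule sumF, simp)
      also have "norm \<dots> \<le> (\<Sum>\<^sub>\<infinity>d. 2 * B * (3 * K) powr (B + 1/2) * ?Q (Re s + 1/2) d)"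
      proof (rule norm_infsum_le[OF has_sum_infsum[OF abs_summable_summable] has_sum_infsum])
        show sm: "(\<lambda>d. 2 * B * (3 * K) powr (B + 1/2) * ?Q (Re s + 1/2) d) summable_on UNIV"
          using Q2 by (intro summable_on_cmult_right)
        show le: "norm (F (d + 1) * e_mod c (- m * d) - F d * e_mod c (- m * d)) \<le> 2 * B * (3 * K) powr (B + 1/2) * ?Q (Re s + 1/2) d" for d
          using lb(2)[of d] by (simp add: F_def norm_mult left_diff_distrib[symmetric])
        show "(\<lambda>d. norm (F (d + 1) * e_mod c (- m * d) - F d * e_mod c (- m * d))) summable_on UNIV"
          by (rule summable_on_comparison_test[OF sm]) (use le in auto)
      qed
      also have "\<dots> = 2 * B * (3 * K) powr (B + 1/2) * infsum (?Q (Re s + 1/2)) UNIV" using Q2 by (simp add: infsum_cmult_right')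
      also have "\<dots> \<le> 2 * B * (3 * K) powr (B + 1/2) * (K1 * (w / real c))" using Q2 sB by (intro mult_left_mono) auto
      also have "\<dots> = (2 * B * (3 * K) powr (B + 1/2) * K1) * (w / real c)" by (simp add: mult_ac)
      also have "\<dots> \<le> A2 * (w / real c)" unfolding A2_def using w by (intro mult_right_mono) auto
      finally show ?thesis by (simp add: norm_mult)
    qed
    have Hb: "norm (H (int m)) \<le> A2 * w * (1 / real m + 1 / real (c - m))" if m: "m \<in> {1..<c}" for m
    proof -
      define \<mu> where "\<mu> = min (real m) (real c - real m)"
      have \<mu>: "\<mu> > 0" using m by (simp add: \<mu>_def)
      have "4 * \<mu> / real c * norm (H (int m)) \<le> norm (e_mod c (int m) - 1) * norm (H (int m))"
        using norm_e_mod_minus_1[OF c0, of "int m"] m by (intro mult_right_mono) (auto simp: \<mu>_def)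
      also have "\<dots> \<le> A2 * (w / real c)" by (rule Hm)
      finally have "4 * \<mu> * norm (H (int m)) \<le> A2 * w" using c by (simp add: field_simps)
      moreover have "\<mu> * norm (H (int m)) \<le> 4 * \<mu> * norm (H (int m))" using \<mu> by simp
      ultimately have "\<mu> * norm (H (int m)) \<le> A2 * w" by (rule order_trans[rotated])
      then have "norm (H (int m)) \<le> A2 * w * (1 / \<mu>)" using \<mu> by (simp add: field_simps)
      \<comment> \<open>The inverse of a minimum is at most the sum of the inverses; each of the two
        summands gives a harmonic sum over m.\<close>
      also have "A2 * w * (1 / \<mu>) \<le> A2 * w * (1 / real m + 1 / real (c - m))"
        using w m by (intro mult_left_mono) (auto simp: \<mu>_def A2_def min_def of_nat_diff)
      finally show ?thesis .
    qed
    have sumH: "(\<Sum>m\<in>{0..<int c}. norm (H m)) \<le> (A1 + 2 * A2 * K2) * w * real c powr (1/16)"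
    proof -
      have "(\<Sum>m\<in>{0..<int c}. norm (H m)) = (\<Sum>m\<in>{0..<c}. norm (H (int m)))"
        by (rule sum.reindex_bij_witness[of _ int nat]) auto
      also have "\<dots> = norm (H 0) + (\<Sum>m\<in>{1..<c}. norm (H (int m)))"
        using c by (simp add: sum.atLeast_Suc_lessThan)
      also have "(\<Sum>m\<in>{1..<c}. norm (H (int m))) \<le> (\<Sum>m\<in>{1..<c}. A2 * w * (1 / real m + 1 / real (c - m)))"
        using Hb by (intro sum_mono) auto
      also have "\<dots> = A2 * w * ((\<Sum>m\<in>{1..<c}. 1 / real m) + (\<Sum>m\<in>{1..<c}. 1 / real (c - m)))"
        by (simp only: sum_distrib_left sum.distrib distrib_left)
      also have "(\<Sum>m\<in>{1..<c}. 1 / real (c - m)) = (\<Sum>m\<in>{1..<c}. 1 / real m)"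
        by (rule sum.reindex_bij_witness[of _ "\<lambda>m. c - m" "\<lambda>m. c - m"]) auto
      also have "A2 * w * ((\<Sum>m\<in>{1..<c}. 1 / real m) + (\<Sum>m\<in>{1..<c}. 1 / real m))
          \<le> A2 * w * (K2 * real c powr (1/16) + K2 * real c powr (1/16))"
        using K2 c w by (intro mult_left_mono add_mono) (auto simp: A2_def)
      also have "norm (H 0) \<le> A1 * w * real c powr (1/16)"
      proof -
        have "A1 * w * 1 \<le> A1 * w * real c powr (1/16)"
          using w c by (intro mult_left_mono ge_one_powr_ge_zero) (auto simp: A1_def)
        then show ?thesis using H0[of 0] by simp
      qed
      finally show ?thesis by (simp add: algebra_simps)
    qed
    have "kloosterman_zeta_term \<tau> c s = (\<Sum>\<^sub>\<infinity>d. F d * (if coprime d (int c) then e_mod c (- modular_inverse (int c) d) else 0))"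
      unfolding kloosterman_zeta_term_def
      by (rule infsum_cong_neutral) (auto simp: F_def)
    also have "\<dots> = (\<Sum>\<^sub>\<infinity>d. \<Sum>m\<in>{0..<int c}. (kloosterman c m (-1) / of_nat c) * (F d * e_mod c (- m * d)))"
    proof (rule infsum_cong)
      fix d
      have "(if coprime d (int c) then e_mod c (- modular_inverse (int c) d) else 0)
         = (\<Sum>m\<in>{0..<int c}. kloosterman c m (-1) * e_mod c (- m * d)) / of_nat c"
        unfolding kloosterman_inversion[OF c0] using c0 by simp
      then show "F d * (if coprime d (int c) then e_mod c (- modular_inverse (int c) d) else 0)
        = (\<Sum>m\<in>{0..<int c}. (kloosterman c m (-1) / of_nat c) * (F d * e_mod c (- m * d)))"
        by (simp only: sum_divide_distrib sum_distrib_left) (intro sum.cong refl, simp)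
    qed
    also have "\<dots> = (\<Sum>m\<in>{0..<int c}. \<Sum>\<^sub>\<infinity>d. (kloosterman c m (-1) / of_nat c) * (F d * e_mod c (- m * d)))"
      by (intro infsum_sum_finite[THEN conjunct2] summable_on_cmult_right sumF) auto
    also have "\<dots> = (\<Sum>m\<in>{0..<int c}. (kloosterman c m (-1) / of_nat c) * H m)"
      unfolding H_def infsum_cmult_right' by (rule refl)
    also have "norm \<dots> \<le> (\<Sum>m\<in>{0..<int c}. (2 * real c powr (3/4) * D / real c) * norm (H m))"
    proof (rule sum_norm_le)
      fix m
      show "norm ((kloosterman c m (-1) / of_nat c) * H m) \<le> (2 * real c powr (3/4) * D / real c) * norm (H m)"
        unfolding norm_mult norm_divide using kloosterman_bound[OF c0, of m]
        by (intro mult_right_mono) (auto simp: D_def intro!: divide_right_mono)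
    qed
    also have "\<dots> = (2 * real c powr (3/4) * D / real c) * (\<Sum>m\<in>{0..<int c}. norm (H m))"
      by (simp add: sum_distrib_left)
    also have "\<dots> \<le> (2 * real c powr (3/4) * D / real c) * ((A1 + 2 * A2 * K2) * w * real c powr (1/16))"
      using sumH by (intro mult_left_mono) (auto simp: D_def)
    also have "\<dots> = 2 * (A1 + 2 * A2 * K2) * (real c powr (3/4 + 1/16 - 2 * Re s) * D)"
    proof -
      have e: "3/4 + 1/16 - 2 * Re s = 3/4 - 1 + (1 - 2 * Re s) + 1/16" by simp
      have "real c powr (3/4 + 1/16 - 2 * Re s) = real c powr (3/4) / real c * w * real c powr (1/16)"
        unfolding e w_def using c by (simp only: powr_add powr_diff) simp
      then show ?thesis by simp
    qed
    also have "real c powr (3/4 + 1/16 - 2 * Re s) * D \<le> real c powr (-17/16) * D"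
      using s c by (intro mult_right_mono powr_mono) (auto simp: D_def)
    finally show "norm (kloosterman_zeta_term \<tau> c s) \<le> 2 * (A1 + 2 * A2 * K2) * (real c powr (-17/16) * real (card {e. e dvd c}))"
      using K2 by (simp add: D_def A1_def A2_def mult_left_mono)
  qed
qed

section \<open>Bessel functions\<close>

text \<open>The Weierstrass M-test along the net of finite partial sums. Differentiability is local,
  so uniform convergence on a closed ball around each point is enough.\<close>

lemma holomorphic_on_infsum:
  fixes f :: "'a \<Rightarrow> complex \<Rightarrow> complex"
  assumes "open S" and hol: "\<And>x. x \<in> A \<Longrightarrow> f x holomorphic_on S"
    and le: "\<And>x s. x \<in> A \<Longrightarrow> s \<in> S \<Longrightarrow> norm (f x s) \<le> M x" and M: "M summable_on A"
  shows "(\<lambda>s. \<Sum>\<^sub>\<infinity>x\<in>A. f x s) holomorphic_on S"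
proof -
  have "(\<lambda>s. \<Sum>\<^sub>\<infinity>x\<in>A. f x s) field_differentiable at z" if z: "z \<in> S" for z
  proof -
    obtain r where r: "r > 0" "cball z r \<subseteq> S" using \<open>open S\<close> z open_contains_cball by blast
    have ul: "uniform_limit (cball z r) (\<lambda>X s. \<Sum>x\<in>X. f x s) (\<lambda>s. \<Sum>\<^sub>\<infinity>x\<in>A. f x s) (finite_subsets_at_top A)"
      using r le M by (intro Weierstrass_m_test_general) auto
    have ev: "eventually (\<lambda>X. continuous_on (cball z r) (\<lambda>s. \<Sum>x\<in>X. f x s) \<and>
        (\<lambda>s. \<Sum>x\<in>X. f x s) holomorphic_on ball z r) (finite_subsets_at_top A)"
    proof (rule eventually_finite_subsets_at_top_weakI)
      fix X assume X: "finite X" "X \<subseteq> A"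
      have "(\<lambda>s. \<Sum>x\<in>X. f x s) holomorphic_on S" using X hol by (intro holomorphic_on_sum) auto
      then show "continuous_on (cball z r) (\<lambda>s. \<Sum>x\<in>X. f x s) \<and> (\<lambda>s. \<Sum>x\<in>X. f x s) holomorphic_on ball z r"
        using r ball_subset_cball holomorphic_on_imp_continuous_on holomorphic_on_subset
        by (metis (no_types, lifting) subset_trans)
    qed
    have "(\<lambda>s. \<Sum>\<^sub>\<infinity>x\<in>A. f x s) holomorphic_on ball z r"
      using holomorphic_uniform_limit[OF ev ul] by auto
    then show ?thesis using r by (auto simp: holomorphic_on_open field_differentiable_def)
  qed
  then show ?thesis by (auto simp: holomorphic_on_def field_differentiable_at_within)
qed

definition bessel_term :: "complex \<Rightarrow> real \<Rightarrow> nat \<Rightarrow> complex" where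
  "bessel_term \<nu> x k = (of_real (x / 2) powr (\<nu> + 2 * of_nat k)) * rGamma (\<nu> + of_nat k + 1) / fact k"

text \<open>Each use of the functional equation divides by a number of real part at least 1. The
  Bessel series is therefore dominated by an exponential series with a single Gamma factor in
  front.\<close>

lemma norm_rGamma_shift_le:
  assumes "Re \<nu> \<ge> 0"
  shows "norm (rGamma (\<nu> + of_nat k + 1)) \<le> norm (rGamma (\<nu> + 1))"
proof (induction k)
  case (Suc k)
  have "rGamma (\<nu> + of_nat k + 1) = (\<nu> + of_nat k + 1) * rGamma (\<nu> + of_nat (Suc k) + 1)"
    using rGamma_plus1[of "\<nu> + of_nat k + 1"] by (simp add: add_ac)
  then have "norm (rGamma (\<nu> + of_nat k + 1)) = norm (\<nu> + of_nat k + 1) * norm (rGamma (\<nu> + of_nat (Suc k) + 1))"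
    by (simp add: norm_mult)
  moreover have "norm (\<nu> + of_nat k + 1) \<ge> 1"
    using complex_Re_le_cmod[of "\<nu> + of_nat k + 1"] assms by simp
  ultimately have "norm (rGamma (\<nu> + of_nat (Suc k) + 1)) \<le> norm (rGamma (\<nu> + of_nat k + 1))"
    by (metis mult_right_mono mult_1 norm_ge_zero)
  then show ?case using Suc by linarith
qed simp

lemma norm_bessel_term_le:
  assumes "Re \<nu> \<ge> 0" "x > 0"
  shows "norm (bessel_term \<nu> x k) \<le> norm (rGamma (\<nu> + 1)) * (x/2) powr Re \<nu> * (((x/2)^2) ^ k / fact k)"
proof -
  have "norm (of_real (x / 2) powr (\<nu> + 2 * of_nat k)) = (x/2) powr Re \<nu> * ((x/2)^2) ^ k"
  proof -
    have "norm (of_real (x / 2) powr (\<nu> + 2 * of_nat k)) = (x/2) powr (Re \<nu> + real (2 * k))"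
      using assms by (subst norm_of_real_powr) auto
    also have "\<dots> = (x/2) powr Re \<nu> * (x/2) ^ (2 * k)"
      using assms by (simp add: powr_add powr_realpow del: of_nat_mult)
    finally show ?thesis by (simp add: power_mult)
  qed
  then have "norm (bessel_term \<nu> x k) = (x/2) powr Re \<nu> * ((x/2)^2) ^ k * norm (rGamma (\<nu> + of_nat k + 1)) / fact k"
    by (simp add: bessel_term_def norm_mult norm_divide)
  also have "\<dots> \<le> (x/2) powr Re \<nu> * ((x/2)^2) ^ k * norm (rGamma (\<nu> + 1)) / fact k"
    using norm_rGamma_shift_le[OF assms(1), of k] by (intro divide_right_mono mult_left_mono) auto
  finally show ?thesis by (simp add: mult_ac)
qed

lemma exp_has_sum: "((\<lambda>k. t ^ k / fact k) has_sum exp t) UNIV" if "t \<ge> 0" for t :: real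
proof -
  have "(\<lambda>k. t ^ k / fact k) sums exp t" using exp_converges[of t] by (simp add: field_simps)
  then show ?thesis using that by (intro sums_nonneg_imp_has_sum) auto
qed

lemma bessel_I_has_sum:
  assumes "Re \<nu> \<ge> 0" "x > 0"
  shows "(bessel_term \<nu> x has_sum bessel_I \<nu> x) UNIV" "(\<lambda>k. norm (bessel_term \<nu> x k)) summable_on UNIV"
proof -
  have s: "(\<lambda>k. norm (rGamma (\<nu> + 1)) * (x/2) powr Re \<nu> * (((x/2)^2) ^ k / fact k)) summable_on UNIV"
    by (intro summable_on_cmult_right has_sum_imp_summable[OF exp_has_sum]) simp
  show n: "(\<lambda>k. norm (bessel_term \<nu> x k)) summable_on UNIV"
    by (rule summable_on_comparison_test[OF s]) (use norm_bessel_term_le[OF assms] in auto)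
  then have "summable (\<lambda>k. norm (bessel_term \<nu> x k))" by (rule summable_on_imp_summable)
  moreover from this have "bessel_term \<nu> x sums bessel_I \<nu> x"
    unfolding bessel_I_def using summable_norm_cancel[of "bessel_term \<nu> x"] summable_sums
    by (fastforce simp: bessel_term_def[abs_def])
  ultimately show "(bessel_term \<nu> x has_sum bessel_I \<nu> x) UNIV" by (rule norm_summable_imp_has_sum)
qed

lemma norm_bessel_I_le:
  assumes "Re \<nu> \<ge> 0" "x > 0"
  shows "norm (bessel_I \<nu> x) \<le> norm (rGamma (\<nu> + 1)) * (x/2) powr Re \<nu> * exp ((x/2)^2)"
  by (rule norm_infsum_le[OF bessel_I_has_sum(1)[OF assms] has_sum_cmult_right[OF exp_has_sum]])
     (use norm_bessel_term_le[OF assms] in auto)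

lemma exp_minus_1_le: "exp t - 1 \<le> t * exp t" for t :: real
proof -
  have "exp t * (1 - t) \<le> exp t * exp (- t)" using exp_ge_add_one_self[of "-t"] by (intro mult_left_mono) auto
  then show ?thesis by (simp add: exp_minus_inverse algebra_simps)
qed

text \<open>Removing the term k = 0 from the dominating exponential series leaves e^t - 1 \<le> t
  e^t with t = (x/2)^2. The gain of x^2 is what makes the remainder of the Poincare series converge
  to the left of s = 1.\<close>

lemma norm_bessel_I_minus_leading_le:
  assumes "Re \<nu> \<ge> 0" "x > 0"
  shows "norm (bessel_I \<nu> x - of_real (x/2) powr \<nu> * rGamma (\<nu> + 1))
     \<le> norm (rGamma (\<nu> + 1)) * (x/2) powr Re \<nu> * ((x/2)^2 * exp ((x/2)^2))"
proof -
  let ?t = "(x/2)^2"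
  have h1: "((\<lambda>k. bessel_term \<nu> x k) has_sum (bessel_I \<nu> x - bessel_term \<nu> x 0)) (UNIV - {0})"
    by (intro has_sum_Diff bessel_I_has_sum assms) (auto intro: has_sum_finiteI)
  have h2: "((\<lambda>k. ?t ^ k / fact k) has_sum (exp ?t - ?t ^ 0 / fact 0)) (UNIV - {0})"
    by (intro has_sum_Diff exp_has_sum) (auto intro: has_sum_finiteI)
  have "norm (bessel_I \<nu> x - bessel_term \<nu> x 0) \<le> norm (rGamma (\<nu> + 1)) * (x/2) powr Re \<nu> * (exp ?t - ?t ^ 0 / fact 0)"
    by (rule norm_infsum_le[OF h1 has_sum_cmult_right[OF h2]]) (rule norm_bessel_term_le[OF assms])
  also have "\<dots> \<le> norm (rGamma (\<nu> + 1)) * (x/2) powr Re \<nu> * (?t * exp ?t)"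
    using exp_minus_1_le[of ?t] by (intro mult_left_mono) auto
  finally show ?thesis by (simp add: bessel_term_def)
qed

text \<open>The abscissa is the one reached by the Kloosterman estimate; the bound on |s| makes all
  constants uniform. These regions exhaust a half-plane as B grows.\<close>

definition cont_region :: "real \<Rightarrow> complex set" where
  "cont_region B = {s. Re s > 15/16 \<and> norm s < B}"

lemma open_cont_region [simp]: "open (cont_region B)"
proof -
  have "cont_region B = {s. Re s > 15/16} \<inter> ball 0 B" by (auto simp: cont_region_def)
  then show ?thesis by (simp only:) (intro open_Int open_halfspace_Re_gt open_ball)
qed

lemma cont_regionD:
  assumes "s \<in> cont_region B"
  shows "Re s \<ge> 15/16" "Re s \<le> B" "norm s \<le> B" "Re (s - 1/2) \<ge> 0"
  using assms complex_Re_le_cmod[of s] by (auto simp: cont_region_def)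

lemma rGamma_bounded_cont_region: "\<exists>G\<ge>0. \<forall>s\<in>cont_region B. norm (rGamma (s + 1/2)) \<le> G"
proof -
  have "compact ((\<lambda>s. rGamma (s + 1/2 :: complex)) ` cball 0 B)"
    by (intro compact_continuous_image continuous_on_compose2[OF continuous_on_rGamma[of UNIV]] continuous_intros) auto
  then obtain G where "\<forall>z\<in>(\<lambda>s. rGamma (s + 1/2 :: complex)) ` cball 0 B. norm z \<le> G"
    using compact_imp_bounded bounded_iff by metis
  then have "\<forall>s\<in>cont_region B. norm (rGamma (s + 1/2)) \<le> max 0 G"
    by (auto simp: cont_region_def intro!: max.coboundedI2)
  then show ?thesis by (intro exI[of _ "max 0 G"]) auto
qed

lemma powr_le_max_1: "0 < x \<Longrightarrow> 0 \<le> r \<Longrightarrow> r \<le> B \<Longrightarrow> x powr r \<le> (max 1 x) powr B" for x :: real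
  by (meson max.cobounded1 max.cobounded2 order_trans powr_mono powr_mono2 less_imp_le)

lemma holomorphic_bessel_I:
  assumes x: "x > 0"
  shows "(\<lambda>s. bessel_I (s - 1/2) x) holomorphic_on cont_region B"
proof -
  obtain G where G: "G \<ge> 0" "\<forall>s\<in>cont_region B. norm (rGamma (s + 1/2)) \<le> G"
    using rGamma_bounded_cont_region by blast
  have "(\<lambda>s. \<Sum>\<^sub>\<infinity>k. bessel_term (s - 1/2) x k) holomorphic_on cont_region B"
  proof (rule holomorphic_on_infsum[where M = "\<lambda>k. G * (max 1 (x/2)) powr B * (((x/2)^2) ^ k / fact k)"])
    show "(\<lambda>k. G * (max 1 (x/2)) powr B * (((x/2)^2) ^ k / fact k)) summable_on UNIV"
      by (intro summable_on_cmult_right has_sum_imp_summable[OF exp_has_sum]) simp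
    fix k show "(\<lambda>s. bessel_term (s - 1/2) x k) holomorphic_on cont_region B"
      unfolding bessel_term_def using x by (intro holomorphic_intros) auto
    fix s assume s: "s \<in> cont_region B"
    have "norm (bessel_term (s - 1/2) x k) \<le> norm (rGamma (s + 1/2)) * (x/2) powr Re (s - 1/2) * (((x/2)^2) ^ k / fact k)"
      using norm_bessel_term_le[of "s - 1/2" x k] cont_regionD[OF s] x by (simp add: algebra_simps)
    also have "\<dots> \<le> G * (max 1 (x/2)) powr B * (((x/2)^2) ^ k / fact k)"
      using G s cont_regionD[OF s] x by (intro mult_right_mono mult_mono powr_le_max_1) auto
    finally show "norm (bessel_term (s - 1/2) x k) \<le> G * (max 1 (x/2)) powr B * (((x/2)^2) ^ k / fact k)" .
  qed simp
  then show ?thesis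
    by (rule holomorphic_transform) (use x in \<open>auto dest: cont_regionD intro!: infsumI bessel_I_has_sum\<close>)
qed

section \<open>Summands of the series near the real line\<close>

definition niebur_term :: "nat \<Rightarrow> complex \<Rightarrow> complex \<Rightarrow> complex" where
  "niebur_term n s z = of_real (sqrt (Im z)) * bessel_I (s - 1/2) (2 * pi * real n * Im z)
     * cis (2 * pi * (- (real n) * Re z))"

text \<open>The coefficient of y^s e(-x) in \<open>niebur_term 1 s (x + i y)\<close> as y tends to
  0: sqrt y times (pi y)^(s - 1/2) / Gamma(s + 1/2).\<close>

definition leading_coeff :: "complex \<Rightarrow> complex" where
  "leading_coeff s = of_real pi powr (s - 1/2) * rGamma (s + 1/2)"

lemma holomorphic_niebur_term:
  "n > 0 \<Longrightarrow> Im z > 0 \<Longrightarrow> (\<lambda>s. niebur_term n s z) holomorphic_on cont_region B"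
  unfolding niebur_term_def by (intro holomorphic_intros holomorphic_bessel_I) auto

lemma norm_niebur_term_le:
  assumes n: "n > 0" and s: "Re s \<ge> 1/2"
  shows "\<exists>C\<ge>0. \<forall>z. 0 < Im z \<longrightarrow> Im z \<le> Y \<longrightarrow> norm (niebur_term n s z) \<le> C * Im z powr Re s"
proof (intro exI conjI allI impI)
  let ?C = "norm (rGamma (s + 1/2)) * (pi * n) powr (Re s - 1/2) * exp ((pi * n * Y)^2)"
  show "?C \<ge> 0" by simp
  fix z assume z: "0 < Im z" "Im z \<le> Y"
  have "norm (niebur_term n s z) = sqrt (Im z) * norm (bessel_I (s - 1/2) (2 * pi * real n * Im z))"
    using z by (simp add: niebur_term_def norm_mult)
  also have "\<dots> \<le> sqrt (Im z) * (norm (rGamma (s - 1/2 + 1)) * (2 * pi * real n * Im z / 2) powr Re (s - 1/2) * exp ((2 * pi * real n * Im z / 2)^2))"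
    using z n s by (intro mult_left_mono norm_bessel_I_le) auto
  also have "\<dots> = (norm (rGamma (s + 1/2)) * (pi * n) powr (Re s - 1/2) * exp ((pi * n * Im z)^2)) * (sqrt (Im z) * Im z powr (Re s - 1/2))"
    using z by (simp add: powr_mult mult_ac add.commute)
  also have "sqrt (Im z) * Im z powr (Re s - 1/2) = Im z powr Re s"
    using z by (simp add: powr_half_sqrt[symmetric] powr_add[symmetric])
  also have "(norm (rGamma (s + 1/2)) * (pi * n) powr (Re s - 1/2) * exp ((pi * n * Im z)^2)) * Im z powr Re s \<le> ?C * Im z powr Re s"
    using z by (intro mult_right_mono mult_left_mono) (auto intro!: power_mono mult_left_mono)
  finally show "norm (niebur_term n s z) \<le> ?C * Im z powr Re s" .
qed

lemma norm_leading_coeff_le: "\<exists>G\<ge>0. \<forall>s\<in>cont_region B. norm (leading_coeff s) \<le> G"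
proof -
  obtain G where G: "G \<ge> 0" "\<forall>s\<in>cont_region B. norm (rGamma (s + 1/2)) \<le> G"
    using rGamma_bounded_cont_region by blast
  have "norm (leading_coeff s) \<le> pi powr B * G" if s: "s \<in> cont_region B" for s
  proof -
    have "pi powr Re (s - 1/2) \<le> pi powr B" using cont_regionD[OF s] pi_gt3 by (intro powr_mono) auto
    then show ?thesis unfolding leading_coeff_def norm_mult using G s
      by (intro mult_mono) (auto simp: norm_of_real_powr)
  qed
  then show ?thesis using G by (intro exI[of _ "pi powr B * G"]) auto
qed

text \<open>The prefactor sqrt y turns (pi y)^(s - 1/2) into y^s, and the Bessel remainder supplies
  y^2 more. The ceiling Y serves to bound the exponential.\<close>

lemma niebur_term_approx:
  "\<exists>C\<ge>0. \<forall>s\<in>cont_region B. \<forall>z. 0 < Im z \<longrightarrow> Im z \<le> Y \<longrightarrow>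
     norm (niebur_term 1 s z - leading_coeff s * of_real (Im z) powr s * cis (- 2 * pi * Re z))
       \<le> C * Im z powr (Re s + 2)"
proof -
  obtain G where G: "G \<ge> 0" "\<forall>s\<in>cont_region B. norm (rGamma (s + 1/2)) \<le> G"
    using rGamma_bounded_cont_region by blast
  let ?C = "G * pi powr B * (pi^2 * exp ((pi * Y)^2))"
  have "norm (niebur_term 1 s z - leading_coeff s * of_real (Im z) powr s * cis (- 2 * pi * Re z)) \<le> ?C * Im z powr (Re s + 2)"
    if s: "s \<in> cont_region B" and z: "0 < Im z" "Im z \<le> Y" for s z
  proof -
    define y where "y = Im z"
    have y: "y > 0" "y \<le> Y" using z by (auto simp: y_def)
    have "leading_coeff s * of_real y powr s = of_real (sqrt y) * (of_real (pi * y) powr (s - 1/2) * rGamma (s - 1/2 + 1))"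
    proof -
      have "of_real (pi * y) powr (s - 1/2) = of_real pi powr (s - 1/2) * (of_real y :: complex) powr (s - 1/2)"
        using y by (simp add: powr_times_real)
      moreover have "of_real y powr s = of_real (sqrt y) * (of_real y :: complex) powr (s - 1/2)"
      proof -
        have "of_real (sqrt y) = (of_real y :: complex) powr (1/2)"
          using y by (simp add: powr_half_sqrt[symmetric] powr_of_real[symmetric])
        then have "of_real (sqrt y) * (of_real y :: complex) powr (s - 1/2) = of_real y powr (1/2 + (s - 1/2))"
          using y by (simp only: powr_add)
        then show ?thesis by simp
      qed
      ultimately show ?thesis by (simp add: leading_coeff_def add_ac)
    qed
    then have "niebur_term 1 s z - leading_coeff s * of_real (Im z) powr s * cis (- 2 * pi * Re z)
      = of_real (sqrt y) * (bessel_I (s - 1/2) (2 * pi * y) - of_real (2 * pi * y / 2) powr (s - 1/2) * rGamma (s - 1/2 + 1)) * cis (- 2 * pi * Re z)"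
      by (simp add: niebur_term_def y_def[symmetric] algebra_simps)
    then have "norm (niebur_term 1 s z - leading_coeff s * of_real (Im z) powr s * cis (- 2 * pi * Re z))
      = sqrt y * norm (bessel_I (s - 1/2) (2 * pi * y) - of_real (2 * pi * y / 2) powr (s - 1/2) * rGamma (s - 1/2 + 1))"
      using y by (simp only: norm_mult norm_cis) simp
    also have "\<dots> \<le> sqrt y * (norm (rGamma (s - 1/2 + 1)) * (2 * pi * y / 2) powr Re (s - 1/2) * ((2 * pi * y / 2)^2 * exp ((2 * pi * y / 2)^2)))"
      using y cont_regionD[OF s] by (intro mult_left_mono norm_bessel_I_minus_leading_le) auto
    also have "\<dots> = (norm (rGamma (s + 1/2)) * pi powr (Re s - 1/2) * (pi^2 * exp ((pi * y)^2))) * (sqrt y * y powr (Re s - 1/2) * y^2)"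
      using y by (simp add: powr_mult power_mult_distrib mult_ac add_ac)
    also have "sqrt y * y powr (Re s - 1/2) * y^2 = y powr (Re s + 2)"
      using y by (simp add: powr_half_sqrt[symmetric] powr_add[symmetric] flip: powr_numeral)
    also have "norm (rGamma (s + 1/2)) * pi powr (Re s - 1/2) * (pi^2 * exp ((pi * y)^2)) \<le> ?C"
    proof -
      have "pi powr (Re s - 1/2) \<le> pi powr B" using cont_regionD[OF s] pi_gt3 by (intro powr_mono) auto
      moreover have "exp ((pi * y)^2) \<le> exp ((pi * Y)^2)" using y by (auto intro!: power_mono mult_left_mono)
      ultimately show ?thesis using G s by (intro mult_mono) auto
    qed
    finally show ?thesis by (simp add: y_def mult_right_mono)
  qed
  then show ?thesis using G by (intro exI[of _ ?C]) auto
qed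

section \<open>The modular group and its cosets\<close>

definition mat2 :: "int \<Rightarrow> int \<Rightarrow> int \<Rightarrow> int \<Rightarrow> int^2^2" where
  "mat2 a b c d = vector [vector [a, b], vector [c, d]]"

lemma mat2_sel [simp]:
  "mat2 a b c d $ 1 $ 1 = a" "mat2 a b c d $ 1 $ 2 = b"
  "mat2 a b c d $ 2 $ 1 = c" "mat2 a b c d $ 2 $ 2 = d"
  by (simp_all add: mat2_def)

lemma mat_eq_iff_2:
  "A = B \<longleftrightarrow> A$1$1 = B$1$1 \<and> A$1$2 = B$1$2 \<and> A$2$1 = B$2$1 \<and> A$2$2 = B$2$2" for A B :: "int^2^2"
  by (auto simp: vec_eq_iff forall_2)

lemma mat_mult_2: "(A ** B) $ i $ j = A$i$1 * B$1$j + A$i$2 * B$2$j" for A B :: "int^2^2"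
  by (simp add: matrix_matrix_mult_def sum_2)

lemma mat_1_sel: "(mat 1 :: int^2^2)$1$1 = 1" "(mat 1 :: int^2^2)$1$2 = 0"
  "(mat 1 :: int^2^2)$2$1 = 0" "(mat 1 :: int^2^2)$2$2 = 1"
  by (simp_all add: mat_def)

text \<open>Stands in for the inverse: it remains integral for determinant p, where it is p times
  the inverse and induces the inverse Moebius map.\<close>

definition adj2 :: "int^2^2 \<Rightarrow> int^2^2" where
  "adj2 A = mat2 (A$2$2) (- A$1$2) (- A$2$1) (A$1$1)"

lemma det_mat2 [simp]: "det (mat2 a b c d) = a * d - b * c"
  by (simp add: det_2)

lemma det_adj2 [simp]: "det (adj2 A) = det A"
  by (simp add: adj2_def det_2)

lemma adj2_adj2 [simp]: "adj2 (adj2 A) = A"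
  by (simp add: adj2_def mat_eq_iff_2)

lemma adj2_mult: "adj2 (A ** B) = adj2 B ** adj2 A"
  by (simp add: adj2_def mat_eq_iff_2 mat_mult_2)

lemma mult_adj2: "A ** adj2 A = mat (det A)" "adj2 A ** A = mat (det A)"
  by (simp_all add: adj2_def mat_eq_iff_2 mat_mult_2 det_2 mat_def algebra_simps)

lemma SL2Z_iff: "A \<in> SL2Z \<longleftrightarrow> A$1$1 * A$2$2 - A$1$2 * A$2$1 = 1"
  by (simp add: SL2Z_def det_2)

lemma SL2Z_mult: "A \<in> SL2Z \<Longrightarrow> B \<in> SL2Z \<Longrightarrow> A ** B \<in> SL2Z"
  by (simp add: SL2Z_def det_mul)

lemma SL2Z_adj2: "A \<in> SL2Z \<Longrightarrow> adj2 A \<in> SL2Z"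
  by (simp add: SL2Z_def)

lemma SL2Z_cancel:
  assumes "A \<in> SL2Z"
  shows "A ** adj2 A = mat 1" "adj2 A ** A = mat 1" "A ** (adj2 A ** B) = B" "adj2 A ** (A ** B) = B"
    "B ** A ** adj2 A = B" "B ** adj2 A ** A = B"
  using assms mult_adj2[of A] by (simp_all add: SL2Z_def matrix_mul_assoc)
    (simp_all flip: matrix_mul_assoc)

lemma mat_1_SL2Z [simp]: "mat 1 \<in> SL2Z"
  by (simp add: SL2Z_def)

lemma bij_betw_SL2Z_left: "A \<in> SL2Z \<Longrightarrow> bij_betw (\<lambda>\<gamma>. A ** \<gamma>) SL2Z SL2Z"
  by (rule bij_betwI[of _ _ _ "\<lambda>\<gamma>. adj2 A ** \<gamma>"]) (auto simp: SL2Z_cancel SL2Z_mult SL2Z_adj2)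

lemma bij_betw_SL2Z_right: "A \<in> SL2Z \<Longrightarrow> bij_betw (\<lambda>\<gamma>. \<gamma> ** A) SL2Z SL2Z"
  by (rule bij_betwI[of _ _ _ "\<lambda>\<gamma>. \<gamma> ** adj2 A"]) (auto simp: SL2Z_cancel SL2Z_mult SL2Z_adj2)

lemma SL2Z_uminus [simp]: "- A \<in> SL2Z \<longleftrightarrow> A \<in> SL2Z"
  by (simp add: SL2Z_iff)

abbreviation den :: "int^2^2 \<Rightarrow> complex \<Rightarrow> complex" where
  "den A z \<equiv> of_int (A$2$1) * z + of_int (A$2$2)"

lemma den_nonzero:
  assumes "Im z > 0" "det A \<noteq> 0"
  shows "den A z \<noteq> 0"
proof
  assume h: "den A z = 0"
  then have "Im (den A z) = 0" by simp
  then have "A$2$1 = 0" using assms by simp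
  moreover then have "A$2$2 = 0" using h by simp
  ultimately show False using assms by (simp add: det_2)
qed

lemma moebius_mult:
  assumes "Im z > 0" "det B \<noteq> 0"
  shows "moebius (A ** B) z = moebius A (moebius B z)"
proof -
  define \<delta> where "\<delta> = den B z"
  have \<delta>: "\<delta> \<noteq> 0" using den_nonzero[OF assms] by (simp add: \<delta>_def)
  define \<nu> where "\<nu> = of_int (B$1$1) * z + of_int (B$1$2)"
  have "moebius (A ** B) z = (of_int (A$1$1) * \<nu> + of_int (A$1$2) * \<delta>) / (of_int (A$2$1) * \<nu> + of_int (A$2$2) * \<delta>)"
    by (simp add: moebius_def mat_mult_2 \<nu>_def \<delta>_def algebra_simps)
  also have "\<dots> = ((of_int (A$1$1) * \<nu> + of_int (A$1$2) * \<delta>) / \<delta>) / ((of_int (A$2$1) * \<nu> + of_int (A$2$2) * \<delta>) / \<delta>)"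
    using \<delta> by simp
  also have "\<dots> = moebius A (\<nu> / \<delta>)"
    unfolding moebius_def add_divide_distrib using \<delta> by simp
  finally show ?thesis by (simp add: moebius_def \<nu>_def \<delta>_def)
qed

lemma Im_moebius: "Im (moebius A z) = of_int (det A) * Im z / (norm (den A z))^2"
  by (simp add: moebius_def Im_divide cmod_power2 det_2 algebra_simps)

lemma Im_moebius_pos: "Im z > 0 \<Longrightarrow> det A > 0 \<Longrightarrow> Im (moebius A z) > 0"
  using den_nonzero[of z A] by (simp add: Im_moebius)

lemma Im_moebius_SL2Z: "Im z > 0 \<Longrightarrow> A \<in> SL2Z \<Longrightarrow> Im (moebius A z) > 0"
  by (rule Im_moebius_pos) (auto simp: SL2Z_def)

lemma moebius_uminus: "moebius (- A) z = moebius A z"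
proof -
  have "moebius (- A) z = (- (of_int (A$1$1) * z + of_int (A$1$2))) / (- (den A z))"
    by (simp add: moebius_def)
  then show ?thesis by (simp only: minus_divide_divide moebius_def)
qed

lemma moebius_mat_1 [simp]: "moebius (mat 1) z = z"
  by (simp add: moebius_def mat_1_sel)

lemma moebius_adj2_cancel:
  assumes "Im z > 0" "A \<in> SL2Z"
  shows "moebius (adj2 A) (moebius A z) = z" "moebius A (moebius (adj2 A) z) = z"
  using assms moebius_mult[of z A "adj2 A"] moebius_mult[of z "adj2 A" A]
  by (simp_all add: SL2Z_cancel) (simp_all add: SL2Z_def)

lemma moebius_scalar: "k \<noteq> 0 \<Longrightarrow> moebius (mat k) z = z"
  by (simp add: moebius_def mat_def)

text \<open>Splits off the rational number a/c. The remaining term is small for large bottom rows,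
  so the phase at \<gamma>z may be replaced by e(-a/c).\<close>

lemma Re_moebius:
  assumes "Im z > 0" "A \<in> SL2Z" "A$2$1 \<noteq> 0"
  shows "moebius A z = of_int (A$1$1) / of_int (A$2$1) - 1 / (of_int (A$2$1) * den A z)"
proof -
  have "den A z \<noteq> 0" using assms by (intro den_nonzero) (auto simp: SL2Z_def)
  moreover have "of_int (A$1$1) * of_int (A$2$2) - of_int (A$1$2) * of_int (A$2$1) = (1 :: complex)"
    using assms by (simp add: SL2Z_iff flip: of_int_mult of_int_diff)
  ultimately show ?thesis using assms(3) by (simp add: moebius_def divide_simps) (simp add: algebra_simps)
qed

section \<open>Cosets of the stabilizer of the cusp\<close>

abbreviation Gamma_inf_coset :: "int^2^2 \<Rightarrow> (int^2^2) set" where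
  "Gamma_inf_coset \<gamma> \<equiv> (\<lambda>\<sigma>. \<sigma> ** \<gamma>) ` Gamma_inf"

text \<open>Elements of \<open>Gamma_inf\<close> have diagonal entries 1, 1 or -1, -1, so left
  multiplication by them changes a bottom row by a sign only. Conversely, equal bottom rows up to
  sign make \<delta>\<gamma>^(-1) upper triangular.\<close>

lemma Gamma_inf_coset_eq:
  assumes g: "\<gamma> \<in> SL2Z"
  shows "Gamma_inf_coset \<gamma> = {\<delta> \<in> SL2Z. \<delta>$2 = \<gamma>$2 \<or> \<delta>$2 = - \<gamma>$2}"
proof (intro equalityI subsetI)
  fix \<delta> assume "\<delta> \<in> Gamma_inf_coset \<gamma>"
  then obtain \<sigma> where s: "\<sigma> \<in> SL2Z" "\<sigma>$2$1 = 0" "\<delta> = \<sigma> ** \<gamma>" by (auto simp: Gamma_inf_def)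
  then have "\<sigma>$1$1 * \<sigma>$2$2 = 1" by (simp add: SL2Z_iff)
  then have "\<sigma>$2$2 = 1 \<or> \<sigma>$2$2 = -1" by (auto simp: zmult_eq_1_iff)
  then have "\<delta>$2 = \<gamma>$2 \<or> \<delta>$2 = - \<gamma>$2" using s by (auto simp: mat_mult_2 vec_eq_iff forall_2)
  then show "\<delta> \<in> {\<delta> \<in> SL2Z. \<delta>$2 = \<gamma>$2 \<or> \<delta>$2 = - \<gamma>$2}" using s g SL2Z_mult by auto
next
  fix \<delta> assume d: "\<delta> \<in> {\<delta> \<in> SL2Z. \<delta>$2 = \<gamma>$2 \<or> \<delta>$2 = - \<gamma>$2}"
  have "(\<delta> ** adj2 \<gamma>)$2$1 = 0" using d by (auto simp: mat_mult_2 adj2_def)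
  then have "\<delta> ** adj2 \<gamma> \<in> Gamma_inf" using d g by (auto simp: Gamma_inf_def intro!: SL2Z_mult SL2Z_adj2)
  moreover have "\<delta> = (\<delta> ** adj2 \<gamma>) ** \<gamma>" using SL2Z_cancel(6)[OF g, of \<delta>] by simp
  ultimately show "\<delta> \<in> Gamma_inf_coset \<gamma>" by blast
qed

lemma moebius_Gamma_inf_coset:
  assumes "Im z > 0" "\<gamma> \<in> SL2Z" "\<delta> \<in> Gamma_inf_coset \<gamma>"
  shows "\<exists>k. moebius \<delta> z = moebius \<gamma> z + of_int k"
proof -
  obtain \<sigma> where s: "\<sigma> \<in> SL2Z" "\<sigma>$2$1 = 0" "\<delta> = \<sigma> ** \<gamma>" using assms(3) by (auto simp: Gamma_inf_def)
  then have 1: "\<sigma>$1$1 * \<sigma>$2$2 = 1" by (simp add: SL2Z_iff)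
  have "moebius \<sigma> w = w + of_int (\<sigma>$1$2 * \<sigma>$2$2)" for w
    using 1 s(2) by (auto simp: moebius_def zmult_eq_1_iff)
  then show ?thesis using s moebius_mult[of z \<gamma> \<sigma>] assms
    by (intro exI[of _ "\<sigma>$1$2 * \<sigma>$2$2"]) (simp add: SL2Z_def)
qed

text \<open>The members of a coset move z to points that differ by integers, so a function of period
  1 does not see which member \<open>SOME\<close> picks.\<close>

lemma some_coset_value:
  assumes f: "\<And>w k. Im w > 0 \<Longrightarrow> f (w + of_int k) = f w" and z: "Im z > 0" and g: "\<gamma> \<in> SL2Z"
  shows "f (moebius (SOME \<delta>. \<delta> \<in> Gamma_inf_coset \<gamma>) z) = f (moebius \<gamma> z)"
proof -
  have "\<gamma> \<in> Gamma_inf_coset \<gamma>" using g by (simp add: Gamma_inf_coset_eq)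
  then have "(SOME \<delta>. \<delta> \<in> Gamma_inf_coset \<gamma>) \<in> Gamma_inf_coset \<gamma>" by (rule someI)
  from moebius_Gamma_inf_coset[OF z g this] show ?thesis using f z g Im_moebius_SL2Z by metis
qed

definition coprime_index :: "(nat \<times> int) set" where
  "coprime_index = (SIGMA c:{1..}. {d. coprime d (int c)})"

text \<open>Any completion of the bottom row would represent the coset; taking the modular inverse
  as upper left entry makes a/c literally the argument of the Kloosterman weight.\<close>

definition coprime_mat :: "nat \<times> int \<Rightarrow> int^2^2" where
  "coprime_mat = (\<lambda>(c, d). let a = modular_inverse (int c) d in mat2 a ((a * d - 1) div int c) (int c) d)"

lemma coprime_mat:
  assumes "(c, d) \<in> coprime_index"
  shows "coprime_mat (c, d) \<in> SL2Z" "coprime_mat (c, d) $ 2 $ 1 = int c" "coprime_mat (c, d) $ 2 $ 2 = d"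
    "coprime_mat (c, d) $ 1 $ 1 = modular_inverse (int c) d"
proof -
  have "int c dvd modular_inverse (int c) d * d - 1"
    using cong_modular_inverse2[of d "int c"] assms by (auto simp: coprime_index_def cong_iff_dvd_diff)
  then show "coprime_mat (c, d) \<in> SL2Z" by (simp add: coprime_mat_def SL2Z_iff Let_def mult.commute)
qed (simp_all add: coprime_mat_def Let_def)

lemma SL2Z_coprime_row: "A \<in> SL2Z \<Longrightarrow> coprime (A$2$2) (A$2$1)"
proof (rule coprimeI)
  fix k assume "A \<in> SL2Z" "k dvd A$2$2" "k dvd A$2$1"
  then have "k dvd A$1$1 * A$2$2 - A$1$2 * A$2$1" by simp
  then show "is_unit k" using \<open>A \<in> SL2Z\<close> by (simp add: SL2Z_iff)
qed

text \<open>Requiring c > 0 removes the sign ambiguity of the bottom row. For c = 0 only the rows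
  (0, 1) and (0, -1) occur, which both belong to the coset of the identity.\<close>

lemma Gamma_inf_cosets_eq:
  "Gamma_inf_cosets = insert (Gamma_inf_coset (mat 1)) ((\<lambda>i. Gamma_inf_coset (coprime_mat i)) ` coprime_index)"
  "Gamma_inf_coset (mat 1) \<notin> (\<lambda>i. Gamma_inf_coset (coprime_mat i)) ` coprime_index"
  "inj_on (\<lambda>i. Gamma_inf_coset (coprime_mat i)) coprime_index"
proof -
  have eq: "Gamma_inf_coset A = Gamma_inf_coset B \<longleftrightarrow> (A$2 = B$2 \<or> A$2 = - B$2)" if "A \<in> SL2Z" "B \<in> SL2Z" for A B
  proof
    assume "Gamma_inf_coset A = Gamma_inf_coset B"
    moreover have "A \<in> Gamma_inf_coset A" using that by (simp add: Gamma_inf_coset_eq)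
    ultimately have "A \<in> Gamma_inf_coset B" by simp
    then show "A$2 = B$2 \<or> A$2 = - B$2" using that by (simp add: Gamma_inf_coset_eq)
  next
    assume "A$2 = B$2 \<or> A$2 = - B$2"
    then show "Gamma_inf_coset A = Gamma_inf_coset B" using that by (auto simp: Gamma_inf_coset_eq)
  qed
  show "Gamma_inf_coset (mat 1) \<notin> (\<lambda>i. Gamma_inf_coset (coprime_mat i)) ` coprime_index"
  proof
    assume "Gamma_inf_coset (mat 1) \<in> (\<lambda>i. Gamma_inf_coset (coprime_mat i)) ` coprime_index"
    then obtain c d where i: "(c, d) \<in> coprime_index" "Gamma_inf_coset (mat 1) = Gamma_inf_coset (coprime_mat (c, d))" by auto
    then have "(mat 1 :: int^2^2)$2$1 = int c \<or> (mat 1 :: int^2^2)$2$1 = - int c"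
      using eq[of "mat 1" "coprime_mat (c, d)"] coprime_mat[OF i(1)] by (auto simp: vec_eq_iff forall_2)
    then show False using i by (auto simp: mat_1_sel coprime_index_def)
  qed
  show "inj_on (\<lambda>i. Gamma_inf_coset (coprime_mat i)) coprime_index"
  proof (rule inj_onI)
    fix i j assume ij: "i \<in> coprime_index" "j \<in> coprime_index" "Gamma_inf_coset (coprime_mat i) = Gamma_inf_coset (coprime_mat j)"
    obtain c d c' d' where e: "i = (c, d)" "j = (c', d')" by fastforce
    show "i = j" using ij eq[of "coprime_mat i" "coprime_mat j"] coprime_mat[of c d] coprime_mat[of c' d']
      by (auto simp: e vec_eq_iff forall_2 coprime_index_def)
  qed
  show "Gamma_inf_cosets = insert (Gamma_inf_coset (mat 1)) ((\<lambda>i. Gamma_inf_coset (coprime_mat i)) ` coprime_index)"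
  proof (intro equalityI subsetI)
    fix C assume "C \<in> Gamma_inf_cosets"
    then obtain A where A: "A \<in> SL2Z" "C = Gamma_inf_coset A" by (auto simp: Gamma_inf_cosets_def)
    have cop: "coprime (A$2$2) (A$2$1)" using SL2Z_coprime_row[OF A(1)] .
    show "C \<in> insert (Gamma_inf_coset (mat 1)) ((\<lambda>i. Gamma_inf_coset (coprime_mat i)) ` coprime_index)"
    proof (cases "A$2$1 = 0")
      case True
      then have "A$2$2 = 1 \<or> A$2$2 = -1" using A(1) by (auto simp: SL2Z_iff zmult_eq_1_iff)
      then have "Gamma_inf_coset A = Gamma_inf_coset (mat 1)"
        using True A(1) by (subst eq) (auto simp: vec_eq_iff forall_2 mat_1_sel)
      then show ?thesis using A by simp
    next
      case False
      define i where "i = (nat \<bar>A$2$1\<bar>, sgn (A$2$1) * A$2$2)"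
      have i: "i \<in> coprime_index" using False cop by (auto simp: i_def coprime_index_def sgn_if)
      have r: "coprime_mat i \<in> SL2Z" "coprime_mat i $ 2 $ 1 = \<bar>A$2$1\<bar>" "coprime_mat i $ 2 $ 2 = sgn (A$2$1) * A$2$2"
        using coprime_mat[of "fst i" "snd i"] i by (simp_all add: i_def)
      have "A$2 = coprime_mat i $ 2 \<or> A$2 = - coprime_mat i $ 2"
      proof (cases "A$2$1 > 0")
        case True
        then show ?thesis using r by (simp add: vec_eq_iff forall_2)
      next
        case neg: False
        then have "sgn (A$2$1) = -1" "\<bar>A$2$1\<bar> = - (A$2$1)" using False by auto
        then show ?thesis using r by (simp add: vec_eq_iff forall_2)
      qed
      then have "Gamma_inf_coset A = Gamma_inf_coset (coprime_mat i)"
        using r A(1) by (subst eq) auto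
      then show ?thesis using A i by auto
    qed
  next
    fix C assume "C \<in> insert (Gamma_inf_coset (mat 1)) ((\<lambda>i. Gamma_inf_coset (coprime_mat i)) ` coprime_index)"
    then have "C \<in> Gamma_inf_coset ` SL2Z"
    proof
      assume "C \<in> (\<lambda>i. Gamma_inf_coset (coprime_mat i)) ` coprime_index"
      then obtain c d where "(c, d) \<in> coprime_index" "C = Gamma_inf_coset (coprime_mat (c, d))" by auto
      then show ?thesis using coprime_mat(1) by blast
    qed (use mat_1_SL2Z in blast)
    then show "C \<in> Gamma_inf_cosets" by (simp add: Gamma_inf_cosets_def)
  qed
qed

lemma infsum_Gamma_inf_cosets:
  fixes f :: "complex \<Rightarrow> complex"
  assumes f: "\<And>w k. Im w > 0 \<Longrightarrow> f (w + of_int k) = f w" and z: "Im z > 0"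
    and s: "(\<lambda>i. norm (f (moebius (coprime_mat i) z))) summable_on coprime_index"
  shows "(\<lambda>C. norm (f (moebius (SOME \<delta>. \<delta> \<in> C) z))) summable_on Gamma_inf_cosets"
    "(\<Sum>\<^sub>\<infinity>C\<in>Gamma_inf_cosets. f (moebius (SOME \<delta>. \<delta> \<in> C) z)) = f z + (\<Sum>\<^sub>\<infinity>i\<in>coprime_index. f (moebius (coprime_mat i) z))"
proof -
  let ?K = "\<lambda>i. Gamma_inf_coset (coprime_mat i)"
  let ?g = "\<lambda>C. f (moebius (SOME \<delta>. \<delta> \<in> C) z)"
  have v: "?g (?K i) = f (moebius (coprime_mat i) z)" if "i \<in> coprime_index" for i
    using some_coset_value[of f, OF f z] coprime_mat(1)[of "fst i" "snd i"] that by simp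
  have v1: "?g (Gamma_inf_coset (mat 1)) = f z" using some_coset_value[of f, OF f z mat_1_SL2Z] by simp
  have s': "(\<lambda>C. norm (?g C)) summable_on (?K ` coprime_index)"
    by (subst summable_on_reindex[OF Gamma_inf_cosets_eq(3)])
      (use s v in \<open>simp add: o_def cong: summable_on_cong\<close>)
  then show "(\<lambda>C. norm (?g C)) summable_on Gamma_inf_cosets"
    unfolding Gamma_inf_cosets_eq(1) by (subst insert_is_Un) (rule summable_on_union[OF summable_on_finite s'], simp)
  have "infsum ?g Gamma_inf_cosets = infsum ?g {Gamma_inf_coset (mat 1)} + infsum ?g (?K ` coprime_index)"
    unfolding Gamma_inf_cosets_eq(1) using Gamma_inf_cosets_eq(2) s'
    by (subst insert_is_Un) (intro infsum_Un_disjoint, auto intro: abs_summable_summable)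
  also have "infsum ?g (?K ` coprime_index) = (\<Sum>\<^sub>\<infinity>i\<in>coprime_index. f (moebius (coprime_mat i) z))"
    by (subst infsum_reindex[OF Gamma_inf_cosets_eq(3)]) (use v in \<open>simp add: o_def cong: infsum_cong\<close>)
  finally show "infsum ?g Gamma_inf_cosets = f z + (\<Sum>\<^sub>\<infinity>i\<in>coprime_index. f (moebius (coprime_mat i) z))"
    using v1 by simp
qed

text \<open>A half-open fundamental domain for integer translations. It singles out elements of
  \<open>SL2Z\<close> by where they send the point, which makes sense for any integral matrix and
  survives reindexing by Hecke matrices.\<close>

definition in_strip :: "complex \<Rightarrow> bool" where
  "in_strip z \<longleftrightarrow> 0 \<le> Re z \<and> Re z < 1"

text \<open>Within a coset two freedoms remain, a translation and a sign. The strip fixes the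
  translation and the positivity condition on the bottom row fixes the sign.\<close>

lemma coset_strip_rep:
  assumes z: "Im z > 0"
  shows "bij_betw Gamma_inf_coset {\<gamma> \<in> SL2Z. in_strip (moebius \<gamma> z) \<and> (\<gamma>$2$1 > 0 \<or> \<gamma>$2$1 = 0 \<and> \<gamma>$2$2 > 0)} Gamma_inf_cosets"
    (is "bij_betw _ ?A _")
  unfolding bij_betw_def
proof
  show "inj_on Gamma_inf_coset ?A"
  proof (rule inj_onI)
    fix \<gamma> \<delta> assume gd: "\<gamma> \<in> ?A" "\<delta> \<in> ?A" "Gamma_inf_coset \<gamma> = Gamma_inf_coset \<delta>"
    then have SL: "\<gamma> \<in> SL2Z" "\<delta> \<in> SL2Z" by auto
    have "\<delta> \<in> Gamma_inf_coset \<gamma>" using SL gd(3) by (simp add: Gamma_inf_coset_eq)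
    then obtain \<sigma> where s: "\<sigma> \<in> SL2Z" "\<sigma>$2$1 = 0" "\<delta> = \<sigma> ** \<gamma>" by (auto simp: Gamma_inf_def)
    then have "\<sigma>$1$1 * \<sigma>$2$2 = 1" by (simp add: SL2Z_iff)
    moreover have "\<sigma>$2$2 > 0"
    proof -
      have "\<delta>$2$1 = \<sigma>$2$2 * \<gamma>$2$1" "\<delta>$2$2 = \<sigma>$2$2 * \<gamma>$2$2" using s by (simp_all add: mat_mult_2)
      then show ?thesis using gd by (auto simp: zero_less_mult_iff)
    qed
    ultimately have s1: "\<sigma>$1$1 = 1" "\<sigma>$2$2 = 1" by (auto simp: zmult_eq_1_iff)
    have "moebius \<delta> z = moebius \<gamma> z + of_int (\<sigma>$1$2)"
      using s s1 moebius_mult[of z \<gamma> \<sigma>] z SL by (simp add: moebius_def[of \<sigma>] SL2Z_def)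
    then have "\<sigma>$1$2 = 0" using gd by (auto simp: in_strip_def)
    then have "\<sigma> = mat 1" using s s1 by (simp add: mat_eq_iff_2 mat_1_sel)
    then show "\<gamma> = \<delta>" using s by simp
  qed
  show "Gamma_inf_coset ` ?A = Gamma_inf_cosets"
  proof (intro equalityI subsetI)
    fix C assume "C \<in> Gamma_inf_cosets"
    then obtain A where A: "A \<in> SL2Z" "C = Gamma_inf_coset A" by (auto simp: Gamma_inf_cosets_def)
    define A' where "A' = (if A$2$1 > 0 \<or> A$2$1 = 0 \<and> A$2$2 > 0 then A else - A)"
    have A': "A' \<in> SL2Z" "A'$2$1 > 0 \<or> A'$2$1 = 0 \<and> A'$2$2 > 0" "A'$2 = A$2 \<or> A'$2 = - A$2"
    proof -
      have "A$2$1 \<noteq> 0 \<or> A$2$2 \<noteq> 0" using A(1) by (auto simp: SL2Z_iff)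
      then show "A' \<in> SL2Z" "A'$2$1 > 0 \<or> A'$2$1 = 0 \<and> A'$2$2 > 0" "A'$2 = A$2 \<or> A'$2 = - A$2"
        using A(1) by (auto simp: A'_def)
    qed
    define k where "k = \<lfloor>Re (moebius A' z)\<rfloor>"
    define B where "B = mat2 1 (- k) 0 1 ** A'"
    have B: "B \<in> SL2Z" unfolding B_def using A' by (intro SL2Z_mult) (auto simp: SL2Z_iff)
    have B2: "B$2 = A'$2" by (simp add: B_def vec_eq_iff forall_2 mat_mult_2)
    have "moebius B z = moebius A' z - of_int k"
      unfolding B_def using moebius_mult[of z A' "mat2 1 (- k) 0 1"] z A' by (simp add: moebius_def[of "mat2 1 (- k) 0 1"] SL2Z_def)
    then have "in_strip (moebius B z)" by (simp add: in_strip_def k_def) linarith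
    then have "B \<in> ?A" using B B2 A' by auto
    moreover have "Gamma_inf_coset B = C" using A A' B B2 by (auto simp: Gamma_inf_coset_eq)
    ultimately show "C \<in> Gamma_inf_coset ` ?A" by blast
  qed (auto simp: Gamma_inf_cosets_def)
qed

text \<open>The factor 2 counts the lifts \<gamma> and -\<gamma> of each normalized representative.
  A sum over all of \<open>SL2Z\<close> can be reindexed by group multiplication, which a sum over
  chosen representatives cannot.\<close>

lemma has_sum_strip:
  fixes f :: "complex \<Rightarrow> complex"
  assumes f: "\<And>w k. Im w > 0 \<Longrightarrow> f (w + of_int k) = f w" and z: "Im z > 0"
    and s: "(\<lambda>C. norm (f (moebius (SOME \<delta>. \<delta> \<in> C) z))) summable_on Gamma_inf_cosets"
  defines "h \<equiv> \<lambda>\<gamma>. if in_strip (moebius \<gamma> z) then f (moebius \<gamma> z) else 0"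
  shows "(\<lambda>\<gamma>. norm (h \<gamma>)) summable_on SL2Z"
    "(\<Sum>\<^sub>\<infinity>\<gamma>\<in>SL2Z. h \<gamma>) = 2 * (\<Sum>\<^sub>\<infinity>C\<in>Gamma_inf_cosets. f (moebius (SOME \<delta>. \<delta> \<in> C) z))"
proof -
  let ?g = "\<lambda>C. f (moebius (SOME \<delta>. \<delta> \<in> C) z)"
  define A where "A = {\<gamma> \<in> SL2Z. in_strip (moebius \<gamma> z) \<and> (\<gamma>$2$1 > 0 \<or> \<gamma>$2$1 = 0 \<and> \<gamma>$2$2 > 0)}"
  have bij: "bij_betw Gamma_inf_coset A Gamma_inf_cosets" unfolding A_def by (rule coset_strip_rep[OF z])
  have v: "?g (Gamma_inf_coset \<gamma>) = h \<gamma>" if "\<gamma> \<in> A" for \<gamma>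
    using some_coset_value[of f, OF f z, of \<gamma>] that by (simp add: A_def h_def)
  have sA: "(\<lambda>\<gamma>. norm (h \<gamma>)) summable_on A"
    using summable_on_reindex_bij_betw[OF bij, of "\<lambda>C. norm (?g C)"] s v by (simp cong: summable_on_cong)
  have iA: "infsum h A = infsum ?g Gamma_inf_cosets"
    using infsum_reindex_bij_betw[OF bij, of ?g] v by (simp cong: infsum_cong)
  have bm: "bij_betw uminus A (uminus ` A)" by (simp add: bij_betw_def)
  have hm: "h (- \<gamma>) = h \<gamma>" for \<gamma> by (simp add: h_def moebius_uminus)
  have sM: "(\<lambda>\<gamma>. norm (h \<gamma>)) summable_on (uminus ` A)"
    using summable_on_reindex_bij_betw[OF bm, of "\<lambda>\<gamma>. norm (h \<gamma>)"] sA hm by simp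
  have iM: "infsum h (uminus ` A) = infsum h A"
    using infsum_reindex_bij_betw[OF bm, of h] hm by simp
  have disj: "A \<inter> uminus ` A = {}" by (auto simp: A_def)
  have zero: "h \<gamma> = 0" if "\<gamma> \<in> SL2Z - (A \<union> uminus ` A)" for \<gamma>
  proof (rule ccontr)
    assume "h \<gamma> \<noteq> 0"
    then have st: "in_strip (moebius \<gamma> z)" by (auto simp: h_def split: if_splits)
    have "\<gamma>$2$1 \<noteq> 0 \<or> \<gamma>$2$2 \<noteq> 0" using that by (auto simp: SL2Z_iff)
    then have "\<gamma> \<in> A \<or> - \<gamma> \<in> A" using that st by (auto simp: A_def moebius_uminus)
    then show False using that by (metis DiffD2 UnCI imageI minus_minus)
  qed
  have sub: "A \<union> uminus ` A \<subseteq> SL2Z" by (auto simp: A_def)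
  have "(\<lambda>\<gamma>. norm (h \<gamma>)) summable_on (A \<union> uminus ` A)" using sA sM by (rule summable_on_union)
  then show "(\<lambda>\<gamma>. norm (h \<gamma>)) summable_on SL2Z"
    by (rule summable_on_cong_neutral[THEN iffD1, rotated -1]) (use zero sub in auto)
  have "infsum h SL2Z = infsum h (A \<union> uminus ` A)"
    by (rule infsum_cong_neutral) (use zero sub in auto)
  also have "\<dots> = infsum h A + infsum h (uminus ` A)"
    by (rule infsum_Un_disjoint) (use sA sM disj in \<open>auto intro: abs_summable_summable\<close>)
  finally show "infsum h SL2Z = 2 * infsum ?g Gamma_inf_cosets" by (simp add: iA iM)
qed

section \<open>Analytic continuation of the Niebur--Poincare series\<close>

text \<open>A product majorant: its negative powers can be summed over c and d separately, and the
  inequality between arithmetic and geometric mean bounds it by a multiple of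
  \<open>lat\<close>.\<close>

definition index_size :: "nat \<times> int \<Rightarrow> real" where
  "index_size = (\<lambda>(c, d). real c * max 1 \<bar>of_int d\<bar>)"

lemma index_size_ge_1: "i \<in> coprime_index \<Longrightarrow> index_size i \<ge> 1"
proof -
  assume "i \<in> coprime_index"
  then obtain c d where i: "i = (c, d)" "c \<ge> 1" by (auto simp: coprime_index_def)
  then have "1 * 1 \<le> real c * max 1 \<bar>of_int d\<bar>" by (intro mult_mono) auto
  then show ?thesis by (simp add: i index_size_def)
qed

lemma summable_index_size:
  assumes a: "a > 1"
  shows "(\<lambda>i. index_size i powr (-a)) summable_on coprime_index"
proof -
  let ?s = "\<Sum>\<^sub>\<infinity>d::int. (max 1 \<bar>of_int d\<bar>) powr (-a)"
  have "(\<lambda>i. index_size i powr (-a)) summable_on ({1..} \<times> UNIV)"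
  proof (rule summable_on_SigmaI[where g = "\<lambda>c. real c powr (-a) * ?s"])
    show "((\<lambda>d. index_size (c, d) powr (-a)) has_sum real c powr (-a) * ?s) UNIV" for c :: nat
      unfolding index_size_def by (simp add: powr_mult)
        (intro has_sum_cmult_right has_sum_infsum summable_on_int_max_powr a)
    show "(\<lambda>c. real c powr (-a) * ?s) summable_on {1..}"
      using summable_on_subset_banach[OF summable_on_nat_powr[OF a]] by (intro summable_on_cmult_left) auto
  qed auto
  then show ?thesis by (rule summable_on_subset_banach) (auto simp: coprime_index_def)
qed

lemma lat_lower_bound:
  assumes K: "\<forall>a b :: real. a^2 + b^2 \<le> K * (norm (of_real a * \<tau> + of_real b))^2" and i: "(c, d) \<in> coprime_index"
  shows "index_size (c, d) \<le> K * lat \<tau> c d"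
proof -
  have c: "real c \<ge> 1" using i by (auto simp: coprime_index_def)
  have "index_size (c, d) \<le> (real c)^2 + (of_int d)^2"
  proof (cases "\<bar>of_int d\<bar> \<le> (1::real)")
    case True
    then have "index_size (c, d) = real c * 1" by (simp add: index_size_def)
    also have "\<dots> \<le> real c * real c" using c by (intro mult_left_mono) auto
    finally show ?thesis by (simp add: power2_eq_square add_increasing2)
  next
    case False
    have "0 \<le> (real c - \<bar>of_int d\<bar>)^2" by simp
    then have "2 * (real c * \<bar>of_int d\<bar>) \<le> (real c)^2 + (of_int d)^2" by (simp add: power2_diff)
    moreover have "0 \<le> real c * \<bar>of_int d\<bar>" by simp
    moreover have "index_size (c, d) = real c * \<bar>of_int d\<bar>" using False by (simp add: index_size_def)
    ultimately show ?thesis by linarith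
  qed
  also have "\<dots> \<le> K * lat \<tau> c d" using K[rule_format, of "real c" "of_int d"] by (simp add: lat_def)
  finally show ?thesis .
qed

lemma moebius_coprime_mat:
  assumes "Im \<tau> > 0" "(c, d) \<in> coprime_index"
  shows "Im (moebius (coprime_mat (c, d)) \<tau>) = Im \<tau> / lat \<tau> c d"
    "\<bar>Re (moebius (coprime_mat (c, d)) \<tau>) - of_int (modular_inverse (int c) d) / real c\<bar> \<le> 1 / sqrt (lat \<tau> c d)"
proof -
  note m = coprime_mat[OF assms(2)]
  have c: "c \<ge> 1" using assms by (auto simp: coprime_index_def)
  have d: "den (coprime_mat (c, d)) \<tau> = of_nat c * \<tau> + of_int d" using m by simp
  show "Im (moebius (coprime_mat (c, d)) \<tau>) = Im \<tau> / lat \<tau> c d"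
    using m(1) unfolding Im_moebius d by (simp add: SL2Z_def lat_def)
  have "moebius (coprime_mat (c, d)) \<tau> = of_int (modular_inverse (int c) d) / of_nat c - 1 / (of_nat c * (of_nat c * \<tau> + of_int d))"
    using Re_moebius[OF assms(1) m(1)] m c by simp
  then have "Re (moebius (coprime_mat (c, d)) \<tau>) - of_int (modular_inverse (int c) d) / real c
      = - Re (1 / (of_nat c * (of_nat c * \<tau> + of_int d)))" by (simp add: Re_divide_of_nat)
  then have "\<bar>Re (moebius (coprime_mat (c, d)) \<tau>) - of_int (modular_inverse (int c) d) / real c\<bar>
      \<le> norm (1 / (of_nat c * (of_nat c * \<tau> + of_int d)))" by (metis abs_Re_le_cmod abs_minus_cancel)
  also have "\<dots> = 1 / (real c * sqrt (lat \<tau> c d))" by (simp add: lat_def norm_divide norm_mult)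
  also have "\<dots> \<le> 1 / (1 * sqrt (lat \<tau> c d))"
    using c lat_pos[OF assms(1), of c d] by (intro divide_left_mono mult_right_mono) auto
  finally show "\<bar>Re (moebius (coprime_mat (c, d)) \<tau>) - of_int (modular_inverse (int c) d) / real c\<bar> \<le> 1 / sqrt (lat \<tau> c d)"
    by simp
qed

text \<open>The three exponents allow uniform use in s: with r depending on Re s, neither the
  constant \<open>A powr R\<close> nor the decay rate a depends on s.\<close>

lemma Im_orbit_bounds:
  assumes \<tau>: "Im \<tau> > 0"
  shows "\<exists>A\<ge>1. (\<forall>i\<in>coprime_index. 0 < Im (moebius (coprime_mat i) \<tau>) \<and> Im (moebius (coprime_mat i) \<tau>) \<le> A) \<and>
     (\<forall>i\<in>coprime_index. \<forall>a r R. 0 \<le> a \<longrightarrow> a \<le> r \<longrightarrow> r \<le> R \<longrightarrow>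
        Im (moebius (coprime_mat i) \<tau>) powr r \<le> A powr R * index_size i powr (-a))"
proof -
  obtain K where K: "K \<ge> 1" "\<forall>a b :: real. a^2 + b^2 \<le> K * (norm (of_real a * \<tau> + of_real b))^2"
    using lattice_lower_bound[OF \<tau>] by blast
  define A where "A = max 1 (K * Im \<tau>)"
  have A: "A \<ge> 1" by (simp add: A_def)
  have b: "0 < Im (moebius (coprime_mat i) \<tau>) \<and> Im (moebius (coprime_mat i) \<tau>) \<le> A / index_size i" if i: "i \<in> coprime_index" for i
  proof -
    obtain c d where e: "i = (c, d)" by fastforce
    have c: "c > 0" using i by (auto simp: e coprime_index_def)
    have l: "lat \<tau> c d > 0" using lat_pos[OF \<tau> c] .
    have X: "index_size i \<ge> 1" using index_size_ge_1[OF i] .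
    have le: "index_size i \<le> K * lat \<tau> c d" using lat_lower_bound[OF K(2)] i by (simp add: e)
    have "Im \<tau> / lat \<tau> c d \<le> K * Im \<tau> / index_size i"
      using mult_left_mono[OF le, of "Im \<tau>"] \<tau> l X by (simp add: field_simps)
    also have "\<dots> \<le> A / index_size i" using X by (intro divide_right_mono) (auto simp: A_def)
    finally show ?thesis using moebius_coprime_mat(1)[OF \<tau>] i \<tau> l by (simp add: e)
  qed
  show ?thesis
  proof (intro exI[of _ A] conjI ballI allI impI A)
    fix i assume i: "i \<in> coprime_index"
    show "0 < Im (moebius (coprime_mat i) \<tau>)" using b[OF i] by simp
    have X: "index_size i \<ge> 1" using index_size_ge_1[OF i] .
    have "A / index_size i \<le> A / 1" using X A by (intro divide_left_mono) auto
    then show "Im (moebius (coprime_mat i) \<tau>) \<le> A" using b[OF i] by simp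
    fix a r R :: real assume r: "0 \<le> a" "a \<le> r" "r \<le> R"
    have "Im (moebius (coprime_mat i) \<tau>) powr r \<le> (A / index_size i) powr r"
      using b[OF i] r by (intro powr_mono2) auto
    also have "\<dots> = A powr r * index_size i powr (- r)"
      using A X by (simp add: powr_divide powr_minus_divide)
    also have "\<dots> \<le> A powr R * index_size i powr (- a)"
      using A X r by (intro mult_mono powr_mono) auto
    finally show "Im (moebius (coprime_mat i) \<tau>) powr r \<le> A powr R * index_size i powr (- a)" .
  qed
qed

lemma niebur_term_periodic: "niebur_term n s (w + of_int k) = niebur_term n s w"
proof -
  have "2 * pi * (- real n * Re (w + of_int k)) = 2 * pi * (- real n * Re w) + 2 * pi * of_int (- int n * k)"
    by (simp add: algebra_simps)
  then have "cis (2 * pi * (- real n * Re (w + of_int k))) = cis (2 * pi * (- real n * Re w)) * cis (2 * pi * of_int (- int n * k))"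
    by (simp only: cis_mult)
  also have "cis (2 * pi * of_int (- int n * k)) = 1" by (rule cis_multiple_2pi) simp
  finally show ?thesis by (simp add: niebur_term_def)
qed

lemma summable_niebur_orbit:
  assumes \<tau>: "Im \<tau> > 0" and n: "n > 0" and s: "Re s > 1"
  shows "(\<lambda>i. norm (niebur_term n s (moebius (coprime_mat i) \<tau>))) summable_on coprime_index"
proof -
  obtain A where A: "A \<ge> 1" "\<forall>i\<in>coprime_index. 0 < Im (moebius (coprime_mat i) \<tau>) \<and> Im (moebius (coprime_mat i) \<tau>) \<le> A"
     "\<forall>i\<in>coprime_index. \<forall>a r R. 0 \<le> a \<longrightarrow> a \<le> r \<longrightarrow> r \<le> R \<longrightarrow>
        Im (moebius (coprime_mat i) \<tau>) powr r \<le> A powr R * index_size i powr (-a)"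
    using Im_orbit_bounds[OF \<tau>] by blast
  obtain C where C: "C \<ge> 0" "\<forall>z. 0 < Im z \<longrightarrow> Im z \<le> A \<longrightarrow> norm (niebur_term n s z) \<le> C * Im z powr Re s"
    using norm_niebur_term_le[OF n, of s A] s by auto
  show ?thesis
  proof (rule summable_on_comparison_test)
    show "(\<lambda>i. C * (A powr Re s * index_size i powr (- Re s))) summable_on coprime_index"
      by (intro summable_on_cmult_right summable_index_size s)
    fix i assume i: "i \<in> coprime_index"
    have "norm (niebur_term n s (moebius (coprime_mat i) \<tau>)) \<le> C * Im (moebius (coprime_mat i) \<tau>) powr Re s"
      using C(2) A(2) i by blast
    also have "\<dots> \<le> C * (A powr Re s * index_size i powr (- Re s))"
      using A(3) i s C(1) by (intro mult_left_mono) auto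
    finally show "norm (niebur_term n s (moebius (coprime_mat i) \<tau>)) \<le> C * (A powr Re s * index_size i powr (- Re s))" .
  qed simp
qed

lemma poincare_F_eq:
  assumes \<tau>: "Im \<tau> > 0" and n: "n > 0" and s: "Re s > 1"
  shows "poincare_F n \<tau> s = of_real (2 * pi * sqrt (real n)) *
     (niebur_term n s \<tau> + (\<Sum>\<^sub>\<infinity>i\<in>coprime_index. niebur_term n s (moebius (coprime_mat i) \<tau>)))"
  using infsum_Gamma_inf_cosets(2)[of "niebur_term n s", OF niebur_term_periodic \<tau> summable_niebur_orbit[OF assms]]
  by (simp add: poincare_F_def Let_def niebur_term_def[of n s])

lemma norm_cis_diff_le: "norm (cis u - cis v) \<le> \<bar>u - v\<bar>"
proof -
  have "norm (cis u - cis v) \<le> exp (max (Re (\<i> * of_real u)) (Re (\<i> * of_real v))) * norm (\<i> * of_real u - \<i> * of_real v)"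
    unfolding cis_conv_exp by (rule norm_exp_diff_le)
  also have "\<i> * of_real u - \<i> * of_real v = \<i> * of_real (u - v)" by (simp add: algebra_simps)
  finally show ?thesis by (simp add: norm_mult del: of_real_diff)
qed

lemma of_real_divide_powr:
  "y > 0 \<Longrightarrow> l > 0 \<Longrightarrow> (of_real (y / l) :: complex) powr s = of_real y powr s * of_real l powr (- s)"
  by (simp add: powr_def Ln_of_real ln_div exp_add[symmetric] algebra_simps del: of_real_divide)

section \<open>Main term, error term and the continuation for n = 1\<close>

text \<open>The leading power of the summand with Re(\<gamma>\<tau>) replaced by a/c. The power of
  Im(\<gamma>\<tau>) is split so that the factor depending on (c, d) is the summand of
  \<open>kloosterman_zeta_term\<close>.\<close>

definition main_term :: "complex \<Rightarrow> complex \<Rightarrow> nat \<times> int \<Rightarrow> complex" where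
  "main_term \<tau> s = (\<lambda>(c, d). leading_coeff s * of_real (Im \<tau>) powr s *
     (e_mod c (- modular_inverse (int c) d) * of_real (lat \<tau> c d) powr (-s)))"

lemma norm_main_term:
  assumes "Im \<tau> > 0" "i \<in> coprime_index"
  shows "norm (main_term \<tau> s i) = norm (leading_coeff s) * Im (moebius (coprime_mat i) \<tau>) powr Re s"
proof -
  obtain c d where e: "i = (c, d)" by fastforce
  have c: "c > 0" using assms by (auto simp: e coprime_index_def)
  have l: "lat \<tau> c d > 0" using lat_pos[OF assms(1) c] .
  have "norm (main_term \<tau> s i) = norm (leading_coeff s) * norm (of_real (Im \<tau>) powr s * of_real (lat \<tau> c d) powr (-s))"
    by (simp add: main_term_def e norm_mult)
  also have "of_real (Im \<tau>) powr s * of_real (lat \<tau> c d) powr (-s) = of_real (Im \<tau> / lat \<tau> c d) powr s"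
    using assms l by (simp only: of_real_divide_powr)
  also have "norm \<dots> = (Im \<tau> / lat \<tau> c d) powr Re s" using assms l by (intro norm_of_real_powr) auto
  also have "Im \<tau> / lat \<tau> c d = Im (moebius (coprime_mat i) \<tau>)"
    using moebius_coprime_mat(1)[OF assms(1)] assms by (simp add: e)
  finally show ?thesis .
qed

text \<open>Dropping the Bessel tail costs order y^(Re s + 2). Replacing the phase costs order y^(Re
  s + 1/2), since Re(\<gamma>\<tau>) is within a multiple of sqrt y of a/c. The weaker gain fixes
  the exponent 15/16 + 1/2 = 23/16 > 1.\<close>

lemma error_term_bound:
  assumes \<tau>: "Im \<tau> > 0"
  shows "\<exists>C. \<forall>s\<in>cont_region B. \<forall>i\<in>coprime_index.
     norm (niebur_term 1 s (moebius (coprime_mat i) \<tau>) - main_term \<tau> s i) \<le> C * index_size i powr (-23/16)"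
proof -
  obtain A where A: "A \<ge> 1" "\<forall>i\<in>coprime_index. 0 < Im (moebius (coprime_mat i) \<tau>) \<and> Im (moebius (coprime_mat i) \<tau>) \<le> A"
     "\<forall>i\<in>coprime_index. \<forall>a r R. 0 \<le> a \<longrightarrow> a \<le> r \<longrightarrow> r \<le> R \<longrightarrow>
        Im (moebius (coprime_mat i) \<tau>) powr r \<le> A powr R * index_size i powr (-a)"
    using Im_orbit_bounds[OF \<tau>] by blast
  obtain C1 where C1: "C1 \<ge> 0" "\<forall>s\<in>cont_region B. \<forall>z. 0 < Im z \<longrightarrow> Im z \<le> A \<longrightarrow>
     norm (niebur_term 1 s z - leading_coeff s * of_real (Im z) powr s * cis (- 2 * pi * Re z)) \<le> C1 * Im z powr (Re s + 2)"
    using niebur_term_approx[of B A] by blast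
  obtain G where G: "G \<ge> 0" "\<forall>s\<in>cont_region B. norm (leading_coeff s) \<le> G"
    using norm_leading_coeff_le by blast
  let ?C = "C1 * A powr (B + 2) + G * (2 * pi / sqrt (Im \<tau>)) * A powr (B + 1/2)"
  show ?thesis
  proof (intro exI[of _ ?C] ballI)
    fix s i assume s: "s \<in> cont_region B" and i: "i \<in> coprime_index"
    obtain c d where e: "i = (c, d)" by fastforce
    have c: "c > 0" using i by (auto simp: e coprime_index_def)
    have l: "lat \<tau> c d > 0" using lat_pos[OF \<tau> c] .
    define z where "z = moebius (coprime_mat i) \<tau>"
    have z: "0 < Im z" "Im z \<le> A" using A(2) i by (auto simp: z_def)
    have zi: "Im z = Im \<tau> / lat \<tau> c d" using moebius_coprime_mat(1)[OF \<tau>] i by (simp add: z_def e)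
    have zp: "Im z powr r \<le> A powr R * index_size i powr (-a)" if "0 \<le> a" "a \<le> r" "r \<le> R" for a r R
      using A(3) i that by (simp add: z_def)
    have "norm (niebur_term 1 s z - leading_coeff s * of_real (Im z) powr s * cis (- 2 * pi * Re z)) \<le> C1 * Im z powr (Re s + 2)"
      using C1(2) s z by blast
    also have "\<dots> \<le> C1 * (A powr (B + 2) * index_size i powr (-(23/16)))"
      using cont_regionD[OF s] by (intro mult_left_mono zp C1) auto
    finally have 1: "norm (niebur_term 1 s z - leading_coeff s * of_real (Im z) powr s * cis (- 2 * pi * Re z))
       \<le> C1 * (A powr (B + 2) * index_size i powr (-23/16))" by simp
    have m: "main_term \<tau> s i = leading_coeff s * of_real (Im z) powr s * e_mod c (- modular_inverse (int c) d)"
      using of_real_divide_powr[OF \<tau> l, of s] by (simp add: main_term_def e zi mult_ac del: of_real_divide)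
    have "norm (leading_coeff s * of_real (Im z) powr s * cis (- 2 * pi * Re z) - main_term \<tau> s i)
      = norm (leading_coeff s) * Im z powr Re s * norm (cis (- 2 * pi * Re z) - e_mod c (- modular_inverse (int c) d))"
      unfolding m right_diff_distrib[symmetric] using z by (simp add: norm_mult norm_of_real_powr)
    also have "norm (cis (- 2 * pi * Re z) - e_mod c (- modular_inverse (int c) d)) \<le> 2 * pi / sqrt (Im \<tau>) * Im z powr (1/2)"
    proof -
      have "norm (cis (- 2 * pi * Re z) - e_mod c (- modular_inverse (int c) d))
         \<le> \<bar>- 2 * pi * Re z - 2 * pi * of_int (- modular_inverse (int c) d) / of_nat c\<bar>"
        unfolding e_mod_def by (rule norm_cis_diff_le)
      also have "- 2 * pi * Re z - 2 * pi * of_int (- modular_inverse (int c) d) / of_nat c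
         = - 2 * pi * (Re z - of_int (modular_inverse (int c) d) / real c)" by (simp add: algebra_simps)
      also have "\<bar>\<dots>\<bar> = 2 * pi * \<bar>Re z - of_int (modular_inverse (int c) d) / real c\<bar>" by (simp add: abs_mult)
      also have "\<dots> \<le> 2 * pi * (1 / sqrt (lat \<tau> c d))"
        using moebius_coprime_mat(2)[OF \<tau>] i by (intro mult_left_mono) (auto simp: z_def e)
      also have "1 / sqrt (lat \<tau> c d) = Im z powr (1/2) / sqrt (Im \<tau>)"
        using \<tau> l zi by (simp add: powr_half_sqrt real_sqrt_divide)
      finally show ?thesis by simp
    qed
    also have "norm (leading_coeff s) * Im z powr Re s * (2 * pi / sqrt (Im \<tau>) * Im z powr (1/2))
        = norm (leading_coeff s) * (2 * pi / sqrt (Im \<tau>)) * Im z powr (Re s + 1/2)"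
      by (simp add: powr_add)
    also have "\<dots> \<le> G * (2 * pi / sqrt (Im \<tau>)) * (A powr (B + 1/2) * index_size i powr (-(23/16)))"
      using G s cont_regionD[OF s] \<tau> by (intro mult_mono zp) auto
    finally have 2: "norm (leading_coeff s * of_real (Im z) powr s * cis (- 2 * pi * Re z) - main_term \<tau> s i)
       \<le> G * (2 * pi / sqrt (Im \<tau>)) * (A powr (B + 1/2) * index_size i powr (-23/16))"
      by (simp add: mult_left_mono)
    show "norm (niebur_term 1 s (moebius (coprime_mat i) \<tau>) - main_term \<tau> s i) \<le> ?C * index_size i powr (-23/16)"
      using norm_triangle_le[OF add_mono[OF 1 2]] by (simp add: z_def algebra_simps)
  qed
qed

lemma holomorphic_leading_coeff: "leading_coeff holomorphic_on S"
  unfolding leading_coeff_def[abs_def] by (intro holomorphic_intros) auto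

lemma holomorphic_kloosterman_zeta_term:
  assumes \<tau>: "Im \<tau> > 0" and c: "c \<ge> 1"
  shows "kloosterman_zeta_term \<tau> c holomorphic_on cont_region B"
proof -
  obtain K where K: "K \<ge> 1" "\<forall>a b :: real. a^2 + b^2 \<le> K * (norm (of_real a * \<tau> + of_real b))^2"
    using lattice_lower_bound[OF \<tau>] by blast
  obtain K1 where K1: "\<forall>c::nat. \<forall>a. c \<ge> 1 \<longrightarrow> a \<ge> 15/16 \<longrightarrow>
     (\<lambda>d::int. (real c ^ 2 + (of_int d)^2) powr (-a)) summable_on UNIV \<and>
     (\<Sum>\<^sub>\<infinity>d::int. (real c ^ 2 + (of_int d)^2) powr (-a)) \<le> K1 * real c powr (1 - 2 * a)"
    using sum_int_quadratic_bound[of "15/16"] by auto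
  show ?thesis unfolding kloosterman_zeta_term_def[abs_def]
  proof (rule holomorphic_on_infsum[where M = "\<lambda>d. (3 * K) powr B * (real c ^ 2 + (of_int d)^2) powr (-(15/16))"])
    show "(\<lambda>d. (3 * K) powr B * (real c ^ 2 + (real_of_int d)^2) powr (-(15/16))) summable_on {d. coprime d (int c)}"
    proof (rule summable_on_cmult_right)
      have "(\<lambda>d. (real c ^ 2 + (real_of_int d)^2) powr (-(15/16))) summable_on UNIV"
        using K1[rule_format, OF c, of "15/16"] by simp
      then show "(\<lambda>d. (real c ^ 2 + (real_of_int d)^2) powr (-(15/16))) summable_on {d. coprime d (int c)}"
        by (rule summable_on_subset_banach) simp
    qed
    fix d
    show "(\<lambda>s. e_mod c (- modular_inverse (int c) d) * of_real (lat \<tau> c d) powr (-s)) holomorphic_on cont_region B"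
      using lat_pos[OF \<tau>, of c d] c by (intro holomorphic_intros) auto
    fix s assume s: "s \<in> cont_region B"
    have "norm (of_real (lat \<tau> c d) powr (-s)) \<le> (3 * K) powr B * (real c ^ 2 + (of_int d)^2) powr (- Re s)"
      using cont_regionD[OF s] by (intro lat_powr_bounds(1)[OF K \<tau> c]) auto
    also have "\<dots> \<le> (3 * K) powr B * (real c ^ 2 + (of_int d)^2) powr (-(15/16))"
    proof -
      have "1 \<le> (real c)^2" using c by simp
      then have "1 \<le> real c ^ 2 + (of_int d)^2" using zero_le_power2[of "real_of_int d"] by linarith
      then show ?thesis using cont_regionD[OF s] by (intro mult_left_mono powr_mono) auto
    qed
    finally show "norm (e_mod c (- modular_inverse (int c) d) * of_real (lat \<tau> c d) powr (-s))
       \<le> (3 * K) powr B * (real c ^ 2 + (of_int d)^2) powr (-(15/16))" by (simp add: norm_mult)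
  qed simp
qed

text \<open>The error sum converges absolutely for Re s > 15/16, while the main terms are collected
  into a series over c. The regrouping is carried out where Re s > 1, by absolute convergence of the
  double sum.\<close>

theorem poincare_F_1_continues:
  assumes \<tau>: "Im \<tau> > 0"
  shows "\<exists>G. continues_to_1 (poincare_F 1 \<tau>) G"
proof -
  define E where "E s = (\<Sum>\<^sub>\<infinity>i\<in>coprime_index. niebur_term 1 s (moebius (coprime_mat i) \<tau>) - main_term \<tau> s i)" for s
  \<comment> \<open>The inner sum over d is taken first: to the left of 1 the double sum over (c, d)
    no longer converges absolutely.\<close>
  define Z where "Z s = (\<Sum>\<^sub>\<infinity>c\<in>{1..}. kloosterman_zeta_term \<tau> c s)" for s
  define G where "G s = of_real (2 * pi) * (niebur_term 1 s \<tau> + E s + leading_coeff s * of_real (Im \<tau>) powr s * Z s)" for s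
  define U where "U = {s. Re s > 15/16}"
  have U: "open U" "connected U" "{s. Re s > 1} \<subseteq> U" "1 \<in> U"
    unfolding U_def by (intro open_halfspace_Re_gt convex_connected convex_halfspace_Re_gt | force)+
  have holB: "G holomorphic_on cont_region B" for B
  proof -
    obtain C where C: "\<forall>s\<in>cont_region B. \<forall>i\<in>coprime_index.
       norm (niebur_term 1 s (moebius (coprime_mat i) \<tau>) - main_term \<tau> s i) \<le> C * index_size i powr (-23/16)"
      using error_term_bound[OF \<tau>] by blast
    have "E holomorphic_on cont_region B" unfolding E_def
    proof (rule holomorphic_on_infsum[where M = "\<lambda>i. C * index_size i powr (-23/16)"])
      show "(\<lambda>i. C * index_size i powr (-23/16)) summable_on coprime_index"
        using summable_index_size[of "23/16"] by (intro summable_on_cmult_right) simp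
      fix i assume i: "i \<in> coprime_index"
      obtain c d where e: "i = (c, d)" by fastforce
      have c: "c > 0" using i by (auto simp: e coprime_index_def)
      have l: "lat \<tau> c d > 0" using lat_pos[OF \<tau> c] .
      have "Im (moebius (coprime_mat i) \<tau>) > 0" using coprime_mat(1) i \<tau> by (auto simp: e intro: Im_moebius_SL2Z)
      then show "(\<lambda>s. niebur_term 1 s (moebius (coprime_mat i) \<tau>) - main_term \<tau> s i) holomorphic_on cont_region B"
        using l \<tau> unfolding main_term_def e case_prod_conv
        by (intro holomorphic_intros holomorphic_niebur_term holomorphic_leading_coeff) auto
    qed (use C in auto)
    moreover have "Z holomorphic_on cont_region B" unfolding Z_def
    proof -
      obtain C where C: "\<forall>c s. c \<ge> 1 \<longrightarrow> Re s \<ge> 15/16 \<longrightarrow> norm s \<le> B \<longrightarrow>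
         norm (kloosterman_zeta_term \<tau> c s) \<le> C * (real c powr (-17/16) * real (card {e. e dvd c}))"
        using kloosterman_zeta_term_bound[OF \<tau>] by blast
      show "(\<lambda>s. \<Sum>\<^sub>\<infinity>c\<in>{1..}. kloosterman_zeta_term \<tau> c s) holomorphic_on cont_region B"
      proof (rule holomorphic_on_infsum[where M = "\<lambda>c. C * (real c powr (-17/16) * real (card {e. e dvd c}))"])
        show "(\<lambda>c. C * (real c powr (-17/16) * real (card {e. e dvd c}))) summable_on {1..}"
          using summable_on_divisor_count_powr[of "17/16"] by (intro summable_on_cmult_right) simp
      qed (use C cont_regionD holomorphic_kloosterman_zeta_term[OF \<tau>] in auto)
    qed
    ultimately show ?thesis unfolding G_def[abs_def] using \<tau>
      by (intro holomorphic_intros holomorphic_niebur_term holomorphic_leading_coeff) auto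
  qed
  have holU: "G holomorphic_on U"
  proof -
    have "G field_differentiable at s" if "s \<in> U" for s
    proof -
      \<comment> \<open>The estimates are uniform on bounded regions only; every point of the
        half-plane lies in one of them.\<close>
      have "s \<in> cont_region (norm s + 1)" using that by (simp add: U_def cont_region_def)
      then show ?thesis using holB[of "norm s + 1"] by (simp add: holomorphic_on_open field_differentiable_def)
    qed
    then show ?thesis by (auto simp: holomorphic_on_def field_differentiable_at_within)
  qed
  have eq: "G s = poincare_F 1 \<tau> s" if s: "Re s > 1" for s
  proof -
    obtain A where A: "A \<ge> 1"
       "\<forall>i\<in>coprime_index. \<forall>a r R. 0 \<le> a \<longrightarrow> a \<le> r \<longrightarrow> r \<le> R \<longrightarrow>
          Im (moebius (coprime_mat i) \<tau>) powr r \<le> A powr R * index_size i powr (-a)"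
      using Im_orbit_bounds[OF \<tau>] by blast
    let ?N = "\<lambda>i. niebur_term 1 s (moebius (coprime_mat i) \<tau>)"
    have sN: "?N summable_on coprime_index"
      using summable_niebur_orbit[OF \<tau> _ s, of 1] abs_summable_summable by auto
    have sM: "main_term \<tau> s summable_on coprime_index"
    proof (rule abs_summable_summable, rule summable_on_comparison_test)
      show "(\<lambda>i. norm (leading_coeff s) * (A powr Re s * index_size i powr (- Re s))) summable_on coprime_index"
        by (intro summable_on_cmult_right summable_index_size s)
      show "norm (main_term \<tau> s i) \<le> norm (leading_coeff s) * (A powr Re s * index_size i powr (- Re s))" if "i \<in> coprime_index" for i
        using A(2) that s \<tau> by (simp add: norm_main_term mult_left_mono)
    qed simp
    have "E s = infsum ?N coprime_index - infsum (main_term \<tau> s) coprime_index"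
      unfolding E_def by (rule infsum_diff[OF sN sM])
    moreover have "infsum (main_term \<tau> s) coprime_index = leading_coeff s * of_real (Im \<tau>) powr s * Z s"
    proof -
      have "infsum (main_term \<tau> s) coprime_index = (\<Sum>\<^sub>\<infinity>c\<in>{1..}. \<Sum>\<^sub>\<infinity>d\<in>{d. coprime d (int c)}. main_term \<tau> s (c, d))"
        using sM unfolding coprime_index_def by (rule infsum_Sigma_banach[symmetric])
      then show ?thesis
        by (simp add: main_term_def Z_def kloosterman_zeta_term_def infsum_cmult_right')
    qed
    ultimately show ?thesis using poincare_F_eq[OF \<tau> _ s, of 1] by (simp add: G_def)
  qed
  show ?thesis unfolding continues_to_1_def
    using U holU eq by blast
qed

section \<open>Hecke operators\<close>

text \<open>Representatives A of the cosets \<open>SL2Z\<close> A in determinant p, i.e. the usual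
  points p z and (z + b)/p of the operator T_p.\<close>

definition hecke_left :: "nat \<Rightarrow> (int^2^2) set" where
  "hecke_left p = insert (mat2 (int p) 0 0 1) ((\<lambda>b. mat2 1 b 0 (int p)) ` {0..<int p})"

text \<open>The adjoints of \<open>hecke_left\<close>, whence the signs; they represent the cosets A
  \<open>SL2Z\<close>. Applied last, they act on the strip simply as w / p and p w - b.\<close>

definition hecke_right :: "nat \<Rightarrow> (int^2^2) set" where
  "hecke_right p = insert (mat2 1 0 0 (int p)) ((\<lambda>b. mat2 (int p) (- b) 0 1) ` {0..<int p})"

definition mats_of_det :: "nat \<Rightarrow> (int^2^2) set" where
  "mats_of_det p = {M. det M = int p}"

lemma finite_hecke [simp]: "finite (hecke_left p)" "finite (hecke_right p)"
  by (simp_all add: hecke_left_def hecke_right_def)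

lemma det_hecke: "A \<in> hecke_left p \<Longrightarrow> det A = int p" "A \<in> hecke_right p \<Longrightarrow> det A = int p"
  by (auto simp: hecke_left_def hecke_right_def)

lemma adj2_hecke: "adj2 ` hecke_left p = hecke_right p" "adj2 ` hecke_right p = hecke_left p"
  by (auto simp: hecke_left_def hecke_right_def adj2_def image_image)

lemma ex_dvd_linear:
  fixes x y :: int
  assumes p: "prime p" and y: "\<not> int p dvd y"
  shows "\<exists>j\<in>{0..<int p}. int p dvd x + j * y"
proof -
  have "coprime y (int p)" using p y by (metis coprime_commute prime_imp_coprime prime_int_nat_transfer of_nat_0_le_iff prime_nat_int_transfer)
  then obtain v where v: "[y * v = 1] (mod int p)" using cong_solve_coprime_int by blast
  have "[x + (- x * v) mod int p * y = x + (- x * v) * y] (mod int p)"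
    by (intro cong_add cong_mult cong_refl) auto
  also have "x + (- x * v) * y = x + (- x) * (y * v)" by (simp add: algebra_simps)
  also have "[x + (- x) * (y * v) = x + (- x) * 1] (mod int p)" by (intro cong_add cong_mult cong_refl v)
  finally have "int p dvd x + (- x * v) mod int p * y" by (simp add: cong_0_iff)
  then show ?thesis using prime_gt_0_nat[OF p] by (intro bexI[of _ "(- x * v) mod int p"]) auto
qed

text \<open>Modulo p the rows of M are linearly dependent. If the bottom row vanishes modulo p, it
  can be divided by p; otherwise some multiple of it added to the top row makes that row divisible
  by p.\<close>

lemma ex_hecke_right_factor:
  assumes p: "prime p" and M: "det M = int p"
  shows "\<exists>A\<in>hecke_right p. \<exists>\<gamma>\<in>SL2Z. M = A ** \<gamma>"
proof -
  have p0: "int p \<noteq> 0" and pp: "prime (int p)" using p by auto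
  define a b c d where "a = M$1$1" and "b = M$1$2" and "c = M$2$1" and "d = M$2$2"
  have dt: "a * d - b * c = int p" using M by (simp add: det_2 a_def b_def c_def d_def)
  have Mm: "M = mat2 a b c d" by (simp add: mat_eq_iff_2 a_def b_def c_def d_def)
  show ?thesis
  proof (cases "int p dvd c \<and> int p dvd d")
    case True
    then obtain c' d' where cd: "c = int p * c'" "d = int p * d'" by (auto elim!: dvdE)
    have "int p * (a * d' - b * c') = int p * 1" using dt cd by (simp add: algebra_simps)
    then have "a * d' - b * c' = 1" using p0 mult_left_cancel by blast
    then have "mat2 a b c' d' \<in> SL2Z" by (simp add: SL2Z_iff)
    moreover have "M = mat2 1 0 0 (int p) ** mat2 a b c' d'" by (simp add: Mm mat_eq_iff_2 mat_mult_2 cd)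
    ultimately show ?thesis by (auto simp: hecke_right_def)
  next
    case False
    have "\<exists>j\<in>{0..<int p}. int p dvd a + j * c \<and> int p dvd b + j * d"
    proof (cases "int p dvd c")
      case nc: False
      then obtain j where j: "j \<in> {0..<int p}" "int p dvd a + j * c" using ex_dvd_linear[OF p] by blast
      have "c * (b + j * d) = d * (a + j * c) - int p" using dt by (simp add: algebra_simps)
      then have "int p dvd c * (b + j * d)" using j by simp
      then show ?thesis using j nc pp by (auto simp: prime_dvd_mult_iff)
    next
      case True
      then have nd: "\<not> int p dvd d" using False by blast
      then obtain j where j: "j \<in> {0..<int p}" "int p dvd b + j * d" using ex_dvd_linear[OF p] by blast
      have "d * (a + j * c) = c * (b + j * d) + int p" using dt by (simp add: algebra_simps)
      then have "int p dvd d * (a + j * c)" using j by simp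
      then show ?thesis using j nd pp by (auto simp: prime_dvd_mult_iff)
    qed
    then obtain j a' b' where j: "j \<in> {0..<int p}" and ab: "a + j * c = int p * a'" "b + j * d = int p * b'"
      by (auto elim!: dvdE)
    have a: "a = int p * a' - j * c" and b: "b = int p * b' - j * d" using ab by simp_all
    have "int p * (a' * d - b' * c) = int p * 1" using dt unfolding a b by (simp add: algebra_simps)
    then have "a' * d - b' * c = 1" using p0 mult_left_cancel by blast
    then have "mat2 a' b' c d \<in> SL2Z" by (simp add: SL2Z_iff)
    moreover have "M = mat2 (int p) (- j) 0 1 ** mat2 a' b' c d" by (simp add: Mm mat_eq_iff_2 mat_mult_2 a b)
    ultimately show ?thesis using j by (auto simp: hecke_right_def)
  qed
qed

text \<open>The bottom row of a matrix of determinant 1 cannot vanish modulo p. This separates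
  \<open>mat2 1 0 0 p\<close> from the other representatives and forces equal offsets among
  those.\<close>

lemma hecke_right_factor_unique:
  assumes p: "prime p" and A: "A \<in> hecke_right p" "B \<in> hecke_right p"
    and g: "\<gamma> \<in> SL2Z" "\<delta> \<in> SL2Z" and eq: "A ** \<gamma> = B ** \<delta>"
  shows "A = B \<and> \<gamma> = \<delta>"
proof -
  have p1: "int p > 1" using p prime_gt_1_nat by simp
  have e: "A$i$1 * \<gamma>$1$j + A$i$2 * \<gamma>$2$j = B$i$1 * \<delta>$1$j + B$i$2 * \<delta>$2$j" for i j
    using arg_cong[OF eq, of "\<lambda>M. M$i$j"] by (simp add: mat_mult_2)
  have no: False if "\<gamma> \<in> SL2Z" "int p dvd \<gamma>$2$1" "int p dvd \<gamma>$2$2" for \<gamma> :: "int^2^2"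
  proof -
    have "int p dvd \<gamma>$1$1 * \<gamma>$2$2 - \<gamma>$1$2 * \<gamma>$2$1" using that by simp
    moreover have "\<gamma>$1$1 * \<gamma>$2$2 - \<gamma>$1$2 * \<gamma>$2$1 = 1" using that(1) by (simp add: SL2Z_iff)
    ultimately have "int p dvd 1" by simp
    then show False using p1 by simp
  qed
  have AB: "A = B"
  proof (cases "A = mat2 1 0 0 (int p)")
    case True
    show ?thesis
    proof (rule ccontr)
      assume "A \<noteq> B"
      then obtain j where "B = mat2 (int p) (- j) 0 1" using A True by (auto simp: hecke_right_def)
      then have "int p dvd \<delta>$2$1" "int p dvd \<delta>$2$2" using e[of 2 1] e[of 2 2] True by (metis add_0 dvd_triv_left mat2_sel mult_1 mult_zero_left)+
      then show False using no g by blast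
    qed
  next
    case False
    then obtain i where i: "A = mat2 (int p) (- i) 0 1" "i \<in> {0..<int p}" using A by (auto simp: hecke_right_def)
    show ?thesis
    proof (cases "B = mat2 1 0 0 (int p)")
      case True
      then have "int p dvd \<gamma>$2$1" "int p dvd \<gamma>$2$2" using e[of 2 1] e[of 2 2] i by (metis add_0 dvd_triv_left mat2_sel mult_1 mult_zero_left)+
      then show ?thesis using no g by blast
    next
      case False
      then obtain j where j: "B = mat2 (int p) (- j) 0 1" "j \<in> {0..<int p}" using A by (auto simp: hecke_right_def)
      have r2: "\<gamma>$2$1 = \<delta>$2$1" "\<gamma>$2$2 = \<delta>$2$2" using e[of 2 1] e[of 2 2] i j by simp_all
      have "(i - j) * \<gamma>$2$1 = int p * (\<gamma>$1$1 - \<delta>$1$1)" "(i - j) * \<gamma>$2$2 = int p * (\<gamma>$1$2 - \<delta>$1$2)"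
        using e[of 1 1] e[of 1 2] i j r2 by (simp_all add: algebra_simps)
      then have "int p dvd (i - j) * \<gamma>$2$1" "int p dvd (i - j) * \<gamma>$2$2" by simp_all
      \<comment> \<open>Weighted with the top row of \<gamma>, the two multiples of i - j combine to
        (i - j) times det \<gamma> = 1.\<close>
      then have "int p dvd \<gamma>$1$1 * ((i - j) * \<gamma>$2$2) - \<gamma>$1$2 * ((i - j) * \<gamma>$2$1)" by simp
      also have "\<gamma>$1$1 * ((i - j) * \<gamma>$2$2) - \<gamma>$1$2 * ((i - j) * \<gamma>$2$1) = (i - j) * (\<gamma>$1$1 * \<gamma>$2$2 - \<gamma>$1$2 * \<gamma>$2$1)"
        by (simp add: algebra_simps)
      also have "\<dots> = i - j" using g by (simp add: SL2Z_iff)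
      finally have "int p dvd i - j" .
      then have "i mod int p = j mod int p" by (simp add: mod_eq_dvd_iff)
      then have "i = j" using i j by simp
      then show ?thesis using i j by simp
    qed
  qed
  have "adj2 A ** (A ** \<gamma>) = adj2 A ** (A ** \<delta>)" using eq AB by simp
  then have "mat (int p) ** \<gamma> = mat (int p) ** \<delta>"
    using mult_adj2(2)[of A] det_hecke(2)[OF A(1)] by (simp add: matrix_mul_assoc)
  then have "\<gamma> = \<delta>" using p1 by (simp add: mat_eq_iff_2 mat_mult_2 mat_def)
  then show ?thesis using AB by simp
qed

lemma bij_betw_hecke_right:
  assumes p: "prime p"
  shows "bij_betw (\<lambda>(A, \<gamma>). A ** \<gamma>) (hecke_right p \<times> SL2Z) (mats_of_det p)"
  unfolding bij_betw_def
proof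
  show "inj_on (\<lambda>(A, \<gamma>). A ** \<gamma>) (hecke_right p \<times> SL2Z)"
    using hecke_right_factor_unique[OF p] by (auto simp: inj_on_def)
  show "(\<lambda>(A, \<gamma>). A ** \<gamma>) ` (hecke_right p \<times> SL2Z) = mats_of_det p"
  proof (intro equalityI subsetI)
    fix M assume "M \<in> mats_of_det p"
    then show "M \<in> (\<lambda>(A, \<gamma>). A ** \<gamma>) ` (hecke_right p \<times> SL2Z)"
      using ex_hecke_right_factor[OF p] by (force simp: mats_of_det_def)
  qed (auto simp: mats_of_det_def det_mul det_hecke SL2Z_def)
qed

lemma bij_betw_adj2: "bij_betw adj2 (mats_of_det p) (mats_of_det p)" "bij_betw adj2 SL2Z SL2Z"
  "bij_betw adj2 (hecke_left p) (hecke_right p)"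
proof -
  show "bij_betw adj2 (mats_of_det p) (mats_of_det p)" "bij_betw adj2 SL2Z SL2Z"
    by (rule bij_betwI[of _ _ _ adj2]; auto simp: mats_of_det_def SL2Z_def)+
  show "bij_betw adj2 (hecke_left p) (hecke_right p)"
    unfolding bij_betw_def using adj2_hecke(1) by (auto intro: inj_on_inverseI[of _ adj2])
qed

lemma bij_betw_hecke_left:
  assumes p: "prime p"
  shows "bij_betw (\<lambda>(A, \<gamma>). \<gamma> ** A) (hecke_left p \<times> SL2Z) (mats_of_det p)"
proof -
  have "bij_betw (map_prod adj2 adj2) (hecke_left p \<times> SL2Z) (hecke_right p \<times> SL2Z)"
    by (intro bij_betw_map_prod bij_betw_adj2)
  from bij_betw_trans[OF bij_betw_trans[OF this bij_betw_hecke_right[OF p]] bij_betw_adj2(1)]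
  show ?thesis by (rule bij_betw_cong[THEN iffD1, rotated]) (auto simp: adj2_mult)
qed

lemma infsum_finite_times:
  fixes f :: "'a \<Rightarrow> 'b \<Rightarrow> complex"
  assumes "finite R" "\<And>a. a \<in> R \<Longrightarrow> (\<lambda>b. norm (f a b)) summable_on S"
  shows "(\<lambda>(a, b). norm (f a b)) summable_on (R \<times> S)"
    "(\<Sum>\<^sub>\<infinity>(a, b)\<in>R \<times> S. f a b) = (\<Sum>a\<in>R. \<Sum>\<^sub>\<infinity>b\<in>S. f a b)"
proof -
  show s: "(\<lambda>(a, b). norm (f a b)) summable_on (R \<times> S)"
    by (rule summable_on_SigmaI[where g = "\<lambda>a. \<Sum>\<^sub>\<infinity>b\<in>S. norm (f a b)"]) (use assms in auto)
  then have "(\<lambda>x. norm (case x of (a, b) \<Rightarrow> f a b)) summable_on (R \<times> S)"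
    by (simp add: case_prod_unfold)
  then have "(\<lambda>(a, b). f a b) summable_on (R \<times> S)" by (rule abs_summable_summable)
  from infsum_Sigma_banach[OF this] show "(\<Sum>\<^sub>\<infinity>(a, b)\<in>R \<times> S. f a b) = (\<Sum>a\<in>R. \<Sum>\<^sub>\<infinity>b\<in>S. f a b)"
    using assms(1) by simp
qed

text \<open>Both sides are the sum over all integral matrices of determinant \<open>p\<close>.\<close>

lemma sum_hecke_left_eq_right:
  fixes h :: "complex \<Rightarrow> complex"
  assumes p: "prime p" and z: "Im z > 0"
    and h: "\<And>w. Im w > 0 \<Longrightarrow> (\<lambda>\<gamma>. norm (h (moebius \<gamma> w))) summable_on SL2Z"
  shows "(\<Sum>A\<in>hecke_left p. \<Sum>\<^sub>\<infinity>\<gamma>\<in>SL2Z. h (moebius \<gamma> (moebius A z)))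
       = (\<Sum>A\<in>hecke_right p. \<Sum>\<^sub>\<infinity>\<gamma>\<in>SL2Z. h (moebius A (moebius \<gamma> z)))"
    and "A \<in> hecke_right p \<Longrightarrow> (\<lambda>\<gamma>. norm (h (moebius A (moebius \<gamma> z)))) summable_on SL2Z"
proof -
  have p0: "p > 0" using p prime_gt_0_nat by blast
  have zA: "Im (moebius A z) > 0" if "A \<in> hecke_left p" for A
    using that z p0 by (intro Im_moebius_pos) (simp_all add: det_hecke)
  have s: "(\<lambda>\<gamma>. norm (h (moebius \<gamma> (moebius A z)))) summable_on SL2Z" if "A \<in> hecke_left p" for A
    by (rule h[OF zA[OF that]])
  note L = infsum_finite_times[of "hecke_left p" "\<lambda>A \<gamma>. h (moebius \<gamma> (moebius A z))", OF finite_hecke(1) s]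
  have eL: "moebius \<gamma> (moebius A z) = moebius (\<gamma> ** A) z" if "A \<in> hecke_left p" for A \<gamma>
    using that z p0 by (subst moebius_mult) (auto simp: det_hecke)
  have eR: "moebius A (moebius \<gamma> z) = moebius (A ** \<gamma>) z" if "\<gamma> \<in> SL2Z" for A \<gamma>
    using that z by (subst moebius_mult) (auto simp: SL2Z_def)
  have sM: "(\<lambda>M. norm (h (moebius M z))) summable_on mats_of_det p"
    by (subst summable_on_reindex_bij_betw[OF bij_betw_hecke_left[OF p], symmetric])
      (rule summable_on_cong[THEN iffD1, OF _ L(1)], auto simp: eL)
  then have sR: "(\<lambda>x. norm (h (moebius (case x of (A, \<gamma>) \<Rightarrow> A ** \<gamma>) z))) summable_on (hecke_right p \<times> SL2Z)"
    by (subst (asm) summable_on_reindex_bij_betw[OF bij_betw_hecke_right[OF p], symmetric])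
  show sR': "(\<lambda>\<gamma>. norm (h (moebius A (moebius \<gamma> z)))) summable_on SL2Z" if "A \<in> hecke_right p" for A
  proof -
    have "(\<lambda>(A, \<gamma>). norm (h (moebius (A ** \<gamma>) z))) summable_on (hecke_right p \<times> SL2Z)"
      using sR by (simp add: case_prod_unfold)
    from summable_on_SigmaD1[OF this that] show ?thesis by (simp add: eR cong: summable_on_cong)
  qed
  note R = infsum_finite_times(2)[of "hecke_right p" "\<lambda>A \<gamma>. h (moebius A (moebius \<gamma> z))", OF finite_hecke(2) sR']
  have "(\<Sum>\<^sub>\<infinity>(A, \<gamma>)\<in>hecke_left p \<times> SL2Z. h (moebius \<gamma> (moebius A z))) = (\<Sum>\<^sub>\<infinity>M\<in>mats_of_det p. h (moebius M z))"
    by (subst infsum_reindex_bij_betw[OF bij_betw_hecke_left[OF p], symmetric]) (rule infsum_cong, auto simp: eL)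
  also have "\<dots> = (\<Sum>\<^sub>\<infinity>(A, \<gamma>)\<in>hecke_right p \<times> SL2Z. h (moebius A (moebius \<gamma> z)))"
    by (subst infsum_reindex_bij_betw[OF bij_betw_hecke_right[OF p], symmetric]) (rule infsum_cong, auto simp: eR)
  finally show "(\<Sum>A\<in>hecke_left p. \<Sum>\<^sub>\<infinity>\<gamma>\<in>SL2Z. h (moebius \<gamma> (moebius A z)))
       = (\<Sum>A\<in>hecke_right p. \<Sum>\<^sub>\<infinity>\<gamma>\<in>SL2Z. h (moebius A (moebius \<gamma> z)))"
    using L(2) R by simp
qed

section \<open>The Hecke relation for the series\<close>

text \<open>\<open>niebur_term 1\<close> at n z equals sqrt n times \<open>niebur_term n\<close> at
  z. This absorbs the prefactor sqrt n of the series and turns a change of n into a scaling of the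
  argument.\<close>

definition strip_term :: "nat \<Rightarrow> complex \<Rightarrow> complex \<Rightarrow> complex" where
  "strip_term n s z = (if in_strip z then niebur_term 1 s (of_nat n * z) else 0)"

lemma niebur_term_scale: "niebur_term 1 s (of_nat n * z) = of_real (sqrt (real n)) * niebur_term n s z"
  by (simp add: niebur_term_def real_sqrt_mult mult_ac)

lemma niebur_term_shift: "niebur_term 1 s (z + of_real t) = niebur_term 1 s z * cis (- 2 * pi * t)"
  by (simp add: niebur_term_def cis_mult algebra_simps)

lemma strip_term_eq: "strip_term n s (moebius \<gamma> z) = of_real (sqrt (real n)) * (if in_strip (moebius \<gamma> z) then niebur_term n s (moebius \<gamma> z) else 0)"
  by (auto simp: strip_term_def niebur_term_scale simp del: One_nat_def)

text \<open>The prefactor 2 pi sqrt n shrinks to pi: sqrt n sits inside \<open>strip_term\<close>,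
  and \<open>SL2Z\<close> counts every coset twice.\<close>

lemma poincare_F_strip:
  assumes z: "Im z > 0" and n: "n > 0" and s: "Re s > 1"
  shows "(\<lambda>\<gamma>. norm (strip_term n s (moebius \<gamma> z))) summable_on SL2Z"
    "poincare_F n z s = of_real pi * (\<Sum>\<^sub>\<infinity>\<gamma>\<in>SL2Z. strip_term n s (moebius \<gamma> z))"
proof -
  note c = infsum_Gamma_inf_cosets(1)[of "niebur_term n s", OF niebur_term_periodic z summable_niebur_orbit[OF z n s]]
  note st = has_sum_strip[of "niebur_term n s", OF niebur_term_periodic z c]
  show "(\<lambda>\<gamma>. norm (strip_term n s (moebius \<gamma> z))) summable_on SL2Z"
    unfolding strip_term_eq norm_mult by (intro summable_on_cmult_right st(1))
  show "poincare_F n z s = of_real pi * (\<Sum>\<^sub>\<infinity>\<gamma>\<in>SL2Z. strip_term n s (moebius \<gamma> z))"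
    unfolding strip_term_eq infsum_cmult_right' st(2)
    by (simp add: poincare_F_def Let_def niebur_term_def[of n s])
qed

text \<open>Exactly one integer j moves v into the strip, the floor of Re v, and it lies in the
  range iff 0 \<le> Re v < p. The two claims are the cases v = p w and v = w.\<close>

lemma strip_scaling:
  assumes p: "p > 0"
  shows "(\<Sum>j\<in>{0..<int p}. if in_strip (of_nat p * w - of_int j) then x else 0) = (if in_strip w then x else (0::complex))"
    and "(\<Sum>j\<in>{0..<int p}. if in_strip (w - of_int j) then x else 0) = (if in_strip (w / of_nat p) then x else (0::complex))"
proof -
  have g: "(\<Sum>j\<in>{0..<int p}. if in_strip (v - of_int j) then x else 0) = (if 0 \<le> Re v \<and> Re v < real p then x else 0)" for v
  proof -
    have "in_strip (v - of_int j) \<longleftrightarrow> j = \<lfloor>Re v\<rfloor>" for j by (auto simp: in_strip_def) linarith+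
    then have "(\<Sum>j\<in>{0..<int p}. if in_strip (v - of_int j) then x else 0) = (if \<lfloor>Re v\<rfloor> \<in> {0..<int p} then x else 0)"
      by simp
    also have "\<lfloor>Re v\<rfloor> \<in> {0..<int p} \<longleftrightarrow> 0 \<le> Re v \<and> Re v < real p" by (auto simp: floor_less_iff)
    finally show ?thesis .
  qed
  show "(\<Sum>j\<in>{0..<int p}. if in_strip (of_nat p * w - of_int j) then x else 0) = (if in_strip w then x else (0::complex))"
    unfolding g using p by (simp add: in_strip_def zero_le_mult_iff)
  show "(\<Sum>j\<in>{0..<int p}. if in_strip (w - of_int j) then x else 0) = (if in_strip (w / of_nat p) then x else (0::complex))"
    unfolding g using p by (simp add: in_strip_def zero_le_divide_iff divide_less_eq)
qed

lemma sum_hecke_right: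
  assumes "p > 1"
  shows "(\<Sum>A\<in>hecke_right p. f A) = f (mat2 1 0 0 (int p)) + (\<Sum>j\<in>{0..<int p}. f (mat2 (int p) (- j) 0 1))"
proof -
  have "mat2 1 0 0 (int p) \<notin> (\<lambda>b. mat2 (int p) (- b) 0 1) ` {0..<int p}"
    using assms by (auto simp: mat_eq_iff_2)
  moreover have "inj_on (\<lambda>b. mat2 (int p) (- b) 0 1) {0..<int p}"
    by (auto simp: inj_on_def mat_eq_iff_2)
  ultimately show ?thesis by (simp add: hecke_right_def sum.reindex)
qed

text \<open>The translates p w - j reassemble into the series of index p n, since n (p w - j) and p
  n w differ by an integer. The translate w / p covers p unit strips; moving each back to the first
  one gives the phase e(-n j/p), and these phases sum to p or to 0.\<close>

theorem poincare_F_hecke: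
  assumes p: "prime p" and n: "n > 0" and z: "Im z > 0" and s: "Re s > 1"
  shows "(\<Sum>A\<in>hecke_left p. poincare_F n (moebius A z) s)
    = poincare_F (p * n) z s + (if p dvd n then of_nat p * poincare_F (n div p) z s else 0)"
proof -
  have p1: "p > 1" and p0: "p > 0" using p prime_gt_1_nat prime_gt_0_nat by blast+
  let ?h = "strip_term n s"
  note hs = poincare_F_strip(1)[OF _ n s]
  have zA: "Im (moebius A z) > 0" if "A \<in> hecke_left p" for A
    using that z p0 by (intro Im_moebius_pos) (simp_all add: det_hecke)
  have zg: "Im (moebius \<gamma> z) > 0" if "\<gamma> \<in> SL2Z" for \<gamma> using Im_moebius_SL2Z[OF z that] .
  let ?D = "mat2 1 0 0 (int p)" and ?A = "\<lambda>j. mat2 (int p) (- j) 0 1"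
  have m0: "moebius ?D w = w / of_nat p" for w by (simp add: moebius_def)
  have mj: "moebius (?A j) w = of_nat p * w - of_int j" for w j by (simp add: moebius_def)
  have "(\<Sum>A\<in>hecke_left p. poincare_F n (moebius A z) s)
     = of_real pi * (\<Sum>A\<in>hecke_left p. \<Sum>\<^sub>\<infinity>\<gamma>\<in>SL2Z. ?h (moebius \<gamma> (moebius A z)))"
    unfolding sum_distrib_left by (intro sum.cong refl poincare_F_strip(2) zA n s)
  also have "(\<Sum>A\<in>hecke_left p. \<Sum>\<^sub>\<infinity>\<gamma>\<in>SL2Z. ?h (moebius \<gamma> (moebius A z)))
     = (\<Sum>A\<in>hecke_right p. \<Sum>\<^sub>\<infinity>\<gamma>\<in>SL2Z. ?h (moebius A (moebius \<gamma> z)))"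
    by (rule sum_hecke_left_eq_right(1)[OF p z hs])
  also have "\<dots> = (\<Sum>\<^sub>\<infinity>\<gamma>\<in>SL2Z. ?h (moebius ?D (moebius \<gamma> z))) + (\<Sum>j\<in>{0..<int p}. \<Sum>\<^sub>\<infinity>\<gamma>\<in>SL2Z. ?h (moebius (?A j) (moebius \<gamma> z)))"
    using sum_hecke_right[OF p1] by blast
  also have "(\<Sum>j\<in>{0..<int p}. \<Sum>\<^sub>\<infinity>\<gamma>\<in>SL2Z. ?h (moebius (?A j) (moebius \<gamma> z)))
     = (\<Sum>\<^sub>\<infinity>\<gamma>\<in>SL2Z. \<Sum>j\<in>{0..<int p}. ?h (moebius (?A j) (moebius \<gamma> z)))"
  proof -
    have sj: "(\<lambda>\<gamma>. ?h (moebius (?A j) (moebius \<gamma> z))) summable_on SL2Z" if "j \<in> {0..<int p}" for j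
      by (rule abs_summable_summable[OF sum_hecke_left_eq_right(2)[OF p z hs]]) (use that in \<open>auto simp: hecke_right_def\<close>)
    show ?thesis
      by (rule infsum_sum_finite[THEN conjunct2, symmetric]) (use sj in simp_all)
  qed
  also have "\<dots> = (\<Sum>\<^sub>\<infinity>\<gamma>\<in>SL2Z. strip_term (p * n) s (moebius \<gamma> z))"
  proof (rule infsum_cong)
    fix \<gamma>
    define w where "w = moebius \<gamma> z"
    have "?h (moebius (?A j) w) = (if in_strip (of_nat p * w - of_int j) then niebur_term 1 s (of_nat (p * n) * w) else 0)" for j
      using niebur_term_periodic[of 1 s "of_nat (p * n) * w" "- int n * j"]
      by (simp add: strip_term_def mj algebra_simps)
    then show "(\<Sum>j\<in>{0..<int p}. ?h (moebius (?A j) (moebius \<gamma> z))) = strip_term (p * n) s (moebius \<gamma> z)"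
      unfolding w_def[symmetric] by (simp only: strip_scaling(1)[OF p0]) (simp add: strip_term_def)
  qed
  also have "(\<Sum>\<^sub>\<infinity>\<gamma>\<in>SL2Z. ?h (moebius ?D (moebius \<gamma> z)))
     = (if p dvd n then of_nat p * (\<Sum>\<^sub>\<infinity>\<gamma>\<in>SL2Z. strip_term (n div p) s (moebius \<gamma> z)) else 0)"
  proof -
    define k where "k j w = (if in_strip (w - of_int j) then niebur_term 1 s (of_nat n * (w / of_nat p)) else 0)" for j w
    have hk: "?h (moebius ?D w) = (\<Sum>j\<in>{0..<int p}. k j w)" for w
      unfolding k_def strip_scaling(2)[OF p0] by (simp add: strip_term_def m0)
    have sk: "(\<lambda>\<gamma>. k j (moebius \<gamma> z)) summable_on SL2Z" if j: "j \<in> {0..<int p}" for j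
    proof (rule abs_summable_summable, rule summable_on_comparison_test)
      show "(\<lambda>\<gamma>. norm (?h (moebius ?D (moebius \<gamma> z)))) summable_on SL2Z"
        by (rule sum_hecke_left_eq_right(2)[OF p z hs]) (auto simp: hecke_right_def)
      show "norm (k j (moebius \<gamma> z)) \<le> norm (?h (moebius ?D (moebius \<gamma> z)))" for \<gamma>
      proof -
        have "in_strip (moebius \<gamma> z / of_nat p)" if "in_strip (moebius \<gamma> z - of_int j)"
        proof -
          have "j + 1 \<le> int p" "0 \<le> real_of_int j" using j by simp_all
          then have "real_of_int (j + 1) \<le> real_of_int (int p)" "0 \<le> real_of_int j" by (simp_all only: of_int_le_iff)
          then have "0 \<le> real_of_int j" "real_of_int j + 1 \<le> real p" by simp_all
          then show ?thesis using that p0 by (auto simp: in_strip_def field_simps)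
        qed
        then show ?thesis by (simp add: k_def strip_term_def m0)
      qed
    qed simp
    \<comment> \<open>Translation by j lies in \<open>SL2Z\<close>, so reindexing moves the j-th
      unit strip to the first at the cost of a phase.\<close>
    have kj: "(\<Sum>\<^sub>\<infinity>\<gamma>\<in>SL2Z. k j (moebius \<gamma> z)) = (\<Sum>\<^sub>\<infinity>\<gamma>\<in>SL2Z. k 0 (moebius \<gamma> z)) * cis (- 2 * pi * (real n * of_int j / real p))" for j
    proof -
      let ?T = "mat2 1 j 0 1"
      have T: "?T \<in> SL2Z" by (simp add: SL2Z_iff)
      have "(\<Sum>\<^sub>\<infinity>\<gamma>\<in>SL2Z. k j (moebius \<gamma> z)) = (\<Sum>\<^sub>\<infinity>\<gamma>\<in>SL2Z. k j (moebius (?T ** \<gamma>) z))"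
        by (rule infsum_reindex_bij_betw[OF bij_betw_SL2Z_left[OF T], symmetric])
      also have "\<dots> = (\<Sum>\<^sub>\<infinity>\<gamma>\<in>SL2Z. k 0 (moebius \<gamma> z) * cis (- 2 * pi * (real n * of_int j / real p)))"
      proof (rule infsum_cong)
        fix \<gamma> assume "\<gamma> \<in> SL2Z"
        then have "moebius (?T ** \<gamma>) z = moebius \<gamma> z + of_int j"
          using z by (subst moebius_mult) (auto simp: SL2Z_def moebius_def[of ?T])
        moreover have "of_nat n * ((w + of_int j) / of_nat p) = of_nat n * (w / of_nat p) + of_real (real n * of_int j / real p)" for w :: complex
          by (simp add: field_simps add_divide_distrib)
        ultimately show "k j (moebius (?T ** \<gamma>) z) = k 0 (moebius \<gamma> z) * cis (- 2 * pi * (real n * of_int j / real p))"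
          by (simp only: k_def niebur_term_shift) simp
      qed
      finally show ?thesis by (simp add: infsum_cmult_left')
    qed
    have cs: "(\<Sum>j\<in>{0..<int p}. cis (- 2 * pi * (real n * of_int j / real p))) = (if p dvd n then of_nat p else 0)"
    proof -
      have "cis (- 2 * pi * (real n * of_int j / real p)) = e_mod p (j * (- int n))" for j
        by (simp add: e_mod_def mult_ac)
      then show ?thesis using e_mod_orthogonality[OF p0, of "- int n"] by (simp only:) simp
    qed
    have "(\<Sum>\<^sub>\<infinity>\<gamma>\<in>SL2Z. ?h (moebius ?D (moebius \<gamma> z))) = (\<Sum>j\<in>{0..<int p}. \<Sum>\<^sub>\<infinity>\<gamma>\<in>SL2Z. k j (moebius \<gamma> z))"
      unfolding hk by (intro infsum_sum_finite[THEN conjunct2] sk) auto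
    also have "\<dots> = (\<Sum>\<^sub>\<infinity>\<gamma>\<in>SL2Z. k 0 (moebius \<gamma> z)) * (if p dvd n then of_nat p else 0)"
      unfolding cs[symmetric] sum_distrib_left by (intro sum.cong refl kj)
    also have "\<dots> = (if p dvd n then of_nat p * (\<Sum>\<^sub>\<infinity>\<gamma>\<in>SL2Z. strip_term (n div p) s (moebius \<gamma> z)) else 0)"
    proof (cases "p dvd n")
      case True
      have "k 0 w = strip_term (n div p) s w" for w
        using True p0 by (auto simp: k_def strip_term_def elim!: dvdE)
      then show ?thesis using True by simp
    qed simp
    finally show ?thesis .
  qed
  finally have "(\<Sum>A\<in>hecke_left p. poincare_F n (moebius A z) s) = of_real pi *
     ((if p dvd n then of_nat p * (\<Sum>\<^sub>\<infinity>\<gamma>\<in>SL2Z. strip_term (n div p) s (moebius \<gamma> z)) else 0)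
       + (\<Sum>\<^sub>\<infinity>\<gamma>\<in>SL2Z. strip_term (p * n) s (moebius \<gamma> z)))" .
  moreover have "poincare_F (p * n) z s = of_real pi * (\<Sum>\<^sub>\<infinity>\<gamma>\<in>SL2Z. strip_term (p * n) s (moebius \<gamma> z))"
    using n p0 by (intro poincare_F_strip(2) z s) auto
  moreover have "poincare_F (n div p) z s = of_real pi * (\<Sum>\<^sub>\<infinity>\<gamma>\<in>SL2Z. strip_term (n div p) s (moebius \<gamma> z))" if "p dvd n"
    using n p0 that by (intro poincare_F_strip(2) z s) (auto elim!: dvdE)
  ultimately show ?thesis by (simp add: algebra_simps)
qed

section \<open>The sesquiharmonic functions\<close>

text \<open>A relation that is linear in the pair (F, D). Identities between series on Re s > 1 pass
  through it to \<open>J1\<close>, whichever continuation \<open>SOME\<close> selects; the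
  coefficient of s - 1 is the derivative at 1.\<close>

definition continuation_deriv :: "(complex \<Rightarrow> complex) \<Rightarrow> complex \<Rightarrow> bool" where
  "continuation_deriv F D \<longleftrightarrow> (\<exists>G. continues_to_1 F G \<and> deriv G 1 = D)"

text \<open>Every domain of continuation is shrunk to a half-plane together with a disc. Two such
  domains intersect in one of the same shape, hence connected, whereas arbitrary connected domains
  may intersect badly.\<close>

lemma continues_to_1_ballD:
  assumes "continues_to_1 F G"
  obtains r where "r > 0" "G holomorphic_on ({s. Re s > 1} \<union> ball 1 r)" "\<And>s. Re s > 1 \<Longrightarrow> G s = F s"
proof -
  obtain U where U: "open U" "{s. Re s > 1} \<subseteq> U" "1 \<in> U" "G holomorphic_on U" "\<forall>s. Re s > 1 \<longrightarrow> G s = F s"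
    using assms by (auto simp: continues_to_1_def)
  obtain r where "r > 0" "ball 1 r \<subseteq> U" using U open_contains_ball by blast
  then show ?thesis using U that[of r] holomorphic_on_subset[of G U "{s. Re s > 1} \<union> ball 1 r"] by auto
qed

lemma half_step_mem:
  assumes r: "r > 0"
  shows "of_real (1 + r / 2) \<in> {s. Re s > 1} \<inter> ball (1 :: complex) r"
proof -
  have e: "1 - of_real (1 + r / 2) = (of_real (- (r / 2)) :: complex)" by simp
  have "dist (1 :: complex) (of_real (1 + r / 2)) = r / 2"
    unfolding dist_norm e norm_of_real using r by simp
  then show ?thesis using r by simp
qed

lemma continues_to_1_ballI:
  assumes r: "r > 0" and "G holomorphic_on ({s. Re s > 1} \<union> ball 1 r)" "\<And>s. Re s > 1 \<Longrightarrow> G s = F s"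
  shows "continues_to_1 F G"
  unfolding continues_to_1_def
proof (intro exI[of _ "{s. Re s > 1} \<union> ball 1 r"] conjI)
  have "of_real (1 + r / 2) \<in> {s. Re s > 1} \<inter> ball (1 :: complex) r"
    by (rule half_step_mem[OF r])
  then show "connected ({s. Re s > 1} \<union> ball (1 :: complex) r)"
    by (intro connected_Un convex_connected convex_halfspace_Re_gt convex_ball) blast
qed (use assms in \<open>auto intro: open_halfspace_Re_gt\<close>)

lemma holomorphic_deriv_at:
  assumes "r > 0" "G holomorphic_on ({s. Re s > 1} \<union> ball 1 r)"
  shows "G field_differentiable at 1"
  using assms holomorphic_on_imp_differentiable_at[of G "ball 1 r" 1] holomorphic_on_subset[of G _ "ball 1 r"] by auto

text \<open>Identity theorem on a disc around 1, starting from the part of the disc with Re s >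
  1.\<close>

lemma continues_to_1_deriv_unique:
  assumes "continues_to_1 F G" "continues_to_1 F' H" "\<And>s. Re s > 1 \<Longrightarrow> F s = F' s"
  shows "deriv G 1 = deriv H 1"
proof -
  obtain r1 where r1: "r1 > 0" "G holomorphic_on ({s. Re s > 1} \<union> ball 1 r1)" "\<And>s. Re s > 1 \<Longrightarrow> G s = F s"
    using continues_to_1_ballD[OF assms(1)] by blast
  obtain r2 where r2: "r2 > 0" "H holomorphic_on ({s. Re s > 1} \<union> ball 1 r2)" "\<And>s. Re s > 1 \<Longrightarrow> H s = F' s"
    using continues_to_1_ballD[OF assms(2)] by blast
  define r where "r = min r1 r2"
  have r: "r > 0" using r1 r2 by (simp add: r_def)
  have eq: "G s = H s" if "s \<in> ball 1 r" for s
  proof (rule analytic_continuation_open[of "{s. Re s > 1} \<inter> ball 1 r" "ball 1 r" G H])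
    show "open ({s. Re s > 1} \<inter> ball (1::complex) r)" by (intro open_Int open_halfspace_Re_gt open_ball)
    have "of_real (1 + r / 2) \<in> {s. Re s > 1} \<inter> ball (1 :: complex) r"
      by (rule half_step_mem[OF r])
    then show "{s. Re s > 1} \<inter> ball (1::complex) r \<noteq> {}" by blast
    show "G holomorphic_on ball 1 r" "H holomorphic_on ball 1 r"
      by (rule holomorphic_on_subset[OF r1(2)] holomorphic_on_subset[OF r2(2)]; force simp: r_def)+
  qed (use that r1 r2 assms(3) in auto)
  have "eventually (\<lambda>s. G s = H s) (nhds 1)"
    using r eq eventually_nhds_in_open[of "ball 1 r" 1] by (auto elim: eventually_mono)
  then show ?thesis by (intro deriv_cong_ev refl)
qed

lemma continuation_deriv_unique:
  "continuation_deriv F D \<Longrightarrow> continuation_deriv F' D' \<Longrightarrow> (\<And>s. Re s > 1 \<Longrightarrow> F s = F' s) \<Longrightarrow> D = D'"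
  unfolding continuation_deriv_def using continues_to_1_deriv_unique by blast

lemma continuation_deriv_cong:
  "continuation_deriv F D \<Longrightarrow> (\<And>s. Re s > 1 \<Longrightarrow> F s = F' s) \<Longrightarrow> continuation_deriv F' D"
  unfolding continuation_deriv_def continues_to_1_def by metis

lemma continuation_deriv_add:
  assumes "continuation_deriv F D" "continuation_deriv F' D'"
  shows "continuation_deriv (\<lambda>s. F s + F' s) (D + D')"
proof -
  obtain G H where G: "continues_to_1 F G" "deriv G 1 = D" and H: "continues_to_1 F' H" "deriv H 1 = D'"
    using assms by (auto simp: continuation_deriv_def)
  obtain r1 where r1: "r1 > 0" "G holomorphic_on ({s. Re s > 1} \<union> ball 1 r1)" "\<And>s. Re s > 1 \<Longrightarrow> G s = F s"
    using continues_to_1_ballD[OF G(1)] by blast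
  obtain r2 where r2: "r2 > 0" "H holomorphic_on ({s. Re s > 1} \<union> ball 1 r2)" "\<And>s. Re s > 1 \<Longrightarrow> H s = F' s"
    using continues_to_1_ballD[OF H(1)] by blast
  define r where "r = min r1 r2"
  have sub: "{s. Re s > 1} \<union> ball 1 r \<subseteq> {s. Re s > 1} \<union> ball 1 r1" "{s. Re s > 1} \<union> ball 1 r \<subseteq> {s. Re s > 1} \<union> ball 1 r2"
    by (auto simp: r_def)
  have "continues_to_1 (\<lambda>s. F s + F' s) (\<lambda>s. G s + H s)"
    by (rule continues_to_1_ballI[of r])
      (use r1 r2 in \<open>auto simp: r_def intro!: holomorphic_on_add holomorphic_on_subset[OF r1(2)] holomorphic_on_subset[OF r2(2)]\<close>)
  moreover have "deriv (\<lambda>s. G s + H s) 1 = D + D'"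
    using G H holomorphic_deriv_at[OF r1(1,2)] holomorphic_deriv_at[OF r2(1,2)] by (simp add: deriv_add)
  ultimately show ?thesis by (auto simp: continuation_deriv_def)
qed

lemma continuation_deriv_cmult:
  assumes "continuation_deriv F D"
  shows "continuation_deriv (\<lambda>s. k * F s) (k * D)"
proof -
  obtain G where G: "continues_to_1 F G" "deriv G 1 = D"
    using assms by (auto simp: continuation_deriv_def)
  obtain r1 where r1: "r1 > 0" "G holomorphic_on ({s. Re s > 1} \<union> ball 1 r1)" "\<And>s. Re s > 1 \<Longrightarrow> G s = F s"
    using continues_to_1_ballD[OF G(1)] by blast
  have "continues_to_1 (\<lambda>s. k * F s) (\<lambda>s. k * G s)"
    by (rule continues_to_1_ballI[of r1]) (use r1 in \<open>auto intro!: holomorphic_intros\<close>)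
  moreover have "deriv (\<lambda>s. k * G s) 1 = k * D"
    using G holomorphic_deriv_at[OF r1(1,2)] by (simp add: deriv_cmult)
  ultimately show ?thesis by (auto simp: continuation_deriv_def)
qed

lemma continuation_deriv_0: "continuation_deriv (\<lambda>s. 0) 0"
proof -
  have "continues_to_1 (\<lambda>s. 0) (\<lambda>s. 0)" by (rule continues_to_1_ballI[of 1]) auto
  then show ?thesis by (auto simp: continuation_deriv_def)
qed

lemma continuation_deriv_sum:
  "finite A \<Longrightarrow> (\<And>a. a \<in> A \<Longrightarrow> continuation_deriv (F a) (D a)) \<Longrightarrow>
     continuation_deriv (\<lambda>s. \<Sum>a\<in>A. F a s) (\<Sum>a\<in>A. D a)"
  by (induction A rule: finite_induct) (auto intro: continuation_deriv_0 continuation_deriv_add)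

lemma continuation_deriv_J1:
  assumes "continues_to_1 (poincare_F n \<tau>) G"
  shows "continuation_deriv (poincare_F n \<tau>) (J1 n \<tau>)"
  unfolding continuation_deriv_def
proof (intro exI conjI)
  show "continues_to_1 (poincare_F n \<tau>) (SOME G. continues_to_1 (poincare_F n \<tau>) G)"
    using assms by (rule someI[of "continues_to_1 (poincare_F n \<tau>)"])
qed (simp add: J1_def fps_expansion_def)

text \<open>Strong induction on n: for n = p k the Hecke relation is solved for the series of index
  p k. The remaining series have smaller index but are taken at translated points, so \<tau> must
  vary in the induction.\<close>

theorem poincare_F_continuation_deriv:
  assumes "n > 0" "Im \<tau> > 0"
  shows "continuation_deriv (poincare_F n \<tau>) (J1 n \<tau>)"
  using assms
proof (induction n arbitrary: \<tau> rule: less_induct)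
  case (less n)
  show ?case
  proof (cases "n = 1")
    case True
    then show ?thesis using poincare_F_1_continues[OF less.prems(2)] continuation_deriv_J1 by blast
  next
    case False
    then obtain p where p: "prime p" "p dvd n" using prime_factor_nat by blast
    then obtain k where k: "n = p * k" by (auto elim: dvdE)
    have kn: "k > 0" "k < n" using k less.prems p prime_gt_1_nat[of p] by auto
    have p0: "p > 0" using p prime_gt_0_nat by blast
    let ?D = "(\<Sum>A\<in>hecke_left p. J1 k (moebius A \<tau>)) + (-1) * (if p dvd k then of_nat p * J1 (k div p) \<tau> else 0)"
    have "continuation_deriv (\<lambda>s. (\<Sum>A\<in>hecke_left p. poincare_F k (moebius A \<tau>) s)
      + (-1) * (if p dvd k then of_nat p * poincare_F (k div p) \<tau> s else 0)) ?D"
    proof (intro continuation_deriv_add continuation_deriv_sum continuation_deriv_cmult)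
      fix A assume "A \<in> hecke_left p"
      then have "Im (moebius A \<tau>) > 0" using less.prems p0 by (intro Im_moebius_pos) (simp_all add: det_hecke)
      then show "continuation_deriv (poincare_F k (moebius A \<tau>)) (J1 k (moebius A \<tau>))"
        using less.IH kn by blast
    next
      show "continuation_deriv (\<lambda>s. if p dvd k then of_nat p * poincare_F (k div p) \<tau> s else 0)
          (if p dvd k then of_nat p * J1 (k div p) \<tau> else 0)"
      proof (cases "p dvd k")
        case True
        then have "k div p > 0" using kn by (auto elim!: dvdE)
        moreover have "k div p < n" using div_le_dividend[of k p] kn by linarith
        ultimately have "k div p > 0" "k div p < n" by simp_all
        then show ?thesis using True less by (auto intro: continuation_deriv_cmult)
      qed (simp add: continuation_deriv_0)
    qed simp
    then have "continuation_deriv (poincare_F n \<tau>) ?D"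
      by (rule continuation_deriv_cong)
        (use poincare_F_hecke[OF p(1) kn(1) less.prems(2)] in \<open>simp add: k\<close>)
    then show ?thesis using continuation_deriv_J1 by (auto simp: continuation_deriv_def)
  qed
qed

theorem J1_hecke:
  assumes p: "prime p" and n: "n > 0" and z: "Im z > 0"
  shows "(\<Sum>A\<in>hecke_left p. J1 n (moebius A z)) = J1 (p * n) z + (if p dvd n then of_nat p * J1 (n div p) z else 0)"
proof -
  have p0: "p > 0" using p prime_gt_0_nat by blast
  have 1: "continuation_deriv (\<lambda>s. \<Sum>A\<in>hecke_left p. poincare_F n (moebius A z) s) (\<Sum>A\<in>hecke_left p. J1 n (moebius A z))"
    using n z p0 by (intro continuation_deriv_sum poincare_F_continuation_deriv Im_moebius_pos) (simp_all add: det_hecke)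
  have 2: "continuation_deriv (\<lambda>s. if p dvd n then of_nat p * poincare_F (n div p) z s else 0)
          (if p dvd n then of_nat p * J1 (n div p) z else 0)"
  proof (cases "p dvd n")
    case True
    then have "n div p > 0" using n by (auto elim!: dvdE)
    then show ?thesis using True z by (auto intro: continuation_deriv_cmult poincare_F_continuation_deriv)
  qed (simp add: continuation_deriv_0)
  have "p * n > 0" using p0 n by simp
  from continuation_deriv_add[OF poincare_F_continuation_deriv[OF this z] 2]
  show ?thesis by (rule continuation_deriv_unique[OF 1]) (rule poincare_F_hecke[OF p n z])
qed

theorem J1_invariant:
  assumes n: "n > 0" and z: "Im z > 0" and A: "A \<in> SL2Z"
  shows "J1 n (moebius A z) = J1 n z"
proof (rule continuation_deriv_unique)
  have zA: "Im (moebius A z) > 0" using Im_moebius_SL2Z z A by blast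
  show "continuation_deriv (poincare_F n (moebius A z)) (J1 n (moebius A z))" "continuation_deriv (poincare_F n z) (J1 n z)"
    using n z zA by (auto intro: poincare_F_continuation_deriv)
  fix s :: complex assume s: "Re s > 1"
  have "(\<Sum>\<^sub>\<infinity>\<gamma>\<in>SL2Z. strip_term n s (moebius \<gamma> (moebius A z))) = (\<Sum>\<^sub>\<infinity>\<gamma>\<in>SL2Z. strip_term n s (moebius (\<gamma> ** A) z))"
    using z A by (intro infsum_cong) (simp add: moebius_mult SL2Z_def)
  also have "\<dots> = (\<Sum>\<^sub>\<infinity>\<gamma>\<in>SL2Z. strip_term n s (moebius \<gamma> z))"
    by (rule infsum_reindex_bij_betw[OF bij_betw_SL2Z_right[OF A]])
  finally show "poincare_F n (moebius A z) s = poincare_F n z s"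
    using poincare_F_strip(2)[OF _ n s] z zA by simp
qed

section \<open>The Kronecker symbol\<close>

lemma positive_prime_induct [consumes 1, case_names one prime_mult]:
  fixes x :: int
  assumes "x > 0" "P 1" "\<And>p x. prime p \<Longrightarrow> x > 0 \<Longrightarrow> P x \<Longrightarrow> P (p * x)"
  shows "P x"
proof -
  have "x > 0 \<longrightarrow> P x"
  proof (induction x rule: prime_divisors_induct)
    case (unit x)
    then show ?case using assms(2) by (auto simp: zdvd1_eq)
  next
    case (factor p x)
    then show ?case using assms(3)[of p x] prime_gt_0_int[of p] by (auto simp: zero_less_mult_iff)
  qed simp
  then show ?thesis using assms(1) by simp
qed

lemma Legendre_cong: "[a = b] (mod p) \<Longrightarrow> Legendre a p = Legendre b p"
  by (simp add: Legendre_def QuadRes_def cong_def)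

lemma Legendre_range: "Legendre a p \<in> {-1, 0, 1}"
  by (simp add: Legendre_def)

lemma small_cong_eq:
  fixes p x y :: int
  assumes "p > 2" "x \<in> {-1, 0, 1}" "y \<in> {-1, 0, 1}" "[x = y] (mod p)"
  shows "x = y"
proof (rule ccontr)
  assume "x \<noteq> y"
  have "p dvd x - y" using assms by (simp add: cong_iff_dvd_diff)
  then have "\<bar>p\<bar> \<le> \<bar>x - y\<bar>" using \<open>x \<noteq> y\<close> by (intro dvd_imp_le_int) auto
  then show False using assms by auto
qed

lemma Legendre_euler:
  fixes p :: int
  assumes "prime p" "p > 2"
  shows "[Legendre a p = a ^ ((nat p - 1) div 2)] (mod p)"
  using euler_criterion[of "nat p" a] assms by simp

lemma Legendre_mult:
  fixes p :: int
  assumes p: "prime p" "p > 2"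
  shows "Legendre (a * b) p = Legendre a p * Legendre b p"
proof (rule small_cong_eq[OF p(2)])
  have "[Legendre a p * Legendre b p = a ^ ((nat p - 1) div 2) * b ^ ((nat p - 1) div 2)] (mod p)"
    by (intro cong_mult Legendre_euler p)
  then show "[Legendre (a * b) p = Legendre a p * Legendre b p] (mod p)"
    using Legendre_euler[OF p, of "a * b"] by (metis cong_sym cong_trans power_mult_distrib)
qed (use Legendre_range[of a p] Legendre_range[of b p] Legendre_range[of "a * b" p] in auto)

lemma Legendre_eq_0_iff: "Legendre a p = 0 \<longleftrightarrow> p dvd a"
  by (auto simp: Legendre_def cong_0_iff)

lemma Legendre_square: "\<not> p dvd x \<Longrightarrow> prime p \<Longrightarrow> Legendre (x^2) p = 1" for p :: int
  by (auto simp: Legendre_def QuadRes_def cong_0_iff prime_dvd_power_iff intro: exI[of _ x])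

lemma odd_prime_gt_2: "prime p \<Longrightarrow> odd p \<Longrightarrow> p > 2" for p :: int
  using prime_ge_2_int[of p] by (cases "p = 2") auto

lemma prime_odd_iff: "prime p \<Longrightarrow> odd p \<longleftrightarrow> p \<noteq> 2" for p :: int
  using primes_dvd_imp_eq[of 2 p] by auto

lemma kronecker_prime_2: "kronecker_prime a 2 = (if even a then 0 else if a mod 8 = 1 \<or> a mod 8 = 7 then 1 else - 1)"
  by (simp add: kronecker_prime_def)

lemma odd_mod_8: "odd a \<Longrightarrow> a mod 8 = 1 \<or> a mod 8 = 3 \<or> a mod 8 = 5 \<or> a mod 8 = 7" for a :: int
  by presburger

lemma odd_mod_4: "odd a \<Longrightarrow> a mod 4 = 1 \<or> a mod 4 = 3" for a :: int
  by presburger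

lemma kronecker_prime_2_mult: "kronecker_prime (a * b) 2 = kronecker_prime a 2 * kronecker_prime b 2"
proof (cases "odd a \<and> odd b")
  case True
  define x y where "x = a mod 8" and "y = b mod 8"
  have "(a * b) mod 8 = (x * y) mod 8" unfolding x_def y_def by (simp only: mod_mult_eq)
  moreover have "x = 1 \<or> x = 3 \<or> x = 5 \<or> x = 7" "y = 1 \<or> y = 3 \<or> y = 5 \<or> y = 7"
    using odd_mod_8[of a] odd_mod_8[of b] True by (simp_all add: x_def y_def)
  ultimately show ?thesis using True by (auto simp: kronecker_prime_2 x_def[symmetric] y_def[symmetric])
qed (auto simp: kronecker_prime_2)

section \<open>Reciprocity for the Kronecker symbol\<close>

text \<open>For odd a and b this is the sign (-1)^((a-1)/2 (b-1)/2), in a form that depends visibly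
  on residues modulo 4.\<close>

definition recip_sign :: "int \<Rightarrow> int \<Rightarrow> int" where
  "recip_sign a b = (if a mod 4 = 3 \<and> b mod 4 = 3 then - 1 else 1)"

lemma recip_sign_mult: "odd a \<Longrightarrow> odd b \<Longrightarrow> recip_sign (a * b) c = recip_sign a c * recip_sign b c"
proof -
  assume "odd a" "odd b"
  define x y where "x = a mod 4" and "y = b mod 4"
  have "(a * b) mod 4 = (x * y) mod 4" unfolding x_def y_def by (simp only: mod_mult_eq)
  moreover have "x = 1 \<or> x = 3" "y = 1 \<or> y = 3"
    using odd_mod_4[of a] odd_mod_4[of b] \<open>odd a\<close> \<open>odd b\<close> by (simp_all add: x_def y_def)
  ultimately show ?thesis by (auto simp: recip_sign_def x_def[symmetric] y_def[symmetric])
qed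

lemma recip_sign_commute: "recip_sign a b = recip_sign b a"
  by (auto simp: recip_sign_def)

text \<open>The second supplementary law, by Gauss's lemma: the sign is the parity of the number of
  doubles 2 x with x \<le> (p-1)/2 that exceed (p-1)/2.\<close>

lemma Legendre_2:
  fixes p :: int
  assumes p: "prime p" "p > 2"
  shows "Legendre 2 p = kronecker_prime p 2"
proof -
  define h where "h = (p - 1) div 2"
  have np: "int (nat p) = p" using p by simp
  have odd: "odd p" using p prime_odd_iff by auto
  have h: "p = 2 * h + 1" using odd by (simp add: h_def)
  interpret G: GAUSS "nat p" 2
  proof
    show "prime (nat p)" "2 < nat p" "(0::int) < 2" using p by auto
    show "[2 \<noteq> 0] (mod int (nat p))" using p by (auto simp: cong_0_iff dest: zdvd_imp_le)
  qed
  \<comment> \<open>No double wraps around modulo p, since 2 x \<le> 2 h < p; those above h come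
    from x above h/2.\<close>
  have E: "G.E = (\<lambda>x. 2 * x) ` {h div 2<..h}"
  proof (intro equalityI subsetI)
    fix y assume "y \<in> G.E"
    then obtain x where x: "x \<in> {0<..h}" "y = (x * 2) mod p" "y > h"
      unfolding G.E_def G.C_def G.B_def G.A_def using np by (auto simp: h_def)
    then have "y = 2 * x" using h by (simp add: mod_pos_pos_trivial)
    then show "y \<in> (\<lambda>x. 2 * x) ` {h div 2<..h}" using x by auto
  next
    fix y assume "y \<in> (\<lambda>x. 2 * x) ` {h div 2<..h}"
    then obtain x where x: "x \<in> {h div 2<..h}" "y = 2 * x" by auto
    have h0: "h > 0" using h p by simp
    then have "0 < x" "2 * x > h" using x by auto
    moreover have "(x * 2) mod p = y" using x h \<open>0 < x\<close> by (simp add: mod_pos_pos_trivial mult.commute)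
    moreover have "x \<in> G.A" using x \<open>0 < x\<close> np by (simp add: G.A_def h_def)
    then have "(x * 2) mod int (nat p) \<in> G.C" unfolding G.C_def G.B_def by blast
    ultimately show "y \<in> G.E" unfolding G.E_def using x np by (simp add: h_def)
  qed
  have "card G.E = nat (h - h div 2)"
    unfolding E by (subst card_image) (auto simp: inj_on_def)
  then have L: "Legendre 2 p = (-1) ^ nat (h - h div 2)" using G.gauss_lemma np by simp
  have "even (nat (h - h div 2)) \<longleftrightarrow> p mod 8 = 1 \<or> p mod 8 = 7"
  proof -
    have "h - h div 2 \<ge> 0" using h p by simp
    then have "even (nat (h - h div 2)) \<longleftrightarrow> even (h - h div 2)" by (simp add: even_nat_iff)
    also have "\<dots> \<longleftrightarrow> p mod 8 = 1 \<or> p mod 8 = 7" unfolding h by presburger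
    finally show ?thesis .
  qed
  then show ?thesis using L odd by (auto simp: kronecker_prime_2)
qed

lemma Legendre_reciprocity:
  fixes p q :: int
  assumes p: "prime p" "p > 2" and q: "prime q" "q > 2" and "p \<noteq> q"
  shows "Legendre p q = recip_sign p q * Legendre q p"
proof -
  have "Legendre p q * Legendre q p = (-1) ^ (nat ((p - 1) div 2 * ((q - 1) div 2)))"
    using assms by (intro Quadratic_Reciprocity_int) auto
  also have "\<dots> = recip_sign p q"
  proof -
    have nn: "(p - 1) div 2 * ((q - 1) div 2) \<ge> 0" using p q by simp
    have o: "odd p" "odd q" using p q prime_odd_iff by auto
    have "even ((x - 1) div 2) \<longleftrightarrow> x mod 4 = 1" if "odd x" for x :: int using that by presburger
    then have "even (nat ((p - 1) div 2 * ((q - 1) div 2))) \<longleftrightarrow> p mod 4 = 1 \<or> q mod 4 = 1"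
      using nn o by (simp add: even_nat_iff)
    then show ?thesis using odd_mod_4[OF o(1)] odd_mod_4[OF o(2)] by (auto simp: recip_sign_def)
  qed
  finally have e: "Legendre p q * Legendre q p = recip_sign p q" .
  have "Legendre q p \<noteq> 0"
    using assms by (simp add: Legendre_eq_0_iff) (meson primes_dvd_imp_eq)
  then have "Legendre q p * Legendre q p = 1" using Legendre_range[of q p] by auto
  then show ?thesis using e by (metis mult.assoc mult.right_neutral)
qed

text \<open>In this multiset form multiplicativity in the lower argument is immediate.\<close>

lemma kronecker_pos: "n > 0 \<Longrightarrow> kronecker a n = prod_mset (image_mset (kronecker_prime a) (prime_factorization n))"
  unfolding kronecker_def image_prod_mset_multiplicity
  by (auto intro!: prod.cong simp: count_prime_factorization_prime in_prime_factors_imp_prime)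

lemma kronecker_mult: "m > 0 \<Longrightarrow> n > 0 \<Longrightarrow> kronecker a (m * n) = kronecker a m * kronecker a n"
  by (simp add: kronecker_pos prime_factorization_mult)

lemma kronecker_1 [simp]: "kronecker a 1 = 1"
  by (simp add: kronecker_pos)

lemma kronecker_prime_eq: "prime p \<Longrightarrow> kronecker a p = kronecker_prime a p"
  using prime_gt_0_int[of p] by (simp add: kronecker_pos prime_factorization_prime)

lemma kronecker_prime_mult_left: "prime p \<Longrightarrow> kronecker_prime (a * b) p = kronecker_prime a p * kronecker_prime b p"
  using kronecker_prime_2_mult[of a b] Legendre_mult[of p a b] odd_prime_gt_2[of p] prime_odd_iff[of p]
  by (cases "p = 2") (auto simp: kronecker_prime_def)

lemma kronecker_prime_range: "kronecker_prime a p \<in> {-1, 0, 1}"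
  using Legendre_range by (auto simp: kronecker_prime_def)

lemma kronecker_prime_eq_0_iff: "prime p \<Longrightarrow> kronecker_prime a p = 0 \<longleftrightarrow> p dvd a"
  by (auto simp: kronecker_prime_def Legendre_eq_0_iff)

lemma kronecker_mult_left:
  assumes "n > 0"
  shows "kronecker (a * b) n = kronecker a n * kronecker b n"
  using assms
proof (induction n rule: positive_prime_induct)
  case (prime_mult p n)
  then show ?case using prime_gt_0_int[of p]
    by (simp add: kronecker_mult kronecker_prime_eq kronecker_prime_mult_left)
qed simp

lemma kronecker_coprime_range:
  assumes "n > 0" "coprime n a"
  shows "kronecker a n = 1 \<or> kronecker a n = -1"
  using assms
proof (induction n rule: positive_prime_induct)
  case (prime_mult p n)
  then have "\<not> p dvd a" "coprime n a" by (auto simp: coprime_absorb_left prime_int_iff)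
  then show ?case using prime_mult prime_gt_0_int[of p] kronecker_prime_range[of a p] kronecker_prime_eq_0_iff[of p a]
    by (auto simp: kronecker_mult kronecker_prime_eq)
qed simp

text \<open>Each prime factor contributes the Legendre symbol of a nonzero square. The congruence is
  asked for prime by prime, so repeated prime factors of n cause no trouble.\<close>

lemma kronecker_square_mod:
  assumes "n > 0" "odd n" "coprime a n" "\<And>q. prime q \<Longrightarrow> q dvd n \<Longrightarrow> [a = x^2] (mod q)"
  shows "kronecker a n = 1"
  using assms
proof (induction n rule: positive_prime_induct)
  case (prime_mult p n)
  have "odd p" "odd n" "coprime a n" using prime_mult.prems by auto
  have pa: "\<not> p dvd a" using prime_mult by (metis coprime_common_divisor dvd_refl dvd_triv_left not_prime_unit)
  have c: "[a = x^2] (mod p)" using prime_mult by simp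
  then have "\<not> p dvd x" using pa cong_dvd_iff[OF c] by (auto simp: power2_eq_square)
  then have "Legendre a p = 1" using Legendre_cong[OF c] Legendre_square prime_mult.hyps by simp
  moreover have "p \<noteq> 2" using \<open>odd p\<close> by auto
  moreover have "kronecker a n = 1"
    using prime_mult \<open>odd n\<close> \<open>coprime a n\<close> by (intro prime_mult.IH) auto
  ultimately show ?case using prime_mult.hyps prime_gt_0_int[of p] by (simp add: kronecker_mult kronecker_prime_eq kronecker_prime_def)
qed simp

lemma kronecker_2_left:
  assumes "n > 0" "odd n"
  shows "kronecker 2 n = kronecker_prime n 2"
  using assms
proof (induction n rule: positive_prime_induct)
  case (prime_mult p n)
  then have o: "odd p" "odd n" by auto
  then have "p > 2" "p \<noteq> 2" using odd_prime_gt_2[of p] prime_mult by auto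
  then show ?case using prime_mult o Legendre_2[of p]
    by (simp add: kronecker_mult kronecker_prime_eq kronecker_prime_def[of 2 p] kronecker_prime_2_mult)
qed (simp add: kronecker_prime_2)

lemma kronecker_reciprocity_prime:
  assumes q: "prime q" "odd q" and "n > 0" "odd n" "coprime q n"
  shows "kronecker q n = recip_sign q n * kronecker n q"
  using assms(3-)
proof (induction n rule: positive_prime_induct)
  case (prime_mult p n)
  then have o: "odd p" "odd n" "coprime q n" "coprime q p" by auto
  then have p2: "p > 2" "p \<noteq> 2" using odd_prime_gt_2[of p] prime_mult by auto
  have "q \<noteq> p" using o(4) q by auto
  have q2: "q > 2" "q \<noteq> 2" using odd_prime_gt_2[of q] q by auto
  have "kronecker q (p * n) = Legendre q p * kronecker q n"
    using prime_mult p2 by (simp add: kronecker_mult kronecker_prime_eq kronecker_prime_def)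
  also have "Legendre q p = recip_sign q p * Legendre p q"
    using q q2 p2 prime_mult \<open>q \<noteq> p\<close> by (intro Legendre_reciprocity) auto
  also have "kronecker q n = recip_sign q n * kronecker n q" using prime_mult o by blast
  also have "recip_sign q p * Legendre p q * (recip_sign q n * kronecker n q) = recip_sign q (p * n) * kronecker (p * n) q"
    using q q2 o recip_sign_mult[of p n q]
    by (simp add: recip_sign_commute[of q] kronecker_prime_eq kronecker_prime_def Legendre_mult)
  finally show ?case .
next
  case one
  have "kronecker 1 q = 1"
    by (rule kronecker_square_mod[of _ _ 1]) (use q prime_gt_0_int[of q] in auto)
  then show ?case by (simp add: recip_sign_def)
qed

lemma kronecker_reciprocity:
  assumes "m > 0" "odd m" "n > 0" "odd n" "coprime m n"
  shows "kronecker m n = recip_sign m n * kronecker n m"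
  using assms
proof (induction m rule: positive_prime_induct)
  case one
  have "kronecker 1 n = 1" by (rule kronecker_square_mod[of _ _ 1]) (use one in auto)
  then show ?case by (simp add: recip_sign_def)
next
  case (prime_mult p m)
  then have o: "odd p" "odd m" "coprime p n" "coprime m n" by auto
  then show ?case using prime_mult kronecker_reciprocity_prime[of p n] recip_sign_mult[of p m n] prime_gt_0_int[of p]
    by (simp add: kronecker_mult kronecker_mult_left)
qed

text \<open>The sign disappears because D is 1 modulo 4. Even n is allowed: the prime 2 is covered
  by the supplementary law.\<close>

lemma kronecker_reciprocity_1_mod_4:
  assumes "D > 0" "D mod 4 = 1" "n > 0" "coprime D n"
  shows "kronecker D n = kronecker n D"
  using assms(3,4)
proof (induction n rule: positive_prime_induct)
  case one
  have "odd D" using assms by presburger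
  then have "kronecker 1 D = 1" using assms by (intro kronecker_square_mod[of _ _ 1]) auto
  then show ?case by simp
next
  case (prime_mult p n)
  have oD: "odd D" using assms by presburger
  have "kronecker D p = kronecker p D"
  proof (cases "p = 2")
    case True
    then show ?thesis using kronecker_2_left[OF assms(1) oD] by (simp add: kronecker_prime_eq)
  next
    case False
    then have "odd p" "p > 0" using prime_mult prime_odd_iff prime_gt_0_int by blast+
    then show ?thesis using kronecker_reciprocity[of D p] assms oD prime_mult by (auto simp: recip_sign_def)
  qed
  then show ?case using prime_mult prime_gt_0_int[of p] assms(1) by (simp add: kronecker_mult kronecker_mult_left)
qed

text \<open>The equation makes 4 N a square modulo D, and reciprocity exchanges N and D. For D = 4 k
  the exchange costs a sign at 2; that -d is a discriminant restricts N modulo 4 or modulo 8 to the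
  residues where the signs cancel. This fact makes the genus character well defined.\<close>

theorem kronecker_norm_value:
  assumes D: "fundamental_discriminant D" "D > 1" and N: "N > 0" "coprime N D"
    and d: "is_discriminant (- d)" and eq: "4 * N = B^2 + d * D * e^2"
  shows "kronecker D N = 1"
proof -
  have cop4: "coprime 4 x" if "odd x" for x :: int
  proof -
    have "coprime (2 ^ 2) x" using that by (simp only: coprime_power_left_iff coprime_left_2_iff_odd) simp
    then show ?thesis by simp
  qed
  consider "D mod 4 = 1" | k where "D = 4 * k" "k mod 4 = 2 \<or> k mod 4 = 3"
    using D(1) by (auto simp: fundamental_discriminant_def)
  then show ?thesis
  proof cases
    case 1
    have oD: "odd D" using 1 by presburger
    have "kronecker (4 * N) D = 1"
    proof (rule kronecker_square_mod[where x = B])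
      show "coprime (4 * N) D" using cop4[OF oD] N by simp
      fix q assume "q dvd D"
      then show "[4 * N = B^2] (mod q)" using eq by (simp add: cong_iff_dvd_diff)
    qed (use oD D in auto)
    moreover have "kronecker 4 D = 1"
      by (rule kronecker_square_mod[where x = 2]) (use oD D cop4[OF oD] in auto)
    ultimately have "kronecker N D = 1" using kronecker_mult_left[of D 4 N] D by simp
    then show ?thesis using kronecker_reciprocity_1_mod_4[of D N] 1 D N by (simp add: coprime_commute)
  next
    case (2 k)
    have k0: "k > 0" using 2 D by simp
    have oN: "odd N"
    proof
      assume "even N"
      then have "is_unit (2 :: int)" using N 2 by (meson coprime_common_divisor dvd_mult2 even_numeral)
      then show False by simp
    qed
    have copk: "coprime N k" using N 2 by simp
    have "even (B^2)"
    proof -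
      have "B^2 = 2 * (2 * N - 2 * d * k * e^2)" using eq 2 by (simp add: algebra_simps)
      then show ?thesis by simp
    qed
    then obtain b where b: "B = 2 * b" by (auto elim: evenE)
    have eN: "N = b^2 + d * k * e^2" using eq 2 by (simp add: b power_mult_distrib)
    have k4: "kronecker D N = kronecker k N"
    proof -
      have "kronecker 4 N = 1"
        by (rule kronecker_square_mod[where x = 2]) (use oN N cop4[OF oN] in auto)
      then show ?thesis using kronecker_mult_left[of N 4 k] N 2 by simp
    qed
    have dm: "d mod 4 = 0 \<or> d mod 4 = 3"
    proof -
      have "(- d) mod 4 = 0 \<or> (- d) mod 4 = 1" using d by (simp add: is_discriminant_def)
      then show ?thesis by presburger
    qed
    have sq4: "x^2 mod 4 = (if even x then 0 else 1)" for x :: int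
    proof -
      have "x mod 4 = 0 \<or> x mod 4 = 1 \<or> x mod 4 = 2 \<or> x mod 4 = 3" by presburger
      moreover have "x^2 mod 4 = (x mod 4)^2 mod 4" by (simp add: power_mod)
      moreover have "even x \<longleftrightarrow> x mod 4 = 0 \<or> x mod 4 = 2" by presburger
      ultimately show ?thesis by auto
    qed
    have sqN: "kronecker N k' = 1" if "k' dvd k" "odd k'" "k' > 0" for k'
    proof (rule kronecker_square_mod[where x = b])
      show "coprime N k'" using copk that by (metis coprime_divisors dvd_refl)
      fix q assume "q dvd k'"
      then have "q dvd k" using that dvd_trans by blast
      then show "[N = b^2] (mod q)" using eN by (simp add: cong_iff_dvd_diff)
    qed (use that in auto)
    from 2(2) show ?thesis
    proof
      assume k3: "k mod 4 = 3"
      have ok: "odd k" using k3 by presburger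
      define t where "t = d * k * e^2"
      have "[t = (d mod 4) * (k mod 4) * (e^2 mod 4)] (mod 4)" unfolding t_def by (intro cong_mult) auto
      then have t4: "t mod 4 = ((d mod 4) * (k mod 4) * (e^2 mod 4)) mod 4" by (simp only: cong_def)
      have N4': "N mod 4 = (b^2 mod 4 + t mod 4) mod 4" unfolding eN t_def by (simp only: mod_add_eq)
      have N4: "N mod 4 = (b^2 mod 4 + ((d mod 4) * (k mod 4) * (e^2 mod 4)) mod 4) mod 4"
        using N4' unfolding t4 .
      define \<beta> \<epsilon> \<delta> where "\<beta> = b^2 mod 4" and "\<epsilon> = e^2 mod 4" and "\<delta> = d mod 4"
      have "\<beta> = 0 \<or> \<beta> = 1" "\<epsilon> = 0 \<or> \<epsilon> = 1" "\<delta> = 0 \<or> \<delta> = 3"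
        using dm sq4[of b] sq4[of e] by (simp_all add: \<beta>_def \<epsilon>_def \<delta>_def)
      \<comment> \<open>The product is 0 or 1 modulo 4, so N cannot be 3 modulo 4.\<close>
      then have "(\<beta> + (\<delta> * 3 * \<epsilon>) mod 4) mod 4 \<in> {0, 1, 2}" by (elim disjE) simp_all
      then have "N mod 4 \<in> {0, 1, 2}" unfolding N4 k3 \<beta>_def \<epsilon>_def \<delta>_def .
      then have "N mod 4 = 0 \<or> N mod 4 = 1 \<or> N mod 4 = 2" by blast
      then have "N mod 4 = 1" using oN by presburger
      then have "recip_sign k N = 1" by (simp add: recip_sign_def)
      then show ?thesis using k4 kronecker_reciprocity[of k N] k0 ok N oN copk sqN[of k] by (simp add: coprime_commute)
    next
      assume k2: "k mod 4 = 2"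
      define h where "h = k div 2"
      have kh: "k = 2 * h" and oh: "odd h" using k2 unfolding h_def by presburger+
      have h0: "h > 0" using kh k0 by simp
      have "kronecker k N = kronecker 2 N * kronecker h N" unfolding kh by (rule kronecker_mult_left[OF N(1)])
      also have "kronecker h N = recip_sign h N"
        using kronecker_reciprocity[of h N] h0 oh N oN copk sqN[of h] kh by (simp add: coprime_commute)
      also have "kronecker 2 N = kronecker_prime N 2" by (rule kronecker_2_left[OF N(1) oN])
      also have "kronecker_prime N 2 * recip_sign h N = 1"
      proof -
        have ob: "odd b" using eN oN kh by (auto simp: power2_eq_square)
        have b8: "b^2 mod 8 = 1"
        proof -
          have "b^2 mod 8 = (b mod 8)^2 mod 8" by (simp add: power_mod)
          then show ?thesis using odd_mod_8[OF ob] by auto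
        qed
        define t where "t = d * h * e^2"
        have N8: "N = b^2 + 2 * t" using eN kh by (simp add: t_def)
        have "[t = (d mod 4) * (h mod 4) * (e^2 mod 4)] (mod 4)" unfolding t_def by (intro cong_mult) auto
        then have t4: "t mod 4 = ((d mod 4) * (h mod 4) * (e^2 mod 4)) mod 4" by (simp only: cong_def)
        have "(s + 2 * t) mod 8 = (1 + 2 * (t mod 4)) mod 8" if "s mod 8 = 1" for s t :: int
        proof -
          define u v r where "u = s div 8" and "v = t div 4" and "r = t mod 4"
          have "s = u * 8 + 1" "t = v * 4 + r"
            using div_mult_mod_eq[of s 8] div_mult_mod_eq[of t 4] that by (simp_all add: u_def v_def r_def)
          then have "s + 2 * t = 1 + 2 * r + 8 * (u + v)" by simp
          then show ?thesis by (simp only: mod_mult_self2 r_def)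
        qed
        then have N8': "N mod 8 = (1 + 2 * (t mod 4)) mod 8" using N8 b8 by blast
        have N4: "N mod 4 = x mod 4" if "N mod 8 = x" for x
          using mod_mod_cancel[of 4 8 N] that by simp
        define \<eta> \<epsilon> \<delta> where "\<eta> = h mod 4" and "\<epsilon> = e^2 mod 4" and "\<delta> = d mod 4"
        have r: "\<eta> = 1 \<or> \<eta> = 3" "\<epsilon> = 0 \<or> \<epsilon> = 1" "\<delta> = 0 \<or> \<delta> = 3"
          using dm odd_mod_4[OF oh] sq4[of e] by (simp_all add: \<eta>_def \<epsilon>_def \<delta>_def)
        have "N mod 8 = (1 + 2 * ((\<delta> * \<eta> * \<epsilon>) mod 4)) mod 8"
          using N8' unfolding t4 \<eta>_def \<epsilon>_def \<delta>_def .
        \<comment> \<open>In every case the two signs agree: both are 1 when N is 1 modulo 8, or 7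
          modulo 8 with h congruent to 1; both are -1 when N is 3 modulo 8 with h congruent to
          3.\<close>
        with r have "N mod 8 = 1 \<or> (N mod 8 = 7 \<and> \<eta> = 1) \<or> (N mod 8 = 3 \<and> \<eta> = 3)"
          by (elim disjE) simp_all
        then show ?thesis
        proof (elim disjE conjE)
          assume "N mod 8 = 1"
          then show ?thesis using N4[of 1] oN by (simp add: kronecker_prime_2 recip_sign_def)
        next
          assume "N mod 8 = 7" "\<eta> = 1"
          then show ?thesis using oN by (simp add: kronecker_prime_2 recip_sign_def \<eta>_def)
        next
          assume "N mod 8 = 3" "\<eta> = 3"
          then show ?thesis using N4[of 3] oN by (simp add: kronecker_prime_2 recip_sign_def \<eta>_def)
        qed
      qed
      finally show ?thesis using k4 by simp
    qed
  qed
qed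

section \<open>Binary quadratic forms\<close>

fun form_smult :: "int \<Rightarrow> bqf \<Rightarrow> bqf" where
  "form_smult k (a, b, c) = (k * a, k * b, k * c)"

lemma form_eval_act: "form_eval (form_act Q g) x y
    = form_eval Q (of_int (g$1$1) * x + of_int (g$1$2) * y) (of_int (g$2$1) * x + of_int (g$2$2) * y)"
  by (cases Q) (simp add: power2_eq_square algebra_simps)

lemma form_act_mult: "form_act (form_act Q A) B = form_act Q (A ** B)"
  by (cases Q) (simp add: mat_mult_2 power2_eq_square algebra_simps)

lemma form_act_mat [simp]: "form_act Q (mat k) = form_smult (k^2) Q"
  by (cases Q) (simp add: mat_def power2_eq_square)

lemma form_smult_1 [simp]: "form_smult 1 Q = Q"
  by (cases Q) simp

lemma form_act_uminus: "form_act Q (- A) = form_act Q A"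
  by (cases Q) (simp add: power2_eq_square)

lemma form_act_smult: "form_act (form_smult k Q) A = form_smult k (form_act Q A)"
  by (cases Q) (simp add: algebra_simps)

lemma form_disc_act: "form_disc (form_act Q g) = (det g)^2 * form_disc Q"
  by (cases Q) (simp add: det_2 power2_eq_square algebra_simps)

lemma form_disc_smult: "form_disc (form_smult k Q) = k^2 * form_disc Q"
  by (cases Q) (simp add: power2_eq_square algebra_simps)

lemma form_eval_smult: "form_eval (form_smult k Q) x y = of_int k * form_eval Q x y"
  by (cases Q) (simp add: algebra_simps)

lemma forms_of_pos:
  fixes x y :: real
  assumes "Q \<in> forms_of D" "(x, y) \<noteq> (0, 0)"
  shows "form_eval Q x y > 0"
proof -
  have "pos_def_form Q" using assms(1) by (simp add: forms_of_def)
  then show ?thesis using assms(2) unfolding pos_def_form_def by (elim allE impE)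
qed

lemma forms_of_iff:
  assumes "D > 0"
  shows "(a, b, c) \<in> forms_of D \<longleftrightarrow> a > 0 \<and> b^2 - 4 * a * c = - D"
proof
  assume h: "(a, b, c) \<in> forms_of D"
  then have "form_eval (a, b, c) (1::real) 0 > 0" by (intro forms_of_pos[of _ D]) auto
  then show "a > 0 \<and> b^2 - 4 * a * c = - D" using h by (simp add: forms_of_def)
next
  assume h: "a > 0 \<and> b^2 - 4 * a * c = - D"
  have "form_eval (a, b, c) x y > 0" if "(x, y) \<noteq> (0, 0)" for x y :: real
  proof -
    have "4 * a' * (a' * x^2 + b' * x * y + c' * y^2) = (2 * a' * x + b' * y)^2 - (b'^2 - 4 * a' * c') * y^2" for a' b' c' :: real
      by (simp add: power2_eq_square algebra_simps)
    from this[of "of_int a" "of_int b" "of_int c"]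
    have "4 * of_int a * form_eval (a, b, c) x y = (2 * of_int a * x + of_int b * y)^2 - of_int (b^2 - 4 * a * c) * y^2"
      by simp
    also have "\<dots> = (2 * of_int a * x + of_int b * y)^2 + of_int D * y^2" using h by simp
    also have "\<dots> > 0"
    proof (cases "y = 0")
      case True
      then show ?thesis using that h by simp
    next
      case False
      then show ?thesis using assms by (intro add_nonneg_pos) auto
    qed
    finally show ?thesis using h by (simp add: zero_less_mult_iff)
  qed
  then show "(a, b, c) \<in> forms_of D" using h by (simp add: forms_of_def pos_def_form_def)
qed

lemma form_eval_pos:
  fixes x y :: int
  assumes "Q \<in> forms_of D" "(x, y) \<noteq> (0, 0)"
  shows "form_eval Q x y > 0"
proof -
  obtain a b c where Q: "Q = (a, b, c)" by (cases Q)
  have "form_eval Q (of_int x :: real) (of_int y) > 0"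
    using assms(2) by (intro forms_of_pos[OF assms(1)]) simp
  also have "form_eval Q (of_int x :: real) (of_int y) = of_int (form_eval Q x y)" by (simp add: Q)
  finally show ?thesis by simp
qed

lemma form_act_forms_of:
  assumes D: "D > 0" and Q: "Q \<in> forms_of D" and g: "det g \<noteq> 0"
  shows "form_act Q g \<in> forms_of ((det g)^2 * D)"
proof -
  obtain a b c where abc: "form_act Q g = (a, b, c)" by (cases "form_act Q g")
  have "(g$1$1, g$2$1) \<noteq> (0, 0)" using g by (auto simp: det_2)
  then have "form_eval Q (g$1$1) (g$2$1) > 0" using form_eval_pos[OF Q] by blast
  moreover have "a = form_eval Q (g$1$1) (g$2$1)" using form_eval_act[of Q g 1 "0::int"] by (simp add: abc)
  ultimately have "a > 0" by simp
  moreover have "b^2 - 4 * a * c = - ((det g)^2 * D)"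
    using form_disc_act[of Q g] Q by (simp add: abc forms_of_def)
  ultimately show ?thesis unfolding abc using D g by (subst forms_of_iff) auto
qed

lemma form_act_SL2Z: "D > 0 \<Longrightarrow> Q \<in> forms_of D \<Longrightarrow> g \<in> SL2Z \<Longrightarrow> form_act Q g \<in> forms_of D"
  using form_act_forms_of[of D Q g] by (simp add: SL2Z_def)

lemma form_smult_forms_of:
  assumes D: "D > 0" and k: "k > 0"
  shows "form_smult k Q \<in> forms_of (k^2 * D) \<longleftrightarrow> Q \<in> forms_of D"
proof -
  obtain a b c where Q: "Q = (a, b, c)" by (cases Q)
  have "(k * b)^2 - 4 * (k * a) * (k * c) = k^2 * (b^2 - 4 * a * c)" by (simp add: power2_eq_square algebra_simps)
  moreover have "k^2 * (b^2 - 4 * a * c) = - (k^2 * D) \<longleftrightarrow> b^2 - 4 * a * c = - D"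
    using k by (metis mult_cancel_left mult_minus_right power_not_zero less_irrefl)
  ultimately show ?thesis using assms unfolding Q form_smult.simps
    by (subst (1 2) forms_of_iff) (auto simp: zero_less_mult_iff)
qed

lemma form_smult_inj: "k \<noteq> 0 \<Longrightarrow> form_smult k Q = form_smult k Q' \<longleftrightarrow> Q = Q'"
  by (cases Q; cases Q') auto

lemma form_eval_eq_0_iff:
  assumes D: "D > 0" and Q: "(a, b, c) \<in> forms_of D" and z: "Im z > 0"
  shows "form_eval (a, b, c) z 1 = 0 \<longleftrightarrow> z = Complex (- of_int b / (2 * of_int a)) (sqrt (of_int D) / (2 * of_int a))"
proof -
  have a: "a > 0" and d: "b^2 - 4 * a * c = - D" using Q forms_of_iff[OF D] by auto
  define w where "w = 2 * of_int a * z + of_int b"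
  have Iw: "Im w > 0" using z a by (simp add: w_def)
  have "4 * of_int a * form_eval (a, b, c) z 1 = w^2 - of_int (b^2 - 4 * a * c)"
    by (simp add: w_def power2_eq_square algebra_simps)
  then have e: "4 * of_int a * form_eval (a, b, c) z 1 = w^2 + of_int D" unfolding d by simp
  have sq: "(\<i> * of_real (sqrt (of_int D)))^2 = (- of_int D :: complex)"
  proof -
    have "(of_real (sqrt (of_int D)) :: complex)^2 = of_real ((sqrt (of_int D))^2)" by (simp only: of_real_power)
    also have "\<dots> = of_int D" using D by simp
    finally show ?thesis by (simp add: power_mult_distrib)
  qed
  have "form_eval (a, b, c) z 1 = 0 \<longleftrightarrow> w^2 + of_int D = 0" using e a by (metis mult_eq_0_iff of_int_eq_0_iff less_irrefl zero_neq_numeral)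
  also have "\<dots> \<longleftrightarrow> w^2 = (\<i> * of_real (sqrt (of_int D)))^2" unfolding sq by (simp add: eq_neg_iff_add_eq_0)
  also have "\<dots> \<longleftrightarrow> w = \<i> * of_real (sqrt (of_int D))"
  proof -
    have "w \<noteq> - (\<i> * of_real (sqrt (of_int D)))" using Iw D by (auto simp: complex_eq_iff)
    then show ?thesis by (simp add: power2_eq_iff)
  qed
  also have "\<dots> \<longleftrightarrow> z = Complex (- of_int b / (2 * of_int a)) (sqrt (of_int D) / (2 * of_int a))"
    using a by (auto simp: w_def complex_eq_iff field_simps)
  finally show ?thesis .
qed

lemma form_root_eq:
  assumes D: "D > 0" and Q: "(a, b, c) \<in> forms_of D"
  shows "form_root (a, b, c) = Complex (- of_int b / (2 * of_int a)) (sqrt (of_int D) / (2 * of_int a))"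
proof -
  let ?z = "Complex (- of_int b / (2 * of_int a)) (sqrt (of_int D) / (2 * of_int a))"
  have "a > 0" using Q forms_of_iff[OF D] by auto
  then have z: "Im ?z > 0" using D by simp
  show ?thesis unfolding form_root_def
    using form_eval_eq_0_iff[OF D Q] z by (intro the_equality) blast+
qed

lemma Im_form_root_pos: "D > 0 \<Longrightarrow> Q \<in> forms_of D \<Longrightarrow> Im (form_root Q) > 0"
  using form_root_eq[of D] forms_of_iff[of D] by (cases Q) auto

lemma form_root_iff:
  "D > 0 \<Longrightarrow> Q \<in> forms_of D \<Longrightarrow> Im z > 0 \<Longrightarrow> form_eval Q z 1 = 0 \<longleftrightarrow> form_root Q = z"
  using form_root_eq[of D] form_eval_eq_0_iff[of D _ _ _ z] by (cases Q) auto

text \<open>The imaginary part of the root determines a, the real part then b, and the discriminant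
  c.\<close>

lemma form_root_inj:
  assumes D: "D > 0" and Q: "Q \<in> forms_of D" "Q' \<in> forms_of D" and eq: "form_root Q = form_root Q'"
  shows "Q = Q'"
proof -
  obtain a b c a' b' c' where e: "Q = (a, b, c)" "Q' = (a', b', c')" by (cases Q; cases Q')
  have h: "a > 0" "a' > 0" "b^2 - 4 * a * c = - D" "b'^2 - 4 * a' * c' = - D"
    using Q forms_of_iff[OF D] by (auto simp: e)
  have "sqrt (of_int D) / (2 * of_int a) = sqrt (of_int D) / (2 * of_int a')"
    "- of_int b / (2 * of_int a) = (- of_int b' / (2 * of_int a') :: real)"
    using eq form_root_eq[OF D] Q by (auto simp: e)
  then have a: "a = a'" and b: "b = b'" using D h by (auto simp: field_simps)
  moreover have "4 * a * c = b^2 + D" "4 * a' * c' = b'^2 + D" using h by linarith+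
  ultimately have "4 * a * c = 4 * a * c'" by simp
  then have "c = c'" using h by simp
  then show ?thesis using a b e by simp
qed

text \<open>Substitution is a right action, so roots move by the inverse, here the adjoint; scalar
  factors do not affect the Moebius map.\<close>

lemma form_root_act:
  assumes D: "D > 0" and Q: "Q \<in> forms_of D" and g: "det g > 0"
  shows "form_root (form_act Q g) = moebius (adj2 g) (form_root Q)"
proof -
  let ?z = "form_root Q" and ?w = "moebius (adj2 g) (form_root Q)"
  have z: "Im ?z > 0" using Im_form_root_pos[OF D Q] .
  have w: "Im ?w > 0" using z g by (intro Im_moebius_pos) auto
  have gw: "moebius g ?w = ?z"
    using moebius_mult[of ?z "adj2 g" g] z g by (simp add: mult_adj2 moebius_scalar)
  have \<delta>: "den g ?w \<noteq> 0" using den_nonzero[OF w] g by simp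
  have "form_eval (form_act Q g) ?w 1 = form_eval Q (of_int (g$1$1) * ?w + of_int (g$1$2)) (den g ?w)"
    by (simp add: form_eval_act)
  also have "of_int (g$1$1) * ?w + of_int (g$1$2) = ?z * den g ?w"
    using gw \<delta> by (simp add: moebius_def[of g] divide_eq_eq)
  also have "form_eval Q (?z * den g ?w) (den g ?w) = (den g ?w)^2 * form_eval Q ?z 1"
    by (cases Q) (simp add: power2_eq_square algebra_simps)
  also have "form_eval Q ?z 1 = 0" using form_root_iff[OF D Q z] by simp
  finally have "form_eval (form_act Q g) ?w 1 = 0" by simp
  moreover have "form_act Q g \<in> forms_of ((det g)^2 * D)" using form_act_forms_of[OF D Q] g by simp
  ultimately show ?thesis using form_root_iff[of "(det g)^2 * D" _ ?w] D g w by simp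
qed

lemma form_root_smult:
  assumes D: "D > 0" and Q: "Q \<in> forms_of D" and k: "k > 0"
  shows "form_root (form_smult k Q) = form_root Q"
proof -
  have z: "Im (form_root Q) > 0" using Im_form_root_pos[OF D Q] .
  have "form_eval (form_smult k Q) (form_root Q) 1 = 0"
    using form_root_iff[OF D Q z] by (simp add: form_eval_smult)
  then show ?thesis using form_root_iff[of "k^2 * D" _ "form_root Q"] form_smult_forms_of[OF D k] Q D k z by simp
qed

section \<open>Stabilizers and finiteness of the class number\<close>

definition form_stab :: "bqf \<Rightarrow> (int^2^2) set" where
  "form_stab Q = {\<gamma> \<in> SL2Z. form_act Q \<gamma> = Q}"

text \<open>4 a r is the sum of (2 a x + b y)^2 and D y^2, which bounds y and then x.\<close>

lemma finite_representations:
  assumes D: "D > 0" and Q: "Q \<in> forms_of D"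
  shows "finite {(x, y). form_eval Q x y = (r :: int)}"
proof -
  obtain a b c where e: "Q = (a, b, c)" by (cases Q)
  have a: "a > 0" and d: "b^2 - 4 * a * c = - D" using Q forms_of_iff[OF D] by (auto simp: e)
  define R where "R = 4 * a * \<bar>r\<bar>"
  have le_sq: "\<bar>t\<bar> \<le> s" if "t^2 \<le> s" for t s :: int
  proof -
    have "\<bar>t\<bar> \<le> t^2"
    proof (cases "t = 0")
      case False
      then have "\<bar>t\<bar> * 1 \<le> \<bar>t\<bar> * \<bar>t\<bar>" by (intro mult_left_mono) auto
      then show ?thesis by (simp add: power2_eq_square)
    qed simp
    then show ?thesis using that by linarith
  qed
  have "{(x, y). form_eval Q x y = r} \<subseteq> {- (R + \<bar>b\<bar> * R)..R + \<bar>b\<bar> * R} \<times> {- R..R}"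
  proof
    fix p assume "p \<in> {(x, y). form_eval Q x y = r}"
    then obtain x y where p: "p = (x, y)" and "form_eval Q x y = r" by auto
    then have "4 * a * r = (2 * a * x + b * y)^2 - (b^2 - 4 * a * c) * y^2"
      by (simp add: e power2_eq_square algebra_simps) (simp add: flip: distrib_left)
    then have eq: "4 * a * r = (2 * a * x + b * y)^2 + D * y^2" unfolding d by simp
    have r: "4 * a * r \<le> R" using a by (simp add: R_def)
    have "1 * y^2 \<le> D * y^2" using D by (intro mult_right_mono) auto
    then have "y^2 \<le> R" using eq r zero_le_power2[of "2 * a * x + b * y"] by linarith
    then have y: "\<bar>y\<bar> \<le> R" by (rule le_sq)
    have "0 \<le> D * y^2" using D by simp
    then have "(2 * a * x + b * y)^2 \<le> R" using eq r by linarith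
    then have "\<bar>2 * a * x + b * y\<bar> \<le> R" by (rule le_sq)
    then have "\<bar>2 * a * x\<bar> \<le> R + \<bar>b * y\<bar>" by linarith
    also have "\<bar>b * y\<bar> \<le> \<bar>b\<bar> * R" using y by (simp add: abs_mult mult_left_mono)
    finally have 1: "\<bar>2 * a * x\<bar> \<le> R + \<bar>b\<bar> * R" by simp
    have "1 * \<bar>x\<bar> \<le> (2 * a) * \<bar>x\<bar>" using a by (intro mult_right_mono) auto
    then have "\<bar>x\<bar> \<le> R + \<bar>b\<bar> * R" using 1 a by (simp add: abs_mult)
    then show "p \<in> {- (R + \<bar>b\<bar> * R)..R + \<bar>b\<bar> * R} \<times> {- R..R}" using y p by auto
  qed
  then show ?thesis by (rule finite_subset) auto
qed

lemma finite_form_stab: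
  assumes D: "D > 0" and Q: "Q \<in> forms_of D"
  shows "finite (form_stab Q)"
proof -
  obtain a b c where e: "Q = (a, b, c)" by (cases Q)
  let ?X = "\<lambda>r. {(x, y). form_eval Q x y = (r :: int)}"
  have "form_stab Q \<subseteq> (\<lambda>((x, y), (x', y')). mat2 x x' y y') ` (?X a \<times> ?X c)"
  proof
    fix \<gamma> assume "\<gamma> \<in> form_stab Q"
    then have "form_act Q \<gamma> = (a, b, c)" by (simp add: form_stab_def e)
    then have "form_eval Q (\<gamma>$1$1) (\<gamma>$2$1) = a" "form_eval Q (\<gamma>$1$2) (\<gamma>$2$2) = c"
      by (simp_all add: e)
    then show "\<gamma> \<in> (\<lambda>((x, y), (x', y')). mat2 x x' y y') ` (?X a \<times> ?X c)"
      by (intro image_eqI[of _ _ "((\<gamma>$1$1, \<gamma>$2$1), (\<gamma>$1$2, \<gamma>$2$2))"]) (auto simp: mat_eq_iff_2)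
  qed
  then show ?thesis using finite_representations[OF D Q] by (meson finite_SigmaI finite_imageI finite_subset)
qed

text \<open>The matrix -1 acts trivially on forms, so the stabilizer in \<open>SL2Z\<close> is a
  disjoint union of two-element sets {\<gamma>, -\<gamma>}.\<close>

lemma form_omega_eq:
  assumes D: "D > 0" and Q: "Q \<in> forms_of D"
  shows "card (form_stab Q) = 2 * form_omega Q" "form_omega Q > 0"
proof -
  let ?C = "{P \<in> PSL2Z. \<forall>\<gamma>\<in>P. form_act Q \<gamma> = Q}"
  have C: "?C = (\<lambda>\<gamma>. {\<gamma>, - \<gamma>}) ` form_stab Q"
    by (auto simp: PSL2Z_def form_stab_def form_act_uminus)
  have U: "\<Union>?C = form_stab Q" unfolding C by (auto simp: form_stab_def form_act_uminus)
  have fin: "finite (form_stab Q)" by (rule finite_form_stab[OF D Q])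
  have "2 * card ?C = card (\<Union>?C)"
  proof (rule card_partition)
    show "finite ?C" unfolding C using fin by simp
    show "finite (\<Union>?C)" unfolding U by (rule fin)
    fix P assume "P \<in> ?C"
    then obtain \<gamma> where \<gamma>: "P = {\<gamma>, - \<gamma>}" "\<gamma> \<in> SL2Z" by (auto simp: PSL2Z_def)
    have "\<gamma> \<noteq> - \<gamma>"
    proof
      assume "\<gamma> = - \<gamma>"
      then have "\<gamma>$1$1 = 0" "\<gamma>$1$2 = 0"
        by (metis equation_minus_iff neg_equal_zero vector_uminus_component)+
      then show False using \<gamma>(2) by (simp add: SL2Z_iff)
    qed
    then show "card P = 2" using \<gamma>(1) by simp
  next
    fix P P' assume P: "P \<in> ?C" "P' \<in> ?C" "P \<noteq> P'"
    then obtain \<gamma> \<delta> where "P = {\<gamma>, - \<gamma>}" "P' = {\<delta>, - \<delta>}" by (auto simp: PSL2Z_def)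
    then show "P \<inter> P' = {}" using P(3) by (auto simp: minus_equation_iff)
  qed
  then show c: "card (form_stab Q) = 2 * form_omega Q" by (simp add: U form_omega_def)
  have "mat 1 \<in> form_stab Q" by (simp add: form_stab_def)
  then have "card (form_stab Q) > 0" using fin card_gt_0_iff by blast
  then show "form_omega Q > 0" using c by simp
qed

lemma form_stab_root:
  assumes D: "D > 0" and Q: "Q \<in> forms_of D" and \<gamma>: "\<gamma> \<in> SL2Z"
  shows "\<gamma> \<in> form_stab Q \<longleftrightarrow> moebius \<gamma> (form_root Q) = form_root Q"
proof -
  have z: "Im (form_root Q) > 0" using Im_form_root_pos[OF D Q] .
  have r: "form_root (form_act Q \<gamma>) = moebius (adj2 \<gamma>) (form_root Q)"
    using \<gamma> by (intro form_root_act[OF D Q]) (simp add: SL2Z_def)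
  have "\<gamma> \<in> form_stab Q \<longleftrightarrow> form_root (form_act Q \<gamma>) = form_root Q"
    using \<gamma> form_root_inj[OF D form_act_SL2Z[OF D Q \<gamma>] Q] by (auto simp: form_stab_def)
  also have "\<dots> \<longleftrightarrow> moebius \<gamma> (form_root Q) = form_root Q"
    unfolding r using moebius_adj2_cancel[OF z \<gamma>] by metis
  finally show ?thesis .
qed

lemma form_orbit_eq:
  assumes "Q' \<in> form_act Q ` SL2Z"
  shows "form_act Q' ` SL2Z = form_act Q ` SL2Z"
proof -
  obtain g where g: "g \<in> SL2Z" "Q' = form_act Q g" using assms by auto
  have "form_act Q' ` SL2Z = form_act Q ` ((\<lambda>h. g ** h) ` SL2Z)"
    using g by (simp add: image_image form_act_mult)
  then show ?thesis using bij_betw_SL2Z_left[OF g(1)] by (simp add: bij_betw_def)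
qed

lemma form_self_in_orbit: "Q \<in> form_act Q ` SL2Z"
  by (rule image_eqI[of _ _ "mat 1"]) simp_all

text \<open>Reduction theory: each class contains a form with |b| \<le> a \<le> c, and then 3 a^2
  \<le> 4 a c - b^2 = D leaves finitely many possibilities.\<close>

lemma finite_form_classes:
  assumes D: "D > 0"
  shows "finite (form_classes D)"
proof -
  let ?B = "{0..D} \<times> {-D..D} \<times> {0..D^2 + D}"
  have "form_classes D \<subseteq> (\<lambda>Q. form_act Q ` SL2Z) ` ?B"
  proof
    fix C assume "C \<in> form_classes D"
    then obtain Q0 where Q0: "Q0 \<in> forms_of D" "C = form_act Q0 ` SL2Z" by (auto simp: form_classes_def)
    have CF: "C \<subseteq> forms_of D"
    proof
      fix Q assume "Q \<in> C"
      then obtain g where "g \<in> SL2Z" "Q = form_act Q0 g" using Q0(2) by blast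
      then show "Q \<in> forms_of D" using form_act_SL2Z[OF D Q0(1)] by simp
    qed
    have C0: "Q0 \<in> C" using Q0 form_self_in_orbit by simp
    \<comment> \<open>Minimality of the leading coefficient replaces the reduction algorithm:
      exchanging the variables cannot make it smaller, so a \<le> c.\<close>
    define Q1 where "Q1 = arg_min (\<lambda>Q. nat (fst Q)) (\<lambda>Q. Q \<in> C)"
    have Q1: "Q1 \<in> C" "\<And>Q. Q \<in> C \<Longrightarrow> nat (fst Q1) \<le> nat (fst Q)"
      unfolding Q1_def using arg_min_nat_lemma[of "\<lambda>Q. Q \<in> C" Q0 "\<lambda>Q. nat (fst Q)"] C0 by blast+
    obtain a b0 c0 where e1: "Q1 = (a, b0, c0)" by (cases Q1)
    have a: "a > 0" using Q1(1) CF forms_of_iff[OF D] by (auto simp: e1)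
    \<comment> \<open>This translation makes a - b the remainder of a - b0 modulo 2 a, so that -a <
      b \<le> a.\<close>
    define k where "k = (a - b0) div (2 * a)"
    define T where "T = mat2 1 k 0 1"
    have T: "T \<in> SL2Z" by (simp add: T_def SL2Z_iff)
    define Q where "Q = form_act Q1 T"
    define b where "b = b0 + 2 * a * k"
    have C_eq: "C = form_act Q1 ` SL2Z" using Q0 Q1(1) form_orbit_eq by simp
    have QC: "Q \<in> C" unfolding C_eq Q_def using T by blast
    obtain c where eQ: "Q = (a, b, c)" unfolding Q_def e1 T_def b_def by (simp add: algebra_simps)
    have d: "b^2 - 4 * a * c = - D" using QC CF forms_of_iff[OF D] by (auto simp: eQ)
    have "0 \<le> (a - b0) mod (2 * a)" "(a - b0) mod (2 * a) < 2 * a" using a by simp_all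
    moreover have "(a - b0) mod (2 * a) = a - b"
      using minus_div_mult_eq_mod[of "a - b0" "2 * a"] by (simp add: b_def k_def algebra_simps)
    ultimately have b: "\<bar>b\<bar> \<le> a" by linarith
    have "form_act Q (mat2 0 (-1) 1 0) \<in> C"
    proof -
      have "form_act Q (mat2 0 (-1) 1 0) \<in> form_act Q ` SL2Z" by (intro imageI) (simp add: SL2Z_iff)
      then show ?thesis using form_orbit_eq[of Q Q1] QC C_eq by simp
    qed
    from Q1(2)[OF this] have "nat a \<le> nat c" by (simp add: e1 eQ)
    then have c: "a \<le> c" using a by simp
    have b2: "b^2 \<le> a^2" using b by (simp add: abs_le_square_iff[symmetric])
    have "a * a \<le> a * c" using a c by (intro mult_left_mono) auto
    then have "3 * a^2 \<le> D" using d b2 by (simp add: power2_eq_square)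
    moreover have "a \<le> a^2" using a by (simp add: power2_eq_square)
    ultimately have aD: "a \<le> D" using a by linarith
    have "1 * c \<le> a * c" using a c by (intro mult_right_mono) auto
    then have "4 * c \<le> b^2 + D" using d by linarith
    moreover have "a^2 \<le> D^2" using a aD by (intro power_mono) auto
    ultimately have "c \<le> D^2 + D" using b2 a c D by linarith
    then have "Q \<in> ?B" using a aD b c by (auto simp: eQ)
    moreover have "C = form_act Q ` SL2Z" using form_orbit_eq[of Q Q1] QC C_eq by simp
    ultimately show "C \<in> (\<lambda>Q. form_act Q ` SL2Z) ` ?B" by blast
  qed
  then show ?thesis by (rule finite_subset) auto
qed

section \<open>The genus character\<close>

lemma Gcd_4_dvd:
  "Gcd {a, b, c, d} dvd a" "Gcd {a, b, c, d} dvd b" "Gcd {a, b, c, d} dvd c" "Gcd {a, b, c, d} dvd d" for a b c d :: int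
  by (rule Gcd_dvd, simp)+

lemma Gcd_4_nontrivial:
  fixes a b c d :: int
  assumes "Gcd {a, b, c, d} \<noteq> 1"
  obtains g where "\<not> is_unit g" "g dvd a" "g dvd b" "g dvd c" "g dvd d"
proof (rule that[of "Gcd {a, b, c, d}"])
  have "Gcd {a, b, c, d} \<ge> 0" by (rule Gcd_int_greater_eq_0)
  then show "\<not> is_unit (Gcd {a, b, c, d})" using assms by (metis zdvd1_eq abs_of_nonneg)
qed (rule Gcd_4_dvd)+

lemma genus_char_eq_0I:
  assumes "\<not> is_unit g" "g dvd a" "g dvd b" "g dvd c" "g dvd \<Delta>"
  shows "genus_char \<Delta> (a, b, c) = 0"
proof -
  have "g dvd Gcd {a, b, c, \<Delta>}" using assms by (intro Gcd_greatest) auto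
  have "Gcd {a, b, c, \<Delta>} \<noteq> 1"
  proof
    assume h: "Gcd {a, b, c, \<Delta>} = 1"
    from \<open>g dvd Gcd {a, b, c, \<Delta>}\<close> show False using assms(1) unfolding h by simp
  qed
  then show ?thesis by (simp only: genus_char.simps if_False)
qed

lemma coprimeI_prime_divisor:
  fixes m n :: int
  assumes "n \<noteq> 0" "\<And>q. prime q \<Longrightarrow> q dvd m \<Longrightarrow> q dvd n \<Longrightarrow> False"
  shows "coprime m n"
proof (rule ccontr)
  assume "\<not> coprime m n"
  then have "\<not> is_unit (gcd m n)" using is_unit_gcd by blast
  moreover have "gcd m n \<noteq> 0" using assms(1) by simp
  ultimately obtain q where "prime q" "q dvd gcd m n" using prime_divisor_exists by blast
  then show False using assms(2)[of q] by simp
qed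

text \<open>For each prime q dividing \<Delta> the choice of x and y leaves exactly one of a x^2, b
  x y, c y^2 nonzero modulo q: the first if q does not divide a, the third if q divides a but not c,
  and the middle one if q divides both, in which case it does not divide b.\<close>

lemma ex_coprime_value:
  assumes \<Delta>: "\<Delta> > 0" and g: "Gcd {a, b, c, \<Delta>} = (1 :: int)"
  shows "\<exists>x y. coprime (form_eval (a, b, c) x y) \<Delta>"
proof -
  let ?P = "prime_factors \<Delta>"
  define x where "x = \<Prod>{q \<in> ?P. q dvd a \<and> \<not> q dvd c}"
  define y where "y = \<Prod>{q \<in> ?P. \<not> q dvd a}"
  have pd: "q dvd \<Prod>{r \<in> ?P. R r} \<longleftrightarrow> R q" if "q \<in> ?P" for q R
  proof
    assume "q dvd \<Prod>{r \<in> ?P. R r}"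
    moreover have qp: "prime q" and fin: "finite {r \<in> ?P. R r}" using that in_prime_factors_imp_prime by auto
    ultimately have "\<exists>r\<in>{r \<in> ?P. R r}. q dvd r"
      by (simp only: prime_dvd_prod_iff[OF fin qp])
    then obtain r where r: "r \<in> ?P" "R r" "q dvd r" by blast
    then have "q = r" by (intro primes_dvd_imp_eq[OF qp in_prime_factors_imp_prime])
    then show "R q" using r by simp
  next
    assume "R q"
    then show "q dvd \<Prod>{r \<in> ?P. R r}" using that by (intro dvd_prodI) auto
  qed
  have "\<not> q dvd form_eval (a, b, c) x y" if q: "q \<in> ?P" for q
  proof
    assume h: "q dvd form_eval (a, b, c) x y"
    have qp: "prime q" using q in_prime_factors_imp_prime by blast
    have qx: "q dvd x \<longleftrightarrow> q dvd a \<and> \<not> q dvd c" unfolding x_def by (rule pd[OF q, of "\<lambda>q. q dvd a \<and> \<not> q dvd c"])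
    have qy: "q dvd y \<longleftrightarrow> \<not> q dvd a" unfolding y_def by (rule pd[OF q, of "\<lambda>q. \<not> q dvd a"])
    have ev: "form_eval (a, b, c) x y = a * x^2 + b * x * y + c * y^2" by simp
    show False
    proof (cases "q dvd a")
      case False
      then have "q dvd b * x * y + c * y^2" using qy by (simp add: power2_eq_square)
      with h have "q dvd (a * x^2 + b * x * y + c * y^2) - (b * x * y + c * y^2)" unfolding ev by (rule dvd_diff)
      then have "q dvd a * x^2" by simp
      then show False using False qx qp by (auto simp: prime_dvd_mult_iff prime_dvd_power_iff)
    next
      case qa: True
      show False
      proof (cases "q dvd c")
        case False
        then have "q dvd a * x^2 + b * x * y" using qx qa by simp
        with h have "q dvd (a * x^2 + b * x * y + c * y^2) - (a * x^2 + b * x * y)" unfolding ev by (rule dvd_diff)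
        then have "q dvd c * y^2" by simp
        then show False using False qy qa qp by (auto simp: prime_dvd_mult_iff prime_dvd_power_iff)
      next
        case True
        then have "q dvd a * x^2 + c * y^2" using qa by simp
        with h have "q dvd (a * x^2 + b * x * y + c * y^2) - (a * x^2 + c * y^2)" unfolding ev by (rule dvd_diff)
        then have "q dvd b * x * y" by simp
        then have "q dvd b" using qx qy qa True qp by (auto simp: prime_dvd_mult_iff)
        moreover have "q dvd \<Delta>" using q by (simp add: in_prime_factors_iff)
        ultimately have "q dvd Gcd {a, b, c, \<Delta>}" using qa True by (intro Gcd_greatest) auto
        then have "q dvd 1" unfolding g .
        then show False using qp not_prime_unit by blast
      qed
    qed
  qed
  then have "coprime (form_eval (a, b, c) x y) \<Delta>"
    using \<Delta> by (intro coprimeI_prime_divisor) (auto simp: in_prime_factors_iff)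
  then show ?thesis by blast
qed

text \<open>For two values r, r' of the form, 4 r r' is a square plus d \<Delta> (x y' - x' y)^2. So
  \<open>kronecker_norm_value\<close> gives symbol 1 for the product, and any coprime value may
  replace the one picked by \<open>SOME\<close>.\<close>

lemma genus_char_eq:
  assumes \<Delta>: "fundamental_discriminant \<Delta>" "\<Delta> > 1" and d: "d > 0" "is_discriminant (- d)"
    and Q: "Q \<in> forms_of (d * \<Delta>)" and r: "form_eval Q x y = r" "coprime r \<Delta>"
  shows "genus_char \<Delta> Q = kronecker \<Delta> r" "r > 0"
proof -
  obtain a b c where e: "Q = (a, b, c)" by (cases Q)
  have disc: "b^2 - 4 * a * c = - (d * \<Delta>)" using Q by (simp add: e forms_of_def)
  have pos: "form_eval Q x y > 0" if "coprime (form_eval Q x y) \<Delta>" for x y :: int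
  proof -
    have "(x, y) \<noteq> (0, 0)" using that \<Delta> by (auto simp: e)
    then show ?thesis using form_eval_pos[OF Q] by blast
  qed
  show r0: "r > 0" using pos[of x y] r by simp
  have g: "Gcd {a, b, c, \<Delta>} = 1"
  proof (rule ccontr)
    assume "Gcd {a, b, c, \<Delta>} \<noteq> 1"
    then obtain g where g: "\<not> is_unit g" "g dvd a" "g dvd b" "g dvd c" "g dvd \<Delta>" by (rule Gcd_4_nontrivial)
    have "r = a * x^2 + b * x * y + c * y^2" using r(1) by (simp add: e)
    then have "g dvd r" using g by (simp only:) (intro dvd_add dvd_mult2)
    then show False using r(2) g by (meson coprime_common_divisor)
  qed
  define r' where "r' = (SOME r. represents (a, b, c) r \<and> coprime r \<Delta>)"
  have "represents (a, b, c) r \<and> coprime r \<Delta>" using r by (auto simp: represents_def e)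
  then have "represents (a, b, c) r' \<and> coprime r' \<Delta>" unfolding r'_def by (rule someI)
  then obtain x' y' where r': "form_eval Q x' y' = r'" "coprime r' \<Delta>" by (auto simp: represents_def e)
  have r'0: "r' > 0" using pos[of x' y'] r' by simp
  have "4 * (r * r') = (2 * a * x * x' + b * (x * y' + x' * y) + 2 * c * y * y')^2 - (b^2 - 4 * a * c) * (x * y' - x' * y)^2"
    unfolding r(1)[symmetric] r'(1)[symmetric] e by (simp add: power2_eq_square algebra_simps)
  then have id: "4 * (r * r') = (2 * a * x * x' + b * (x * y' + x' * y) + 2 * c * y * y')^2 + d * \<Delta> * (x * y' - x' * y)^2"
    unfolding disc by simp
  have "kronecker \<Delta> (r * r') = 1"
    by (rule kronecker_norm_value[OF \<Delta> _ _ d(2) id]) (use r r' r0 r'0 in auto)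
  then have "kronecker \<Delta> r * kronecker \<Delta> r' = 1" using kronecker_mult[OF r0 r'0] by simp
  then have "kronecker \<Delta> r' = kronecker \<Delta> r"
    using kronecker_coprime_range[OF r0 r(2)] kronecker_coprime_range[OF r'0 r'(2)] by auto
  then show "genus_char \<Delta> Q = kronecker \<Delta> r" using g by (simp add: e r'_def)
qed

lemma is_discriminant_square_mult: "is_discriminant D \<Longrightarrow> is_discriminant (k^2 * D)"
proof -
  assume D: "is_discriminant D"
  have "k mod 4 = 0 \<or> k mod 4 = 1 \<or> k mod 4 = 2 \<or> k mod 4 = 3" by presburger
  moreover have "k^2 mod 4 = (k mod 4)^2 mod 4" by (simp only: power_mod)
  ultimately have "k^2 mod 4 = 0 \<or> k^2 mod 4 = 1" by auto
  moreover define s where "s = k^2"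
  moreover have "(s * D) mod 4 = ((s mod 4) * (D mod 4)) mod 4" by (simp only: mod_mult_eq)
  ultimately show ?thesis using D unfolding is_discriminant_def s_def by fastforce
qed

text \<open>The new form represents (det M)^2 r, whose symbol agrees with that of r because det M is
  coprime to \<Delta>. Common divisors with \<Delta> persist under the substitution, which settles
  the value 0.\<close>

lemma genus_char_act:
  assumes \<Delta>: "fundamental_discriminant \<Delta>" "\<Delta> > 1" and d: "d > 0" "is_discriminant (- d)"
    and Q: "Q \<in> forms_of (d * \<Delta>)" and M: "det M > 0" "coprime (det M) \<Delta>"
  shows "genus_char \<Delta> (form_act Q M) = genus_char \<Delta> Q"
proof -
  obtain a b c where e: "Q = (a, b, c)" by (cases Q)
  obtain a' b' c' where e': "form_act Q M = (a', b', c')" by (cases "form_act Q M")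
  have D: "d * \<Delta> > 0" using \<Delta> d by simp
  show ?thesis
  proof (cases "Gcd {a, b, c, \<Delta>} = 1")
    case True
    then obtain x y where xy: "coprime (form_eval Q x y) \<Delta>"
      using ex_coprime_value[of \<Delta> a b c] \<Delta> by (auto simp: e)
    define r where "r = form_eval Q x y"
    have 1: "genus_char \<Delta> Q = kronecker \<Delta> r" "r > 0"
      using genus_char_eq[OF \<Delta> d Q] xy by (auto simp: r_def)
    \<comment> \<open>The adjoint of M applied to (x, y); M maps it to det M times (x, y).\<close>
    let ?x = "M$2$2 * x - M$1$2 * y" and ?y = "M$1$1 * y - M$2$1 * x"
    have "form_eval (form_act Q M) ?x ?y = form_eval Q (det M * x) (det M * y)"
      unfolding form_eval_act by (rule arg_cong2[of _ _ _ _ "form_eval Q"]) (simp_all add: det_2 algebra_simps)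
    also have "\<dots> = (det M)^2 * r" by (simp add: r_def e power2_eq_square algebra_simps)
    finally have ev: "form_eval (form_act Q M) ?x ?y = (det M)^2 * r" .
    have cop: "coprime ((det M)^2 * r) \<Delta>" using M xy by (simp add: r_def)
    have F: "form_act Q M \<in> forms_of (((det M)^2 * d) * \<Delta>)"
      using form_act_forms_of[OF D Q] M by (simp add: mult.assoc)
    have d': "(det M)^2 * d > 0" "is_discriminant (- ((det M)^2 * d))"
      using d M is_discriminant_square_mult[OF d(2), of "det M"] by auto
    have "genus_char \<Delta> (form_act Q M) = kronecker \<Delta> ((det M)^2 * r)"
      by (rule genus_char_eq(1)[OF \<Delta> d' F ev cop])
    also have "\<dots> = kronecker \<Delta> (det M) * kronecker \<Delta> (det M) * kronecker \<Delta> r"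
      using M 1 by (simp add: power2_eq_square kronecker_mult)
    also have "kronecker \<Delta> (det M) * kronecker \<Delta> (det M) = 1"
      using kronecker_coprime_range[OF M] by auto
    finally show ?thesis using 1 by simp
  next
    case False
    then obtain g where g: "\<not> is_unit g" "g dvd a" "g dvd b" "g dvd c" "g dvd \<Delta>" by (rule Gcd_4_nontrivial)
    have "a' = a * (M$1$1)^2 + b * (M$1$1 * M$2$1) + c * (M$2$1)^2"
      "b' = a * (2 * M$1$1 * M$1$2) + b * (M$1$1 * M$2$2 + M$1$2 * M$2$1) + c * (2 * M$2$1 * M$2$2)"
      "c' = a * (M$1$2)^2 + b * (M$1$2 * M$2$2) + c * (M$2$2)^2"
      using e' by (simp_all add: e algebra_simps)
    then have "g dvd a'" "g dvd b'" "g dvd c'" using g by (simp_all only: dvd_add dvd_mult2)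
    then show ?thesis unfolding e' unfolding e using g by (simp only: genus_char_eq_0I)
  qed
qed

lemma genus_char_smult:
  assumes \<Delta>: "fundamental_discriminant \<Delta>" "\<Delta> > 1" and d: "d > 0" "is_discriminant (- d)"
    and Q: "Q \<in> forms_of (d * \<Delta>)" and k: "k > 0" "coprime k \<Delta>"
  shows "genus_char \<Delta> (form_smult k Q) = kronecker \<Delta> k * genus_char \<Delta> Q"
proof -
  obtain a b c where e: "Q = (a, b, c)" by (cases Q)
  have D: "d * \<Delta> > 0" using \<Delta> d by simp
  show ?thesis
  proof (cases "Gcd {a, b, c, \<Delta>} = 1")
    case True
    then obtain x y where xy: "coprime (form_eval Q x y) \<Delta>"
      using ex_coprime_value[of \<Delta> a b c] \<Delta> by (auto simp: e)
    define r where "r = form_eval Q x y"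
    have 1: "genus_char \<Delta> Q = kronecker \<Delta> r" "r > 0"
      using genus_char_eq[OF \<Delta> d Q] xy by (auto simp: r_def)
    have ev: "form_eval (form_smult k Q) x y = k * r" by (simp add: form_eval_smult r_def)
    have cop: "coprime (k * r) \<Delta>" using k xy by (simp add: r_def)
    have F: "form_smult k Q \<in> forms_of ((k^2 * d) * \<Delta>)"
      using form_smult_forms_of[OF D k(1)] Q by (simp add: mult.assoc)
    have d': "k^2 * d > 0" "is_discriminant (- (k^2 * d))"
      using d k is_discriminant_square_mult[OF d(2), of k] by auto
    have "genus_char \<Delta> (form_smult k Q) = kronecker \<Delta> (k * r)"
      by (rule genus_char_eq(1)[OF \<Delta> d' F ev cop])
    then show ?thesis using 1 k by (simp add: kronecker_mult)
  next
    case False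
    then obtain g where g: "\<not> is_unit g" "g dvd a" "g dvd b" "g dvd c" "g dvd \<Delta>" by (rule Gcd_4_nontrivial)
    then have "genus_char \<Delta> (k * a, k * b, k * c) = 0" by (intro genus_char_eq_0I[of g] dvd_mult)
    moreover have "genus_char \<Delta> (a, b, c) = 0" using g by (rule genus_char_eq_0I)
    ultimately show ?thesis unfolding e form_smult.simps by simp
  qed
qed

section \<open>Forms divisible by a square after a Hecke translation\<close>

lemma card_dvd_linear:
  fixes x y :: int
  assumes p: "prime p" and y: "\<not> int p dvd y"
  shows "card {j \<in> {0..<int p}. int p dvd x + j * y} = 1"
proof -
  obtain j where j: "j \<in> {0..<int p}" "int p dvd x + j * y" using ex_dvd_linear[OF p y] by blast
  have "{j \<in> {0..<int p}. int p dvd x + j * y} = {j}"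
  proof (intro equalityI subsetI)
    fix i assume i: "i \<in> {j \<in> {0..<int p}. int p dvd x + j * y}"
    then have "int p dvd (x + i * y) - (x + j * y)" using j by (intro dvd_diff) auto
    then have "int p dvd (i - j) * y" by (simp add: algebra_simps)
    then have "int p dvd i - j" using y p by (simp add: prime_dvd_mult_iff)
    then have "i mod int p = j mod int p" by (simp add: mod_eq_dvd_iff)
    then show "i \<in> {j}" using i j by simp
  qed (use j in auto)
  then show ?thesis by simp
qed

text \<open>The number of A in \<open>hecke_right p\<close> for which the translated form is
  divisible by p^2, with the condition written out in coefficients: the first summand belongs to
  \<open>mat2 1 0 0 p\<close>, the others to \<open>mat2 p (-j) 0 1\<close>.\<close>

definition square_divisible_count :: "nat \<Rightarrow> bqf \<Rightarrow> nat" where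
  "square_divisible_count p = (\<lambda>(a, b, c). (if int p ^ 2 dvd a \<and> int p dvd b then 1 else 0) +
     card {j \<in> {0..<int p}. int p dvd b - 2 * a * j \<and> int p ^ 2 dvd a * j^2 - b * j + c})"

lemma interval_0_2: "{0..<int 2} = {0, 1}"
  by auto

lemma card_filter_0_1: "card {j \<in> {0, 1 :: int}. R j} = (if R 0 then 1 else 0) + (if R 1 then 1 else 0)"
proof -
  have "{j \<in> {0, 1 :: int}. R j} = (if R 0 then {0} else {}) \<union> (if R 1 then {1} else {})" by auto
  then show ?thesis by simp
qed

text \<open>Modulo an odd p the form is a nonzero multiple of the square of a linear form, so it has
  a single zero on the projective line. At this zero the divisibility of the discriminant by p^2
  lifts divisibility by p to divisibility by p^2.\<close>

lemma square_divisible_count_primitive: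
  assumes p: "prime p" and prim: "\<not> (int p dvd a \<and> int p dvd b \<and> int p dvd c)"
    and disc: "b^2 - 4 * a * c = int p ^ 2 * E" and E: "is_discriminant E"
  shows "square_divisible_count p (a, b, c) = 1"
proof (cases "p = 2")
  case False
  have pp: "prime (int p)" using p by simp
  have odd: "\<not> int p dvd 2" using False p by (metis int_dvd_int_iff of_nat_numeral primes_dvd_imp_eq two_is_prime_nat)
  have odd4: "\<not> int p dvd 4" using odd pp prime_dvd_mult_iff[of "int p" 2 2] by simp
  show ?thesis
  proof (cases "int p dvd a")
    case True
    have "b^2 = int p ^ 2 * E + 4 * a * c" using disc by simp
    then have "int p dvd b^2" using True by (simp add: power2_eq_square)
    then have pb: "int p dvd b" using pp prime_dvd_power by blast
    then have pc: "\<not> int p dvd c" using prim True by blast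
    have "4 * a * c = b^2 - int p ^ 2 * E" using disc by simp
    moreover have "int p ^ 2 dvd b^2 - int p ^ 2 * E" using pb by (intro dvd_diff dvd_power_same) auto
    ultimately have "int p ^ 2 dvd (4 * c) * a" by (simp add: mult_ac)
    moreover have "coprime (int p ^ 2) (4 * c)"
      using pp odd4 pc by (intro coprime_power_left_iff[THEN iffD2] disjI1 prime_imp_coprime) (auto simp: prime_dvd_mult_iff)
    ultimately have pa: "int p ^ 2 dvd a" by (simp add: coprime_dvd_mult_right_iff)
    have no: "\<not> int p ^ 2 dvd a * j^2 - b * j + c" for j
    proof
      assume "int p ^ 2 dvd a * j^2 - b * j + c"
      then have "int p dvd a * j^2 - b * j + c" by (metis dvd_mult_left power2_eq_square)
      moreover have "int p dvd a * j^2 - b * j" using True pb by simp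
      ultimately show False using pc by (simp add: dvd_add_right_iff)
    qed
    show ?thesis using pa pb no by (simp add: square_divisible_count_def)
  next
    case False
    then have "\<not> int p ^ 2 dvd a" by (metis dvd_mult_left power2_eq_square)
    have iff: "int p dvd b - 2 * a * j \<and> int p ^ 2 dvd a * j^2 - b * j + c \<longleftrightarrow> int p dvd b + j * (- 2 * a)" for j
    proof -
      have "int p ^ 2 dvd a * j^2 - b * j + c" if h: "int p dvd b - 2 * a * j"
      proof -
        have "(4 * a) * (a * j^2 - b * j + c) = (b - 2 * a * j)^2 - (b^2 - 4 * a * c)"
          by (simp add: power2_eq_square algebra_simps)
        also have "int p ^ 2 dvd (b - 2 * a * j)^2 - (b^2 - 4 * a * c)"
          unfolding disc using dvd_power_same[OF h, of 2] by (intro dvd_diff dvd_triv_left)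
        finally have "int p ^ 2 dvd (4 * a) * (a * j^2 - b * j + c)" .
        moreover have "coprime (int p ^ 2) (4 * a)"
          using pp odd4 False by (intro coprime_power_left_iff[THEN iffD2] disjI1 prime_imp_coprime) (auto simp: prime_dvd_mult_iff)
        ultimately show ?thesis by (simp add: coprime_dvd_mult_right_iff)
      qed
      then show ?thesis by (auto simp: algebra_simps)
    qed
    have "\<not> int p dvd - 2 * a" using odd False pp by (simp add: prime_dvd_mult_iff)
    then show ?thesis using card_dvd_linear[OF p, of "- 2 * a" b] \<open>\<not> int p ^ 2 dvd a\<close>
      by (simp only: square_divisible_count_def case_prod_conv iff) simp
  qed
next
  case True
  have "even (b^2)"
  proof -
    have "b^2 = 2 * (2 * E + 2 * a * c)" using disc True by simp
    then show ?thesis by simp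
  qed
  then obtain b' where b: "b = 2 * b'" by (auto elim: evenE)
  have eE: "E = b'^2 - a * c" using disc True by (simp add: b power_mult_distrib)
  \<comment> \<open>For p = 2 all conditions depend on a, b/2 and c modulo 4 only, which leaves a
    finite check.\<close>
  define x y z where "x = a mod 4" and "y = b' mod 4" and "z = c mod 4"
  have r: "x = 0 \<or> x = 1 \<or> x = 2 \<or> x = 3" "y = 0 \<or> y = 1 \<or> y = 2 \<or> y = 3" "z = 0 \<or> z = 1 \<or> z = 2 \<or> z = 3"
    unfolding x_def y_def z_def by presburger+
  have "[E = y^2 - x * z] (mod 4)" unfolding eE x_def y_def z_def by (intro cong_diff cong_mult cong_pow) auto
  then have E4: "E mod 4 = (y^2 - x * z) mod 4" by (simp only: cong_def)
  have "[a - 2 * b' + c = x - 2 * y + z] (mod 4)" unfolding x_def y_def z_def by (intro cong_add cong_diff cong_mult) auto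
  then have s4: "4 dvd a - 2 * b' + c \<longleftrightarrow> (x - 2 * y + z) mod 4 = 0" by (simp only: cong_def dvd_eq_mod_eq_0)
  have a4: "4 dvd a \<longleftrightarrow> x = 0" "4 dvd c \<longleftrightarrow> z = 0" by (simp_all add: x_def z_def dvd_eq_mod_eq_0)
  have "x mod 2 = a mod 2" "z mod 2 = c mod 2" unfolding x_def z_def by (simp_all add: mod_mod_cancel)
  then have nz: "\<not> (x mod 2 = 0 \<and> z mod 2 = 0)" using prim True b by (simp add: even_iff_mod_2_eq_zero)
  have cnt: "square_divisible_count p (a, b, c) = (if x = 0 then 1 else 0) + ((if z = 0 then 1 else 0) + (if (x - 2 * y + z) mod 4 = 0 then 1 else 0))"
  proof -
    have "square_divisible_count p (a, b, c) = (if 4 dvd a then 1 else 0) + card {j \<in> {0, 1}. 4 dvd a * j^2 - b * j + c}"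
      unfolding square_divisible_count_def True interval_0_2 by (simp add: b)
    also have "card {j \<in> {0, 1}. 4 dvd a * j^2 - b * j + c} = (if 4 dvd c then 1 else 0) + (if 4 dvd a - 2 * b' + c then 1 else 0)"
      unfolding card_filter_0_1 by (simp add: b)
    finally show ?thesis unfolding s4 a4 .
  qed
  have "(y^2 - x * z) mod 4 = 0 \<or> (y^2 - x * z) mod 4 = 1" using E unfolding is_discriminant_def E4 .
  then show ?thesis unfolding cnt using r nz by (elim disjE) simp_all
qed

lemma square_divisible_count_smult:
  assumes p: "prime p"
  shows "square_divisible_count p (int p * a, int p * b, int p * c)
    = (if int p dvd a then 1 else 0) + card {j \<in> {0..<int p}. int p dvd a * j^2 - b * j + c}"
proof -
  have p0: "int p \<noteq> 0" using p by auto
  have 1: "int p ^ 2 dvd int p * x \<longleftrightarrow> int p dvd x" for x using p0 by (simp add: power2_eq_square)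
  have 2: "int p * a * j^2 - int p * b * j + int p * c = int p * (a * j^2 - b * j + c)" for j by (simp add: algebra_simps)
  have 3: "int p dvd int p * b - 2 * (int p * a) * j" for j by (intro dvd_diff) auto
  show ?thesis unfolding square_divisible_count_def case_prod_conv 1 2 using 3 by simp
qed

text \<open>The left side counts the zeros on the projective line over the field with p elements,
  the first summand standing for the point at infinity. For odd p one completes the square; for p =
  2 and odd b the discriminant modulo 8 detects the parity of a c.\<close>

lemma root_count_mod_prime:
  assumes p: "prime p" and prim: "\<not> (int p dvd a \<and> int p dvd b \<and> int p dvd c)"
  shows "int ((if int p dvd a then 1 else 0) + card {j \<in> {0..<int p}. int p dvd a * j^2 - b * j + c})
    = 1 + kronecker_prime (b^2 - 4 * a * c) (int p)"
proof (cases "p = 2")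
  case False
  have pp: "prime (int p)" using p by simp
  have odd: "\<not> int p dvd 2" using False p by (metis int_dvd_int_iff of_nat_numeral primes_dvd_imp_eq two_is_prime_nat)
  have odd4: "\<not> int p dvd 4" using odd pp prime_dvd_mult_iff[of "int p" 2 2] by simp
  define \<delta> where "\<delta> = b^2 - 4 * a * c"
  have kp: "kronecker_prime x (int p) = Legendre x (int p)" for x using False by (simp add: kronecker_prime_def)
  show ?thesis
  proof (cases "int p dvd a")
    case True
    have c1: "[\<delta> = b^2] (mod int p)" using True by (simp add: \<delta>_def cong_iff_dvd_diff)
    have red: "int p dvd a * j^2 - b * j + c \<longleftrightarrow> int p dvd c + j * (- b)" for j
    proof -
      have e: "a * j^2 - b * j + c = a * j^2 + (c + j * (- b))" by (simp add: algebra_simps)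
      show ?thesis unfolding e using True by (simp add: dvd_add_right_iff)
    qed
    show ?thesis
    proof (cases "int p dvd b")
      case False
      then have "Legendre \<delta> (int p) = 1" using Legendre_cong[OF c1] Legendre_square[OF False pp] by simp
      moreover have "card {j \<in> {0..<int p}. int p dvd c + j * (- b)} = 1"
        using False by (intro card_dvd_linear p) simp
      ultimately show ?thesis using True kp by (simp only: red \<delta>_def) simp
    next
      case pb: True
      then have "int p dvd \<delta>" using True by (simp add: \<delta>_def power2_eq_square)
      then have "Legendre \<delta> (int p) = 0" by (simp add: Legendre_eq_0_iff)
      moreover have "\<not> int p dvd c + j * (- b)" for j
      proof -
        have "int p dvd j * (- b)" using pb by simp
        then show ?thesis using prim True pb by (simp only: dvd_add_left_iff) simp
      qed
      ultimately show ?thesis using True kp by (simp only: red \<delta>_def) simp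
    qed
  next
    case na: False
    have n2a: "\<not> int p dvd 2 * a" "\<not> int p dvd 4 * a" using na odd odd4 pp by (simp_all add: prime_dvd_mult_iff)
    have red: "int p dvd a * j^2 - b * j + c \<longleftrightarrow> int p dvd (- b + j * (2 * a))^2 - \<delta>" for j
    proof -
      have "(- b + j * (2 * a))^2 - \<delta> = (4 * a) * (a * j^2 - b * j + c)"
        by (simp add: \<delta>_def power2_eq_square algebra_simps)
      then show ?thesis using n2a pp by (simp add: prime_dvd_mult_iff)
    qed
    let ?S = "{j \<in> {0..<int p}. int p dvd (- b + j * (2 * a))^2 - \<delta>}"
    have cS: "int (card ?S) = 1 + Legendre \<delta> (int p)"
    proof (cases "int p dvd \<delta>")
      case True
      have "int p dvd (- b + j * (2 * a))^2 - \<delta> \<longleftrightarrow> int p dvd - b + j * (2 * a)" for j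
      proof -
        have "int p dvd (- b + j * (2 * a))^2 - \<delta> \<longleftrightarrow> int p dvd (- b + j * (2 * a))^2"
          using True by (simp add: dvd_diff_left_iff)
        then show ?thesis using prime_dvd_power_iff[OF pp] by simp
      qed
      then have "card ?S = 1" using card_dvd_linear[OF p n2a(1), of "- b"] by simp
      moreover have "Legendre \<delta> (int p) = 0" using True by (simp add: Legendre_eq_0_iff)
      ultimately show ?thesis by simp
    next
      case nd: False
      show ?thesis
      proof (cases "QuadRes (int p) \<delta>")
        case True
        then obtain y where y: "int p dvd y^2 - \<delta>" by (auto simp: QuadRes_def cong_iff_dvd_diff)
        have ny: "\<not> int p dvd y"
        proof
          assume "int p dvd y"
          then have "int p dvd y^2" by (simp add: power2_eq_square)
          then have "int p dvd y^2 - (y^2 - \<delta>)" using y by (rule dvd_diff)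
          then show False using nd by simp
        qed
        let ?A = "\<lambda>t. {j \<in> {0..<int p}. int p dvd t + j * (2 * a)}"
        have iff: "int p dvd w^2 - \<delta> \<longleftrightarrow> int p dvd w - y \<or> int p dvd w + y" for w
        proof -
          have "w^2 - \<delta> = (w - y) * (w + y) + (y^2 - \<delta>)" by (simp add: power2_eq_square algebra_simps)
          then have "int p dvd w^2 - \<delta> \<longleftrightarrow> int p dvd (w - y) * (w + y)" using y by (simp only: dvd_add_left_iff)
          then show ?thesis using pp by (simp add: prime_dvd_mult_iff)
        qed
        have "?S = ?A (- b - y) \<union> ?A (- b + y)" unfolding iff by (auto simp: algebra_simps)
        moreover have "?A (- b - y) \<inter> ?A (- b + y) = {}"
        proof -
          have False if "int p dvd - b - y + j * (2 * a)" "int p dvd - b + y + j * (2 * a)" for j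
          proof -
            have "int p dvd (- b + y + j * (2 * a)) - (- b - y + j * (2 * a))" using that by (intro dvd_diff)
            then have "int p dvd 2 * y" by simp
            then show False using ny odd pp by (simp add: prime_dvd_mult_iff)
          qed
          then show ?thesis by blast
        qed
        moreover have "finite (?A t)" for t by (rule finite_subset[of _ "{0..<int p}"]) auto
        ultimately have "card ?S = card (?A (- b - y)) + card (?A (- b + y))" by (simp add: card_Un_disjoint)
        then have "card ?S = 2" using card_dvd_linear[OF p n2a(1)] by simp
        moreover have "Legendre \<delta> (int p) = 1" using True nd by (simp add: Legendre_def cong_0_iff)
        ultimately show ?thesis by simp
      next
        case False
        then have "\<not> int p dvd w^2 - \<delta>" for w by (auto simp: QuadRes_def cong_iff_dvd_diff)
        then have "card ?S = 0" by simp
        moreover have "Legendre \<delta> (int p) = -1" using False nd by (simp add: Legendre_def cong_0_iff)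
        ultimately show ?thesis by simp
      qed
    qed
    show ?thesis using cS na kp by (simp only: red \<delta>_def) simp
  qed
next
  case True
  have S: "card {j \<in> {0..<int p}. int p dvd a * j^2 - b * j + c} = (if even c then 1 else 0) + (if even (a - b + c) then 1 else 0)"
    unfolding True interval_0_2 card_filter_0_1 by simp
  have E: "even (b^2 - 4 * a * c) \<longleftrightarrow> even b" by simp
  have b8: "(b^2 - 4 * a * c) mod 8 = (if even (a * c) then 1 else 5)" if "odd b"
  proof -
    have "[b = b mod 8] (mod 8)" by simp
    then have "[b^2 = (b mod 8)^2] (mod 8)" by (rule cong_pow)
    then have "[b^2 = 1] (mod 8)" using odd_mod_8[OF that] by (auto simp: cong_def)
    then have "[b^2 - 4 * (a * c) = 1 - 4 * (a * c)] (mod 8)" by (intro cong_diff cong_refl)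
    moreover have "(1 - 4 * x) mod 8 = (if even x then 1 else 5)" for x :: int by presburger
    ultimately show ?thesis by (simp add: cong_def mult.assoc)
  qed
  show ?thesis
  proof (cases "even b")
    case True
    then show ?thesis using prim \<open>p = 2\<close> unfolding S by (auto simp: kronecker_prime_2)
  next
    case False
    then show ?thesis using b8[OF False] \<open>p = 2\<close> unfolding S by (auto simp: kronecker_prime_2)
  qed
qed

text \<open>Three cases by divisibility at p: a form not divisible by p gives 1; a form p R gives
  the zeros of R modulo p, where R has discriminant E; for a form p^2 R every one of the p + 1
  translates counts, and the symbol vanishes because p divides E.\<close>

theorem square_divisible_count_eq:
  assumes p: "prime p" and disc: "form_disc Q = int p ^ 2 * E" and E: "is_discriminant E"
  shows "int (square_divisible_count p Q) = 1 +
     (if \<exists>R. Q = form_smult (int p) R then kronecker_prime E (int p) else 0) +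
     (if \<exists>R. Q = form_smult (int p ^ 2) R then int p else 0)"
proof -
  obtain a b c where Q: "Q = (a, b, c)" by (cases Q)
  have p0: "int p \<noteq> 0" using p by auto
  have sm: "(\<exists>R. (x, y, z) = form_smult k R) \<longleftrightarrow> k dvd x \<and> k dvd y \<and> k dvd z" for x y z k
    by (force elim!: dvdE)
  show ?thesis
  proof (cases "int p dvd a \<and> int p dvd b \<and> int p dvd c")
    case False
    then have "\<not> (int p ^ 2 dvd a \<and> int p ^ 2 dvd b \<and> int p ^ 2 dvd c)"
      by (metis dvd_mult_left power2_eq_square)
    moreover have "square_divisible_count p (a, b, c) = 1"
      using disc by (intro square_divisible_count_primitive[OF p False _ E]) (simp add: Q)
    ultimately show ?thesis using False unfolding Q sm by auto
  next
    case True
    then obtain x y z where e: "a = int p * x" "b = int p * y" "c = int p * z" by (auto elim!: dvdE)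
    have "int p ^ 2 * (y^2 - 4 * x * z) = int p ^ 2 * E" using disc unfolding Q e
      by (simp add: power2_eq_square algebra_simps)
    then have xyz: "y^2 - 4 * x * z = E" using p0 by simp
    have sq: "int p ^ 2 dvd int p * t \<longleftrightarrow> int p dvd t" for t using p0 by (simp add: power2_eq_square)
    show ?thesis
    proof (cases "int p dvd x \<and> int p dvd y \<and> int p dvd z")
      case False
      then show ?thesis using root_count_mod_prime[OF p False] True
        unfolding Q sm e square_divisible_count_smult[OF p] xyz sq by auto
    next
      case all: True
      have "int p dvd E" unfolding xyz[symmetric] using all by (simp add: power2_eq_square)
      then have "kronecker_prime E (int p) = 0" using p by (simp add: kronecker_prime_eq_0_iff)
      moreover have "card {j \<in> {0..<int p}. int p dvd x * j^2 - y * j + z} = p"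
      proof -
        have "int p dvd x * j^2 - y * j + z" for j using all by simp
        then have "{j \<in> {0..<int p}. int p dvd x * j^2 - y * j + z} = {0..<int p}" by auto
        then show ?thesis by simp
      qed
      ultimately show ?thesis using all True
        unfolding Q sm e square_divisible_count_smult[OF p] sq by simp
    qed
  qed
qed

section \<open>The Hecke operator on twisted traces\<close>

definition orbit_of :: "complex \<Rightarrow> complex set" where
  "orbit_of z = (\<lambda>\<gamma>. moebius \<gamma> z) ` SL2Z"

text \<open>Chosen from the orbit as a set, hence the same for all its points; it takes the place of
  a fundamental domain.\<close>

definition orbit_rep :: "complex \<Rightarrow> complex" where
  "orbit_rep z = (SOME w. w \<in> orbit_of z)"

definition is_rep :: "complex \<Rightarrow> bool" where
  "is_rep z \<longleftrightarrow> orbit_rep z = z"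

text \<open>The stabilizer is taken in \<open>SL2Z\<close>, so twice this weight is the reciprocal
  of \<open>form_omega\<close>. Attached to a point rather than to a form, it is shared by a form
  and its multiples.\<close>

definition rep_weight :: "complex \<Rightarrow> complex" where
  "rep_weight z = 1 / of_nat (card {\<gamma> \<in> SL2Z. moebius \<gamma> z = z})"

definition rep_forms :: "int \<Rightarrow> bqf set" where
  "rep_forms D = {Q \<in> forms_of D. is_rep (form_root Q)}"

lemma moebius_mult_SL2Z: "Im z > 0 \<Longrightarrow> B \<in> SL2Z \<Longrightarrow> moebius (A ** B) z = moebius A (moebius B z)"
  by (rule moebius_mult) (auto simp: SL2Z_def)

lemma orbit_of_moebius:
  assumes z: "Im z > 0" and \<gamma>: "\<gamma> \<in> SL2Z"
  shows "orbit_of (moebius \<gamma> z) = orbit_of z"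
proof -
  have "orbit_of (moebius \<gamma> z) = (\<lambda>\<delta>. moebius \<delta> z) ` ((\<lambda>\<delta>. \<delta> ** \<gamma>) ` SL2Z)"
    using z \<gamma> by (simp add: orbit_of_def image_image moebius_mult_SL2Z)
  then show ?thesis using bij_betw_SL2Z_right[OF \<gamma>] by (simp add: bij_betw_def orbit_of_def)
qed

lemma orbit_rep_moebius: "Im z > 0 \<Longrightarrow> \<gamma> \<in> SL2Z \<Longrightarrow> orbit_rep (moebius \<gamma> z) = orbit_rep z"
  by (simp add: orbit_rep_def orbit_of_moebius)

lemma orbit_rep_obtain:
  obtains \<gamma> where "\<gamma> \<in> SL2Z" "orbit_rep z = moebius \<gamma> z"
proof -
  have "moebius (mat 1) z \<in> orbit_of z" unfolding orbit_of_def by (rule imageI) simp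
  then have "orbit_rep z \<in> orbit_of z" unfolding orbit_rep_def by (rule someI)
  then show ?thesis using that by (auto simp: orbit_of_def)
qed

lemma is_rep_moebius_iff:
  "Im z > 0 \<Longrightarrow> \<gamma> \<in> SL2Z \<Longrightarrow> is_rep (moebius \<gamma> z) \<longleftrightarrow> moebius \<gamma> z = orbit_rep z"
  unfolding is_rep_def by (subst orbit_rep_moebius) auto

lemma card_transporter:
  assumes z: "Im z > 0" and \<gamma>0: "\<gamma>0 \<in> SL2Z"
  shows "bij_betw (\<lambda>\<delta>. \<delta> ** \<gamma>0) {\<delta> \<in> SL2Z. moebius \<delta> (moebius \<gamma>0 z) = moebius \<gamma>0 z} {\<gamma> \<in> SL2Z. moebius \<gamma> z = moebius \<gamma>0 z}"
    "bij_betw (\<lambda>\<delta>. \<gamma>0 ** \<delta>) {\<delta> \<in> SL2Z. moebius \<delta> z = z} {\<gamma> \<in> SL2Z. moebius \<gamma> z = moebius \<gamma>0 z}"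
proof -
  let ?w = "moebius \<gamma>0 z"
  have w: "Im ?w > 0" using Im_moebius_SL2Z[OF z \<gamma>0] .
  show "bij_betw (\<lambda>\<delta>. \<delta> ** \<gamma>0) {\<delta> \<in> SL2Z. moebius \<delta> ?w = ?w} {\<gamma> \<in> SL2Z. moebius \<gamma> z = ?w}"
    by (rule bij_betwI[of _ _ _ "\<lambda>\<gamma>. \<gamma> ** adj2 \<gamma>0"])
      (use z w \<gamma>0 in \<open>auto simp: SL2Z_mult SL2Z_adj2 SL2Z_cancel moebius_mult_SL2Z moebius_adj2_cancel\<close>)
  show "bij_betw (\<lambda>\<delta>. \<gamma>0 ** \<delta>) {\<delta> \<in> SL2Z. moebius \<delta> z = z} {\<gamma> \<in> SL2Z. moebius \<gamma> z = ?w}"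
    by (rule bij_betwI[of _ _ _ "\<lambda>\<gamma>. adj2 \<gamma>0 ** \<gamma>"])
      (use z w \<gamma>0 in \<open>auto simp: SL2Z_mult SL2Z_adj2 SL2Z_cancel moebius_mult_SL2Z moebius_adj2_cancel\<close>)
qed

lemma rep_weight_moebius:
  assumes "Im z > 0" "\<gamma> \<in> SL2Z"
  shows "rep_weight (moebius \<gamma> z) = rep_weight z"
  using bij_betw_same_card[OF card_transporter(1)[OF assms]] bij_betw_same_card[OF card_transporter(2)[OF assms]]
  by (simp add: rep_weight_def)

lemma stab_root_eq:
  assumes "D > 0" "Q \<in> forms_of D"
  shows "{\<gamma> \<in> SL2Z. moebius \<gamma> (form_root Q) = form_root Q} = form_stab Q"
  using form_stab_root[OF assms] by (auto simp: form_stab_def)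

lemma rep_weight_root:
  assumes "D > 0" "Q \<in> forms_of D"
  shows "2 * rep_weight (form_root Q) = 1 / of_nat (form_omega Q)"
  using form_omega_eq[OF assms] by (simp add: rep_weight_def stab_root_eq[OF assms])

lemma form_root_act_SL2Z:
  "D > 0 \<Longrightarrow> Q \<in> forms_of D \<Longrightarrow> \<gamma> \<in> SL2Z \<Longrightarrow> form_root (form_act Q \<gamma>) = moebius (adj2 \<gamma>) (form_root Q)"
  by (rule form_root_act) (auto simp: SL2Z_def)

text \<open>The \<gamma> that carry the root to the representative of its orbit correspond to a
  coset of the stabilizer. This 1 can be inserted into any invariant sum to turn it into a sum over
  group elements.\<close>

lemma sum_rep_weight:
  assumes D: "D > 0" and Q: "Q \<in> forms_of D"
  shows "finite {\<gamma> \<in> SL2Z. is_rep (form_root (form_act Q \<gamma>))}"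
    "(\<Sum>\<gamma>\<in>{\<gamma> \<in> SL2Z. is_rep (form_root (form_act Q \<gamma>))}. rep_weight (form_root (form_act Q \<gamma>))) = 1"
proof -
  let ?z = "form_root Q" and ?S = "{\<gamma> \<in> SL2Z. is_rep (form_root (form_act Q \<gamma>))}"
  have z: "Im ?z > 0" using Im_form_root_pos[OF D Q] .
  obtain \<gamma>0 where \<gamma>0: "\<gamma>0 \<in> SL2Z" "orbit_rep ?z = moebius \<gamma>0 ?z" by (rule orbit_rep_obtain)
  let ?T = "{\<gamma> \<in> SL2Z. moebius \<gamma> ?z = moebius \<gamma>0 ?z}"
  have bij: "bij_betw adj2 ?S ?T"
    by (rule bij_betwI[of _ _ _ adj2])
      (use z \<gamma>0 in \<open>auto simp: SL2Z_adj2 form_root_act_SL2Z[OF D Q] is_rep_moebius_iff\<close>)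
  have fin: "finite (form_stab Q)" "form_stab Q \<noteq> {}"
    using finite_form_stab[OF D Q] by (auto simp: form_stab_def intro!: exI[of _ "mat 1"])
  have bT: "bij_betw (\<lambda>\<delta>. \<gamma>0 ** \<delta>) (form_stab Q) ?T"
    using card_transporter(2)[OF z \<gamma>0(1)] by (simp only: stab_root_eq[OF D Q])
  have finT: "finite ?T" using bij_betw_finite[OF bT] fin by simp
  then show "finite ?S" using bij_betw_finite[OF bij] by simp
  have "(\<Sum>\<gamma>\<in>?S. rep_weight (form_root (form_act Q \<gamma>))) = (\<Sum>\<gamma>\<in>?S. rep_weight ?z)"
    by (rule sum.cong) (auto simp: form_root_act_SL2Z[OF D Q] rep_weight_moebius z SL2Z_adj2)
  also have "\<dots> = of_nat (card (form_stab Q)) * rep_weight ?z"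
    using bij_betw_same_card[OF bij] bij_betw_same_card[OF bT] by simp
  also have "\<dots> = 1" using fin by (simp add: rep_weight_def stab_root_eq[OF D Q])
  finally show "(\<Sum>\<gamma>\<in>?S. rep_weight (form_root (form_act Q \<gamma>))) = 1" .
qed

text \<open>A form of given discriminant is determined by its root, so each class contains exactly
  one form whose root is the chosen point of its orbit.\<close>

lemma bij_betw_rep_forms:
  assumes D: "D > 0"
  shows "bij_betw (\<lambda>Q. form_act Q ` SL2Z) (rep_forms D) (form_classes D)"
  unfolding bij_betw_def
proof
  show "inj_on (\<lambda>Q. form_act Q ` SL2Z) (rep_forms D)"
  proof (rule inj_onI)
    fix Q Q' assume h: "Q \<in> rep_forms D" "Q' \<in> rep_forms D" "form_act Q ` SL2Z = form_act Q' ` SL2Z"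
    then have F: "Q \<in> forms_of D" "Q' \<in> forms_of D" "is_rep (form_root Q)" "is_rep (form_root Q')"
      by (auto simp: rep_forms_def)
    have "Q \<in> form_act Q' ` SL2Z" using form_self_in_orbit[of Q] h(3) by simp
    then obtain g where g: "g \<in> SL2Z" "Q = form_act Q' g" by blast
    have "form_root Q = moebius (adj2 g) (form_root Q')" using form_root_act_SL2Z[OF D F(2) g(1)] g by simp
    then have "orbit_rep (form_root Q) = orbit_rep (form_root Q')"
      using orbit_rep_moebius[OF Im_form_root_pos[OF D F(2)] SL2Z_adj2[OF g(1)]] by simp
    then have "form_root Q = form_root Q'" using F by (simp add: is_rep_def)
    then show "Q = Q'" using form_root_inj[OF D F(1,2)] by simp
  qed
  show "(\<lambda>Q. form_act Q ` SL2Z) ` rep_forms D = form_classes D"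
  proof (intro equalityI subsetI)
    fix C assume "C \<in> form_classes D"
    then obtain Q where Q: "Q \<in> forms_of D" "C = form_act Q ` SL2Z" by (auto simp: form_classes_def)
    have z: "Im (form_root Q) > 0" using Im_form_root_pos[OF D Q(1)] .
    obtain \<gamma> where \<gamma>: "\<gamma> \<in> SL2Z" "orbit_rep (form_root Q) = moebius \<gamma> (form_root Q)" by (rule orbit_rep_obtain)
    let ?Q = "form_act Q (adj2 \<gamma>)"
    have a: "adj2 \<gamma> \<in> SL2Z" using \<gamma> by (simp add: SL2Z_adj2)
    have "form_root ?Q = moebius \<gamma> (form_root Q)" using form_root_act_SL2Z[OF D Q(1) a] by simp
    then have "is_rep (form_root ?Q)" using is_rep_moebius_iff[OF z \<gamma>(1)] \<gamma>(2) by simp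
    then have "?Q \<in> rep_forms D" using form_act_SL2Z[OF D Q(1) a] by (simp add: rep_forms_def)
    moreover have "form_act ?Q ` SL2Z = C" unfolding Q(2) by (rule form_orbit_eq) (use a in blast)
    ultimately show "C \<in> (\<lambda>Q. form_act Q ` SL2Z) ` rep_forms D" by blast
  qed (auto simp: rep_forms_def form_classes_def)
qed

lemma finite_rep_forms: "D > 0 \<Longrightarrow> finite (rep_forms D)"
  using bij_betw_finite[OF bij_betw_rep_forms] finite_form_classes by blast

text \<open>The factor 2 compensates for stabilizers taken in \<open>SL2Z\<close> instead of
  \<open>PSL2Z\<close>.\<close>

lemma twisted_trace_eq:
  assumes \<Delta>: "fundamental_discriminant \<Delta>" "\<Delta> > 1" and d: "d > 0" "is_discriminant (- int d)"
    and g: "\<And>z \<gamma>. Im z > 0 \<Longrightarrow> \<gamma> \<in> SL2Z \<Longrightarrow> g (moebius \<gamma> z) = g z"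
  shows "twisted_trace \<Delta> d g =
    2 * (\<Sum>Q\<in>rep_forms (int d * \<Delta>). of_int (genus_char \<Delta> Q) * g (form_root Q) * rep_weight (form_root Q))"
proof -
  let ?D = "int d * \<Delta>"
  have D: "?D > 0" using \<Delta> d by simp
  let ?f = "\<lambda>Q. of_int (genus_char \<Delta> Q) / of_nat (form_omega Q) * g (form_root Q)"
  have inv: "?f (form_act Q \<gamma>) = ?f Q" if Q: "Q \<in> forms_of ?D" and \<gamma>: "\<gamma> \<in> SL2Z" for Q \<gamma>
  proof -
    have z: "Im (form_root Q) > 0" using Im_form_root_pos[OF D Q] .
    have r: "form_root (form_act Q \<gamma>) = moebius (adj2 \<gamma>) (form_root Q)" using form_root_act_SL2Z[OF D Q \<gamma>] .
    have "genus_char \<Delta> (form_act Q \<gamma>) = genus_char \<Delta> Q"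
      using d \<gamma> by (intro genus_char_act[OF \<Delta> _ _ Q]) (auto simp: SL2Z_def)
    moreover have "g (form_root (form_act Q \<gamma>)) = g (form_root Q)" using r g z \<gamma> SL2Z_adj2 by simp
    moreover have "rep_weight (form_root (form_act Q \<gamma>)) = rep_weight (form_root Q)"
      using r rep_weight_moebius z \<gamma> SL2Z_adj2 by simp
    then have "(1 :: complex) / of_nat (form_omega (form_act Q \<gamma>)) = 1 / of_nat (form_omega Q)"
      using rep_weight_root[OF D form_act_SL2Z[OF D Q \<gamma>]] rep_weight_root[OF D Q] by simp
    ultimately show ?thesis by (simp add: divide_inverse)
  qed
  have "twisted_trace \<Delta> d g = (\<Sum>C\<in>form_classes ?D. ?f (SOME Q. Q \<in> C))"
    by (simp add: twisted_trace_def Let_def)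
  also have "\<dots> = (\<Sum>Q\<in>rep_forms ?D. ?f (SOME Q'. Q' \<in> form_act Q ` SL2Z))"
    by (rule sum.reindex_bij_betw[OF bij_betw_rep_forms[OF D], symmetric])
  also have "\<dots> = (\<Sum>Q\<in>rep_forms ?D. ?f Q)"
  proof (rule sum.cong[OF refl])
    fix Q assume "Q \<in> rep_forms ?D"
    then have Q: "Q \<in> forms_of ?D" by (simp add: rep_forms_def)
    have "(SOME Q'. Q' \<in> form_act Q ` SL2Z) \<in> form_act Q ` SL2Z" using form_self_in_orbit by (rule someI)
    then obtain \<gamma> where "\<gamma> \<in> SL2Z" "(SOME Q'. Q' \<in> form_act Q ` SL2Z) = form_act Q \<gamma>" by blast
    then show "?f (SOME Q'. Q' \<in> form_act Q ` SL2Z) = ?f Q" using inv[OF Q] by simp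
  qed
  also have "\<dots> = (\<Sum>Q\<in>rep_forms ?D. 2 * (of_int (genus_char \<Delta> Q) * g (form_root Q) * rep_weight (form_root Q)))"
  proof (rule sum.cong[OF refl])
    fix Q assume "Q \<in> rep_forms ?D"
    then have Q: "Q \<in> forms_of ?D" by (simp add: rep_forms_def)
    have "?f Q = of_int (genus_char \<Delta> Q) * g (form_root Q) * (1 / of_nat (form_omega Q))" by simp
    then show "?f Q = 2 * (of_int (genus_char \<Delta> Q) * g (form_root Q) * rep_weight (form_root Q))"
      unfolding rep_weight_root[OF D Q, symmetric] by simp
  qed
  finally show ?thesis by (simp add: sum_distrib_left)
qed

section \<open>Hecke translates of forms and their traces\<close>

definition rep_mats :: "nat \<Rightarrow> bqf \<Rightarrow> (int^2^2) set" where
  "rep_mats p Q = {M \<in> mats_of_det p. is_rep (form_root (form_act Q M))}"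

text \<open>The weights of \<open>sum_rep_weight\<close> are inserted for each A and the pairs (A,
  \<gamma>) merged into A\<gamma>. The sum then runs over all matrices of determinant p, a set
  stable under the adjoint, which coset representatives are not.\<close>

lemma sum_hecke_right_weighted:
  fixes \<phi> :: "bqf \<Rightarrow> complex"
  assumes p: "prime p" and D: "D > 0" and Q: "Q \<in> forms_of D"
    and \<phi>: "\<And>R \<gamma>. R \<in> forms_of (int p ^ 2 * D) \<Longrightarrow> \<gamma> \<in> SL2Z \<Longrightarrow> \<phi> (form_act R \<gamma>) = \<phi> R"
  shows "finite (rep_mats p Q)"
    "(\<Sum>A\<in>hecke_right p. \<phi> (form_act Q A)) = (\<Sum>M\<in>rep_mats p Q. \<phi> (form_act Q M) * rep_weight (form_root (form_act Q M)))"
proof -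
  have p0: "int p > 0" using prime_gt_0_nat[OF p] by simp
  have D': "int p ^ 2 * D > 0" using p0 D by simp
  have QA: "form_act Q A \<in> forms_of (int p ^ 2 * D)" if "A \<in> hecke_right p" for A
    using form_act_forms_of[OF D Q, of A] det_hecke(2)[OF that] p0 by simp
  let ?G = "\<lambda>A. {\<gamma> \<in> SL2Z. is_rep (form_root (form_act (form_act Q A) \<gamma>))}"
  have bij: "bij_betw (\<lambda>(A, \<gamma>). A ** \<gamma>) (Sigma (hecke_right p) ?G) (rep_mats p Q)"
  proof -
    have "bij_betw (\<lambda>(A, \<gamma>). A ** \<gamma>) {x \<in> hecke_right p \<times> SL2Z. is_rep (form_root (form_act Q (case x of (A, \<gamma>) \<Rightarrow> A ** \<gamma>)))} (rep_mats p Q)"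
      unfolding rep_mats_def bij_betw_def
    proof
      show "inj_on (\<lambda>(A, \<gamma>). A ** \<gamma>) {x \<in> hecke_right p \<times> SL2Z. is_rep (form_root (form_act Q (case x of (A, \<gamma>) \<Rightarrow> A ** \<gamma>)))}"
        using bij_betw_hecke_right[OF p] by (auto simp: bij_betw_def intro: inj_on_subset)
      show "(\<lambda>(A, \<gamma>). A ** \<gamma>) ` {x \<in> hecke_right p \<times> SL2Z. is_rep (form_root (form_act Q (case x of (A, \<gamma>) \<Rightarrow> A ** \<gamma>)))}
          = {M \<in> mats_of_det p. is_rep (form_root (form_act Q M))}"
      proof (intro equalityI subsetI)
        fix M assume M: "M \<in> {M \<in> mats_of_det p. is_rep (form_root (form_act Q M))}"
        then obtain A \<gamma> where "A \<in> hecke_right p" "\<gamma> \<in> SL2Z" "M = A ** \<gamma>"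
          using ex_hecke_right_factor[OF p, of M] by (auto simp: mats_of_det_def)
        then show "M \<in> (\<lambda>(A, \<gamma>). A ** \<gamma>) ` {x \<in> hecke_right p \<times> SL2Z. is_rep (form_root (form_act Q (case x of (A, \<gamma>) \<Rightarrow> A ** \<gamma>)))}"
          using M by (intro image_eqI[of _ _ "(A, \<gamma>)"]) simp_all
      next
        fix M assume "M \<in> (\<lambda>(A, \<gamma>). A ** \<gamma>) ` {x \<in> hecke_right p \<times> SL2Z. is_rep (form_root (form_act Q (case x of (A, \<gamma>) \<Rightarrow> A ** \<gamma>)))}"
        then obtain A \<gamma> where "A \<in> hecke_right p" "\<gamma> \<in> SL2Z" "M = A ** \<gamma>" "is_rep (form_root (form_act Q M))" by auto
        then show "M \<in> {M \<in> mats_of_det p. is_rep (form_root (form_act Q M))}"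
          by (simp add: mats_of_det_def det_mul det_hecke SL2Z_def)
      qed
    qed
    also have "{x \<in> hecke_right p \<times> SL2Z. is_rep (form_root (form_act Q (case x of (A, \<gamma>) \<Rightarrow> A ** \<gamma>)))} = Sigma (hecke_right p) ?G"
      by (auto simp: form_act_mult simp del: form_act.simps)
    finally show ?thesis .
  qed
  have finG: "finite (?G A)" if "A \<in> hecke_right p" for A by (rule sum_rep_weight(1)[OF D' QA[OF that]])
  then have "finite (Sigma (hecke_right p) ?G)" by auto
  then show "finite (rep_mats p Q)" using bij_betw_finite[OF bij] by simp
  have "(\<Sum>A\<in>hecke_right p. \<phi> (form_act Q A)) = (\<Sum>A\<in>hecke_right p. \<Sum>\<gamma>\<in>?G A. \<phi> (form_act Q A) * rep_weight (form_root (form_act (form_act Q A) \<gamma>)))"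
    by (intro sum.cong refl) (simp only: sum_distrib_left[symmetric] sum_rep_weight(2)[OF D' QA] mult_1_right)
  also have "\<dots> = (\<Sum>(A, \<gamma>)\<in>Sigma (hecke_right p) ?G. \<phi> (form_act Q A) * rep_weight (form_root (form_act (form_act Q A) \<gamma>)))"
    using finG by (subst sum.Sigma) auto
  also have "\<dots> = (\<Sum>x\<in>Sigma (hecke_right p) ?G. \<phi> (form_act Q (case x of (A, \<gamma>) \<Rightarrow> A ** \<gamma>)) * rep_weight (form_root (form_act Q (case x of (A, \<gamma>) \<Rightarrow> A ** \<gamma>))))"
    by (intro sum.cong refl) (auto simp: form_act_mult[symmetric] \<phi> QA simp del: form_act.simps)
  also have "\<dots> = (\<Sum>M\<in>rep_mats p Q. \<phi> (form_act Q M) * rep_weight (form_root (form_act Q M)))"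
    by (rule sum.reindex_bij_betw[OF bij])
  finally show "(\<Sum>A\<in>hecke_right p. \<phi> (form_act Q A)) = (\<Sum>M\<in>rep_mats p Q. \<phi> (form_act Q M) * rep_weight (form_root (form_act Q M)))" .
qed

text \<open>An explicit left inverse of \<open>form_smult\<close>, used as the backward map of a
  bijection.\<close>

fun form_sdiv :: "bqf \<Rightarrow> int \<Rightarrow> bqf" where
  "form_sdiv (a, b, c) k = (a div k, b div k, c div k)"

lemma form_sdiv_smult [simp]: "k \<noteq> 0 \<Longrightarrow> form_sdiv (form_smult k R) k = R"
  by (cases R) simp

lemma square_divisible_count_hecke:
  assumes p: "prime p"
  shows "(\<Sum>A\<in>hecke_right p. if \<exists>R. form_act Q A = form_smult (int p ^ 2) R then 1 else 0) = (of_nat (square_divisible_count p Q) :: complex)"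
proof -
  obtain a b c where Q: "Q = (a, b, c)" by (cases Q)
  have p1: "p > 1" and p0: "int p \<noteq> 0" using prime_gt_1_nat[OF p] by auto
  have sm: "(\<exists>R. (x, y, z) = form_smult k R) \<longleftrightarrow> k dvd x \<and> k dvd y \<and> k dvd z" for x y z k
    by (force elim!: dvdE)
  have pd: "int p ^ 2 dvd int p * x \<longleftrightarrow> int p dvd x" for x using p0 by (simp add: power2_eq_square)
  have 1: "(\<exists>R. form_act Q (mat2 1 0 0 (int p)) = form_smult (int p ^ 2) R) \<longleftrightarrow> int p ^ 2 dvd a \<and> int p dvd b"
  proof -
    have e: "form_act Q (mat2 1 0 0 (int p)) = (a, int p * b, int p ^ 2 * c)" by (simp add: Q)
    show ?thesis unfolding e sm pd by simp
  qed
  have 2: "(\<exists>R. form_act Q (mat2 (int p) (- j) 0 1) = form_smult (int p ^ 2) R) \<longleftrightarrow>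
      int p dvd b - 2 * a * j \<and> int p ^ 2 dvd a * j^2 - b * j + c" for j
  proof -
    have e: "form_act Q (mat2 (int p) (- j) 0 1) = (int p ^ 2 * a, int p * (b - 2 * a * j), a * j^2 - b * j + c)"
      by (simp add: Q algebra_simps)
    show ?thesis unfolding e sm pd by simp
  qed
  show ?thesis
    unfolding sum_hecke_right[OF p1] 1 2
    by (simp add: square_divisible_count_def Q sum.If_cases Int_def)
qed

text \<open>Both ends of a pair (Q, M) carry an inverse stabilizer weight, which makes the
  correspondence an exact bijection. After the exchange the sum runs over forms of discriminant -p^2
  D with D = d \<Delta>, each counted \<open>square_divisible_count\<close> times; the three
  summands of that count give the three traces.\<close>

theorem twisted_trace_hecke:
  assumes \<Delta>: "fundamental_discriminant \<Delta>" "\<Delta> > 1" and p: "prime p" "\<not> int p dvd \<Delta>"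
    and d: "d > 0" "is_discriminant (- int d)"
    and g: "\<And>z \<gamma>. Im z > 0 \<Longrightarrow> \<gamma> \<in> SL2Z \<Longrightarrow> g (moebius \<gamma> z) = g z"
    and Tg: "\<And>z \<gamma>. Im z > 0 \<Longrightarrow> \<gamma> \<in> SL2Z \<Longrightarrow>
        (\<Sum>A\<in>hecke_left p. g (moebius A (moebius \<gamma> z))) = (\<Sum>A\<in>hecke_left p. g (moebius A z))"
  shows "twisted_trace \<Delta> d (\<lambda>z. \<Sum>A\<in>hecke_left p. g (moebius A z)) =
     twisted_trace \<Delta> (p ^ 2 * d) g + of_int (kronecker_prime (- int d) (int p)) * twisted_trace \<Delta> d g
     + (if p ^ 2 dvd d \<and> is_discriminant (- int (d div p ^ 2)) then of_nat p * twisted_trace \<Delta> (d div p ^ 2) g else 0)"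
proof -
  define D where "D = int d * \<Delta>"
  have D: "D > 0" using \<Delta> d by (simp add: D_def)
  have p0: "int p > 0" and p1: "p > 0" using prime_gt_0_nat[OF p(1)] by simp_all
  have D': "int p ^ 2 * D > 0" using p0 D by simp
  have pp: "prime (int p)" using p by simp
  have cop: "coprime (int p) \<Delta>" using pp p(2) by (rule prime_imp_coprime)
  have dpos: "0 < int d" using d by simp
  let ?w = "\<lambda>Q. rep_weight (form_root Q)" and ?r = form_root and ?\<chi> = "\<lambda>Q. (of_int (genus_char \<Delta> Q) :: complex)"
  define S where "S = {(Q, M). Q \<in> rep_forms D \<and> M \<in> rep_mats p Q}"
  define S' where "S' = {(Q, M). Q \<in> rep_forms (int p ^ 2 * D) \<and> M \<in> rep_mats p Q \<and> (\<exists>R. form_act Q M = form_smult (int p ^ 2) R)}"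
  have ginv: "g (?r (form_act R \<gamma>)) = g (?r R)" if "R \<in> forms_of (int p ^ 2 * D)" "\<gamma> \<in> SL2Z" for R \<gamma>
    using form_root_act_SL2Z[OF D' that] g Im_form_root_pos[OF D' that(1)] SL2Z_adj2[OF that(2)] by simp
  have L: "(\<Sum>A\<in>hecke_left p. g (moebius A (?r Q))) = (\<Sum>M\<in>rep_mats p Q. g (?r (form_act Q M)) * ?w (form_act Q M))"
    if Q: "Q \<in> forms_of D" for Q
  proof -
    have "(\<Sum>A\<in>hecke_left p. g (moebius A (?r Q))) = (\<Sum>A\<in>hecke_right p. g (?r (form_act Q A)))"
    proof (rule sum.reindex_bij_witness[of _ adj2 adj2])
      show "adj2 A \<in> hecke_right p" if "A \<in> hecke_left p" for A using that adj2_hecke(1) by blast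
      show "adj2 A \<in> hecke_left p" if "A \<in> hecke_right p" for A using that adj2_hecke(2) by blast
      show "g (?r (form_act Q (adj2 A))) = g (moebius A (?r Q))" if "A \<in> hecke_left p" for A
        using form_root_act[OF D Q, of "adj2 A"] det_hecke(1)[OF that] p0 by simp
    qed simp_all
    also have "\<dots> = (\<Sum>M\<in>rep_mats p Q. g (?r (form_act Q M)) * ?w (form_act Q M))"
      by (rule sum_hecke_right_weighted(2)[OF p(1) D Q, of "\<lambda>R. g (?r R)"]) (rule ginv)
    finally show ?thesis .
  qed
  have "twisted_trace \<Delta> d (\<lambda>z. \<Sum>A\<in>hecke_left p. g (moebius A z)) =
     2 * (\<Sum>Q\<in>rep_forms D. ?\<chi> Q * (\<Sum>A\<in>hecke_left p. g (moebius A (?r Q))) * ?w Q)"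
    unfolding D_def by (rule twisted_trace_eq[OF \<Delta> d]) (rule Tg)
  also have "(\<Sum>Q\<in>rep_forms D. ?\<chi> Q * (\<Sum>A\<in>hecke_left p. g (moebius A (?r Q))) * ?w Q)
     = (\<Sum>Q\<in>rep_forms D. \<Sum>M\<in>rep_mats p Q. ?\<chi> Q * (g (?r (form_act Q M)) * ?w (form_act Q M)) * ?w Q)"
  proof (rule sum.cong[OF refl])
    fix Q assume "Q \<in> rep_forms D"
    then have "Q \<in> forms_of D" by (simp add: rep_forms_def)
    then show "?\<chi> Q * (\<Sum>A\<in>hecke_left p. g (moebius A (?r Q))) * ?w Q = (\<Sum>M\<in>rep_mats p Q. ?\<chi> Q * (g (?r (form_act Q M)) * ?w (form_act Q M)) * ?w Q)"
      by (simp only: L sum_distrib_left sum_distrib_right)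
  qed
  also have "\<dots> = (\<Sum>(Q, M)\<in>S. ?\<chi> Q * (g (?r (form_act Q M)) * ?w (form_act Q M)) * ?w Q)"
  proof -
    have fin: "finite (rep_mats p Q)" if "Q \<in> rep_forms D" for Q
      using that sum_hecke_right_weighted(1)[OF p(1) D, of Q "\<lambda>_. 0"] by (simp add: rep_forms_def)
    have "S = Sigma (rep_forms D) (rep_mats p)" by (auto simp: S_def)
    then show ?thesis using fin finite_rep_forms[OF D] by (simp add: sum.Sigma)
  qed
  also have "\<dots> = (\<Sum>(Q, M)\<in>S'. ?\<chi> Q * g (?r Q) * ?w Q * ?w (form_act Q M))"
  \<comment> \<open>Going forth and back yields p^2 Q, so the backward map divides by p^2. The
    weights of the two end forms trade places, and the genus character is unchanged since p is
    coprime to \<Delta>.\<close>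
  proof (rule sum.reindex_bij_witness[where
      i = "\<lambda>(Q, M). (form_sdiv (form_act Q M) (int p ^ 2), adj2 M)" and j = "\<lambda>(Q, M). (form_act Q M, adj2 M)"])
    have adj_back: "form_act (form_act Q M) (adj2 M) = form_smult (int p ^ 2) Q" if "det M = int p" for Q M
      using that by (simp add: form_act_mult mult_adj2)
    have p2: "int p ^ 2 \<noteq> 0" using p0 by simp
    {
      fix x assume "x \<in> S"
      then obtain Q M where x: "x = (Q, M)" and Q: "Q \<in> forms_of D" "is_rep (?r Q)" and M: "det M = int p" "is_rep (?r (form_act Q M))"
        by (auto simp: S_def rep_forms_def rep_mats_def mats_of_det_def)
      have b: "form_act (form_act Q M) (adj2 M) = form_smult (int p ^ 2) Q" by (rule adj_back[OF M(1)])
      have F: "form_act Q M \<in> forms_of (int p ^ 2 * D)" using form_act_forms_of[OF D Q(1), of M] M p0 by simp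
      have rt: "?r (form_smult (int p ^ 2) Q) = ?r Q" using p0 by (intro form_root_smult[OF D Q(1)]) simp
      show "(case (case x of (Q, M) \<Rightarrow> (form_act Q M, adj2 M)) of (Q, M) \<Rightarrow> (form_sdiv (form_act Q M) (int p ^ 2), adj2 M)) = x"
        using p2 by (simp add: x b del: form_act.simps)
      show "(case x of (Q, M) \<Rightarrow> (form_act Q M, adj2 M)) \<in> S'"
        using F M Q rt by (auto simp: x S'_def rep_forms_def rep_mats_def mats_of_det_def b simp del: form_act.simps form_smult.simps split_paired_Ex)
      have "genus_char \<Delta> (form_act Q M) = genus_char \<Delta> Q"
        using M p0 cop Q by (intro genus_char_act[OF \<Delta> dpos d(2)]) (auto simp: D_def)
      then show "(case (case x of (Q, M) \<Rightarrow> (form_act Q M, adj2 M)) of (Q, M) \<Rightarrow> ?\<chi> Q * g (?r Q) * ?w Q * ?w (form_act Q M))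
         = (case x of (Q, M) \<Rightarrow> ?\<chi> Q * (g (?r (form_act Q M)) * ?w (form_act Q M)) * ?w Q)"
        by (simp add: x b rt mult_ac del: form_act.simps)
    }
    fix y assume "y \<in> S'"
    then obtain Q M R where y: "y = (Q, M)" and Q: "Q \<in> forms_of (int p ^ 2 * D)" "is_rep (?r Q)"
      and M: "det M = int p" "is_rep (?r (form_act Q M))" and R: "form_act Q M = form_smult (int p ^ 2) R"
      by (auto simp: S'_def rep_forms_def rep_mats_def mats_of_det_def)
    have "form_act Q M \<in> forms_of ((int p ^ 2)^2 * D)"
      using form_act_forms_of[OF D' Q(1), of M] M p0 by (simp add: power2_eq_square mult_ac)
    then have RF: "R \<in> forms_of D" unfolding R using form_smult_forms_of[OF D, of "int p ^ 2" R] p0 by simp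
    have rt: "?r (form_act Q M) = ?r R" unfolding R using p0 by (intro form_root_smult[OF D RF]) simp
    have RM: "form_act R (adj2 M) = Q"
    proof -
      have "form_smult (int p ^ 2) (form_act R (adj2 M)) = form_act (form_smult (int p ^ 2) R) (adj2 M)"
        by (simp only: form_act_smult)
      also have "\<dots> = form_smult (int p ^ 2) Q" unfolding R[symmetric] by (rule adj_back[OF M(1)])
      finally show ?thesis using p2 form_smult_inj by blast
    qed
    show "(case (case y of (Q, M) \<Rightarrow> (form_sdiv (form_act Q M) (int p ^ 2), adj2 M)) of (Q, M) \<Rightarrow> (form_act Q M, adj2 M)) = y"
      using p2 by (simp add: y R RM del: form_act.simps)
    show "(case y of (Q, M) \<Rightarrow> (form_sdiv (form_act Q M) (int p ^ 2), adj2 M)) \<in> S"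
      using p2 RF M Q rt by (simp add: y R RM S_def rep_forms_def rep_mats_def mats_of_det_def del: form_act.simps)
  qed
  also have "\<dots> = (\<Sum>Q\<in>rep_forms (int p ^ 2 * D). ?\<chi> Q * g (?r Q) * ?w Q * of_nat (square_divisible_count p Q))"
  proof -
    let ?P = "\<lambda>Q M. \<exists>R. form_act Q M = form_smult (int p ^ 2) R"
    have fin: "finite (rep_mats p Q)" if "Q \<in> rep_forms (int p ^ 2 * D)" for Q
      using that sum_hecke_right_weighted(1)[OF p(1) D', of Q "\<lambda>_. 0"] by (simp add: rep_forms_def)
    have S': "S' = (SIGMA Q:rep_forms (int p ^ 2 * D). {M \<in> rep_mats p Q. ?P Q M})" by (auto simp: S'_def)
    have "(\<Sum>(Q, M)\<in>S'. ?\<chi> Q * g (?r Q) * ?w Q * ?w (form_act Q M))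
      = (\<Sum>Q\<in>rep_forms (int p ^ 2 * D). \<Sum>M\<in>{M \<in> rep_mats p Q. ?P Q M}. ?\<chi> Q * g (?r Q) * ?w Q * ?w (form_act Q M))"
      unfolding S' using fin finite_rep_forms[OF D'] by (subst sum.Sigma) auto
    also have "\<dots> = (\<Sum>Q\<in>rep_forms (int p ^ 2 * D). ?\<chi> Q * g (?r Q) * ?w Q * of_nat (square_divisible_count p Q))"
    proof (rule sum.cong[OF refl])
      fix Q assume QR: "Q \<in> rep_forms (int p ^ 2 * D)"
      then have Q: "Q \<in> forms_of (int p ^ 2 * D)" by (simp add: rep_forms_def)
      let ?\<phi> = "\<lambda>R'. if \<exists>R. R' = form_smult (int p ^ 2) R then 1 else (0 :: complex)"
      have \<phi>inv: "?\<phi> (form_act R' \<gamma>) = ?\<phi> R'" if \<gamma>: "\<gamma> \<in> SL2Z" for R' \<gamma>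
      proof -
        have "(\<exists>R. form_act R' \<gamma> = form_smult (int p ^ 2) R) \<longleftrightarrow> (\<exists>R. R' = form_smult (int p ^ 2) R)"
        proof
          assume "\<exists>R. form_act R' \<gamma> = form_smult (int p ^ 2) R"
          then obtain R where "form_act R' \<gamma> = form_smult (int p ^ 2) R" by blast
          then have "form_act (form_act R' \<gamma>) (adj2 \<gamma>) = form_smult (int p ^ 2) (form_act R (adj2 \<gamma>))"
            by (simp only: form_act_smult)
          then have "R' = form_smult (int p ^ 2) (form_act R (adj2 \<gamma>))"
            using SL2Z_cancel(1)[OF \<gamma>] by (simp add: form_act_mult del: form_act.simps)
          then show "\<exists>R. R' = form_smult (int p ^ 2) R" by blast
        next
          assume "\<exists>R. R' = form_smult (int p ^ 2) R"
          then obtain R where "R' = form_smult (int p ^ 2) R" by blast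
          then have "form_act R' \<gamma> = form_smult (int p ^ 2) (form_act R \<gamma>)" by (simp only: form_act_smult)
          then show "\<exists>R. form_act R' \<gamma> = form_smult (int p ^ 2) R" by blast
        qed
        then show ?thesis by simp
      qed
      have W: "(\<Sum>A\<in>hecke_right p. ?\<phi> (form_act Q A)) = (\<Sum>M\<in>rep_mats p Q. ?\<phi> (form_act Q M) * ?w (form_act Q M))"
        by (rule sum_hecke_right_weighted(2)[OF p(1) D' Q]) (rule \<phi>inv)
      have "(\<Sum>M\<in>{M \<in> rep_mats p Q. ?P Q M}. ?\<chi> Q * g (?r Q) * ?w Q * ?w (form_act Q M))
        = ?\<chi> Q * g (?r Q) * ?w Q * (\<Sum>M\<in>rep_mats p Q. ?\<phi> (form_act Q M) * ?w (form_act Q M))"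
        using fin[OF QR] by (simp add: sum_distrib_left[symmetric] sum.inter_filter if_distrib if_distribR cong: if_cong)
      also have "(\<Sum>M\<in>rep_mats p Q. ?\<phi> (form_act Q M) * ?w (form_act Q M)) = of_nat (square_divisible_count p Q)"
        by (rule trans[OF W[symmetric] square_divisible_count_hecke[OF p(1)]])
      finally show "(\<Sum>M\<in>{M \<in> rep_mats p Q. ?P Q M}. ?\<chi> Q * g (?r Q) * ?w Q * ?w (form_act Q M)) = ?\<chi> Q * g (?r Q) * ?w Q * of_nat (square_divisible_count p Q)" .
    qed
    finally show ?thesis .
  qed
  finally have main: "twisted_trace \<Delta> d (\<lambda>z. \<Sum>A\<in>hecke_left p. g (moebius A z)) =
     2 * (\<Sum>Q\<in>rep_forms (int p ^ 2 * D). ?\<chi> Q * g (?r Q) * ?w Q * of_nat (square_divisible_count p Q))" .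
  define f where "f Q = ?\<chi> Q * g (?r Q) * ?w Q" for Q
  have tr: "twisted_trace \<Delta> e g = 2 * sum f (rep_forms (int e * \<Delta>))" if "e > 0" "is_discriminant (- int e)" for e
    unfolding f_def by (rule twisted_trace_eq[OF \<Delta> that]) (rule g)
  have scale: "(\<Sum>Q\<in>{Q \<in> rep_forms (k ^ 2 * (int e * \<Delta>)). \<exists>R. Q = form_smult k R}. f Q)
      = of_int (kronecker \<Delta> k) * sum f (rep_forms (int e * \<Delta>))"
    if k: "k > 0" "coprime k \<Delta>" and e: "e > 0" "is_discriminant (- int e)" for k e
  proof -
    have E: "int e * \<Delta> > 0" and E': "k ^ 2 * (int e * \<Delta>) > 0" and ep: "0 < int e" using e k \<Delta> by simp_all
    have iff: "form_smult k R \<in> rep_forms (k ^ 2 * (int e * \<Delta>)) \<longleftrightarrow> R \<in> rep_forms (int e * \<Delta>)" for R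
      using form_smult_forms_of[OF E k(1), of R] form_root_smult[OF E _ k(1), of R] by (auto simp: rep_forms_def)
    have "bij_betw (form_smult k) (rep_forms (int e * \<Delta>)) {Q \<in> rep_forms (k ^ 2 * (int e * \<Delta>)). \<exists>R. Q = form_smult k R}"
      unfolding bij_betw_def
    proof
      show "inj_on (form_smult k) (rep_forms (int e * \<Delta>))"
        using k(1) form_smult_inj[of k] by (intro inj_onI) blast
      show "form_smult k ` rep_forms (int e * \<Delta>) = {Q \<in> rep_forms (k ^ 2 * (int e * \<Delta>)). \<exists>R. Q = form_smult k R}"
        using iff by blast
    qed
    then have "(\<Sum>Q\<in>{Q \<in> rep_forms (k ^ 2 * (int e * \<Delta>)). \<exists>R. Q = form_smult k R}. f Q)
       = (\<Sum>R\<in>rep_forms (int e * \<Delta>). f (form_smult k R))"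
      by (rule sum.reindex_bij_betw[symmetric])
    also have "\<dots> = (\<Sum>R\<in>rep_forms (int e * \<Delta>). of_int (kronecker \<Delta> k) * f R)"
    proof (rule sum.cong[OF refl])
      fix R assume "R \<in> rep_forms (int e * \<Delta>)"
      then have R: "R \<in> forms_of (int e * \<Delta>)" by (simp add: rep_forms_def)
      show "f (form_smult k R) = of_int (kronecker \<Delta> k) * f R"
        unfolding f_def form_root_smult[OF E R k(1)] genus_char_smult[OF \<Delta> ep e(2) R k] by simp
    qed
    finally show ?thesis by (simp add: sum_distrib_left)
  qed
  have disc_mult: "is_discriminant (a * b)" if "is_discriminant a" "is_discriminant b" for a b
  proof -
    have "(a * b) mod 4 = ((a mod 4) * (b mod 4)) mod 4" by (simp only: mod_mult_eq)
    moreover have "a mod 4 = 0 \<or> a mod 4 = 1" "b mod 4 = 0 \<or> b mod 4 = 1" using that by (simp_all add: is_discriminant_def)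
    ultimately have "(a * b) mod 4 = 0 \<or> (a * b) mod 4 = 1" by (elim disjE) simp_all
    then show ?thesis by (simp add: is_discriminant_def)
  qed
  have \<Delta>disc: "is_discriminant \<Delta>" using \<Delta>(1) by (auto simp: fundamental_discriminant_def is_discriminant_def)
  have Ddisc: "is_discriminant (- D)" using disc_mult[OF d(2) \<Delta>disc] by (simp add: D_def)
  have cnt: "(of_nat (square_divisible_count p Q) :: complex) = 1 +
      (if \<exists>R. Q = form_smult (int p) R then of_int (kronecker_prime (- D) (int p)) else 0) +
      (if \<exists>R. Q = form_smult (int p ^ 2) R then of_nat p else 0)" if "Q \<in> rep_forms (int p ^ 2 * D)" for Q
  proof -
    have "form_disc Q = int p ^ 2 * (- D)" using that by (simp add: rep_forms_def forms_of_def)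
    from arg_cong[OF square_divisible_count_eq[OF p(1) this Ddisc], of "of_int :: int \<Rightarrow> complex"]
    show ?thesis by (simp only: of_int_of_nat_eq of_int_add of_int_1 if_distrib[of of_int] of_int_0)
  qed
  let ?X = "rep_forms (int p ^ 2 * D)"
  have "(\<Sum>Q\<in>?X. f Q * of_nat (square_divisible_count p Q))
     = (\<Sum>Q\<in>?X. f Q + of_int (kronecker_prime (- D) (int p)) * (if \<exists>R. Q = form_smult (int p) R then f Q else 0)
        + of_nat p * (if \<exists>R. Q = form_smult (int p ^ 2) R then f Q else 0))"
    by (rule sum.cong[OF refl]) (simp add: cnt distrib_left)
  also have "\<dots> = sum f ?X + of_int (kronecker_prime (- D) (int p)) * (\<Sum>Q\<in>{Q \<in> ?X. \<exists>R. Q = form_smult (int p) R}. f Q)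
        + of_nat p * (\<Sum>Q\<in>{Q \<in> ?X. \<exists>R. Q = form_smult (int p ^ 2) R}. f Q)"
    using finite_rep_forms[OF D'] by (simp only: sum.distrib sum_distrib_left[symmetric] sum.inter_filter)
  finally have split: "(\<Sum>Q\<in>?X. f Q * of_nat (square_divisible_count p Q)) =
     sum f ?X + of_int (kronecker_prime (- D) (int p)) * (\<Sum>Q\<in>{Q \<in> ?X. \<exists>R. Q = form_smult (int p) R}. f Q)
        + of_nat p * (\<Sum>Q\<in>{Q \<in> ?X. \<exists>R. Q = form_smult (int p ^ 2) R}. f Q)" .
  have t1: "2 * sum f ?X = twisted_trace \<Delta> (p ^ 2 * d) g"
  proof -
    have e: "int (p ^ 2 * d) * \<Delta> = int p ^ 2 * D" by (simp add: D_def)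
    have "is_discriminant (- int (p ^ 2 * d))" using is_discriminant_square_mult[OF d(2), of "int p"] by simp
    moreover have "p ^ 2 * d > 0" using d p1 by simp
    ultimately show ?thesis using tr[of "p ^ 2 * d"] unfolding e by simp
  qed
  have kk: "kronecker \<Delta> (int p) = kronecker_prime \<Delta> (int p)" by (rule kronecker_prime_eq[OF pp])
  have k1: "kronecker \<Delta> (int p) * kronecker \<Delta> (int p) = 1"
    using kronecker_coprime_range[OF p0 cop] by auto
  \<comment> \<open>The forms p R contribute (\<Delta>/p) through their genus character, and (-D/p)
    = (-d/p)(\<Delta>/p); the two symbols (\<Delta>/p) cancel as p does not divide \<Delta>.\<close>
  have t2: "2 * (of_int (kronecker_prime (- D) (int p)) * (\<Sum>Q\<in>{Q \<in> ?X. \<exists>R. Q = form_smult (int p) R}. f Q))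
     = of_int (kronecker_prime (- int d) (int p)) * twisted_trace \<Delta> d g"
  proof -
    have "kronecker_prime (- D) (int p) * kronecker \<Delta> (int p) = kronecker_prime (- int d) (int p) * (kronecker \<Delta> (int p) * kronecker \<Delta> (int p))"
      using kronecker_prime_mult_left[OF pp, of "- int d" \<Delta>] kk by (simp add: D_def)
    then have "kronecker_prime (- D) (int p) * kronecker \<Delta> (int p) = kronecker_prime (- int d) (int p)" using k1 by simp
    then have "of_int (kronecker_prime (- D) (int p)) * of_int (kronecker \<Delta> (int p)) = (of_int (kronecker_prime (- int d) (int p)) :: complex)"
      by (metis of_int_mult)
    then show ?thesis using scale[OF p0 cop d] tr[OF d] by (simp add: D_def[symmetric] mult.assoc[symmetric])
  qed
  have t3: "2 * (of_nat p * (\<Sum>Q\<in>{Q \<in> ?X. \<exists>R. Q = form_smult (int p ^ 2) R}. f Q))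
     = (if p ^ 2 dvd d \<and> is_discriminant (- int (d div p ^ 2)) then of_nat p * twisted_trace \<Delta> (d div p ^ 2) g else 0)"
  proof (cases "p ^ 2 dvd d \<and> is_discriminant (- int (d div p ^ 2))")
    case True
    define e where "e = d div p ^ 2"
    have de: "d = p ^ 2 * e" using True by (simp add: e_def)
    then have e: "e > 0" "is_discriminant (- int e)" using d True by (auto simp: e_def[symmetric])
    have X: "int p ^ 2 * D = (int p ^ 2) ^ 2 * (int e * \<Delta>)" by (simp add: D_def de power2_eq_square mult_ac)
    have "kronecker \<Delta> (int p ^ 2) = 1" using k1 p0 by (simp add: power2_eq_square kronecker_mult)
    then have "(\<Sum>Q\<in>{Q \<in> ?X. \<exists>R. Q = form_smult (int p ^ 2) R}. f Q) = sum f (rep_forms (int e * \<Delta>))"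
      using scale[of "int p ^ 2" e] e p0 cop unfolding X by simp
    then show ?thesis using True tr[OF e] by (simp add: e_def[symmetric])
  next
    case False
    \<comment> \<open>A form p^2 R would have a discriminant E of R with p^2 E = -d \<Delta>.
      Coprimality puts p^2 into d, so E = -e \<Delta>, and it remains to see that -e is a
      discriminant.\<close>
    have empty: "{Q \<in> ?X. \<exists>R. Q = form_smult (int p ^ 2) R} = {}"
    proof (rule ccontr)
      assume "{Q \<in> ?X. \<exists>R. Q = form_smult (int p ^ 2) R} \<noteq> {}"
      then obtain R where R: "form_smult (int p ^ 2) R \<in> ?X" by blast
      define E where "E = form_disc R"
      have "(int p ^ 2) ^ 2 * E = - (int p ^ 2 * D)"
        using R by (simp add: rep_forms_def forms_of_def form_disc_smult E_def)
      then have "int p ^ 2 * (int p ^ 2 * E) = int p ^ 2 * (- D)" by (simp add: power2_eq_square mult_ac)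
      then have pE: "int p ^ 2 * E = - D" by (subst (asm) mult_left_cancel) (use p0 in auto)
      have "int p ^ 2 dvd int d * \<Delta>" using pE by (metis D_def dvd_minus_iff dvd_triv_left)
      moreover have "coprime (int p ^ 2) \<Delta>" using cop by simp
      ultimately have "int p ^ 2 dvd int d" by (simp add: coprime_dvd_mult_left_iff)
      then have pd: "p ^ 2 dvd d" by (metis int_dvd_int_iff of_nat_power)
      define e where "e = d div p ^ 2"
      have de: "d = p ^ 2 * e" using pd by (simp add: e_def)
      have "int p ^ 2 * E = int p ^ 2 * (- int e * \<Delta>)" using pE by (simp add: D_def de)
      then have Ee: "E = - int e * \<Delta>" by (subst (asm) mult_left_cancel) (use p0 in auto)
      have Ed: "is_discriminant E"
      proof -
        obtain a b c where abc: "R = (a, b, c)" by (cases R)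
        have "E = b^2 - 4 * (a * c)" by (simp add: E_def abc)
        then have "[E = b^2] (mod 4)" by (simp add: cong_iff_dvd_diff)
        then have m: "E mod 4 = b^2 mod 4" by (simp only: cong_def)
        have "is_discriminant (b^2 * 1)" by (rule is_discriminant_square_mult) (simp add: is_discriminant_def)
        then show ?thesis using m by (simp add: is_discriminant_def)
      qed
      \<comment> \<open>If \<Delta> is 1 modulo 4, -e is congruent to E. Otherwise \<Delta> is even,
        p is odd, and p^2 being 1 modulo 4 makes -e congruent to -d.\<close>
      have "is_discriminant (- int e)"
      proof (cases "\<Delta> mod 4 = 1")
        case True
        then have "[- int e * \<Delta> = - int e * 1] (mod 4)" by (intro cong_mult cong_refl) (simp add: cong_def)
        then have "E mod 4 = (- int e) mod 4" unfolding Ee by (simp add: cong_def)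
        then show ?thesis using Ed by (simp add: is_discriminant_def)
      next
        case False
        then have "4 dvd \<Delta>" using \<Delta>disc by (auto simp: is_discriminant_def dvd_eq_mod_eq_0)
        then have "even \<Delta>" by (meson dvd_trans even_numeral)
        then have "odd (int p)" using cop by (metis coprime_common_divisor odd_one)
        then have "int p mod 4 = 1 \<or> int p mod 4 = 3" by (rule odd_mod_4)
        then have "[int p ^ 2 = 1] (mod 4)"
        proof
          assume "int p mod 4 = 1"
          then have "[int p = 1] (mod 4)" by (simp add: cong_def)
          then show ?thesis using cong_pow[of "int p" 1 4 2] by simp
        next
          assume "int p mod 4 = 3"
          then have "[int p = 3] (mod 4)" by (simp add: cong_def)
          then have "[int p ^ 2 = 3 ^ 2] (mod 4)" by (rule cong_pow)
          also have "[3 ^ 2 = 1] (mod (4 :: int))" by (simp add: cong_def)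
          finally show ?thesis .
        qed
        then have "[int p ^ 2 * (- int e) = 1 * (- int e)] (mod 4)" by (intro cong_mult cong_refl)
        then have "(- int d) mod 4 = (- int e) mod 4" by (simp add: cong_def de)
        then show ?thesis using d(2) by (simp add: is_discriminant_def)
      qed
      then show False using \<open>\<not> (p ^ 2 dvd d \<and> is_discriminant (- int (d div p ^ 2)))\<close> pd by (simp add: e_def)
    qed
    show ?thesis unfolding empty if_not_P[OF False] by simp
  qed
  show ?thesis
    unfolding main f_def[symmetric] split distrib_left t1 t2 t3 by (rule refl)
qed

section \<open>The recursion\<close>

lemma twisted_trace_cong:
  assumes D: "int d * \<Delta> > 0" and eq: "\<And>z. Im z > 0 \<Longrightarrow> f z = g z"
  shows "twisted_trace \<Delta> d f = twisted_trace \<Delta> d g"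
  unfolding twisted_trace_def
proof (rule sum.cong[OF refl])
  fix C assume "C \<in> form_classes (int d * \<Delta>)"
  then obtain Q where Q: "Q \<in> forms_of (int d * \<Delta>)" "C = form_act Q ` SL2Z" by (auto simp: form_classes_def)
  have "(SOME Q. Q \<in> C) \<in> C" unfolding Q(2) using form_self_in_orbit by (rule someI)
  then obtain g' where "g' \<in> SL2Z" "(SOME Q. Q \<in> C) = form_act Q g'" unfolding Q(2) by blast
  then have "(SOME Q. Q \<in> C) \<in> forms_of (int d * \<Delta>)" using form_act_SL2Z[OF D Q(1)] by simp
  then have "Im (form_root (SOME Q. Q \<in> C)) > 0" by (rule Im_form_root_pos[OF D])
  then show "(let Q = SOME Q. Q \<in> C in of_int (genus_char \<Delta> Q) / of_nat (form_omega Q) * f (form_root Q)) =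
    (let Q = SOME Q. Q \<in> C in of_int (genus_char \<Delta> Q) / of_nat (form_omega Q) * g (form_root Q))"
    using eq by (simp add: Let_def)
qed

lemma twisted_trace_add: "twisted_trace \<Delta> d (\<lambda>z. f z + g z) = twisted_trace \<Delta> d f + twisted_trace \<Delta> d g"
  by (simp add: twisted_trace_def Let_def distrib_left sum.distrib)

lemma twisted_trace_cmult: "twisted_trace \<Delta> d (\<lambda>z. k * f z) = k * twisted_trace \<Delta> d f"
  by (simp add: twisted_trace_def Let_def sum_distrib_left mult_ac)

lemma twisted_trace_0 [simp]: "twisted_trace \<Delta> d (\<lambda>z. 0) = 0"
  by (simp add: twisted_trace_def Let_def)

lemma twisted_trace_sum:
  "finite A \<Longrightarrow> twisted_trace \<Delta> d (\<lambda>z. \<Sum>a\<in>A. f a z) = (\<Sum>a\<in>A. twisted_trace \<Delta> d (f a))"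
  by (induction A rule: finite_induct) (simp_all add: twisted_trace_add)

section \<open>The recursion in the Hecke exponent and the level\<close>

locale hecke_setting =
  fixes \<Delta> :: int and p n d' v n0 :: nat
  assumes \<Delta>: "fundamental_discriminant \<Delta>" "\<Delta> > 1"
    and p: "prime p" "\<not> int p dvd \<Delta>"
    and n: "n = p ^ v * n0" "\<not> p dvd n0" "n0 > 0"
    and d': "d' > 0" "\<not> p ^ 2 dvd d'"
begin

definition J_pow :: "nat \<Rightarrow> complex \<Rightarrow> complex" where
  "J_pow k = J1 (p ^ k * n0)"

text \<open>The image of J_n under T_(p^m), where n = p^v n0. It is the polynomial in T_p given by
  U(m+1) = T_p U(m) - p U(m-1); the difference v + m - 2 t is never truncated for t \<le> min v
  m.\<close>

definition J_sum :: "nat \<Rightarrow> complex \<Rightarrow> complex" where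
  "J_sum m z = (\<Sum>t\<in>{0..min v m}. of_nat (p ^ t) * J_pow (v + m - 2 * t) z)"

definition level :: "nat \<Rightarrow> nat" where
  "level w = p ^ (2 * w) * d'"

definition admissible :: "nat \<Rightarrow> bool" where
  "admissible w \<longleftrightarrow> is_discriminant (- int (level w))"

definition hecke_trace :: "nat \<Rightarrow> nat \<Rightarrow> complex" where
  "hecke_trace m w = twisted_trace \<Delta> (level w) (J_sum m)"

definition base_trace :: "nat \<Rightarrow> complex" where
  "base_trace w = twisted_trace \<Delta> (level w) (J1 n)"

lemma p_pos: "p > 0"
  using p prime_gt_0_nat by blast

lemma J_pow_invariant: "Im z > 0 \<Longrightarrow> \<gamma> \<in> SL2Z \<Longrightarrow> J_pow k (moebius \<gamma> z) = J_pow k z"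
  unfolding J_pow_def using n p_pos by (intro J1_invariant) auto

lemma J_sum_invariant: "Im z > 0 \<Longrightarrow> \<gamma> \<in> SL2Z \<Longrightarrow> J_sum m (moebius \<gamma> z) = J_sum m z"
  by (simp add: J_sum_def J_pow_invariant)

lemma J_pow_hecke:
  assumes "Im z > 0"
  shows "(\<Sum>A\<in>hecke_left p. J_pow k (moebius A z)) = J_pow (k + 1) z + (if k > 0 then of_nat p * J_pow (k - 1) z else 0)"
proof -
  have dv: "p dvd p ^ k * n0 \<longleftrightarrow> k > 0" 
  proof (cases k)
    case 0
    then show ?thesis using n(2) by simp
  next
    case (Suc j)
    then show ?thesis by (simp add: mult.assoc)
  qed
  have "p ^ k * n0 div p = p ^ (k - 1) * n0" if "k > 0"
    using that p_pos by (cases k) (simp_all add: mult.assoc)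
  then show ?thesis using J1_hecke[OF p(1) _ assms, of "p ^ k * n0"] n p_pos dv
    by (simp add: J_pow_def mult_ac)
qed

text \<open>With a(t) = p^t J_(v+m+1-2t), the t-th summand contributes a(t) + a(t+1), the second
  only if the exponent v + m - 2 t is positive. The a(t) and a(t+1) are regrouped into the sums for
  m + 1 and m - 1; the boundary term depends on how m compares with v.\<close>

lemma J_sum_hecke:
  assumes z: "Im z > 0"
  shows "(\<Sum>A\<in>hecke_left p. J_sum m (moebius A z)) = J_sum (m + 1) z + (if m > 0 then of_nat p * J_sum (m - 1) z else 0)"
proof -
  define a where "a t = of_nat (p ^ t) * J_pow (v + m + 1 - 2 * t) z" for t
  let ?r = "min v m"
  have "(\<Sum>A\<in>hecke_left p. J_sum m (moebius A z)) = (\<Sum>t\<in>{0..?r}. of_nat (p ^ t) * (\<Sum>A\<in>hecke_left p. J_pow (v + m - 2 * t) (moebius A z)))"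
    unfolding J_sum_def by (subst sum.swap) (simp add: sum_distrib_left)
  also have "\<dots> = (\<Sum>t\<in>{0..?r}. a t + (if 2 * t < v + m then a (Suc t) else 0))"
  proof (rule sum.cong[OF refl])
    fix t assume "t \<in> {0..?r}"
    then have "v + m - 2 * t + 1 = v + m + 1 - 2 * t" "v + m - 2 * t - 1 = v + m + 1 - 2 * Suc t" by auto
    then show "of_nat (p ^ t) * (\<Sum>A\<in>hecke_left p. J_pow (v + m - 2 * t) (moebius A z)) = a t + (if 2 * t < v + m then a (Suc t) else 0)"
      unfolding J_pow_hecke[OF z] by (simp add: a_def algebra_simps)
  qed
  also have "\<dots> = sum a {0..?r} + (\<Sum>t\<in>{0..?r}. if 2 * t < v + m then a (Suc t) else 0)" by (rule sum.distrib)
  finally have lhs: "(\<Sum>A\<in>hecke_left p. J_sum m (moebius A z)) = \<dots>" .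
  have up: "J_sum (m + 1) z = sum a {0..min v (m + 1)}" by (simp add: J_sum_def a_def)
  have down: "of_nat p * J_sum (m - 1) z = (\<Sum>t\<in>{0..min v (m - 1)}. a (Suc t))" if "m > 0"
  proof -
    have e: "v + (m - 1) - 2 * t = v + m + 1 - 2 * Suc t" for t using that by simp
    show ?thesis unfolding J_sum_def sum_distrib_left a_def e by (simp add: mult.assoc)
  qed
  show ?thesis
  proof (cases "m < v")
    \<comment> \<open>For m < v the top shifted term a(m+1) is left over and completes the sum for m
      + 1.\<close>
    case True
    have "(\<Sum>t\<in>{0..?r}. if 2 * t < v + m then a (Suc t) else 0) = (\<Sum>t\<in>{0..m}. a (Suc t))"
      using True by (intro sum.cong) auto
    moreover have "(\<Sum>t\<in>{0..m}. a (Suc t)) = a (m + 1) + (if m > 0 then of_nat p * J_sum (m - 1) z else 0)"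
    proof (cases m)
      case (Suc k)
      then show ?thesis using down True by simp
    qed simp
    moreover have "sum a {0..min v (m + 1)} = sum a {0..?r} + a (m + 1)" using True by simp
    ultimately show ?thesis unfolding lhs up by simp
  next
    case False
    have "(\<Sum>t\<in>{0..?r}. if 2 * t < v + m then a (Suc t) else 0) = (if m > 0 then of_nat p * J_sum (m - 1) z else 0)"
    \<comment> \<open>Only for m = v does the exponent v + m - 2 t reach 0, at t = m; the top
      shifted term is then missing.\<close>
    proof (cases "m = v")
      case True
      show ?thesis
      proof (cases m)
        case (Suc k)
        have "(\<Sum>t\<in>{0..?r}. if 2 * t < v + m then a (Suc t) else 0) = (\<Sum>t\<in>{0..Suc k}. if 2 * t < v + m then a (Suc t) else 0)"
          using True Suc by simp
        also have "\<dots> = (\<Sum>t\<in>{0..k}. if 2 * t < v + m then a (Suc t) else 0)"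
          unfolding sum.atLeast0_atMost_Suc using True Suc by simp
        also have "\<dots> = (\<Sum>t\<in>{0..k}. a (Suc t))" using True Suc by (intro sum.cong) auto
        finally have "(\<Sum>t\<in>{0..?r}. if 2 * t < v + m then a (Suc t) else 0) = (\<Sum>t\<in>{0..k}. a (Suc t))" .
        moreover have "min v (m - 1) = k" "m > 0" using True Suc by auto
        ultimately show ?thesis using down by simp
      qed (use True in simp)
    next
      case neq: False
      then have "(\<Sum>t\<in>{0..?r}. if 2 * t < v + m then a (Suc t) else 0) = (\<Sum>t\<in>{0..v}. a (Suc t))"
        using False by (intro sum.cong) auto
      moreover have "min v (m - 1) = v" "m > 0" using False neq by auto
      ultimately show ?thesis using down by simp
    qed
    moreover have "min v (m + 1) = ?r" using False by simp
    ultimately show ?thesis unfolding lhs up by simp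
  qed
qed

lemma level_pos: "level w > 0"
  using p_pos d' by (simp add: level_def)

lemma level_Suc: "level (Suc w) = p ^ 2 * level w"
  by (simp add: level_def power_add power2_eq_square)

lemma admissible_Suc: "admissible w \<Longrightarrow> admissible (Suc w)"
  using is_discriminant_square_mult[of "- int (level w)" "int p"] by (simp add: admissible_def level_Suc)

lemma trace_recursion:
  assumes "admissible w"
  shows "hecke_trace (m + 1) w + (if m > 0 then of_nat p * hecke_trace (m - 1) w else 0) =
    hecke_trace m (Suc w) + of_int (kronecker_prime (- int (level w)) (int p)) * hecke_trace m w
     + (if p ^ 2 dvd level w \<and> is_discriminant (- int (level w div p ^ 2)) then of_nat p * twisted_trace \<Delta> (level w div p ^ 2) (J_sum m) else 0)"
proof -
  have D: "int (level w) * \<Delta> > 0" using level_pos[of w] \<Delta> by simp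
  have "twisted_trace \<Delta> (level w) (\<lambda>z. \<Sum>A\<in>hecke_left p. J_sum m (moebius A z))
     = twisted_trace \<Delta> (level w) (\<lambda>z. J_sum (m + 1) z + (if m > 0 then of_nat p * J_sum (m - 1) z else 0))"
    by (rule twisted_trace_cong[OF D]) (rule J_sum_hecke)
  also have "\<dots> = hecke_trace (m + 1) w + (if m > 0 then of_nat p * hecke_trace (m - 1) w else 0)"
    by (simp add: twisted_trace_add twisted_trace_cmult hecke_trace_def)
  finally have 1: "twisted_trace \<Delta> (level w) (\<lambda>z. \<Sum>A\<in>hecke_left p. J_sum m (moebius A z)) = \<dots>" .
  have "twisted_trace \<Delta> (level w) (\<lambda>z. \<Sum>A\<in>hecke_left p. J_sum m (moebius A z)) =
    twisted_trace \<Delta> (p ^ 2 * level w) (J_sum m) + of_int (kronecker_prime (- int (level w)) (int p)) * twisted_trace \<Delta> (level w) (J_sum m)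
     + (if p ^ 2 dvd level w \<and> is_discriminant (- int (level w div p ^ 2)) then of_nat p * twisted_trace \<Delta> (level w div p ^ 2) (J_sum m) else 0)"
  proof (rule twisted_trace_hecke[OF \<Delta> p level_pos])
    show "is_discriminant (- int (level w))" using assms by (simp add: admissible_def)
    fix z :: complex and \<gamma> assume z: "Im z > 0" and \<gamma>: "\<gamma> \<in> SL2Z"
    show "J_sum m (moebius \<gamma> z) = J_sum m z" by (rule J_sum_invariant[OF z \<gamma>])
    show "(\<Sum>A\<in>hecke_left p. J_sum m (moebius A (moebius \<gamma> z))) = (\<Sum>A\<in>hecke_left p. J_sum m (moebius A z))"
      unfolding J_sum_hecke[OF z] J_sum_hecke[OF Im_moebius_SL2Z[OF z \<gamma>]] using J_sum_invariant[OF z \<gamma>] by simp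
  qed
  then show ?thesis unfolding 1 hecke_trace_def level_Suc .
qed

lemma hecke_trace_0: "hecke_trace 0 w = base_trace w"
proof -
  have "J_sum 0 z = J1 n z" for z by (simp add: J_sum_def J_pow_def n)
  then have "J_sum 0 = J1 n" by (rule ext)
  then show ?thesis by (simp add: hecke_trace_def base_trace_def)
qed

text \<open>At positive levels p divides the level, so the symbol drops out, and division by p^2
  leads to the level below.\<close>

lemma hecke_trace_recursion_Suc:
  assumes "admissible w"
  shows "hecke_trace (m + 1) (Suc w) + (if m > 0 then of_nat p * hecke_trace (m - 1) (Suc w) else 0) = hecke_trace m (Suc (Suc w)) + of_nat p * hecke_trace m w"
proof -
  have "int p dvd int (level (Suc w))" by (simp add: level_Suc)
  then have "kronecker_prime (- int (level (Suc w))) (int p) = 0"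
    using p by (simp add: kronecker_prime_eq_0_iff)
  moreover have "p ^ 2 dvd level (Suc w)" "level (Suc w) div p ^ 2 = level w" using p_pos by (simp_all add: level_Suc)
  ultimately show ?thesis
    using trace_recursion[OF admissible_Suc[OF assms], of m] assms by (simp add: admissible_def hecke_trace_def)
qed

text \<open>The recursion says that T(m+1, w+1) - p T(m, w) is unchanged when m decreases and w
  increases by 1. Moving along this antidiagonal down to m = 0 evaluates it as a base trace.\<close>

lemma hecke_trace_Suc_Suc:
  assumes "admissible w"
  shows "hecke_trace (Suc m) (Suc w) = base_trace (w + m + 2) + of_nat p * hecke_trace m w"
  using assms
proof (induction m arbitrary: w)
  case 0
  then show ?case using hecke_trace_recursion_Suc[OF 0, of 0] by (simp add: hecke_trace_0)
next
  case (Suc m)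
  have "hecke_trace (Suc (Suc m)) (Suc w) + of_nat p * hecke_trace m (Suc w) = hecke_trace (Suc m) (Suc (Suc w)) + of_nat p * hecke_trace (Suc m) w"
    using hecke_trace_recursion_Suc[OF Suc.prems, of "Suc m"] by simp
  moreover have "hecke_trace (Suc m) (Suc (Suc w)) = base_trace (Suc w + m + 2) + of_nat p * hecke_trace m (Suc w)"
    by (rule Suc.IH[OF admissible_Suc[OF Suc.prems]])
  ultimately show ?case by simp
qed

text \<open>At the bottom level p^2 does not divide d', so the trace one level below is absent. The
  term p T(m-1, 0) cancels against the one that \<open>hecke_trace_Suc_Suc\<close> produces for T(m,
  1).\<close>

lemma hecke_trace_Suc_0:
  assumes "admissible 0"
  shows "hecke_trace (Suc m) 0 = base_trace (Suc m) + of_int (kronecker_prime (- int d') (int p)) * hecke_trace m 0"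
proof -
  have l0: "level 0 = d'" by (simp add: level_def)
  have r: "hecke_trace (m + 1) 0 + (if m > 0 then of_nat p * hecke_trace (m - 1) 0 else 0) = hecke_trace m (Suc 0) + of_int (kronecker_prime (- int d') (int p)) * hecke_trace m 0"
    using trace_recursion[OF assms, of m] d' by (simp add: l0)
  show ?thesis
  proof (cases m)
    case 0
    then show ?thesis using r by (simp add: hecke_trace_0)
  next
    case (Suc k)
    then show ?thesis using r hecke_trace_Suc_Suc[OF assms, of k] by simp
  qed
qed

text \<open>The diagonal step from (m, u) to (m-1, u-1) is repeated until m = 0. As m < u, all
  levels visited are at least 1, so admissibility of level 0 is not assumed.\<close>

lemma hecke_trace_small:
  assumes adm: "\<And>w. w \<ge> 1 \<Longrightarrow> admissible w" and "m < u"
  shows "hecke_trace m u = (\<Sum>t=0..m. of_nat (p ^ (m - t)) * base_trace (u - m + 2 * t))"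
  using assms(2)
proof (induction m arbitrary: u)
  case 0
  then show ?case by (simp add: hecke_trace_0)
next
  case (Suc m)
  then obtain w where u: "u = Suc w" "w \<ge> 1" "m < w" by (cases u) auto
  have "hecke_trace (Suc m) u = base_trace (w + m + 2) + of_nat p * hecke_trace m w"
    unfolding u(1) by (rule hecke_trace_Suc_Suc[OF adm[OF u(2)]])
  also have "of_nat p * hecke_trace m w = (\<Sum>t=0..m. of_nat (p ^ (Suc m - t)) * base_trace (u - Suc m + 2 * t))"
    unfolding Suc.IH[OF u(3)] sum_distrib_left by (intro sum.cong) (simp_all add: u Suc_diff_le mult.assoc)
  finally show ?case using u by (simp add: add.commute)
qed

text \<open>After u diagonal steps the pair (m - u, 0) is reached; the remaining steps at the bottom
  level produce the powers of the symbol.\<close>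

lemma hecke_trace_large:
  assumes adm: "admissible 0" and "u \<le> m"
  shows "hecke_trace m u = (\<Sum>t=0..m - u. of_int (kronecker_prime (- int d') (int p) ^ (m - u - t)) * of_nat (p ^ u) * base_trace t)
     + (\<Sum>t=1..u. of_nat (p ^ (u - t)) * base_trace (m - u + 2 * t))"
  using assms(2)
proof (induction u arbitrary: m)
  case 0
  show ?case
  proof (induction m)
    case 0
    then show ?case by (simp add: hecke_trace_0)
  next
    case (Suc m)
    let ?e = "of_int (kronecker_prime (- int d') (int p)) :: complex"
    have "?e * hecke_trace m 0 = (\<Sum>t=0..m. of_int (kronecker_prime (- int d') (int p) ^ (Suc m - t)) * base_trace t)"
      unfolding Suc.IH by (simp add: sum_distrib_left Suc_diff_le mult.assoc)
    then show ?case using hecke_trace_Suc_0[OF adm, of m] by (simp add: add.commute)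
  qed
next
  case (Suc u)
  then obtain k where m: "m = Suc k" "u \<le> k" by (cases m) auto
  have au: "admissible u"
  proof (induction u)
    case 0
    show ?case by (rule adm)
  qed (rule admissible_Suc)
  have "hecke_trace m (Suc u) = base_trace (u + k + 2) + of_nat p * hecke_trace k u" unfolding m(1) by (rule hecke_trace_Suc_Suc[OF au])
  also have "of_nat p * hecke_trace k u = (\<Sum>t=0..k - u. of_int (kronecker_prime (- int d') (int p) ^ (k - u - t)) * of_nat (p ^ Suc u) * base_trace t)
     + (\<Sum>t=1..u. of_nat (p ^ (Suc u - t)) * base_trace (k - u + 2 * t))"
    unfolding Suc.IH[OF m(2)] distrib_left sum_distrib_left
    by (intro arg_cong2[of _ _ _ _ "(+)"] sum.cong) (simp_all add: Suc_diff_le mult_ac)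
  finally show ?case using m by (simp add: algebra_simps)
qed

lemma sum_trace_eq_hecke_trace:
  "(\<Sum>t=0..min v m. of_nat (p ^ t) * twisted_trace \<Delta> (level u) (J1 (p ^ m * n div p ^ (2 * t)))) = hecke_trace m u"
proof -
  have "p ^ m * n div p ^ (2 * t) = p ^ (v + m - 2 * t) * n0" if "t \<le> min v m" for t
  proof -
    have "p ^ m * n = p ^ (2 * t) * (p ^ (v + m - 2 * t) * n0)"
      using that by (simp add: n mult.assoc[symmetric] flip: power_add) (simp add: add.commute)
    then show ?thesis using p_pos by simp
  qed
  then show ?thesis unfolding hecke_trace_def J_sum_def[abs_def] J_pow_def
    by (simp add: twisted_trace_sum twisted_trace_cmult del: of_nat_power)
qed

end

theorem corollary1p4:
  fixes \<Delta> :: int and p m n d d' u l :: nat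
  assumes "fundamental_discriminant \<Delta>" and "\<Delta> > 1"
    and "prime p" and "\<not> int p dvd \<Delta>"
    and "n > 0"
    and "d > 0" and "is_discriminant (- int d)"
    and "d = p ^ (2 * u) * d'" and "\<not> p ^ 2 dvd d'"
    and "m \<ge> u \<Longrightarrow> is_discriminant (- int d')"
    and "l = min (multiplicity p n) m"
  shows "(m < u \<longrightarrow>
           (\<Sum>t=0..l. of_nat (p ^ t) * twisted_trace \<Delta> d (J1 (p ^ m * n div p ^ (2 * t))))
           = (\<Sum>t=0..m. of_nat (p ^ (m - t)) *
                twisted_trace \<Delta> (p ^ (2 * u - 2 * m + 4 * t) * d') (J1 n)))
       \<and> (m \<ge> u \<longrightarrow>
           (\<Sum>t=0..l. of_nat (p ^ t) * twisted_trace \<Delta> d (J1 (p ^ m * n div p ^ (2 * t))))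
           = (\<Sum>t=0..m - u. of_int (kronecker (- int d') (int p) ^ (m - u - t)) * of_nat (p ^ u) *
                twisted_trace \<Delta> (p ^ (2 * t) * d') (J1 n))
           + (\<Sum>t=1..u. of_nat (p ^ (u - t)) *
                twisted_trace \<Delta> (p ^ (2 * m - 2 * u + 4 * t) * d') (J1 n)))"
proof -
  define v where "v = multiplicity p n"
  have "p > 1" using assms(3) prime_gt_1_nat by blast
  then obtain n0 where n0: "n = p ^ v * n0" "\<not> p dvd n0"
    using multiplicity_decompose'[of n p] assms(5) unfolding v_def by auto
  interpret hecke_setting \<Delta> p n d' v n0
    by unfold_locales (use assms n0 in auto)
  have d: "d = level u" using assms(8) by (simp add: level_def)
  have l: "l = min v m" using assms(11) by (simp add: v_def)
  have lhs: "(\<Sum>t=0..l. of_nat (p ^ t) * twisted_trace \<Delta> d (J1 (p ^ m * n div p ^ (2 * t)))) = hecke_trace m u"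
    unfolding d l by (rule sum_trace_eq_hecke_trace)
  have small: "hecke_trace m u = (\<Sum>t=0..m. of_nat (p ^ (m - t)) * twisted_trace \<Delta> (p ^ (2 * u - 2 * m + 4 * t) * d') (J1 n))" if "m < u"
  proof -
    \<comment> \<open>Here -d' itself may fail to be a discriminant. For p = 2 every level above 0
      is divisible by 4; for odd p all levels agree modulo 4 with d.\<close>
    have "admissible w" if w: "w \<ge> 1" for w
    proof (cases "p = 2")
      case True
      obtain k where "w = Suc k" using w by (cases w) auto
      then have "- int (level w) = 4 * (- int (level k))" using True unfolding \<open>w = Suc k\<close> level_Suc by simp
      then show ?thesis unfolding admissible_def is_discriminant_def by (metis mod_mult_self1_is_0)
    next
      case False
      then have "odd (int p)" using assms(3) prime_odd_nat[of p] prime_ge_2_nat[of p] by auto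
      then have "[int p ^ 2 = 1] (mod 4)"
      proof -
        have "int p mod 4 = 1 \<or> int p mod 4 = 3" using \<open>odd (int p)\<close> by (rule odd_mod_4)
        then have "[int p = 1] (mod 4) \<or> [int p = 3] (mod 4)" by (simp add: cong_def)
        then have "[int p ^ 2 = 1 ^ 2] (mod 4) \<or> [int p ^ 2 = 3 ^ 2] (mod 4)" using cong_pow by blast
        then show ?thesis by (simp add: cong_def)
      qed
      then have "[(int p ^ 2) ^ k * (- int d') = 1 ^ k * (- int d')] (mod 4)" for k
        by (intro cong_mult cong_pow cong_refl)
      then have "(- int (level k)) mod 4 = (- int d') mod 4" for k
        by (simp add: level_def cong_def power_mult)
      then show ?thesis using assms(7) unfolding d admissible_def is_discriminant_def by metis
    qed
    from hecke_trace_small[OF this \<open>m < u\<close>] show ?thesis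
      using that by (simp add: base_trace_def level_def algebra_simps)
  qed
  have large: "hecke_trace m u = (\<Sum>t=0..m - u. of_int (kronecker (- int d') (int p) ^ (m - u - t)) * of_nat (p ^ u) *
                twisted_trace \<Delta> (p ^ (2 * t) * d') (J1 n))
           + (\<Sum>t=1..u. of_nat (p ^ (u - t)) * twisted_trace \<Delta> (p ^ (2 * m - 2 * u + 4 * t) * d') (J1 n))" if "u \<le> m"
  proof -
    have "admissible 0" using assms(10)[OF that] by (simp add: admissible_def level_def)
    from hecke_trace_large[OF this that] show ?thesis
      using assms(3) that by (simp add: base_trace_def level_def kronecker_prime_eq algebra_simps)
  qed
  show ?thesis unfolding lhs using small large by blast
qed

end
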